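(* Let $R\in(0,\infty]$, $p\geq1$, and $k\geq1$ an integer, and identify a radial function $u(x)=v(d(x))$ on $B_R^{\mathbb H}$ with $v\colon(0,R)\to\mathbb R$. Then: (1) $W^{k,p}_{\mathbb H,\mathrm{rad}}(B_R^{\mathbb H})\hookrightarrow W^{k,p}((0,R),\sinh^{N-1}(t))$ (continuously); (2) $W^{1,p}_{\mathbb H,\mathrm{rad}}(B_R^{\mathbb H})\equiv W^{1,p}((0,R),\sinh^{N-1}(t))$, i.e. $u\in W^{1,p}_{\mathbb H,\mathrm{rad}}(B_R^{\mathbb H})$ if and only if $v\in W^{1,p}((0,R),\sinh^{N-1}(t))$, with equivalent norms; (3) for $R\in(0,\infty)$ and $k\geq2$, one has $W^{k,p}_{\mathbb H,\mathrm{rad}}(B_R^{\mathbb H})\equiv W^{k,p}((0,R),\sinh^{N-1}(t))$ (in the same sense) if and only if $N>(k-1)p$.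
   Context: $\mathbb H^N$ is the Poincaré ball $\{x\in\mathbb R^N:|x|<1\}$ with metric $g_{ij}=\left(\frac{2}{1-|x|^2}\right)^2\delta_{ij}$, volume element $\mathrm dV_g=\left(\frac{2}{1-|x|^2}\right)^N\mathrm dx$, and $d(x)=\log\frac{1+|x|}{1-|x|}$. For $R\in(0,\infty]$, $B_R^{\mathbb H}=\{x\in\mathbb H^N:d(x)<R\}$ ($B_\infty^{\mathbb H}=\mathbb H^N$). A function $u$ is radial if $u(x)=v(d(x))$. $W^{k,p}(M)$ is the completion of smooth functions with finite norm $\|u\|_{W^{k,p}(M)}=\left(\sum_{j=0}^k\int_M|\nabla^ju|_g^p\mathrm dV_g\right)^{1/p}$, where $\nabla^j$ is the $j$-th covariant derivative and $|\cdot|_g$ the induced tensor norm; $W^{k,p}_{\mathbb H,\mathrm{rad}}(B_R^{\mathbb H})$ is its subspace of radial functions. $W^{k,p}((0,R),\sinh^{N-1}(t))$ is the space of $v$ with weak derivatives up to order $k$ and $\|v\|_{W^{k,p}_{\sinh^{N-1}}}=\left(\sum_{j=0}^k\int_0^R|v^{(j)}|^p\sinh^{N-1}(t)\mathrm dt\right)^{1/p}<\infty$. *)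

theory Defs
  imports "HOL-Analysis.Analysis"
begin

section \<open>Poincare ball model, coordinates on real^'n with N = CARD('n)\<close>

definition hdist :: "real^'n \<Rightarrow> real" where
  "hdist x = ln ((1 + norm x) / (1 - norm x))"

text \<open>Conformal factor lambda(x) = 2/(1-|x|^2): g = lambda^2 delta, dV = lambda^N dx.\<close>
definition lam :: "real^'n \<Rightarrow> real" where
  "lam x = 2 / (1 - (norm x)\<^sup>2)"

definition hball :: "ereal \<Rightarrow> (real^'n) set" where
  "hball R = {x. norm x < 1 \<and> ereal (hdist x) < R}"

definition pd :: "'n::finite \<Rightarrow> (real^'n \<Rightarrow> real) \<Rightarrow> real^'n \<Rightarrow> real" where
  "pd i f x = deriv (\<lambda>s. f (x + s *\<^sub>R axis i 1)) 0"

fun pds :: "'n::finite list \<Rightarrow> (real^'n \<Rightarrow> real) \<Rightarrow> real^'n \<Rightarrow> real" where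
  "pds [] f = f"
| "pds (i # is) f = pd i (pds is f)"

definition hsmooth :: "(real^'n::finite) set \<Rightarrow> (real^'n \<Rightarrow> real) \<Rightarrow> bool" where
  "hsmooth S f \<longleftrightarrow> (\<forall>is. continuous_on S (pds is f) \<and>
      (\<forall>x\<in>S. \<forall>i. (\<lambda>s. pds is f (x + s *\<^sub>R axis i 1)) differentiable (at 0)))"

text \<open>Christoffel symbols Gamma^s_{ab} of the conformal metric g = lambda^2 delta,
  with d_i(log lambda) = 2 x_i / (1 - |x|^2).\<close>
definition dlog :: "'n::finite \<Rightarrow> real^'n \<Rightarrow> real" where
  "dlog i x = 2 * (x $ i) / (1 - (norm x)\<^sup>2)"

definition chr :: "'n::finite \<Rightarrow> 'n \<Rightarrow> 'n \<Rightarrow> real^'n \<Rightarrow> real" where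
  "chr s a b x = (if a = s then dlog b x else 0) + (if b = s then dlog a x else 0)
                 - (if a = b then dlog s x else 0)"

text \<open>Components of the covariant derivative tensor nabla^j u (j = length of the index list),
  with the new differentiation index placed first: (nabla T)_{m i_1..i_j}.\<close>
function cov :: "(real^'n::finite \<Rightarrow> real) \<Rightarrow> 'n list \<Rightarrow> real^'n \<Rightarrow> real" where
  "cov u [] x = u x"
| "cov u (m # is) x = pd m (cov u is) x
     - (\<Sum>l<length is. \<Sum>s\<in>UNIV. chr s m (is ! l) x * cov u (is[l := s]) x)"
  by pat_completeness auto
termination by (relation "Wellfounded.measure (\<lambda>(u, is, x). length is)") auto

text \<open>Tensor norm |nabla^j u|_g (g^{ab} = lambda^{-2} delta^{ab}).\<close>
definition gnorm :: "nat \<Rightarrow> (real^'n::finite \<Rightarrow> real) \<Rightarrow> real^'n \<Rightarrow> real" where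
  "gnorm j u x = lam x powr (- real j) * sqrt (\<Sum>is\<in>{is::'n list. length is = j}. (cov u is x)\<^sup>2)"

definition hint :: "real \<Rightarrow> ereal \<Rightarrow> nat \<Rightarrow> (real^'n::finite \<Rightarrow> real) \<Rightarrow> ennreal" where
  "hint p R j u = (\<integral>\<^sup>+ x\<in>hball R. ennreal (gnorm j u x powr p * lam x ^ CARD('n)) \<partial>lborel)"

definition hsnorm :: "nat \<Rightarrow> real \<Rightarrow> ereal \<Rightarrow> (real^'n::finite \<Rightarrow> real) \<Rightarrow> real" where
  "hsnorm k p R f = (\<Sum>j\<le>k. enn2real (hint p R j f)) powr (1 / p)"

text \<open>phi is a sequence of smooth functions with finite W^{k,p} norm, Cauchy in W^{k,p},
  converging in L^p(B_R, dV_g) to u: this realizes u as an element of the completion.\<close>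
definition happrox :: "nat \<Rightarrow> real \<Rightarrow> ereal \<Rightarrow> (nat \<Rightarrow> real^'n::finite \<Rightarrow> real) \<Rightarrow> (real^'n \<Rightarrow> real) \<Rightarrow> bool" where
  "happrox k p R \<phi> u \<longleftrightarrow>
     (\<forall>n. hsmooth (hball R) (\<phi> n) \<and> (\<forall>j\<le>k. hint p R j (\<phi> n) < \<infinity>)) \<and>
     (\<forall>j\<le>k. \<forall>e>0. \<exists>M. \<forall>m\<ge>M. \<forall>n\<ge>M. hint p R j (\<lambda>x. \<phi> m x - \<phi> n x) < ennreal e) \<and>
     ((\<lambda>n. \<integral>\<^sup>+ x\<in>hball R. ennreal (\<bar>\<phi> n x - u x\<bar> powr p * lam x ^ CARD('n)) \<partial>lborel)
        \<longlonglongrightarrow> 0)"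

definition hW :: "nat \<Rightarrow> real \<Rightarrow> ereal \<Rightarrow> (real^'n::finite \<Rightarrow> real) set" where
  "hW k p R = {u. set_borel_measurable lborel (hball R) u \<and> (\<exists>\<phi>. happrox k p R \<phi> u)}"

definition hnormW :: "nat \<Rightarrow> real \<Rightarrow> ereal \<Rightarrow> (real^'n::finite \<Rightarrow> real) \<Rightarrow> real" where
  "hnormW k p R u = Inf {c. \<exists>\<phi>. happrox k p R \<phi> u \<and> (\<lambda>n. hsnorm k p R (\<phi> n)) \<longlonglongrightarrow> c}"

definition ivl :: "ereal \<Rightarrow> real set" where
  "ivl R = {t. 0 < t \<and> ereal t < R}"

definition test_fn :: "ereal \<Rightarrow> (real \<Rightarrow> real) \<Rightarrow> bool" where
  "test_fn R \<phi> \<longleftrightarrow> (\<forall>m t. ((deriv ^^ m) \<phi> has_real_derivative (deriv ^^ Suc m) \<phi> t) (at t)) \<and>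
     (\<exists>a b. 0 < a \<and> a \<le> b \<and> ereal b < R \<and> (\<forall>t. t \<notin> {a..b} \<longrightarrow> \<phi> t = 0))"

definition loc_int :: "ereal \<Rightarrow> (real \<Rightarrow> real) \<Rightarrow> bool" where
  "loc_int R f \<longleftrightarrow> set_borel_measurable lborel (ivl R) f \<and>
     (\<forall>a b. 0 < a \<longrightarrow> ereal b < R \<longrightarrow> set_integrable lborel {a..b} f)"

definition weak_deriv :: "ereal \<Rightarrow> nat \<Rightarrow> (real \<Rightarrow> real) \<Rightarrow> (real \<Rightarrow> real) \<Rightarrow> bool" where
  "weak_deriv R j v w \<longleftrightarrow> loc_int R v \<and> loc_int R w \<and>
     (\<forall>\<phi>. test_fn R \<phi> \<longrightarrow>
        (LINT t:ivl R|lborel. v t * (deriv ^^ j) \<phi> t) = (-1) ^ j * (LINT t:ivl R|lborel. w t * \<phi> t))"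

definition wint :: "nat \<Rightarrow> real \<Rightarrow> ereal \<Rightarrow> (real \<Rightarrow> real) \<Rightarrow> ennreal" where
  "wint N p R f = (\<integral>\<^sup>+ t\<in>ivl R. ennreal (\<bar>f t\<bar> powr p * sinh t ^ (N - 1)) \<partial>lborel)"

definition wvalid :: "nat \<Rightarrow> nat \<Rightarrow> real \<Rightarrow> ereal \<Rightarrow> (real \<Rightarrow> real) \<Rightarrow> (nat \<Rightarrow> real \<Rightarrow> real) \<Rightarrow> bool" where
  "wvalid N k p R v w \<longleftrightarrow> w 0 = v \<and> (\<forall>j\<in>{1..k}. weak_deriv R j v (w j)) \<and>
     (\<forall>j\<le>k. wint N p R (w j) < \<infinity>)"

definition wW :: "nat \<Rightarrow> nat \<Rightarrow> real \<Rightarrow> ereal \<Rightarrow> (real \<Rightarrow> real) set" where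
  "wW N k p R = {v. \<exists>w. wvalid N k p R v w}"

definition wnorm :: "nat \<Rightarrow> nat \<Rightarrow> real \<Rightarrow> ereal \<Rightarrow> (real \<Rightarrow> real) \<Rightarrow> real" where
  "wnorm N k p R v = Inf {(\<Sum>j\<le>k. enn2real (wint N p R (w j))) powr (1 / p) | w. wvalid N k p R v w}"

definition rad_equiv :: "'n::finite itself \<Rightarrow> nat \<Rightarrow> real \<Rightarrow> ereal \<Rightarrow> bool" where
  "rad_equiv _ k p R \<longleftrightarrow> (\<exists>c C. 0 < c \<and> 0 < C \<and> (\<forall>v::real \<Rightarrow> real.
     ((\<lambda>x::real^'n. v (hdist x)) \<in> hW k p R \<longleftrightarrow> v \<in> wW CARD('n) k p R) \<and>
     ((\<lambda>x::real^'n. v (hdist x)) \<in> hW k p R \<longrightarrow>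
        c * wnorm CARD('n) k p R v \<le> hnormW k p R (\<lambda>x::real^'n. v (hdist x)) \<and>
        hnormW k p R (\<lambda>x::real^'n. v (hdist x)) \<le> C * wnorm CARD('n) k p R v)))"

end

theory Submission
  imports Defs "HOL-Computational_Algebra.Polynomial"
begin

text \<open>
  Along a unit speed geodesic from the origin the j-th derivative of a smooth function is the
  contraction of its j-th covariant derivative with the velocity, because the velocity is parallel;
  hence it is bounded by the tensor norm, and polar coordinates give (1), first for an approximating
  sequence, then in the limit.

  Conversely, the j-th covariant derivative of a radial function is a combination of the terms
  \<open>v\<^sup>(\<^sup>i\<^sup>)(t) O(t\<^sup>i\<^sup>-\<^sup>j)\<close> with \<open>1 \<le> i \<le> j\<close>. For \<open>j = 1\<close> there is no singular factor; for \<open>j \<le> k\<close> the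
  singular factors are absorbed by Hardy's inequality when \<open>N > (k - 1) p\<close>. These estimates are applied
  to profiles that are constant near the origin, which are dense in the weighted space.

  If \<open>N \<le> (k - 1) p\<close>, the profile \<open>v(t) = tanh (t / 2)\<close> is smooth up to the origin but the radial function
  is \<open>|x|\<close>. Were it in the k-th Sobolev space, its k-th differences with step h along an axis would
  have \<open>L\<^sup>p\<close> norm \<open>o(h\<^sup>k)\<close> on balls of radius 2 h, whereas homogeneity makes it a multiple of
  \<open>h\<^sup>1\<^sup>+\<^sup>N\<^sup>/\<^sup>p\<close>.
\<close>

section \<open>Smooth functions and covariant derivatives\<close>

text \<open>The approximating functions need not be radial. Instead of averaging them over spheres,
  one ray is chosen: by Fubini a subsequence converges on almost every ray, and some such ray
  carries at most the average energy.

  The threshold is (k - 1) p rather than k p because the undifferentiated profile never enters a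
  covariant derivative of positive order, so the worst factor is t^(1-k) on the first derivative.
  For the same reason profiles are flattened by cutting off the first derivative and integrating
  back: only k - 1 derivatives fall on the cutoff. Primitives are taken from the outer end, where
  the weight is largest, so the Poincare inequality needs no relation between p and N.

  Density needs no mollifiers: the highest weak derivative is approximated by polynomials, and
  primitives recover the lower orders up to constants.

  At the borderline N = (k - 1) p both sides of the final comparison scale alike; a merely bounded
  k-th derivative would not contradict it, so its norm on small balls must tend to zero uniformly
  along the approximating sequence.\<close>

abbreviation has_pd :: "(real^'n::finite \<Rightarrow> real) \<Rightarrow> 'n \<Rightarrow> real \<Rightarrow> real^'n \<Rightarrow> bool" where
  "has_pd f i D x \<equiv> ((\<lambda>s. f (x + s *\<^sub>R axis i 1)) has_real_derivative D) (at 0)"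

lemma has_pd_imp_pd: "has_pd f i D x \<Longrightarrow> pd i f x = D"
  unfolding pd_def by (rule DERIV_imp_deriv)

lemma eventually_line_in_open:
  fixes x e :: "'a::real_normed_vector"
  assumes "open S" "x \<in> S"
  shows "\<forall>\<^sub>F s in nhds 0. x + s *\<^sub>R e \<in> S"
proof -
  have "((\<lambda>s::real. x + s *\<^sub>R e) \<longlongrightarrow> x + 0 *\<^sub>R e) (at 0)"
    by (intro tendsto_intros)
  then have "((\<lambda>s::real. x + s *\<^sub>R e) \<longlongrightarrow> x) (at 0)" by simp
  from topological_tendstoD[OF this assms] have "\<forall>\<^sub>F s in at 0. x + s *\<^sub>R e \<in> S" .
  then show ?thesis using assms by (auto simp: eventually_at_filter elim: eventually_mono)
qed

lemma has_pd_cong: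
  assumes "open S" "x \<in> S" "\<And>y. y \<in> S \<Longrightarrow> f y = g y" "has_pd f i D x"
  shows "has_pd g i D x"
proof -
  have "\<forall>\<^sub>F s in nhds 0. f (x + s *\<^sub>R axis i 1) = g (x + s *\<^sub>R axis i 1)"
    using eventually_line_in_open[OF assms(1,2), of "axis i 1"] by eventually_elim (simp add: assms(3))
  from DERIV_cong_ev[OF refl this refl] assms(4) show ?thesis by blast
qed

lemma pd_cong:
  assumes "open S" "x \<in> S" "\<And>y. y \<in> S \<Longrightarrow> f y = g y"
  shows "pd i f x = pd i g x"
proof -
  have "\<forall>\<^sub>F s in nhds 0. f (x + s *\<^sub>R axis i 1) = g (x + s *\<^sub>R axis i 1)"
    using eventually_line_in_open[OF assms(1,2), of "axis i 1"] by eventually_elim (simp add: assms(3))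
  then show ?thesis unfolding pd_def by (intro deriv_cong_ev) auto
qed

lemma pds_append: "pds (is @ [i]) f = pds is (pd i f)"
  by (induction "is") auto

lemma hsmooth_has_pd:
  assumes "hsmooth S f" "x \<in> S"
  shows "has_pd (pds is f) i (pds (i # is) f x) x"
  using assms unfolding hsmooth_def pds.simps pd_def
  by (simp add: DERIV_deriv_iff_real_differentiable)

lemma hsmooth_has_pd': "hsmooth S f \<Longrightarrow> x \<in> S \<Longrightarrow> has_pd f i (pd i f x) x"
  using hsmooth_has_pd[of S f x "[]" i] by simp

lemma hsmooth_continuous_pds: "hsmooth S f \<Longrightarrow> continuous_on S (pds is f)"
  unfolding hsmooth_def by blast

lemma hsmooth_continuous: "hsmooth S f \<Longrightarrow> continuous_on S f"
  using hsmooth_continuous_pds[of S f "[]"] by simp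

lemma hsmooth_pd: "hsmooth S f \<Longrightarrow> hsmooth S (pd i f)"
  unfolding hsmooth_def by (metis pds_append)

lemma hsmooth_subset: "hsmooth T f \<Longrightarrow> S \<subseteq> T \<Longrightarrow> hsmooth S f"
  unfolding hsmooth_def by (meson continuous_on_subset subsetD)

lemma pds_cong:
  assumes "open S" "\<And>y. y \<in> S \<Longrightarrow> f y = g y"
  shows "x \<in> S \<Longrightarrow> pds is f x = pds is g x"
proof (induction "is" arbitrary: x)
  case (Cons i "is")
  then show ?case by (simp add: pd_cong[OF assms(1), of x "pds is f" "pds is g"])
qed (simp add: assms)

lemma hsmooth_cong:
  assumes "open S" "\<And>y. y \<in> S \<Longrightarrow> f y = g y" "hsmooth S f"
  shows "hsmooth S g"
  unfolding hsmooth_def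
proof (intro allI conjI ballI)
  fix "is" :: "'a list" and x i
  have eq: "\<And>y. y \<in> S \<Longrightarrow> pds is f y = pds is g y" using pds_cong[OF assms(1), of f g] assms(2) by blast
  show "continuous_on S (pds is g)"
    by (rule continuous_on_eq[OF hsmooth_continuous_pds[OF assms(3)] eq])
  assume "x \<in> S"
  from has_pd_cong[OF assms(1) this eq hsmooth_has_pd[OF assms(3) this]]
  show "(\<lambda>s. pds is g (x + s *\<^sub>R axis i 1)) differentiable (at 0)"
    by (auto simp: real_differentiable_def)
qed

text \<open>The algebra generated by a set of functions. Once every partial derivative of a
  generator lies in the algebra (on the set under consideration), so do all iterated partials, and
  smoothness reduces to a few explicit derivative formulas and continuity of the generators.\<close>

inductive_set galg :: "(real^'n::finite \<Rightarrow> real) set \<Rightarrow> (real^'n \<Rightarrow> real) set" for B where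
  base: "b \<in> B \<Longrightarrow> b \<in> galg B"
| const: "(\<lambda>x. c) \<in> galg B"
| add: "f \<in> galg B \<Longrightarrow> g \<in> galg B \<Longrightarrow> (\<lambda>x. f x + g x) \<in> galg B"
| mult: "f \<in> galg B \<Longrightarrow> g \<in> galg B \<Longrightarrow> (\<lambda>x. f x * g x) \<in> galg B"

lemma galg_has_pd:
  assumes B: "\<And>b i. b \<in> B \<Longrightarrow> \<exists>g\<in>galg B. \<forall>x\<in>S. has_pd b i (g x) x"
    and "f \<in> galg B"
  shows "\<exists>g\<in>galg B. \<forall>x\<in>S. has_pd f i (g x) x"
  using assms(2)
proof induction
  case (const c)
  show ?case by (rule bexI[OF _ galg.const[of 0]]) auto
next
  case (add f g)
  then obtain f' g' where "f' \<in> galg B" "g' \<in> galg B"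
    "\<forall>x\<in>S. has_pd f i (f' x) x" "\<forall>x\<in>S. has_pd g i (g' x) x" by blast
  then show ?case by (intro bexI[OF _ galg.add[of f' B g']]) (auto intro!: DERIV_add)
next
  case (mult f g)
  then obtain f' g' where h: "f' \<in> galg B" "g' \<in> galg B"
    "\<forall>x\<in>S. has_pd f i (f' x) x" "\<forall>x\<in>S. has_pd g i (g' x) x" by blast
  have "(\<lambda>x. f' x * g x + g' x * f x) \<in> galg B" using h mult by (intro galg.add galg.mult)
  moreover have "has_pd (\<lambda>x. f x * g x) i (f' x * g x + g' x * f x) x" if "x \<in> S" for x
    using DERIV_mult'[of "\<lambda>s. f (x + s *\<^sub>R axis i 1)" "f' x" 0 UNIV "\<lambda>s. g (x + s *\<^sub>R axis i 1)" "g' x"] h(3,4) that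
    by (simp add: algebra_simps)
  ultimately show ?case by (intro bexI[of _ "\<lambda>x. f' x * g x + g' x * f x"]) auto
qed (use B in blast)

lemma galg_hsmooth:
  assumes S: "open S"
    and cont: "\<And>b. b \<in> B \<Longrightarrow> continuous_on S b"
    and B: "\<And>b i. b \<in> B \<Longrightarrow> \<exists>g\<in>galg B. \<forall>x\<in>S. has_pd b i (g x) x"
    and f: "f \<in> galg B"
  shows "hsmooth S f"
proof -
  have c: "continuous_on S g" if "g \<in> galg B" for g
    using that by induction (auto intro: cont continuous_on_add continuous_on_mult)
  \<comment> \<open>The agreement holds only on \<open>S\<close>; openness of \<open>S\<close> is
    what lets \<open>pd_cong\<close> differentiate it.\<close>
  have rep: "\<exists>g\<in>galg B. \<forall>x\<in>S. pds is f x = g x" for "is"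
  proof (induction "is")
    case (Cons i "is")
    then obtain g where g: "g \<in> galg B" "\<forall>x\<in>S. pds is f x = g x" by blast
    obtain g' where g': "g' \<in> galg B" "\<forall>x\<in>S. has_pd g i (g' x) x"
      using galg_has_pd[OF B g(1)] by blast
    have "pds (i # is) f x = g' x" if "x \<in> S" for x
      using g g' that by (simp add: pd_cong[OF S that, of "pds is f" g] has_pd_imp_pd)
    then show ?case using g' by blast
  qed (use f in auto)
  show ?thesis
    unfolding hsmooth_def
  proof (intro allI conjI ballI)
    fix "is" :: "'a list" and x i
    obtain g where g: "g \<in> galg B" "\<forall>x\<in>S. pds is f x = g x" using rep by blast
    obtain g' where g': "g' \<in> galg B" "\<forall>x\<in>S. has_pd g i (g' x) x"
      using galg_has_pd[OF B g(1)] by blast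
    show "continuous_on S (pds is f)" by (rule continuous_on_eq[OF c[OF g(1)]]) (simp add: g(2))
    assume x: "x \<in> S"
    have "has_pd (pds is f) i (g' x) x"
      using has_pd_cong[OF S x _ g'(2)[rule_format, OF x]] g(2) by simp
    then show "(\<lambda>s. pds is f (x + s *\<^sub>R axis i 1)) differentiable (at 0)"
      by (auto simp: real_differentiable_def)
  qed
qed

lemma hsmooth_const: "open S \<Longrightarrow> hsmooth S (\<lambda>x. c)"
  by (rule galg_hsmooth[where B="{}"]) (auto intro: galg.const)

text \<open>All iterated partials of both functions serve as generators. This set is closed under
  partial differentiation, so a Leibniz formula over index lists is avoided.\<close>

lemma hsmooth_add_mult:
  assumes S: "open S" and f: "hsmooth S f" and g: "hsmooth S g"
  shows hsmooth_add: "hsmooth S (\<lambda>x. f x + g x)" and hsmooth_mult: "hsmooth S (\<lambda>x. f x * g x)"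
proof -
  define B where "B = range (\<lambda>is. pds is f) \<union> range (\<lambda>is. pds is g)"
  have fg: "f \<in> galg B" "g \<in> galg B"
    unfolding B_def by (rule galg.base, auto intro: range_eqI[of _ _ "[]"])+
  have c: "continuous_on S b" if "b \<in> B" for b
    using that f g unfolding B_def by (auto intro: hsmooth_continuous_pds)
  have d: "\<exists>g\<in>galg B. \<forall>x\<in>S. has_pd b i (g x) x" if "b \<in> B" for b i
  proof -
    from that obtain "is" h where h: "b = pds is h" "h = f \<or> h = g" unfolding B_def by auto
    then have "hsmooth S h" "pds (i # is) h \<in> B" using f g unfolding B_def by (auto simp del: pds.simps)
    then show ?thesis using hsmooth_has_pd h by (intro bexI[of _ "pds (i # is) h"] galg.base) (auto simp del: pds.simps)
  qed
  show "hsmooth S (\<lambda>x. f x + g x)" by (rule galg_hsmooth[OF S c d]) (auto intro: galg.add fg)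
  show "hsmooth S (\<lambda>x. f x * g x)" by (rule galg_hsmooth[OF S c d]) (auto intro: galg.mult fg)
qed

lemma hsmooth_cmult: "open S \<Longrightarrow> hsmooth S f \<Longrightarrow> hsmooth S (\<lambda>x. c * f x)"
  by (rule hsmooth_mult[OF _ hsmooth_const])

lemma hsmooth_diff:
  assumes "open S" "hsmooth S f" "hsmooth S g"
  shows "hsmooth S (\<lambda>x. f x - g x)"
  using hsmooth_add[OF assms(1,2) hsmooth_cmult[OF assms(1,3), of "-1"]] by simp

lemma hsmooth_sum:
  assumes "open S" "\<And>i. i \<in> I \<Longrightarrow> hsmooth S (f i)"
  shows "hsmooth S (\<lambda>x. \<Sum>i\<in>I. f i x)"
  using assms(2) by (induction I rule: infinite_finite_induct)
    (auto intro!: hsmooth_const hsmooth_add assms(1))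

section \<open>Smoothness of the conformal factor, the Christoffel symbols and the covariant
  derivatives\<close>

lemma norm_sq_shift: "(norm (x + s *\<^sub>R axis i 1))\<^sup>2 = (norm x)\<^sup>2 + 2 * s * x $ i + s\<^sup>2"
  for x :: "real^'n"
  unfolding power2_norm_eq_inner
  by (simp add: inner_add_left inner_add_right inner_axis inner_axis_axis inner_axis' power2_eq_square algebra_simps)

lemma one_minus_norm_sq_pos: "norm x < 1 \<Longrightarrow> 0 < 1 - (norm x)\<^sup>2"
  by (simp add: abs_square_less_1)

lemma has_pd_coord: "has_pd (\<lambda>x. x $ j) i (if i = j then 1 else 0) x"
  by (auto intro!: derivative_eq_intros simp: axis_def)

lemma has_pd_conf:
  assumes "norm x < 1"
  shows "has_pd (\<lambda>x. 1 / (1 - (norm x)\<^sup>2)) i (2 * x $ i * (1 / (1 - (norm x)\<^sup>2)) * (1 / (1 - (norm x)\<^sup>2))) x"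
  unfolding norm_sq_shift using one_minus_norm_sq_pos[OF assms]
  by (auto intro!: derivative_eq_intros simp: power2_eq_square)

lemma hsmooth_coord: "open S \<Longrightarrow> hsmooth S (\<lambda>x. x $ j)"
  and hsmooth_conf: "open S \<Longrightarrow> S \<subseteq> ball 0 1 \<Longrightarrow> hsmooth S (\<lambda>x. 1 / (1 - (norm x)\<^sup>2))"
  for S :: "(real^'n::finite) set"
proof -
  have *: "\<exists>g\<in>galg B. \<forall>x\<in>S. has_pd (\<lambda>x. x $ j) i (g x) x" for j i B and S :: "(real^'n) set"
    by (rule bexI[OF _ galg.const[of "if i = j then 1 else 0"]]) (intro ballI has_pd_coord)
  show "hsmooth S (\<lambda>x. x $ j)" if "open S" for S :: "(real^'n) set" and j
    by (rule galg_hsmooth[where B="{\<lambda>x. x $ j}", OF that])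
      (use * in \<open>auto intro!: continuous_intros galg.base\<close>)
  let ?q = "\<lambda>x::real^'n. 1 / (1 - (norm x)\<^sup>2)"
  \<comment> \<open>The coordinates must join \<open>?q\<close>, because the i-th partial derivative
    of \<open>?q\<close> is \<open>2 * x $ i * ?q x * ?q x\<close>.\<close>
  let ?B = "insert ?q (range (\<lambda>j x. x $ j))"
  assume S: "open S" "S \<subseteq> ball 0 1"
  show "hsmooth S ?q"
  proof (rule galg_hsmooth[where B="?B", OF S(1)])
    fix b :: "real^'n \<Rightarrow> real" and i assume b: "b \<in> ?B"
    show "continuous_on S b"
    proof (cases "b = ?q")
      case True
      have "1 - (norm x)\<^sup>2 \<noteq> 0" if "x \<in> S" for x
        using S(2) that one_minus_norm_sq_pos[of x] by force
      then show ?thesis unfolding True by (intro continuous_intros) auto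
    qed (use b in \<open>auto intro!: continuous_intros\<close>)
    show "\<exists>g\<in>galg ?B. \<forall>x\<in>S. has_pd b i (g x) x"
    proof (cases "b = ?q")
      case True
      have "(\<lambda>x. 2 * x $ i * ?q x * ?q x) \<in> galg ?B"
        by (intro galg.mult galg.const) (auto intro!: galg.base)
      moreover have "\<forall>x\<in>S. has_pd ?q i (2 * x $ i * ?q x * ?q x) x"
        using S(2) by (intro ballI has_pd_conf) auto
      ultimately show ?thesis unfolding True by (intro bexI[of _ "\<lambda>x. 2 * x $ i * ?q x * ?q x"])
    next
      case False
      then obtain j where "b = (\<lambda>x. x $ j)" using b by auto
      then show ?thesis using *[of "?B"] by auto
    qed
  qed (auto intro!: galg.base)
qed

lemma dlog_eq: "dlog i = (\<lambda>x. 2 * x $ i * (1 / (1 - (norm x)\<^sup>2)))"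
  by (auto simp: dlog_def)

lemma hsmooth_dlog: "open S \<Longrightarrow> S \<subseteq> ball 0 1 \<Longrightarrow> hsmooth S (dlog i)"
  unfolding dlog_eq by (intro hsmooth_mult hsmooth_const hsmooth_coord hsmooth_conf)

lemma hsmooth_chr:
  assumes "open S" "S \<subseteq> ball 0 1"
  shows "hsmooth S (chr s a b)"
proof -
  have "chr s a b = (\<lambda>x. ((if a = s then 1 else 0) * dlog b x + (if b = s then 1 else 0) * dlog a x)
     - (if a = b then 1 else 0) * dlog s x)"
    by (auto simp: chr_def)
  moreover have "hsmooth S \<dots>"
    by (intro hsmooth_diff hsmooth_add hsmooth_cmult hsmooth_dlog assms)
  ultimately show ?thesis by simp
qed

text \<open>Induction on the length instead of the list: the Christoffel terms involve
  \<open>js[l := s]\<close>, which is not a tail of \<open>is\<close> but has the length of its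
  tail.\<close>

lemma hsmooth_cov:
  assumes S: "open S" "S \<subseteq> ball 0 1" and u: "hsmooth S u"
  shows "hsmooth S (cov u is)"
proof (induction "length is" arbitrary: "is")
  case 0
  then show ?case using u cov.simps(1)[of u, abs_def] by simp
next
  case (Suc n)
  then obtain m js where js: "is = m # js" "length js = n" by (cases "is") auto
  have "cov u (m # js) = (\<lambda>x. pd m (cov u js) x
     - (\<Sum>l<length js. \<Sum>s\<in>UNIV. chr s m (js ! l) x * cov u (js[l := s]) x))"
    by (rule ext) simp
  then show ?case unfolding js(1) using js(2)
    by (simp only:) (intro hsmooth_diff hsmooth_sum hsmooth_mult hsmooth_pd hsmooth_chr S Suc.hyps; simp)
qed

lemma pds_diff:
  assumes "open S" "hsmooth S f" "hsmooth S g" "x \<in> S"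
  shows "pds is (\<lambda>x. f x - g x) x = pds is f x - pds is g x"
  using assms(4)
proof (induction "is" arbitrary: x)
  case (Cons i "is")
  have "pds (i # is) (\<lambda>x. f x - g x) x = pd i (\<lambda>x. pds is f x - pds is g x) x"
    using pd_cong[OF assms(1) Cons.prems, of "pds is (\<lambda>x. f x - g x)" "\<lambda>x. pds is f x - pds is g x" i] Cons.IH by simp
  also have "\<dots> = pds (i # is) f x - pds (i # is) g x"
    by (rule has_pd_imp_pd, rule DERIV_diff; rule hsmooth_has_pd[OF _ Cons.prems]; fact)
  finally show ?case .
qed simp

lemma cov_diff:
  assumes S: "open S" "S \<subseteq> ball 0 1" and u: "hsmooth S u" "hsmooth S v" and "x \<in> S"
  shows "cov (\<lambda>x. u x - v x) is x = cov u is x - cov v is x"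
  using \<open>x \<in> S\<close>
proof (induction "length is" arbitrary: "is" x)
  case 0
  then show ?case by simp
next
  case (Suc n)
  then obtain m js where js: "is = m # js" "length js = n" by (cases "is") auto
  have "pd m (cov (\<lambda>x. u x - v x) js) x = pd m (\<lambda>x. cov u js x - cov v js x) x"
    using Suc js by (intro pd_cong[OF S(1)]) auto
  also have "\<dots> = pd m (cov u js) x - pd m (cov v js) x"
    by (rule has_pd_imp_pd, rule DERIV_diff; rule hsmooth_has_pd'[OF hsmooth_cov[OF S]]; fact)
  finally show ?case
    using Suc js by (simp add: right_diff_distrib sum_subtractf)
qed

text \<open>The displacement is carried out one coordinate at a time. By the mean value inequality
  the error of each move is bounded by the oscillation of one partial derivative near
  \<open>x\<close>.\<close>

lemma C1_has_derivative:
  fixes f :: "real^'n::finite \<Rightarrow> real"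
  assumes S: "open S" "x \<in> S"
    and d: "\<And>y i. y \<in> S \<Longrightarrow> has_pd f i (g i y) y"
    and c: "\<And>i. continuous_on S (g i)"
  shows "(f has_derivative (\<lambda>h. \<Sum>i\<in>UNIV. h $ i * g i x)) (at x)"
  unfolding has_derivative_at_alt
proof (intro conjI allI impI)
  show "bounded_linear (\<lambda>h. \<Sum>i\<in>UNIV. h $ i * g i x)"
    by (intro bounded_linear_sum bounded_linear_mult_const bounded_linear_vec_nth)
  fix e :: real assume e: "e > 0"
  \<comment> \<open>An equal share of \<open>e\<close> for each of the coordinate moves.\<close>
  define e' where "e' = e / CARD('n)"
  have e': "e' > 0" using e by (simp add: e'_def)
  have "\<forall>\<^sub>F y in nhds x. y \<in> S \<and> (\<forall>i\<in>UNIV. \<bar>g i y - g i x\<bar> < e')"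
  proof (intro eventually_conj eventually_ball_finite ballI)
    show "\<forall>\<^sub>F y in nhds x. y \<in> S" using S eventually_nhds by blast
    fix i
    have "(g i \<longlongrightarrow> g i x) (nhds x)"
      using c[of i] S by (simp add: continuous_on_eq_continuous_at isCont_def tendsto_at_iff_tendsto_nhds)
    then show "\<forall>\<^sub>F y in nhds x. \<bar>g i y - g i x\<bar> < e'" using e' by (auto dest!: tendstoD simp: dist_real_def)
  qed auto
  then obtain \<delta> where \<delta>: "\<delta> > 0" "\<And>y. dist y x < \<delta> \<Longrightarrow> y \<in> S \<and> (\<forall>i. \<bar>g i y - g i x\<bar> < e')"
    unfolding eventually_nhds_metric by auto
  show "\<exists>d>0. \<forall>y. norm (y - x) < d \<longrightarrow>
     norm (f y - f x - (\<Sum>i\<in>UNIV. (y - x) $ i * g i x)) \<le> e * norm (y - x)"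
  proof (intro exI[of _ \<delta>] conjI allI impI \<delta>(1))
    fix y assume y: "norm (y - x) < \<delta>"
    define h where "h = y - x"
    \<comment> \<open>\<open>hh A\<close> is the part of the displacement with coordinates in
      \<open>A\<close>; the induction below lets \<open>A\<close> grow to the whole index
      set.\<close>
    define hh :: "'n set \<Rightarrow> real^'n" where "hh A = (\<Sum>i\<in>A. h $ i *\<^sub>R axis i 1)" for A
    have nth: "hh A $ j = (if j \<in> A then h $ j else 0)" if "finite A" for A j
      using that unfolding hh_def by (simp add: axis_def if_distrib if_distribR cong: if_cong)
    have "\<bar>f (x + hh A) - f x - (\<Sum>i\<in>A. h $ i * g i x)\<bar> \<le> (\<Sum>i\<in>A. \<bar>h $ i\<bar> * e')" if "finite A" for A
      using that
    proof induction
      case empty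
      then show ?case by (simp add: hh_def)
    next
      case (insert j A)
      \<comment> \<open>Subtracting the linear part leaves as derivative the difference between
        \<open>g j\<close> at an intermediate point and \<open>g j x\<close>, which is at most
        \<open>e'\<close> in modulus.\<close>
      define F where "F s = f (x + hh A + s *\<^sub>R axis j 1) - s * g j x" for s
      let ?I = "closed_segment 0 (h $ j)"
      \<comment> \<open>Intermediate points stay in the small ball since their displacement is
        dominated componentwise by \<open>h\<close>.\<close>
      have ins: "dist (x + hh A + s *\<^sub>R axis j 1) x < \<delta>" if "s \<in> ?I" for s
      proof -
        have "\<bar>s\<bar> \<le> \<bar>h $ j\<bar>" using that by (auto simp: closed_segment_eq_real_ivl split: if_splits)
        then have "norm (hh A + s *\<^sub>R axis j 1) \<le> norm h"
          using insert by (intro norm_le_componentwise_cart) (auto simp: nth axis_def)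
        then show ?thesis using y by (simp add: dist_norm h_def add.assoc)
      qed
      have "norm (F (h $ j) - F 0) \<le> e' * norm (h $ j - 0)"
      proof (rule field_differentiable_bound[where S="?I" and f=F])
        fix s assume s: "s \<in> ?I"
        from DERIV_shift[of "\<lambda>s. f (x + hh A + s *\<^sub>R axis j 1)" _ 0 s] d[of "x + hh A + s *\<^sub>R axis j 1" j] \<delta>(2)[OF ins[OF s]]
        have "((\<lambda>s. f (x + hh A + s *\<^sub>R axis j 1)) has_real_derivative g j (x + hh A + s *\<^sub>R axis j 1)) (at s)"
          by (simp add: algebra_simps)
        then show "(F has_field_derivative (g j (x + hh A + s *\<^sub>R axis j 1) - g j x)) (at s within ?I)"
          unfolding F_def by (auto intro!: derivative_eq_intros intro: has_field_derivative_at_within)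
        show "norm (g j (x + hh A + s *\<^sub>R axis j 1) - g j x) \<le> e'"
          using \<delta>(2)[OF ins[OF s]] by (simp add: less_imp_le)
      qed auto
      moreover have "x + hh (insert j A) = x + hh A + (h $ j) *\<^sub>R axis j 1"
        using insert by (simp add: hh_def algebra_simps)
      ultimately show ?case using insert by (simp add: F_def algebra_simps)
    qed
    from this[of UNIV] have "\<bar>f (x + hh UNIV) - f x - (\<Sum>i\<in>UNIV. h $ i * g i x)\<bar> \<le> (\<Sum>i\<in>UNIV. \<bar>h $ i\<bar> * e')" by simp
    also have "hh UNIV = h" by (simp add: vec_eq_iff nth)
    also have "(\<Sum>i\<in>UNIV. \<bar>h $ i\<bar> * e') \<le> (\<Sum>i\<in>(UNIV::'n set). norm h * e')"
      using e' by (intro sum_mono mult_right_mono component_le_norm_cart) auto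
    also have "\<dots> = e * norm h" by (simp add: e'_def)
    finally show "norm (f y - f x - (\<Sum>i\<in>UNIV. (y - x) $ i * g i x)) \<le> e * norm (y - x)"
      by (simp add: h_def)
  qed
qed

lemma hsmooth_has_derivative:
  assumes "open S" "x \<in> S" "hsmooth S f"
  shows "(f has_derivative (\<lambda>h. \<Sum>i\<in>UNIV. h $ i * pd i f x)) (at x)"
  using assms by (intro C1_has_derivative[OF assms(1,2)])
    (auto intro: hsmooth_has_pd' hsmooth_continuous hsmooth_pd)

section \<open>Radial components along geodesics\<close>

lemma lists_Suc_eq: "{is::'a::finite list. length is = Suc j} = (\<lambda>(m, is). m # is) ` (UNIV \<times> {is. length is = j})"
  by (auto simp: length_Suc_conv image_iff)

lemma finite_lists_length [simp]: "finite {is::'a::finite list. length is = j}"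
  using finite_lists_length_eq[of "UNIV::'a set" j] by simp

lemma finite_lists_length_le [simp]: "finite {is::'a::finite list. length is \<le> j}"
  using finite_lists_length_le[of "UNIV::'a set" j] by simp

lemma sum_lists_Suc:
  fixes F :: "'a::finite list \<Rightarrow> 'b::comm_monoid_add"
  shows "(\<Sum>is | length is = Suc j. F is) = (\<Sum>m\<in>UNIV. \<Sum>is | length is = j. F (m # is))"
proof -
  have "inj_on (\<lambda>(m, is). m # is) (UNIV \<times> {is::'a list. length is = j})"
    by (auto simp: inj_on_def)
  then show ?thesis unfolding lists_Suc_eq by (simp add: sum.reindex sum.cartesian_product split_def)
qed

lemma sum_lists_prod:
  fixes f :: "'a::finite \<Rightarrow> real"
  shows "(\<Sum>is | length is = j. prod_list (map f is)) = (\<Sum>i\<in>UNIV. f i) ^ j"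
proof (induction j)
  case (Suc j)
  then show ?case by (simp add: sum_lists_Suc sum_distrib_left[symmetric] sum_distrib_right[symmetric])
qed simp

text \<open>Complete contraction of the j-th covariant derivative with the g-unit radial vector. At
  the origin division by zero turns this vector into zero, so only \<open>j = 0\<close> carries
  information there.\<close>

definition Drad :: "(real^'n::finite \<Rightarrow> real) \<Rightarrow> nat \<Rightarrow> real^'n \<Rightarrow> real" where
  "Drad u j x = (\<Sum>is | length is = j. cov u is x * prod_list (map (\<lambda>i. x $ i / (norm x * lam x)) is))"

text \<open>The unit speed geodesic from the origin towards \<open>y\<close>:
  \<open>tanh (t / 2)\<close> is the Euclidean radius at hyperbolic distance t. Only the direction
  of \<open>y\<close> matters, so \<open>y\<close> may range over a full ball instead of the
  sphere.\<close>

definition gam :: "real^'n \<Rightarrow> real \<Rightarrow> real^'n" where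
  "gam y t = (tanh (t / 2) / norm y) *\<^sub>R y"

lemma lam_pos: "norm x < 1 \<Longrightarrow> 0 < lam x"
  using one_minus_norm_sq_pos[of x] by (simp add: lam_def)

lemma lam_ge_2: "norm x < 1 \<Longrightarrow> 2 \<le> lam x"
  using one_minus_norm_sq_pos[of x] by (simp add: lam_def divide_simps)

text \<open>Cauchy-Schwarz against the j-fold tensor power of the radial vector. The length of that
  power factorises over the index list by \<open>sum_lists_prod\<close> and is at most the factor
  \<open>lam x powr (- real j)\<close> of \<open>gnorm\<close>.\<close>

lemma abs_Drad_le_gnorm:
  fixes x :: "real^'n::finite"
  assumes x: "norm x < 1"
  shows "\<bar>Drad u j x\<bar> \<le> gnorm j u x"
proof -
  let ?L = "{is::'n list. length is = j}"
  let ?f = "\<lambda>i. x $ i / (norm x * lam x)"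
  have l: "0 < lam x" using lam_pos[OF x] .
  have "(\<Sum>i\<in>UNIV. (?f i)\<^sup>2) = (\<Sum>i\<in>UNIV. (x $ i)\<^sup>2) / (norm x * lam x)\<^sup>2"
    by (simp add: power_divide sum_divide_distrib)
  also have "(\<Sum>i\<in>UNIV. (x $ i)\<^sup>2) = (norm x)\<^sup>2"
    by (simp add: norm_vec_def L2_set_def sum_nonneg)
  also have "(norm x)\<^sup>2 / (norm x * lam x)\<^sup>2 \<le> (1 / lam x)\<^sup>2"
    using l by (simp add: power_mult_distrib power_divide)
  finally have *: "(\<Sum>i\<in>UNIV. (?f i)\<^sup>2) \<le> (1 / lam x)\<^sup>2" .
  have "\<bar>Drad u j x\<bar> \<le> (\<Sum>is\<in>?L. \<bar>cov u is x\<bar> * \<bar>prod_list (map ?f is)\<bar>)"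
    unfolding Drad_def by (rule order_trans[OF sum_abs]) (simp add: abs_mult)
  also have "\<dots> \<le> L2_set (\<lambda>is. cov u is x) ?L * L2_set (\<lambda>is. prod_list (map ?f is)) ?L"
    by (rule L2_set_mult_ineq)
  finally have 1: "\<bar>Drad u j x\<bar> \<le> L2_set (\<lambda>is. cov u is x) ?L * L2_set (\<lambda>is. prod_list (map ?f is)) ?L" .
  have "L2_set (\<lambda>is. prod_list (map ?f is)) ?L = sqrt ((\<Sum>i\<in>UNIV. (?f i)\<^sup>2) ^ j)"
  proof -
    have "(prod_list (map ?f is))\<^sup>2 = prod_list (map (\<lambda>i. (?f i)\<^sup>2) is)" for "is"
      by (induction "is") (auto simp: power_mult_distrib power_divide)
    then show ?thesis unfolding L2_set_def using sum_lists_prod[of "\<lambda>i. (?f i)\<^sup>2" j] by simp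
  qed
  also have "\<dots> \<le> sqrt (((1 / lam x)\<^sup>2) ^ j)"
    using * by (intro real_sqrt_le_mono power_mono sum_nonneg) auto
  also have "\<dots> = (1 / lam x) ^ j" using l
    by (simp only: real_sqrt_power real_sqrt_abs) simp
  also have "\<dots> = lam x powr (- real j)"
    using l by (simp add: powr_minus powr_realpow divide_simps power_one_over)
  finally have "L2_set (\<lambda>is. prod_list (map ?f is)) ?L \<le> lam x powr (- real j)" .
  from mult_left_mono[OF this, of "L2_set (\<lambda>is. cov u is x) ?L"] 1
  show ?thesis unfolding gnorm_def L2_set_def by (simp add: mult.commute sum_nonneg)
qed

section \<open>Radial geodesics, the distance to the origin and geodesic balls\<close>

lemma gam_simps:
  fixes y :: "real^'n"
  assumes "y \<noteq> 0" "0 < t"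
  shows "norm (gam y t) = tanh (t / 2)" "norm (gam y t) < 1" "gam y t \<noteq> 0" "hdist (gam y t) = t"
proof -
  have p: "0 < tanh (t / 2)" using assms by simp
  show n: "norm (gam y t) = tanh (t / 2)" using assms p by (simp add: gam_def)
  show "norm (gam y t) < 1" unfolding n using tanh_real_lt_1 by blast
  show "gam y t \<noteq> 0" using n p by auto
  have "(1 + tanh (t / 2)) / (1 - tanh (t / 2)) = exp t"
  proof -
    have c: "cosh (t / 2) > 0" by (rule cosh_real_pos)
    have "(1 + tanh (t / 2)) / (1 - tanh (t / 2)) = (cosh (t / 2) + sinh (t / 2)) / (cosh (t / 2) - sinh (t / 2))"
    proof -
      have "cosh (t / 2) * (1 + tanh (t / 2)) = cosh (t / 2) + sinh (t / 2)"
        "cosh (t / 2) * (1 - tanh (t / 2)) = cosh (t / 2) - sinh (t / 2)"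
        using c by (auto simp: tanh_def algebra_simps)
      then show ?thesis using c by (metis mult_divide_mult_cancel_left less_irrefl)
    qed
    also have "\<dots> = exp (t / 2) / exp (- (t / 2))"
      by (simp add: cosh_plus_sinh cosh_minus_sinh)
    also have "\<dots> = exp t" by (simp add: exp_diff[symmetric])
    finally show ?thesis .
  qed
  then show "hdist (gam y t) = t" by (simp add: hdist_def n)
qed

lemma gam_in_hball: "y \<noteq> 0 \<Longrightarrow> t \<in> ivl R \<Longrightarrow> gam y t \<in> hball R"
  by (auto simp: hball_def ivl_def gam_simps(2,4))

lemma hdist_pos: "norm x < 1 \<Longrightarrow> x \<noteq> 0 \<Longrightarrow> 0 < hdist x"
  unfolding hdist_def by (auto intro!: ln_gt_zero simp: field_simps)

lemma tanh_half_hdist: "norm x < 1 \<Longrightarrow> tanh (hdist x / 2) = norm x"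
proof -
  assume x: "norm x < 1"
  let ?t = "hdist x"
  have "exp ?t = (1 + norm x) / (1 - norm x)"
    using x unfolding hdist_def by (subst exp_ln) (auto intro!: divide_pos_pos add_pos_nonneg)
  moreover have "tanh (?t / 2) = (exp ?t - 1) / (exp ?t + 1)"
  proof -
    have e: "exp (- 2 * (?t / 2)) = 1 / exp ?t" by (simp add: exp_minus inverse_eq_divide)
    have "(1 - 1 / E) / (1 + 1 / E) = (E - 1) / (E + 1)" if "E > 0" for E :: real
      using that by (simp add: divide_simps)
    then show ?thesis unfolding tanh_real_altdef e by simp
  qed
  moreover have "((1 + r) / (1 - r) - 1) / ((1 + r) / (1 - r) + 1) = r" if "r < 1" for r :: real
  proof -
    have "(1 + r) / (1 - r) - 1 = 2 * r / (1 - r)" "(1 + r) / (1 - r) + 1 = 2 / (1 - r)"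
      using that by (auto simp: divide_simps)
    then show ?thesis using that by simp
  qed
  ultimately show ?thesis using x by simp
qed

lemma continuous_on_hdist: "continuous_on (ball 0 1) hdist"
  unfolding hdist_def
proof (intro continuous_intros ballI)
  fix x :: "real^'n" assume "x \<in> ball 0 1"
  then have "0 < 1 + norm x" "0 < 1 - norm x" by (auto intro: add_pos_nonneg)
  then show "1 - norm x \<noteq> 0" "(1 + norm x) / (1 - norm x) \<noteq> 0" by auto
qed

lemma hball_subset: "hball R \<subseteq> ball 0 1" by (auto simp: hball_def)

lemma open_hball: "open (hball R :: (real^'n::finite) set)"
proof -
  have "(hball R :: (real^'n) set) = hdist -` {t. ereal t < R} \<inter> ball 0 1" by (auto simp: hball_def)
  moreover have "open {t. ereal t < R}"
    by (intro open_Collect_less continuous_intros)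
  ultimately show ?thesis
    using continuous_on_open_vimage[OF open_ball, THEN iffD1, OF continuous_on_hdist, rule_format] by (simp only:)
qed

lemma has_vector_derivative_gam:
  fixes y :: "real^'n"
  assumes "y \<noteq> 0"
  shows "(gam y has_vector_derivative ((1 - (tanh (t / 2))\<^sup>2) / 2 / norm y) *\<^sub>R y) (at t)"
proof -
  have "((\<lambda>t. tanh (t / 2) / norm y) has_real_derivative (1 - (tanh (t / 2))\<^sup>2) / 2 / norm y) (at t)"
    using cosh_real_nonzero assms by (auto intro!: derivative_eq_intros)
  then show ?thesis unfolding gam_def[abs_def]
    by (rule has_vector_derivative_scaleR[OF _ has_vector_derivative_const, simplified])
qed

lemma prod_list_map_update:
  fixes f :: "'a \<Rightarrow> real"
  assumes "l < length is"
  shows "prod_list (map f (is[l := b])) = prod_list (map f (take l is)) * prod_list (map f (drop (Suc l) is)) * f b"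
  using assms by (simp add: upd_conv_take_nth_drop)

text \<open>Exchanging the l-th entry with the extra index is an involution of the pairs. It moves
  the substituted index of a Christoffel term from the tensor to the contracting vectors.\<close>

lemma sum_lists_update_swap:
  fixes F :: "'a::finite list \<Rightarrow> 'a \<Rightarrow> 'b::comm_monoid_add"
  assumes "l < j"
  shows "(\<Sum>is | length is = j. \<Sum>s\<in>UNIV. F is s) = (\<Sum>is | length is = j. \<Sum>b\<in>UNIV. F (is[l := b]) (is ! l))"
  unfolding sum.cartesian_product
  by (rule sum.reindex_bij_witness[where i="\<lambda>(is, b). (is[l := b], is ! l)" and j="\<lambda>(is, s). (is[l := s], is ! l)"])
    (use assms in auto)

text \<open>\<open>chr\<close> has three Kronecker terms. Since the gradient of the logarithmic
  conformal factor is radial, each contributes \<open>c * \<theta> $ s\<close>, two of them with a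
  plus and one with a minus sign.\<close>

lemma chr_contraction:
  fixes x \<theta> :: "real^'n::finite"
  assumes "\<And>i. dlog i x = c * \<theta> $ i" "norm \<theta> = 1"
  shows "(\<Sum>m\<in>UNIV. \<Sum>b\<in>UNIV. \<theta> $ m * \<theta> $ b * chr s m b x) = c * \<theta> $ s"
proof -
  have 1: "(\<Sum>b\<in>UNIV. (\<theta> $ b)\<^sup>2) = 1" using assms(2) by (simp add: norm_vec_def L2_set_def)
  have "(\<Sum>m\<in>UNIV. \<Sum>b\<in>UNIV. \<theta> $ m * \<theta> $ b * chr s m b x)
     = (\<Sum>m\<in>UNIV. \<Sum>b\<in>UNIV. (if m = s then c * \<theta> $ s * (\<theta> $ b)\<^sup>2 else 0)
       + (if b = s then c * \<theta> $ s * (\<theta> $ m)\<^sup>2 else 0) - (if m = b then c * \<theta> $ s * (\<theta> $ b)\<^sup>2 else 0))"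
    unfolding chr_def assms(1) by (intro sum.cong refl) (auto simp: power2_eq_square algebra_simps)
  also have "\<dots> = (\<Sum>m\<in>UNIV. \<Sum>b\<in>UNIV. if m = s then c * \<theta> $ s * (\<theta> $ b)\<^sup>2 else 0)
     + (\<Sum>m\<in>UNIV. \<Sum>b\<in>UNIV. if b = s then c * \<theta> $ s * (\<theta> $ m)\<^sup>2 else 0)
     - (\<Sum>m\<in>UNIV. \<Sum>b\<in>UNIV. if m = b then c * \<theta> $ s * (\<theta> $ b)\<^sup>2 else 0)"
    by (simp only: sum_subtractf sum.distrib)
  also have "(\<Sum>m\<in>UNIV. \<Sum>b\<in>UNIV. if m = s then c * \<theta> $ s * (\<theta> $ b)\<^sup>2 else 0) = c * \<theta> $ s * (\<Sum>b\<in>UNIV. (\<theta> $ b)\<^sup>2)"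
    by (subst sum.swap) (simp add: sum_distrib_left)
  also have "(\<Sum>m\<in>UNIV. \<Sum>b\<in>UNIV. if b = s then c * \<theta> $ s * (\<theta> $ m)\<^sup>2 else 0) = c * \<theta> $ s * (\<Sum>b\<in>UNIV. (\<theta> $ b)\<^sup>2)"
    by (simp add: sum_distrib_left)
  also have "(\<Sum>m\<in>UNIV. \<Sum>b\<in>UNIV. if m = b then c * \<theta> $ s * (\<theta> $ b)\<^sup>2 else 0) = c * \<theta> $ s * (\<Sum>b\<in>UNIV. (\<theta> $ b)\<^sup>2)"
    by (simp add: sum_distrib_left)
  finally show ?thesis using 1 by simp
qed

text \<open>The curves \<open>gam y\<close> are unit speed geodesics, so the derivative of \<open>Drad u j\<close> along them only
  sees the covariant derivative of the tensor.\<close>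
lemma has_derivative_Drad_gam:
  fixes y :: "real^'n::finite"
  assumes u: "hsmooth (hball R) u" and y: "y \<noteq> 0" and t: "t \<in> ivl R"
  shows "((\<lambda>t. Drad u j (gam y t)) has_real_derivative Drad u (Suc j) (gam y t)) (at t)"
proof -
  define \<theta> where "\<theta> = (1 / norm y) *\<^sub>R y"
  define P where "P is = prod_list (map (\<lambda>i. \<theta> $ i) is)" for "is"
  \<comment> \<open>\<open>a t\<close> is the Euclidean speed of \<open>gam y\<close>, the
    reciprocal of \<open>lam\<close> on the curve.\<close>
  define \<tau> a where "\<tau> = tanh (t / 2)" and "a = (\<lambda>t::real. (1 - (tanh (t / 2))\<^sup>2) / 2)"
  define S where "S j t = (\<Sum>is | length is = j. cov u is (gam y t) * P is)" for j t
  have n\<theta>: "norm \<theta> = 1" using y by (simp add: \<theta>_def)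
  have t0: "0 < t" using t by (simp add: ivl_def)
  have a_pos: "0 < a t" for t using tanh_real_lt_1[of "t/2"] tanh_real_gt_neg1[of "t/2"]
    by (simp add: a_def abs_square_less_1)
  \<comment> \<open>Splitting off the scalar \<open>a t ^ j\<close> leaves a contraction with the
    constant direction \<theta>, so only the components \<open>cov u is\<close> and that scalar vary
    with t.\<close>
  have Drad_gam: "Drad u j (gam y t) = a t ^ j * S j t" if "0 < t" for j t
  proof -
    have "gam y t $ i / (norm (gam y t) * lam (gam y t)) = a t * \<theta> $ i" for i
      using that y a_pos[of t] unfolding gam_simps(1)[OF y that] lam_def
      by (simp add: gam_def \<theta>_def a_def mult_ac)
    moreover have "prod_list (map (\<lambda>i. a t * \<theta> $ i) is) = a t ^ length is * P is" for "is"
      unfolding P_def by (induction "is") auto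
    ultimately show ?thesis
      by (simp add: Drad_def S_def sum_distrib_left mult.left_commute)
  qed
  let ?x = "gam y t"
  have x: "?x \<in> hball R" using gam_in_hball[OF y t] .
  have sm: "hsmooth (hball R) (cov u is)" for "is" by (rule hsmooth_cov[OF open_hball hball_subset u])
  have dcov: "((\<lambda>t. cov u is (gam y t)) has_real_derivative (\<Sum>m\<in>UNIV. a t * \<theta> $ m * pd m (cov u is) ?x)) (at t)" for "is"
  proof -
    have g: "(gam y has_derivative (\<lambda>h. h *\<^sub>R (a t *\<^sub>R \<theta>))) (at t)"
      using has_vector_derivative_gam[OF y, of t] unfolding has_vector_derivative_def by (simp add: a_def \<theta>_def)
    from diff_chain_at[OF g hsmooth_has_derivative[OF open_hball x sm[of "is"]]]
    have "((\<lambda>t. cov u is (gam y t)) has_derivative (\<lambda>h. \<Sum>i\<in>UNIV. h * (a t * \<theta> $ i) * pd i (cov u is) ?x)) (at t)"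
      by (simp add: o_def mult.assoc)
    then show ?thesis unfolding has_field_derivative_def
      by (rule has_derivative_eq_rhs) (simp add: fun_eq_iff sum_distrib_left mult_ac)
  qed
  have dl: "dlog i ?x = (\<tau> / a t) * \<theta> $ i" for i
    using a_pos[of t] unfolding dlog_def gam_simps(1)[OF y t0] by (simp add: a_def \<tau>_def gam_def \<theta>_def mult_ac)
  \<comment> \<open>Each slot of the tensor contributes the same multiple of \<open>S j t\<close>:
    after the index swap its Christoffel symbol is contracted twice with \<theta>.\<close>
  have X: "(\<Sum>is | length is = j. \<Sum>m\<in>UNIV. \<theta> $ m * P is * (\<Sum>s\<in>UNIV. chr s m (is ! l) ?x * cov u (is[l := s]) ?x))
     = \<tau> / a t * S j t" if l: "l < j" for l
  proof -
    have "(\<Sum>is | length is = j. \<Sum>m\<in>UNIV. \<theta> $ m * P is * (\<Sum>s\<in>UNIV. chr s m (is ! l) ?x * cov u (is[l := s]) ?x))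
      = (\<Sum>is | length is = j. \<Sum>s\<in>UNIV. \<Sum>m\<in>UNIV. \<theta> $ m * P is * (chr s m (is ! l) ?x * cov u (is[l := s]) ?x))"
      unfolding sum_distrib_left by (intro sum.cong refl sum.swap)
    also have "\<dots> = (\<Sum>is | length is = j. \<Sum>b\<in>UNIV. \<Sum>m\<in>UNIV. \<theta> $ m * P (is[l := b]) * (chr (is ! l) m b ?x * cov u is ?x))"
      unfolding sum_lists_update_swap[OF l, where F="\<lambda>is s. \<Sum>m\<in>UNIV. \<theta> $ m * P is * (chr s m (is ! l) ?x * cov u (is[l := s]) ?x)"]
      using l by (intro sum.cong refl) auto
    also have "\<dots> = (\<Sum>is | length is = j. cov u is ?x * (\<tau> / a t * P is))"
    proof (rule sum.cong[OF refl])
      fix "is" :: "'n list" assume "is \<in> {is. length is = j}"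
      then have len: "l < length is" using l by simp
      define Q where "Q = prod_list (map (\<lambda>i. \<theta> $ i) (take l is)) * prod_list (map (\<lambda>i. \<theta> $ i) (drop (Suc l) is))"
      have P: "P (is[l := b]) = Q * \<theta> $ b" for b unfolding P_def Q_def by (rule prod_list_map_update[OF len])
      have "(\<Sum>b\<in>UNIV. \<Sum>m\<in>UNIV. \<theta> $ m * P (is[l := b]) * (chr (is ! l) m b ?x * cov u is ?x))
         = cov u is ?x * Q * (\<Sum>m\<in>UNIV. \<Sum>b\<in>UNIV. \<theta> $ m * \<theta> $ b * chr (is ! l) m b ?x)"
        unfolding P by (subst sum.swap) (simp add: sum_distrib_left algebra_simps)
      also have "\<dots> = cov u is ?x * (\<tau> / a t * (Q * \<theta> $ (is ! l)))"
        by (subst chr_contraction[OF dl n\<theta>]) simp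
      also have "Q * \<theta> $ (is ! l) = P is" using P[of "is ! l"] by simp
      finally show "(\<Sum>b\<in>UNIV. \<Sum>m\<in>UNIV. \<theta> $ m * P (is[l := b]) * (chr (is ! l) m b ?x * cov u is ?x)) =
         cov u is ?x * (\<tau> / a t * P is)" .
    qed
    also have "\<dots> = \<tau> / a t * S j t" by (simp add: S_def sum_distrib_left mult.left_commute)
    finally show ?thesis .
  qed
  have "(S j has_real_derivative (\<Sum>is | length is = j. (\<Sum>m\<in>UNIV. a t * \<theta> $ m * pd m (cov u is) ?x) * P is)) (at t)"
    unfolding S_def[abs_def] by (intro DERIV_sum DERIV_cmult_right dcov)
  also have "(\<Sum>is | length is = j. (\<Sum>m\<in>UNIV. a t * \<theta> $ m * pd m (cov u is) ?x) * P is)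
    = a t * S (Suc j) t + j * \<tau> * S j t"
  proof -
    have "S (Suc j) t = (\<Sum>is | length is = j. \<Sum>m\<in>UNIV. cov u (m # is) ?x * (\<theta> $ m * P is))"
      unfolding S_def sum_lists_Suc by (subst sum.swap) (simp add: P_def)
    also have "\<dots> = (\<Sum>is | length is = j. \<Sum>m\<in>UNIV. pd m (cov u is) ?x * (\<theta> $ m * P is))
       - (\<Sum>is | length is = j. \<Sum>m\<in>UNIV. \<Sum>l<j. \<theta> $ m * P is * (\<Sum>s\<in>UNIV. chr s m (is ! l) ?x * cov u (is[l := s]) ?x))"
      unfolding sum_subtractf[symmetric] by (intro sum.cong refl) (simp add: algebra_simps sum_distrib_left)
    also have "(\<Sum>is | length is = j. \<Sum>m\<in>UNIV. \<Sum>l<j. \<theta> $ m * P is * (\<Sum>s\<in>UNIV. chr s m (is ! l) ?x * cov u (is[l := s]) ?x))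
      = (\<Sum>is | length is = j. \<Sum>l<j. \<Sum>m\<in>UNIV. \<theta> $ m * P is * (\<Sum>s\<in>UNIV. chr s m (is ! l) ?x * cov u (is[l := s]) ?x))"
      by (intro sum.cong refl sum.swap)
    also have "\<dots> = (\<Sum>l<j. \<Sum>is | length is = j. \<Sum>m\<in>UNIV. \<theta> $ m * P is * (\<Sum>s\<in>UNIV. chr s m (is ! l) ?x * cov u (is[l := s]) ?x))"
      by (rule sum.swap)
    also have "\<dots> = j * (\<tau> / a t * S j t)" using X by simp
    finally have 1: "(\<Sum>is | length is = j. \<Sum>m\<in>UNIV. pd m (cov u is) ?x * (\<theta> $ m * P is)) = S (Suc j) t + j * (\<tau> / a t * S j t)"
      by simp
    have "(\<Sum>is | length is = j. (\<Sum>m\<in>UNIV. a t * \<theta> $ m * pd m (cov u is) ?x) * P is)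
      = a t * (\<Sum>is | length is = j. \<Sum>m\<in>UNIV. pd m (cov u is) ?x * (\<theta> $ m * P is))"
      by (simp add: sum_distrib_left sum_distrib_right mult_ac)
    also have "\<dots> = a t * S (Suc j) t + j * \<tau> * S j t"
      unfolding 1 using a_pos[of t] by (simp add: algebra_simps)
    finally show ?thesis .
  qed
  finally have dS: "(S j has_real_derivative a t * S (Suc j) t + j * \<tau> * S j t) (at t)" .
  \<comment> \<open>Differentiating \<open>a t ^ j\<close> yields
    \<open>- j * \<tau> * a t ^ j\<close>, which cancels the Christoffel contribution
    \<open>j * \<tau> * S j t\<close>.\<close>
  have da: "(a has_real_derivative - \<tau> * a t) (at t)"
    unfolding a_def using cosh_real_nonzero
    by (auto intro!: derivative_eq_intros simp: \<tau>_def power2_eq_square)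
  have "((\<lambda>t. a t ^ j * S j t) has_real_derivative a t ^ Suc j * S (Suc j) t) (at t)"
  proof (cases j)
    case 0
    then show ?thesis using dS by simp
  next
    case (Suc i)
    show ?thesis by (rule derivative_eq_intros dS da refl)+ (simp add: Suc algebra_simps)
  qed
  moreover have "\<forall>\<^sub>F s in nhds t. a s ^ j * S j s = Drad u j (gam y s)"
    using eventually_nhds_in_open[of "{0<..}" t] t0 by (auto elim!: eventually_mono simp: Drad_gam)
  ultimately show ?thesis
    unfolding Drad_gam[OF t0, of "Suc j"] by (subst (asm) DERIV_cong_ev[OF refl _ refl]) auto
qed

section \<open>Polar coordinates\<close>

lemma nn_integral_lborel_scale:
  fixes f :: "'a::euclidean_space \<Rightarrow> ennreal"
  assumes [measurable]: "f \<in> borel_measurable borel" and c: "c \<noteq> 0"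
  shows "(\<integral>\<^sup>+x. f x \<partial>lborel) = ennreal (\<bar>c\<bar> ^ DIM('a)) * (\<integral>\<^sup>+x. f (c *\<^sub>R x) \<partial>lborel)"
  by (subst lborel_affine[OF c, of 0]) (simp add: nn_integral_density nn_integral_distr nn_integral_cmult)

lemma nn_integral_lborel_shift:
  fixes f :: "'a::euclidean_space \<Rightarrow> ennreal"
  assumes [measurable]: "f \<in> borel_measurable borel"
  shows "(\<integral>\<^sup>+x. f (a + x) \<partial>lborel) = (\<integral>\<^sup>+x. f x \<partial>lborel)"
  by (subst (2) lborel_affine[of 1 a]) (simp_all add: nn_integral_density nn_integral_distr nn_integral_cmult)

lemma AE_lborel_neq: "AE x in lborel. x \<noteq> (a::'a::euclidean_space)"
  by (rule AE_lborel_singleton)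

lemma measurable_ball [measurable]: "ball x r \<in> sets borel" by simp

lemma nn_integral_inverse_power_tail:
  fixes r :: real
  assumes "0 < r" "0 < n"
  shows "(\<integral>\<^sup>+s. ennreal (1 / s ^ (n + 1)) * indicator {r..} s \<partial>lborel) = ennreal (1 / (n * r ^ n))"
proof -
  have "(\<integral>\<^sup>+s. ennreal (1 / s ^ (n + 1)) * indicator {r..} s \<partial>lborel) = ennreal (0 - (- 1 / (n * r ^ n)))"
  proof (rule nn_integral_FTC_atLeast)
    fix x assume x: "r \<le> x"
    then have x0: "x > 0" using assms by simp
    show "((\<lambda>s. - 1 / (real n * s ^ n)) has_real_derivative 1 / x ^ (n + 1)) (at x)"
    proof -
      obtain m where m: "n = Suc m" using assms gr0_implies_Suc by blast
      show ?thesis unfolding m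
        by (rule derivative_eq_intros refl | use x0 in simp)+
    qed
    show "0 \<le> 1 / x ^ (n + 1)" using x0 by simp
  next
    have "((\<lambda>s::real. (1 / s) ^ n) \<longlongrightarrow> 0 ^ n) at_top"
      by (intro tendsto_power tendsto_divide_0[OF tendsto_const] filterlim_at_top_imp_at_infinity filterlim_ident)
    from tendsto_mult[OF tendsto_const[of "- 1 / real n"] this]
    show "((\<lambda>s. - 1 / (real n * s ^ n)) \<longlongrightarrow> 0) at_top"
      using assms by (simp add: power_divide power_0_left)
  qed auto
  then show ?thesis by simp
qed

text \<open>Polar coordinates without surface measure: a direction is sampled by a point y of the
  unit ball. Substitute \<open>t = s * norm y\<close> on each ray, exchange the integrals and
  substitute \<open>x = s *\<^sub>R y\<close> in space. What remains is the integral of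
  \<open>norm x ^ N / s ^ (N + 1)\<close> over \<open>s > norm x\<close>, which is 1 / N and
  explains the factor in front.\<close>

lemma polar_nn_integral:
  fixes f :: "real^'n::finite \<Rightarrow> ennreal"
  assumes f[measurable]: "f \<in> borel_measurable borel"
  shows "(\<integral>\<^sup>+x. f x \<partial>lborel) = of_nat CARD('n) *
     (\<integral>\<^sup>+y. (\<integral>\<^sup>+t. f ((t / norm y) *\<^sub>R y) * ennreal (t ^ (CARD('n) - 1)) * indicator {0<..} t \<partial>lborel) * indicator (ball 0 1) y \<partial>lborel)"
proof -
  let ?N = "CARD('n)"
  let ?k = "\<lambda>s (x::real^'n). ennreal (1 / s ^ (?N + 1)) * (indicator {0<..} s * indicator {norm x<..} s)"
  let ?I = "\<lambda>y. \<integral>\<^sup>+t. f ((t / norm y) *\<^sub>R y) * ennreal (t ^ (?N - 1)) * indicator {0<..} t \<partial>lborel"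
  obtain M where M: "?N = Suc M" using not0_implies_Suc[OF zero_less_card_finite[where 'a='n, THEN gr_implies_not0]] by blast
  have N0: "0 < ?N" by simp
  \<comment> \<open>The integrand after \<open>t = s * norm y\<close>: the power of t and the
    Jacobian together give \<open>norm y ^ ?N\<close>.\<close>
  let ?g = "\<lambda>(y::real^'n) s::real. f (s *\<^sub>R y) * ennreal (s ^ M) * ennreal (norm y ^ ?N) * indicator {0<..} s * indicator (ball 0 1) y"
  have "(\<integral>\<^sup>+y. ?I y * indicator (ball 0 1) y \<partial>lborel)
     = (\<integral>\<^sup>+y. (\<integral>\<^sup>+s. ?g y s \<partial>lborel) \<partial>lborel)"
  proof (rule nn_integral_cong_AE)
    show "AE y in lborel. ?I y * indicator (ball 0 1) y
        = (\<integral>\<^sup>+s. ?g y s \<partial>lborel)"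
      using AE_lborel_neq[of 0]
    proof eventually_elim
      case (elim y)
      then have n: "norm y > 0" by simp
      have "?I y
        = ennreal (norm y) * (\<integral>\<^sup>+s. f (s *\<^sub>R y) * ennreal ((norm y * s) ^ M) * indicator {0<..} s \<partial>lborel)"
        using n by (subst nn_integral_real_affine[where c="norm y" and t=0])
          (auto simp: M zero_less_mult_iff indicator_def intro!: arg_cong[where f="\<lambda>x. _ * x"] nn_integral_cong)
      also have "\<dots> = (\<integral>\<^sup>+s. f (s *\<^sub>R y) * ennreal (s ^ M) * ennreal (norm y ^ ?N) * indicator {0<..} s \<partial>lborel)"
        using n by (subst nn_integral_cmult[symmetric])
          (auto intro!: nn_integral_cong simp: M indicator_def power_mult_distrib ennreal_mult' mult_ac)
      finally show ?case by (simp add: nn_integral_multc)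
    qed
  qed
  also have "\<dots> = (\<integral>\<^sup>+s. (\<integral>\<^sup>+y. ?g y s \<partial>lborel) \<partial>lborel)"
    by (rule lborel_pair.Fubini'[symmetric]) (unfold split_def, measurable)
  also have "\<dots> = (\<integral>\<^sup>+s. (\<integral>\<^sup>+x. f x * ennreal (norm x ^ ?N) * ?k s x \<partial>lborel) \<partial>lborel)"
  proof (rule nn_integral_cong)
    fix s :: real
    show "(\<integral>\<^sup>+y. ?g y s \<partial>lborel) = (\<integral>\<^sup>+x. f x * ennreal (norm x ^ ?N) * ?k s x \<partial>lborel)"
    proof (cases "s > 0")
      case True
      have [measurable]: "(\<lambda>x::real^'n. indicator {norm x<..} s :: ennreal) \<in> borel_measurable borel"
        unfolding indicator_def greaterThan_iff by measurable
      have *: "(\<integral>\<^sup>+x. f x * ennreal (norm x ^ ?N) * ?k s x \<partial>lborel)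
         = ennreal (s ^ ?N) * (\<integral>\<^sup>+y. f (s *\<^sub>R y) * ennreal (norm (s *\<^sub>R y) ^ ?N) * ?k s (s *\<^sub>R y) \<partial>lborel)"
        using True by (subst nn_integral_lborel_scale[where c=s]) auto
      have [measurable]: "(\<lambda>x::real^'n. indicator {norm (s *\<^sub>R x)<..} s :: ennreal) \<in> borel_measurable borel"
        unfolding indicator_def greaterThan_iff by measurable
      note *
      also have "ennreal (s ^ ?N) * (\<integral>\<^sup>+y. f (s *\<^sub>R y) * ennreal (norm (s *\<^sub>R y) ^ ?N) * ?k s (s *\<^sub>R y) \<partial>lborel)
        = (\<integral>\<^sup>+y. ennreal (s ^ ?N) * (f (s *\<^sub>R y) * ennreal (norm (s *\<^sub>R y) ^ ?N) * ?k s (s *\<^sub>R y)) \<partial>lborel)"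
        by (rule nn_integral_cmult[symmetric]) measurable
      also have "\<dots> = (\<integral>\<^sup>+y. ?g y s \<partial>lborel)"
      proof (rule nn_integral_cong)
        fix y :: "real^'n"
        have "ennreal (s ^ ?N) * ennreal (norm (s *\<^sub>R y) ^ ?N) * ennreal (1 / s ^ (?N + 1)) = ennreal (s ^ M) * ennreal (norm y ^ ?N)"
          using True by (simp add: ennreal_mult[symmetric] power_mult_distrib M field_simps)
        moreover have "indicator {norm (s *\<^sub>R y)<..} s = (indicator (ball 0 1) y :: ennreal)"
          using True by (auto simp: indicator_def)
        moreover have "ennreal (s ^ ?N) * (f (s *\<^sub>R y) * ennreal (norm (s *\<^sub>R y) ^ ?N) * ?k s (s *\<^sub>R y))
          = f (s *\<^sub>R y) * (ennreal (s ^ ?N) * ennreal (norm (s *\<^sub>R y) ^ ?N) * ennreal (1 / s ^ (?N + 1))) * indicator {0<..} s * indicator {norm (s *\<^sub>R y)<..} s"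
          by (simp only: mult_ac)
        ultimately show "ennreal (s ^ ?N) * (f (s *\<^sub>R y) * ennreal (norm (s *\<^sub>R y) ^ ?N) * ?k s (s *\<^sub>R y)) = ?g y s"
          by (simp only: mult.assoc)
      qed
      finally show ?thesis by simp
    qed simp
  qed
  also have "\<dots> = (\<integral>\<^sup>+x. (\<integral>\<^sup>+s. f x * ennreal (norm x ^ ?N) * ?k s x \<partial>lborel) \<partial>lborel)"
  proof (rule lborel_pair.Fubini')
    have [measurable]: "Measurable.pred (lborel \<Otimes>\<^sub>M lborel) (\<lambda>x. snd x \<in> {norm (fst x :: real^'n)<..})"
      by simp
    show "(\<lambda>(x, s). f x * ennreal (norm x ^ ?N) * ?k s x)
      \<in> borel_measurable (lborel \<Otimes>\<^sub>M lborel)" unfolding indicator_def split_def by measurable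
  qed
  also have "\<dots> = (\<integral>\<^sup>+x. f x * ennreal (1 / ?N) \<partial>lborel)"
  proof (rule nn_integral_cong_AE)
    show "AE x in lborel. (\<integral>\<^sup>+s. f x * ennreal (norm x ^ ?N) * ?k s x \<partial>lborel)
       = f x * ennreal (1 / ?N)"
      using AE_lborel_neq[of 0]
    proof eventually_elim
      case (elim x)
      then have n: "norm x > 0" by simp
      have "(\<integral>\<^sup>+s. f x * ennreal (norm x ^ ?N) * ?k s x \<partial>lborel)
        = f x * ennreal (norm x ^ ?N) * (\<integral>\<^sup>+s. ennreal (1 / s ^ (?N + 1)) * (indicator {0<..} s * indicator {norm x<..} s) \<partial>lborel)"
        by (rule nn_integral_cmult) simp
      also have "(\<integral>\<^sup>+s. ennreal (1 / s ^ (?N + 1)) * (indicator {0<..} s * indicator {norm x<..} s) \<partial>lborel)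
         = (\<integral>\<^sup>+s. ennreal (1 / s ^ (?N + 1)) * indicator {norm x..} s \<partial>lborel)"
        using AE_lborel_neq[of "norm x"] n
        by (intro nn_integral_cong_AE)
          (auto elim!: eventually_mono simp: indicator_def dest: less_trans[OF n] le_less_trans[OF norm_ge_zero])
      also have "\<dots> = ennreal (1 / (?N * norm x ^ ?N))" by (rule nn_integral_inverse_power_tail[OF n N0])
      also have "f x * ennreal (norm x ^ ?N) * \<dots> = f x * ennreal (1 / ?N)"
        using n by (simp add: mult.assoc ennreal_mult[symmetric])
      finally show ?case .
    qed
  qed
  also have "\<dots> = (\<integral>\<^sup>+x. f x \<partial>lborel) * ennreal (1 / ?N)" by (rule nn_integral_multc) simp
  finally have "of_nat ?N * (\<integral>\<^sup>+y. ?I y * indicator (ball 0 1) y \<partial>lborel)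
     = (\<integral>\<^sup>+x. f x \<partial>lborel) * (ennreal (1 / ?N) * ennreal (real ?N))"
    by (simp add: ennreal_of_nat_eq_real_of_nat mult_ac)
  then show ?thesis by (simp add: ennreal_mult[symmetric])
qed

text \<open>Change of variables on the compact pieces \<open>{0..real n}\<close>, followed by
  continuity from below of the two density measures.\<close>

lemma nn_integral_substitution_tanh:
  fixes g :: "real \<Rightarrow> ennreal"
  assumes [measurable]: "g \<in> borel_measurable borel"
  shows "(\<integral>\<^sup>+r. g r * indicator {0..<1} r \<partial>lborel)
    = (\<integral>\<^sup>+t. g (tanh (t / 2)) * ennreal ((1 - (tanh (t / 2))\<^sup>2) / 2) * indicator {0..} t \<partial>lborel)"
proof -
  let ?A = "\<lambda>n::nat. {0..tanh (real n / 2)}" and ?B = "\<lambda>n::nat. {0..real n}"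
  let ?h = "\<lambda>t. g (tanh (t / 2)) * ennreal ((1 - (tanh (t / 2))\<^sup>2) / 2)"
  have [measurable]: "(\<lambda>t::real. tanh (t / 2)) \<in> borel_measurable borel"
    by (intro borel_measurable_continuous_onI continuous_intros) auto
  have A: "(\<Union>n. ?A n) = {0..<1}"
  proof (intro set_eqI iffI)
    fix r :: real assume r: "r \<in> {0..<1}"
    \<comment> \<open>A vector of norm r in dimension one, so that \<open>tanh_half_hdist\<close>
      provides a preimage of r under tanh.\<close>
    define x :: "real^1" where "x = r *\<^sub>R axis undefined 1"
    have x: "norm x = r" "norm x < 1" using r by (auto simp: x_def norm_axis_1)
    obtain n :: nat where n: "hdist x \<le> real n" using real_arch_simple by blast
    have "r = tanh (hdist x / 2)" using tanh_half_hdist[OF x(2)] x(1) by simp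
    also have "\<dots> \<le> tanh (real n / 2)" using n by simp
    finally show "r \<in> (\<Union>n. ?A n)" using r by auto
  qed (auto intro: le_less_trans[OF _ tanh_real_lt_1])
  have B: "(\<Union>n. ?B n) = {0..}" using real_arch_simple by fastforce
  have eq: "emeasure (density lborel g) (?A n) = emeasure (density lborel ?h) (?B n)" for n
  proof (cases "n = 0")
    case True
    then show ?thesis by (simp add: emeasure_density nn_integral_null_set)
  next
    case False
    have "(\<integral>\<^sup>+x. g x * indicator {tanh (0 / 2)..tanh (real n / 2)} x \<partial>lborel) = (\<integral>\<^sup>+x. g (tanh (x / 2)) * ennreal ((1 - (tanh (x / 2))\<^sup>2) / 2) * indicator {0..real n} x \<partial>lborel)"
    proof (rule nn_integral_substitution_aux)
      show "0 < real n" using False by simp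
      show "continuous_on {0..real n} (\<lambda>x. (1 - (tanh (x / 2))\<^sup>2) / 2)"
        by (intro continuous_intros) auto
      fix x :: real
      show "((\<lambda>x. tanh (x / 2)) has_real_derivative (1 - (tanh (x / 2))\<^sup>2) / 2) (at x)"
        using cosh_real_nonzero by (auto intro!: derivative_eq_intros)
      show "0 \<le> (1 - (tanh (x / 2))\<^sup>2) / 2"
        using tanh_real_bounds[of "x / 2"] by (simp add: abs_square_le_1 abs_le_iff less_imp_le)
    qed auto
    then show ?thesis by (simp add: emeasure_density)
  qed
  have "(\<integral>\<^sup>+r. g r * indicator {0..<1} r \<partial>lborel) = emeasure (density lborel g) (\<Union>n. ?A n)"
    unfolding A by (simp add: emeasure_density)
  also have "\<dots> = (SUP n. emeasure (density lborel g) (?A n))"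
    by (rule SUP_emeasure_incseq[symmetric]) (auto simp: incseq_def intro: order_trans)
  also have "\<dots> = (SUP n. emeasure (density lborel ?h) (?B n))" unfolding eq ..
  also have "\<dots> = emeasure (density lborel ?h) (\<Union>n. ?B n)"
    by (rule SUP_emeasure_incseq) (auto simp: incseq_def)
  also have "\<dots> = (\<integral>\<^sup>+t. ?h t * indicator {0..} t \<partial>lborel)" unfolding B by (simp add: emeasure_density)
  finally show ?thesis .
qed

section \<open>Polar coordinates for the hyperbolic volume\<close>

lemma measurable_hdist [measurable]: "(hdist :: real^'n \<Rightarrow> real) \<in> borel_measurable borel"
  unfolding hdist_def[abs_def] by measurable

lemma measurable_lam [measurable]: "(lam :: real^'n \<Rightarrow> real) \<in> borel_measurable borel"
  unfolding lam_def[abs_def] by measurable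

lemma measurable_hball [measurable]: "hball R \<in> sets borel"
  by (rule borel_open[OF open_hball])

lemma measurable_ivl [measurable]: "ivl R \<in> sets borel"
  unfolding ivl_def by measurable

lemma measurable_gam [measurable]: "(\<lambda>(y, t). gam y t) \<in> borel_measurable (borel \<Otimes>\<^sub>M borel)"
proof -
  have [measurable]: "(\<lambda>t::real. tanh (t / 2)) \<in> borel_measurable borel"
    by (intro borel_measurable_continuous_onI continuous_intros) auto
  show ?thesis unfolding gam_def split_def by measurable
qed

lemma measurable_gam2 [measurable]: "gam y \<in> borel_measurable borel"
proof -
  have [measurable]: "(\<lambda>t::real. tanh (t / 2)) \<in> borel_measurable borel"
    by (intro borel_measurable_continuous_onI continuous_intros) auto
  show ?thesis unfolding gam_def[abs_def] by measurable
qed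

text \<open>The factor next to \<open>lam\<close> is the speed of the geodesic in the first identity
  and its Euclidean radius in the second. Together they convert the volume factor times the
  Euclidean polar density into \<open>sinh t ^ (N - 1)\<close>.\<close>

lemma lam_gam:
  assumes "y \<noteq> 0" "0 < t"
  shows "lam (gam y t) * ((1 - (tanh (t / 2))\<^sup>2) / 2) = 1" "lam (gam y t) * tanh (t / 2) = sinh t"
proof -
  have c: "cosh (t / 2) > 0" by (rule cosh_real_pos)
  have *: "1 - (tanh (t / 2))\<^sup>2 = 1 / (cosh (t / 2))\<^sup>2"
  proof -
    have "1 - (tanh (t / 2))\<^sup>2 = ((cosh (t / 2))\<^sup>2 - (sinh (t / 2))\<^sup>2) / (cosh (t / 2))\<^sup>2"
      using c by (simp add: tanh_def power_divide diff_divide_distrib)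
    then show ?thesis using cosh_square_eq[of "t / 2"] by simp
  qed
  show "lam (gam y t) * ((1 - (tanh (t / 2))\<^sup>2) / 2) = 1"
    unfolding lam_def gam_simps(1)[OF assms] * using c by simp
  have "sinh t = 2 * sinh (t / 2) * cosh (t / 2)" using sinh_double[of "t / 2"] by simp
  then show "lam (gam y t) * tanh (t / 2) = sinh t"
    unfolding lam_def gam_simps(1)[OF assms] * using c by (simp add: tanh_def power2_eq_square)
qed

lemma hpolar_nn_integral:
  fixes f :: "real^'n::finite \<Rightarrow> ennreal"
  assumes [measurable]: "f \<in> borel_measurable borel"
  shows "(\<integral>\<^sup>+x\<in>hball R. (f x * ennreal (lam x ^ CARD('n))) \<partial>lborel) = of_nat CARD('n) *
     (\<integral>\<^sup>+y\<in>ball 0 1. (\<integral>\<^sup>+t\<in>ivl R. (f (gam y t) * ennreal (sinh t ^ (CARD('n) - 1))) \<partial>lborel) \<partial>lborel)"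
proof -
  let ?N = "CARD('n)"
  obtain M where M: "?N = Suc M" using not0_implies_Suc[OF zero_less_card_finite[where 'a='n, THEN gr_implies_not0]] by blast
  let ?F = "\<lambda>x. f x * ennreal (lam x ^ ?N) * indicator (hball R) x"
  have "(\<integral>\<^sup>+x. ?F x \<partial>lborel) = of_nat ?N *
     (\<integral>\<^sup>+y. (\<integral>\<^sup>+t. ?F ((t / norm y) *\<^sub>R y) * ennreal (t ^ (?N - 1)) * indicator {0<..} t \<partial>lborel) * indicator (ball 0 1) y \<partial>lborel)"
    by (rule polar_nn_integral) measurable
  also have "(\<integral>\<^sup>+y. (\<integral>\<^sup>+t. ?F ((t / norm y) *\<^sub>R y) * ennreal (t ^ (?N - 1)) * indicator {0<..} t \<partial>lborel) * indicator (ball 0 1) y \<partial>lborel)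
    = (\<integral>\<^sup>+y\<in>ball 0 1. (\<integral>\<^sup>+t\<in>ivl R. (f (gam y t) * ennreal (sinh t ^ (?N - 1))) \<partial>lborel) \<partial>lborel)"
  proof (rule nn_integral_cong_AE)
    show "AE y in lborel. (\<integral>\<^sup>+t. ?F ((t / norm y) *\<^sub>R y) * ennreal (t ^ (?N - 1)) * indicator {0<..} t \<partial>lborel) * indicator (ball 0 1) y
       = (\<integral>\<^sup>+t\<in>ivl R. (f (gam y t) * ennreal (sinh t ^ (?N - 1))) \<partial>lborel) * indicator (ball 0 1) y"
      using AE_lborel_neq[of 0]
    proof eventually_elim
      case (elim y)
      have "(\<integral>\<^sup>+t. ?F ((t / norm y) *\<^sub>R y) * ennreal (t ^ (?N - 1)) * indicator {0<..} t \<partial>lborel)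
         = (\<integral>\<^sup>+t. (?F ((t / norm y) *\<^sub>R y) * ennreal (t ^ (?N - 1)) * indicator {0<..} t) * indicator {0..<1} t \<partial>lborel)"
        using elim by (intro nn_integral_cong) (auto simp: indicator_def hball_def)
      also have "\<dots> = (\<integral>\<^sup>+t. (?F ((tanh (t / 2) / norm y) *\<^sub>R y) * ennreal (tanh (t / 2) ^ (?N - 1)) * indicator {0<..} (tanh (t / 2)))
           * ennreal ((1 - (tanh (t / 2))\<^sup>2) / 2) * indicator {0..} t \<partial>lborel)"
        by (rule nn_integral_substitution_tanh) measurable
      also have "\<dots> = (\<integral>\<^sup>+t\<in>ivl R. (f (gam y t) * ennreal (sinh t ^ (?N - 1))) \<partial>lborel)"
      proof (rule nn_integral_cong)
        fix t :: real
        show "(?F ((tanh (t / 2) / norm y) *\<^sub>R y) * ennreal (tanh (t / 2) ^ (?N - 1)) * indicator {0<..} (tanh (t / 2)))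
           * ennreal ((1 - (tanh (t / 2))\<^sup>2) / 2) * indicator {0..} t = f (gam y t) * ennreal (sinh t ^ (?N - 1)) * indicator (ivl R) t"
        proof (cases "0 < t \<and> ereal t < R")
          case True
          then have t: "0 < t" "t \<in> ivl R" by (auto simp: ivl_def)
          define L \<tau> a where "L = lam (gam y t)" and "\<tau> = tanh (t / 2)" and "a = (1 - \<tau>\<^sup>2) / 2"
          have L: "L * a = 1" "L * \<tau> = sinh t" "L > 0" "\<tau> > 0"
            using lam_gam[OF elim t(1)] lam_pos[OF gam_simps(2)[OF elim t(1)]] t(1) by (auto simp: L_def a_def \<tau>_def)
          then have a: "a > 0" by (metis zero_less_mult_pos zero_less_one)
          \<comment> \<open>One factor \<open>L\<close> pairs with the speed, the remaining ones
            with the radius.\<close>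
          have "L ^ ?N * \<tau> ^ M * a = (L * \<tau>) ^ M * (L * a)" by (simp add: M power_mult_distrib mult_ac)
          then have "ennreal (L ^ ?N) * ennreal (\<tau> ^ M) * ennreal a = ennreal ((L * \<tau>) ^ M * (L * a))"
            using L(3,4) a by (simp add: ennreal_mult[symmetric] del: power_Suc)
          then have "ennreal (L ^ ?N) * ennreal (\<tau> ^ M) * ennreal a = ennreal (sinh t ^ M)"
            using L by simp
          then show ?thesis
            using t gam_in_hball[OF elim t(2)] unfolding gam_def[symmetric]
            by (simp add: L_def[symmetric] \<tau>_def[symmetric] a_def[symmetric] M mult.assoc L)
        next
          case False
          then have "t \<le> 0 \<or> (0 < t \<and> gam y t \<notin> hball R)"
            using gam_simps(4)[OF elim, of t] by (auto simp: hball_def)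
          then show ?thesis using False unfolding gam_def[symmetric] by (auto simp: ivl_def)
        qed
      qed
      finally show ?case by simp
    qed
  qed
  finally show ?thesis .
qed

section \<open>Tools for powers and integrals\<close>

lemma abs_add_powr_le:
  fixes a b p :: real
  assumes "0 \<le> p"
  shows "\<bar>a + b\<bar> powr p \<le> 2 powr p * (\<bar>a\<bar> powr p + \<bar>b\<bar> powr p)"
proof -
  have "\<bar>a + b\<bar> powr p \<le> (2 * max \<bar>a\<bar> \<bar>b\<bar>) powr p"
    using assms by (intro powr_mono2) auto
  also have "\<dots> = 2 powr p * max \<bar>a\<bar> \<bar>b\<bar> powr p" by (simp add: powr_mult)
  also have "max \<bar>a\<bar> \<bar>b\<bar> powr p \<le> \<bar>a\<bar> powr p + \<bar>b\<bar> powr p" by (auto simp: max_def)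
  finally show ?thesis by simp
qed

lemma abs_sum_powr_le:
  fixes f :: "'a \<Rightarrow> real"
  assumes "0 \<le> p" "finite A"
  shows "\<bar>\<Sum>i\<in>A. f i\<bar> powr p \<le> real (card A) powr p * (\<Sum>i\<in>A. \<bar>f i\<bar> powr p)"
proof (cases "A = {}")
  case False
  define m where "m = Max ((\<lambda>i. \<bar>f i\<bar>) ` A)"
  have m: "m \<in> (\<lambda>i. \<bar>f i\<bar>) ` A" unfolding m_def using assms False by (intro Max_in) auto
  then obtain i where i: "i \<in> A" "m = \<bar>f i\<bar>" by auto
  have "\<bar>\<Sum>i\<in>A. f i\<bar> \<le> (\<Sum>i\<in>A. \<bar>f i\<bar>)" by (rule sum_abs)
  also have "\<dots> \<le> card A * m" using assms unfolding m_def by (intro sum_bounded_above) auto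
  finally have "\<bar>\<Sum>i\<in>A. f i\<bar> powr p \<le> (card A * m) powr p" using assms by (intro powr_mono2) auto
  also have "\<dots> = card A powr p * \<bar>f i\<bar> powr p" by (simp add: i powr_mult)
  also have "\<dots> \<le> card A powr p * (\<Sum>i\<in>A. \<bar>f i\<bar> powr p)"
    using assms i by (intro mult_left_mono member_le_sum) auto
  finally show ?thesis .
qed simp

lemma nn_integral_powr_add_le:
  fixes f g :: "'a \<Rightarrow> real"
  assumes [measurable]: "f \<in> borel_measurable M" "g \<in> borel_measurable M" and p: "0 \<le> p"
  shows "(\<integral>\<^sup>+x. ennreal (\<bar>f x + g x\<bar> powr p) \<partial>M)
    \<le> ennreal (2 powr p) * ((\<integral>\<^sup>+x. ennreal (\<bar>f x\<bar> powr p) \<partial>M) + (\<integral>\<^sup>+x. ennreal (\<bar>g x\<bar> powr p) \<partial>M))"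
proof -
  have "(\<integral>\<^sup>+x. ennreal (\<bar>f x + g x\<bar> powr p) \<partial>M)
    \<le> (\<integral>\<^sup>+x. ennreal (2 powr p) * (ennreal (\<bar>f x\<bar> powr p) + ennreal (\<bar>g x\<bar> powr p)) \<partial>M)"
    using abs_add_powr_le[OF p]
    by (intro nn_integral_mono) (simp add: ennreal_plus[symmetric] ennreal_mult[symmetric] ennreal_leI del: ennreal_plus)
  then show ?thesis by (simp add: nn_integral_cmult nn_integral_add)
qed

lemma strict_mono_choice:
  assumes "\<And>k::nat. \<forall>\<^sub>F n in sequentially. P k n"
  shows "\<exists>r::nat \<Rightarrow> nat. strict_mono r \<and> (\<forall>k. P k (r k))"
proof -
  have "\<exists>r. \<forall>k. P k (r k) \<and> r k < r (Suc k)"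
  proof (rule dependent_nat_choice)
    show "\<exists>x. P 0 x" using eventually_happens[OF assms[of 0]] by auto
    fix x n assume "P n x"
    have "\<forall>\<^sub>F y in sequentially. P (Suc n) y \<and> x < y"
      using assms[of "Suc n"] eventually_gt_at_top by (rule eventually_conj)
    then show "\<exists>y. P (Suc n) y \<and> x < y" using eventually_happens by fastforce
  qed
  then show ?thesis by (auto simp: strict_mono_Suc_iff)
qed

text \<open>Integrals below \<open>(1/2) ^ k\<close> make the sum of the subsequence integrable,
  hence finite almost everywhere, and the terms of a convergent series tend to zero.\<close>

lemma nn_integral_tendsto_zero_AE_subseq:
  fixes b :: "nat \<Rightarrow> 'a \<Rightarrow> ennreal"
  assumes [measurable]: "\<And>n. b n \<in> borel_measurable M" and lim: "(\<lambda>n. \<integral>\<^sup>+x. b n x \<partial>M) \<longlonglongrightarrow> 0"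
  shows "\<exists>r. strict_mono r \<and> (AE x in M. (\<lambda>n. b (r n) x) \<longlonglongrightarrow> 0)"
proof -
  have "\<forall>\<^sub>F n in sequentially. (\<integral>\<^sup>+x. b n x \<partial>M) < ennreal ((1/2) ^ k)" for k
    by (rule order_tendstoD(2)[OF lim]) simp
  from strict_mono_choice[of "\<lambda>k n. (\<integral>\<^sup>+x. b n x \<partial>M) < ennreal ((1/2) ^ k)", OF this]
  obtain r where r: "strict_mono r"
    "\<And>k. (\<integral>\<^sup>+x. b (r k) x \<partial>M) < ennreal ((1/2) ^ k)" by blast
  have "(\<integral>\<^sup>+x. (\<Sum>k. b (r k) x) \<partial>M) = (\<Sum>k. \<integral>\<^sup>+x. b (r k) x \<partial>M)"
    by (rule nn_integral_suminf) simp
  also have "\<dots> \<le> (\<Sum>k. ennreal ((1/2) ^ k))" using r(2) by (intro suminf_le) (auto intro: less_imp_le)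
  also have "\<dots> = ennreal (\<Sum>k. (1/2) ^ k)" by (rule suminf_ennreal2) (auto simp: summable_geometric)
  finally have "(\<integral>\<^sup>+x. (\<Sum>k. b (r k) x) \<partial>M) \<noteq> \<infinity>" by (auto simp: top_unique)
  then have "AE x in M. (\<Sum>k. b (r k) x) \<noteq> \<infinity>" by (intro nn_integral_PInf_AE) auto
  then have "AE x in M. (\<lambda>n. b (r n) x) \<longlonglongrightarrow> 0"
  proof eventually_elim
    case (elim x)
    have fin: "b (r k) x \<noteq> \<infinity>" for k
    proof -
      have "b (r k) x \<le> (\<Sum>k. b (r k) x)" using sum_le_suminf[of "\<lambda>k. b (r k) x" "{k}"] by simp
      then show ?thesis using elim by (auto simp: top_unique)
    qed
    define g where "g k = enn2real (b (r k) x)" for k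
    have g: "b (r k) x = ennreal (g k)" for k using fin[of k] by (simp add: g_def less_top)
    have "summable g" using elim unfolding g by (intro summable_suminf_not_top) (auto simp: g_def)
    then have "(\<lambda>k. ennreal (g k)) \<longlonglongrightarrow> ennreal 0" by (intro tendsto_ennrealI summable_LIMSEQ_zero)
    then show ?case by (simp add: g)
  qed
  with r(1) show ?thesis by blast
qed

lemma tendsto_zero_ennrealI:
  fixes f :: "nat \<Rightarrow> ennreal"
  assumes "\<And>e. e > 0 \<Longrightarrow> \<forall>\<^sub>F n in sequentially. f n \<le> ennreal e"
  shows "f \<longlonglongrightarrow> 0"
proof (rule order_tendstoI)
  fix a :: ennreal assume a: "0 < a"
  obtain e where e: "e > 0" "ennreal e < a"
  proof -
    obtain c where "0 < c" "c < a" using a dense by blast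
    then show ?thesis using that[of "enn2real c"] by (cases c) (auto simp: enn2real_positive_iff)
  qed
  show "\<forall>\<^sub>F n in sequentially. f n < a" using assms[OF e(1)] by eventually_elim (use e(2) in auto)
qed simp

text \<open>Riesz-Fischer in terms of p-th power integrals: along a fast subsequence the increments
  are small off sets of summable measure (Markov, Borel-Cantelli), which gives a limit almost
  everywhere; Fatou's lemma then controls the whole sequence.\<close>

lemma Lp_complete:
  fixes f :: "nat \<Rightarrow> 'a \<Rightarrow> real"
  assumes [measurable]: "\<And>n. f n \<in> borel_measurable M" and p: "0 < p"
    and cauchy: "\<And>e. e > 0 \<Longrightarrow> \<exists>K. \<forall>m\<ge>K. \<forall>n\<ge>K. (\<integral>\<^sup>+x. ennreal (\<bar>f m x - f n x\<bar> powr p) \<partial>M) < ennreal e"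
  obtains g where "g \<in> borel_measurable M" "(\<lambda>n. \<integral>\<^sup>+x. ennreal (\<bar>f n x - g x\<bar> powr p) \<partial>M) \<longlonglongrightarrow> 0"
proof -
  \<comment> \<open>Markov's inequality at the level \<open>1 / 2 ^ k\<close> costs the factor
    \<open>(2 ^ k) powr p\<close>; dividing by it in advance leaves the summable bound
    \<open>(1/2) ^ k\<close>.\<close>
  define \<epsilon> where "\<epsilon> k = (1/2) ^ k / (2 ^ k) powr p" for k :: nat
  have \<epsilon>: "\<epsilon> k > 0" for k by (simp add: \<epsilon>_def)
  have "\<forall>\<^sub>F n in sequentially. \<forall>m\<ge>n. (\<integral>\<^sup>+x. ennreal (\<bar>f m x - f n x\<bar> powr p) \<partial>M) < ennreal (\<epsilon> k)" for k
    using cauchy[OF \<epsilon>[of k]] unfolding eventually_sequentially by (meson order_trans)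
  from strict_mono_choice[of "\<lambda>k n. \<forall>m\<ge>n. (\<integral>\<^sup>+x. ennreal (\<bar>f m x - f n x\<bar> powr p) \<partial>M) < ennreal (\<epsilon> k)", OF this]
  obtain r where r: "strict_mono r"
    "\<And>k m. m \<ge> r k \<Longrightarrow> (\<integral>\<^sup>+x. ennreal (\<bar>f m x - f (r k) x\<bar> powr p) \<partial>M) < ennreal (\<epsilon> k)" by blast
  define A where "A k = {x\<in>space M. 1 / 2 ^ k \<le> \<bar>f (r (Suc k)) x - f (r k) x\<bar>}" for k :: nat
  have [measurable]: "A k \<in> sets M" for k unfolding A_def by measurable
  have mA: "emeasure M (A k) \<le> ennreal ((1/2) ^ k)" for k
  proof -
    let ?c = "(2 ^ k) powr p :: real"
    have c: "?c > 0" by simp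
    have "A k \<subseteq> {x\<in>space M. 1 \<le> ennreal ?c * ennreal (\<bar>f (r (Suc k)) x - f (r k) x\<bar> powr p)}"
    proof
      fix x assume x: "x \<in> A k"
      then have "1 \<le> 2 ^ k * \<bar>f (r (Suc k)) x - f (r k) x\<bar>" by (auto simp: A_def field_simps)
      then have "1 powr p \<le> (2 ^ k * \<bar>f (r (Suc k)) x - f (r k) x\<bar>) powr p" using p by (intro powr_mono2) auto
      then show "x \<in> {x\<in>space M. 1 \<le> ennreal ?c * ennreal (\<bar>f (r (Suc k)) x - f (r k) x\<bar> powr p)}"
        using x by (simp add: A_def powr_mult ennreal_mult[symmetric] ennreal_ge_1 flip: ennreal_1)
    qed
    then have "emeasure M (A k) \<le> emeasure M {x\<in>space M. 1 \<le> ennreal ?c * ennreal (\<bar>f (r (Suc k)) x - f (r k) x\<bar> powr p)}"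
      by (intro emeasure_mono) auto
    also have "\<dots> \<le> ennreal ?c * (\<integral>\<^sup>+x\<in>space M. ennreal (\<bar>f (r (Suc k)) x - f (r k) x\<bar> powr p) \<partial>M)"
      by (rule nn_integral_Markov_inequality) auto
    also have "(\<integral>\<^sup>+x\<in>space M. ennreal (\<bar>f (r (Suc k)) x - f (r k) x\<bar> powr p) \<partial>M) = (\<integral>\<^sup>+x. ennreal (\<bar>f (r (Suc k)) x - f (r k) x\<bar> powr p) \<partial>M)"
      by (intro nn_integral_cong) auto
    also have "\<dots> \<le> ennreal (\<epsilon> k)" using r(2)[of k "r (Suc k)"] r(1) by (simp add: strict_mono_less_eq less_imp_le)
    also have "ennreal ?c * ennreal (\<epsilon> k) = ennreal ((1/2) ^ k)"
      using c by (simp add: ennreal_mult[symmetric] \<epsilon>_def)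
    finally show ?thesis by (simp add: mult_left_mono)
  qed
  have "AE x in M. \<forall>\<^sub>F k in sequentially. x \<in> space M - A k"
  proof (rule borel_cantelli_AE1)
    show "emeasure M (A n) < \<infinity>" for n using mA[of n] by (auto intro: le_less_trans)
    have "measure M (A n) \<le> (1/2) ^ n" for n
      using mA[of n] by (simp add: measure_def enn2real_leI)
    then show "summable (\<lambda>n. measure M (A n))"
      by (intro summable_comparison_test[OF _ summable_geometric[of "1/2::real"]]) auto
  qed simp
  then have conv: "AE x in M. (\<lambda>k. f (r k) x) \<longlonglongrightarrow> lim (\<lambda>k. f (r k) x)"
  proof eventually_elim
    case (elim x)
    have "\<forall>\<^sub>F k in sequentially. norm (f (r (Suc k)) x - f (r k) x) \<le> (1/2) ^ k"
      using elim by (rule eventually_mono) (auto simp: A_def power_one_over)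
    then have "summable (\<lambda>k. f (r (Suc k)) x - f (r k) x)"
      by (rule summable_comparison_test_ev) (simp add: summable_geometric)
    then have "convergent (\<lambda>n. \<Sum>k<n. f (r (Suc k)) x - f (r k) x)" by (simp add: summable_iff_convergent)
    then have "convergent (\<lambda>n. f (r n) x - f (r 0) x)" by (simp add: sum_lessThan_telescope[of "\<lambda>k. f (r k) x"])
    then have "convergent (\<lambda>n. f (r n) x - f (r 0) x + f (r 0) x)" by (intro convergent_add convergent_const)
    then show ?case by (simp add: convergent_LIMSEQ_iff)
  qed
  define g where "g x = lim (\<lambda>k. f (r k) x)" for x
  have g[measurable]: "g \<in> borel_measurable M" unfolding g_def by (rule borel_measurable_lim_metric) simp
  have "(\<lambda>n. \<integral>\<^sup>+x. ennreal (\<bar>f n x - g x\<bar> powr p) \<partial>M) \<longlonglongrightarrow> 0"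
  proof (rule tendsto_zero_ennrealI)
    fix e :: real assume "e > 0"
    from cauchy[OF this] obtain K where K: "\<And>m n. m \<ge> K \<Longrightarrow> n \<ge> K \<Longrightarrow> (\<integral>\<^sup>+x. ennreal (\<bar>f m x - f n x\<bar> powr p) \<partial>M) < ennreal e"
      by blast
    have "(\<integral>\<^sup>+x. ennreal (\<bar>f n x - g x\<bar> powr p) \<partial>M) \<le> ennreal e" if n: "n \<ge> K" for n
    proof -
      have "(\<integral>\<^sup>+x. ennreal (\<bar>f n x - g x\<bar> powr p) \<partial>M) = (\<integral>\<^sup>+x. liminf (\<lambda>k. ennreal (\<bar>f n x - f (r k) x\<bar> powr p)) \<partial>M)"
      proof (rule nn_integral_cong_AE)
        show "AE x in M. ennreal (\<bar>f n x - g x\<bar> powr p) = liminf (\<lambda>k. ennreal (\<bar>f n x - f (r k) x\<bar> powr p))"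
          using conv
        proof eventually_elim
          case (elim x)
          have "(\<lambda>k. ennreal (\<bar>f n x - f (r k) x\<bar> powr p)) \<longlonglongrightarrow> ennreal (\<bar>f n x - g x\<bar> powr p)"
            using elim p unfolding g_def by (intro tendsto_ennrealI tendsto_powr' tendsto_intros) auto
          then show ?case by (intro lim_imp_Liminf[symmetric]) auto
        qed
      qed
      also have "\<dots> \<le> liminf (\<lambda>k. \<integral>\<^sup>+x. ennreal (\<bar>f n x - f (r k) x\<bar> powr p) \<partial>M)"
        by (rule nn_integral_liminf) simp
      also have "\<dots> \<le> ennreal e"
      proof -
        have "\<forall>\<^sub>F k in sequentially. (\<integral>\<^sup>+x. ennreal (\<bar>f n x - f (r k) x\<bar> powr p) \<partial>M) \<le> ennreal e"
          using eventually_ge_at_top[of K]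
        proof eventually_elim
          case (elim k)
          then have "r k \<ge> K" using seq_suble[OF r(1), of k] by simp
          then show ?case using K[OF n] by (simp add: less_imp_le)
        qed
        then show ?thesis by (intro order_trans[OF Liminf_le_Limsup Limsup_bounded]) auto
      qed
      finally show ?thesis .
    qed
    then show "\<forall>\<^sub>F n in sequentially. (\<integral>\<^sup>+x. ennreal (\<bar>f n x - g x\<bar> powr p) \<partial>M) \<le> ennreal e"
      unfolding eventually_sequentially by blast
  qed
  with g show ?thesis by (rule that)
qed

text \<open>If f exceeded its mean throughout \<open>A\<close>, the excess would be positive on
  \<open>A\<close> and have integral zero. The lemma later selects a ray of small energy and, in
  Hardy's inequality, an end point with a controlled value.\<close>

lemma exists_le_average:
  assumes [measurable]: "A \<in> sets M" "f \<in> borel_measurable M"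
    and A: "emeasure M A \<noteq> 0" "emeasure M A \<noteq> \<infinity>"
  shows "\<exists>x\<in>A. f x * emeasure M A \<le> (\<integral>\<^sup>+x\<in>A. f x \<partial>M)"
proof (rule ccontr)
  define I where "I = (\<integral>\<^sup>+x\<in>A. f x \<partial>M)"
  assume "\<not> ?thesis"
  then have *: "I < f x * emeasure M A" if "x \<in> A" for x using that by (auto simp: I_def not_le)
  have "A \<noteq> {}" using A by auto
  then obtain x0 where "x0 \<in> A" by blast
  from *[OF this] have I: "I \<noteq> \<infinity>" by auto
  obtain V where V: "emeasure M A = ennreal V" "V > 0" using A by (cases "emeasure M A") auto
  obtain i where i: "I = ennreal i" "i \<ge> 0" using I by (cases I) auto
  define c where "c = ennreal (i / V)"
  have c: "c * emeasure M A = I" unfolding c_def V i using V i by (simp add: ennreal_mult[symmetric])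
  have cfin: "c \<noteq> \<infinity>" by (simp add: c_def)
  have cf: "c < f x" if "x \<in> A" for x
  proof (rule ccontr)
    assume "\<not> c < f x"
    then have "f x * emeasure M A \<le> c * emeasure M A" by (simp add: mult_right_mono)
    then show False using *[OF that] c by simp
  qed
  have "I = (\<integral>\<^sup>+x. (f x - c) * indicator A x + c * indicator A x \<partial>M)"
    unfolding I_def using cf by (intro nn_integral_cong) (auto simp: indicator_def less_imp_le diff_add_cancel_ennreal)
  also have "\<dots> = (\<integral>\<^sup>+x. (f x - c) * indicator A x \<partial>M) + I"
    by (simp add: nn_integral_add nn_integral_cmult_indicator c)
  finally have "(\<integral>\<^sup>+x. (f x - c) * indicator A x \<partial>M) = 0"
    unfolding i by (cases "\<integral>\<^sup>+x. (f x - c) * indicator A x \<partial>M") (use i in \<open>auto simp: ennreal_plus[symmetric] simp del: ennreal_plus\<close>)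
  then have "AE x in M. (f x - c) * indicator A x = 0" by (simp add: nn_integral_0_iff_AE)
  then have "AE x in M. x \<notin> A"
  proof eventually_elim
    case (elim x)
    show ?case using elim cf[of x] cfin by (auto simp: indicator_def diff_eq_0_iff_ennreal split: if_splits)
  qed
  then have "emeasure M A = 0" using AE_iff_measurable[of A M "\<lambda>x. x \<notin> A"] sets.sets_into_space[of A M] by auto
  with A show False by simp
qed

text \<open>The tangent line of a convex power at \<open>a\<close>, obtained from Young's inequality
  for \<open>x powr p\<close> and \<open>a powr p\<close> with weights \<open>1 / p\<close> and
  \<open>(p - 1) / p\<close>.\<close>

lemma powr_tangent:
  fixes a x p :: real
  assumes "1 \<le> p" "0 < a" "0 \<le> x"
  shows "p * a powr (p - 1) * x \<le> x powr p + (p - 1) * a powr p"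
proof (cases "x = 0")
  case False
  then have x: "x > 0" using assms by simp
  have "(x powr p) powr (1 / p) * (a powr p) powr ((p - 1) / p) \<le> (1 / p) * x powr p + ((p - 1) / p) * a powr p"
    using assms x by (intro Youngs_inequality_0) (auto simp: field_simps)
  then have "x * a powr (p - 1) \<le> (x powr p + (p - 1) * a powr p) / p"
    using assms x by (simp add: powr_powr add_divide_distrib)
  then show ?thesis using assms by (simp add: field_simps)
qed (use assms in auto)

text \<open>Jensen's inequality for \<open>t \<mapsto> t\<^sup>p\<close>, obtained by integrating the tangent line at the mean.\<close>
lemma powr_integral_le:
  fixes f :: "'a \<Rightarrow> real"
  assumes f: "integrable M f" "\<And>x. 0 \<le> f x" and p: "1 \<le> p" and V: "emeasure M (space M) = ennreal V" "0 < V"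
  shows "ennreal ((\<integral>x. f x \<partial>M) powr p) \<le> ennreal (V powr (p - 1)) * (\<integral>\<^sup>+x. ennreal (f x powr p) \<partial>M)"
proof (cases "(\<integral>x. f x \<partial>M) = 0 \<or> (\<integral>\<^sup>+x. ennreal (f x powr p) \<partial>M) = \<infinity>")
  case True
  then show ?thesis using p V by (auto simp: ennreal_mult_top)
next
  case False
  define m where "m = (\<integral>x. f x \<partial>M)"
  have m: "m > 0" using False integral_nonneg_AE[of f M] f(2) by (auto simp: m_def less_le)
  define a where "a = m / V"
  have a: "a > 0" using m V by (simp add: a_def)
  interpret finite_measure M by (rule finite_measureI) (use V in auto)
  have mV: "measure M (space M) = V" using V by (simp add: measure_def)
  have [measurable]: "f \<in> borel_measurable M" using f by auto
  have ip: "integrable M (\<lambda>x. f x powr p)"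
    using False by (intro integrableI_bounded) (auto simp: less_top)
  have "(\<integral>x. p * a powr (p - 1) * f x \<partial>M) \<le> (\<integral>x. f x powr p + (p - 1) * a powr p \<partial>M)"
    using powr_tangent[OF p a f(2)] by (intro integral_mono) (auto intro: f ip)
  then have "p * a powr (p - 1) * m \<le> (\<integral>x. f x powr p \<partial>M) + (p - 1) * a powr p * V"
    using ip f by (simp add: m_def mV mult_ac)
  moreover
  have "a powr (p - 1) * m = a powr p * V"
  proof -
    have "a powr p = a powr (p - 1) * a" using a by (metis powr_mult_base less_imp_le mult.commute add.commute diff_add_cancel)
    then show ?thesis using V by (simp add: a_def)
  qed
  ultimately have "p * (a powr p * V) \<le> (\<integral>x. f x powr p \<partial>M) + (p - 1) * (a powr p * V)"
    by (simp add: mult.assoc)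
  then have 1: "a powr p * V \<le> (\<integral>x. f x powr p \<partial>M)" by (simp add: algebra_simps)
  have "m powr p = V powr (p - 1) * (a powr p * V)"
  proof -
    have "V powr (p - 1) * V = V powr p" using V by (metis powr_mult_base less_imp_le mult.commute add.commute diff_add_cancel)
    moreover have "m = a * V" using V by (simp add: a_def)
    ultimately show ?thesis using a V by (simp add: powr_mult)
  qed
  also have "\<dots> \<le> V powr (p - 1) * (\<integral>x. f x powr p \<partial>M)" using 1 by (intro mult_left_mono) auto
  finally have "ennreal (m powr p) \<le> ennreal (V powr (p - 1)) * ennreal (\<integral>x. f x powr p \<partial>M)"
    by (simp add: ennreal_mult[symmetric] ennreal_leI)
  also have "ennreal (\<integral>x. f x powr p \<partial>M) = (\<integral>\<^sup>+x. ennreal (f x powr p) \<partial>M)"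
    by (rule nn_integral_eq_integral[symmetric, OF ip]) auto
  finally show ?thesis by (simp add: m_def)
qed

section \<open>Weak derivatives on the interval\<close>

lemma deriv_funpow_eq_0_outside:
  fixes \<phi> :: "real \<Rightarrow> real"
  assumes "\<And>t. t \<notin> {a..b} \<Longrightarrow> \<phi> t = 0"
  shows "t \<notin> {a..b} \<Longrightarrow> (deriv ^^ m) \<phi> t = 0"
proof (induction m arbitrary: t)
  case (Suc m)
  have "\<forall>\<^sub>F s in nhds t. s \<in> - {a..b}"
    by (rule eventually_nhds_in_open) (use Suc.prems in \<open>auto simp: open_Compl\<close>)
  then have "\<forall>\<^sub>F s in nhds t. (deriv ^^ m) \<phi> s = 0"
    by (rule eventually_mono) (rule Suc.IH, simp only: Compl_iff not_False_eq_True)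
  then have "deriv ((deriv ^^ m) \<phi>) t = deriv (\<lambda>s. 0) t" by (intro deriv_cong_ev) auto
  then show ?case by simp
qed (use assms in simp)

text \<open>The support is enlarged slightly, so that all derivatives vanish at both end points and
  integration by parts on \<open>{a..b}\<close> has no boundary terms.\<close>

lemma test_fnE:
  assumes "test_fn R \<phi>"
  obtains a b where "0 < a" "a < b" "ereal b < R" "\<And>m t. t \<notin> {a<..<b} \<Longrightarrow> (deriv ^^ m) \<phi> t = 0"
    "\<And>m t. ((deriv ^^ m) \<phi> has_real_derivative (deriv ^^ Suc m) \<phi> t) (at t)"
proof -
  obtain a b where ab: "0 < a" "a \<le> b" "ereal b < R" "\<And>t. t \<notin> {a..b} \<Longrightarrow> \<phi> t = 0"
    and d: "\<And>m t. ((deriv ^^ m) \<phi> has_real_derivative (deriv ^^ Suc m) \<phi> t) (at t)"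
    using assms unfolding test_fn_def by blast
  obtain b' where b': "b < b'" "ereal b' < R" using ereal_dense2[OF ab(3)] by auto
  have *: "(deriv ^^ m) \<phi> t = 0" if "t \<notin> {a/2<..<b'}" for m t
    by (rule deriv_funpow_eq_0_outside[of a b]) (use ab b' that in auto)
  show thesis by (rule that[of "a/2" b']) (use ab b' d * in auto)
qed

lemma ivl_subset: "0 < a \<Longrightarrow> ereal b < R \<Longrightarrow> {a..b} \<subseteq> ivl R"
  by (auto simp: ivl_def intro: le_less_trans[of _ "ereal b"])

lemma set_lebesgue_integral_restrict:
  fixes f :: "'a \<Rightarrow> real"
  assumes "B \<subseteq> A" "\<And>t. t \<in> A - B \<Longrightarrow> f t = 0"
  shows "(LINT t:A|M. f t) = (LINT t:B|M. f t)"
  unfolding set_lebesgue_integral_def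
  by (intro arg_cong[where f="integral\<^sup>L M"] ext) (use assms in \<open>auto simp: indicator_def\<close>)

text \<open>A function bundled with its derivatives. Compared with iterating \<open>deriv\<close>,
  this makes passing to a derivative an index shift and confines the requirement to
  \<open>S\<close>.\<close>

definition smooth_fam :: "real set \<Rightarrow> (nat \<Rightarrow> real \<Rightarrow> real) \<Rightarrow> bool" where
  "smooth_fam S F \<longleftrightarrow> (\<forall>i. \<forall>t\<in>S. (F i has_real_derivative F (Suc i) t) (at t))"

lemma smooth_famD: "smooth_fam S F \<Longrightarrow> t \<in> S \<Longrightarrow> (F i has_real_derivative F (Suc i) t) (at t)"
  by (auto simp: smooth_fam_def)

lemma smooth_fam_continuous: "smooth_fam S F \<Longrightarrow> continuous_on S (F i)"
  by (intro continuous_at_imp_continuous_on) (auto intro: DERIV_isCont smooth_famD)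

lemma smooth_fam_subset: "smooth_fam S F \<Longrightarrow> T \<subseteq> S \<Longrightarrow> smooth_fam T F"
  by (auto simp: smooth_fam_def)

lemma smooth_fam_parts:
  assumes F: "smooth_fam (ivl R) F" and \<phi>: "test_fn R \<phi>"
  shows "(LINT t:ivl R|lborel. F i t * (deriv ^^ Suc m) \<phi> t) = - (LINT t:ivl R|lborel. F (Suc i) t * (deriv ^^ m) \<phi> t)"
proof -
  obtain a b where ab: "0 < a" "a < b" "ereal b < R" "\<And>m t. t \<notin> {a<..<b} \<Longrightarrow> (deriv ^^ m) \<phi> t = 0"
    and d: "\<And>m t. ((deriv ^^ m) \<phi> has_real_derivative (deriv ^^ Suc m) \<phi> t) (at t)"
    using test_fnE[OF \<phi>] by metis
  have sub: "{a..b} \<subseteq> ivl R" using ivl_subset ab by auto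
  have c\<phi>: "continuous_on A ((deriv ^^ m) \<phi>)" for m A
    using d by (intro continuous_at_imp_continuous_on) (auto intro: DERIV_isCont)
  have cF: "continuous_on {a..b} (F i)" for i using smooth_fam_continuous[OF smooth_fam_subset[OF F sub]] .
  have int: "set_integrable lborel {a..b} (\<lambda>t. F i t * (deriv ^^ m) \<phi> t)" for i m
    by (intro borel_integrable_atLeastAtMost' continuous_intros cF c\<phi>)
  have "(LINT t:{a..b}|lborel. F (Suc i) t * (deriv ^^ m) \<phi> t + F i t * (deriv ^^ Suc m) \<phi> t)
      = F i b * (deriv ^^ m) \<phi> b - F i a * (deriv ^^ m) \<phi> a"
    unfolding set_lebesgue_integral_def
  proof (rule integral_FTC_Icc)
    fix x assume "a \<le> x" "x \<le> b"
    then have x: "x \<in> ivl R" using sub by auto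
    show "((\<lambda>t. F i t * (deriv ^^ m) \<phi> t) has_vector_derivative F (Suc i) x * (deriv ^^ m) \<phi> x + F i x * (deriv ^^ Suc m) \<phi> x) (at x within {a..b})"
      unfolding has_real_derivative_iff_has_vector_derivative[symmetric]
      by (rule has_field_derivative_at_within)
        (use DERIV_mult[OF smooth_famD[OF F x, of i] d[of m x]] in \<open>simp add: algebra_simps\<close>)
  qed (use ab cF c\<phi> in \<open>auto intro!: continuous_intros simp del: funpow.simps\<close>)
  also have "\<dots> = 0" using ab(4) by simp
  finally have "(LINT t:{a..b}|lborel. F i t * (deriv ^^ Suc m) \<phi> t) = - (LINT t:{a..b}|lborel. F (Suc i) t * (deriv ^^ m) \<phi> t)"
    using set_integral_add(2)[OF int[of "Suc i" m] int[of i "Suc m"]] by simp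
  moreover have "(LINT t:ivl R|lborel. F i t * (deriv ^^ m) \<phi> t) = (LINT t:{a..b}|lborel. F i t * (deriv ^^ m) \<phi> t)" for i m
    by (rule set_lebesgue_integral_restrict[OF sub]) (use ab(4) in auto)
  ultimately show ?thesis by (simp del: funpow.simps)
qed

lemma smooth_fam_weak:
  assumes F: "smooth_fam (ivl R) F" and \<phi>: "test_fn R \<phi>"
  shows "(LINT t:ivl R|lborel. F 0 t * (deriv ^^ j) \<phi> t) = (-1) ^ j * (LINT t:ivl R|lborel. F j t * \<phi> t)"
proof -
  have "(LINT t:ivl R|lborel. F 0 t * (deriv ^^ (i + m)) \<phi> t) = (-1) ^ i * (LINT t:ivl R|lborel. F i t * (deriv ^^ m) \<phi> t)" for i m
  proof (induction i arbitrary: m)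
    case (Suc i)
    have "(LINT t:ivl R|lborel. F 0 t * (deriv ^^ (Suc i + m)) \<phi> t) = (-1) ^ i * (LINT t:ivl R|lborel. F i t * (deriv ^^ Suc m) \<phi> t)"
      using Suc[of "Suc m"] by simp
    also have "\<dots> = (-1) ^ Suc i * (LINT t:ivl R|lborel. F (Suc i) t * (deriv ^^ m) \<phi> t)"
      unfolding smooth_fam_parts[OF F \<phi>] by simp
    finally show ?case .
  qed simp
  from this[of j 0] show ?thesis by simp
qed

lemma smooth_fam_measurable:
  assumes F: "smooth_fam (ivl R) F"
  shows "set_borel_measurable lborel (ivl R) (F i)"
  using borel_measurable_continuous_on_indicator[OF measurable_ivl smooth_fam_continuous[OF F]]
  unfolding set_borel_measurable_def by simp

lemma smooth_fam_loc_int: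
  assumes F: "smooth_fam (ivl R) F"
  shows "loc_int R (F i)"
  unfolding loc_int_def
  by (intro conjI allI impI smooth_fam_measurable[OF F] borel_integrable_atLeastAtMost'
      continuous_on_subset[OF smooth_fam_continuous[OF F]] ivl_subset)

lemma smooth_fam_weak_deriv: "smooth_fam (ivl R) F \<Longrightarrow> weak_deriv R j (F 0) (F j)"
  unfolding weak_deriv_def using smooth_fam_loc_int smooth_fam_weak by blast

section \<open>Weighted Lebesgue spaces on the interval\<close>

definition wmeas :: "nat \<Rightarrow> ereal \<Rightarrow> real measure" where
  "wmeas N R = density lborel (\<lambda>t. ennreal (sinh t ^ (N - 1)) * indicator (ivl R) t)"

lemma sets_wmeas [measurable_cong, simp]: "sets (wmeas N R) = sets borel"
  by (simp add: wmeas_def)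

lemma measurable_sinh [measurable]: "sinh \<in> borel_measurable (borel :: real measure)"
  by (intro borel_measurable_continuous_onI continuous_intros)

lemma nn_integral_wmeas:
  assumes [measurable]: "f \<in> borel_measurable borel"
  shows "(\<integral>\<^sup>+t. f t \<partial>wmeas N R) = (\<integral>\<^sup>+t\<in>ivl R. (f t * ennreal (sinh t ^ (N - 1))) \<partial>lborel)"
  unfolding wmeas_def by (subst nn_integral_density) (auto intro!: nn_integral_cong simp: mult_ac)

lemma wint_eq_wmeas:
  assumes "set_borel_measurable lborel (ivl R) f"
  shows "wint N p R f = (\<integral>\<^sup>+t. ennreal (\<bar>indicator (ivl R) t * f t\<bar> powr p) \<partial>wmeas N R)"
proof -
  have [measurable]: "(\<lambda>t. indicator (ivl R) t * f t) \<in> borel_measurable borel"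
    using assms by (simp add: set_borel_measurable_def)
  show ?thesis unfolding wint_def
    by (subst nn_integral_wmeas, measurable, intro nn_integral_cong) (auto simp: indicator_def ivl_def ennreal_mult'')
qed

lemma wint_mono:
  assumes "\<And>t. t \<in> ivl R \<Longrightarrow> \<bar>f t\<bar> \<le> \<bar>g t\<bar>" "0 \<le> p"
  shows "wint N p R f \<le> wint N p R g"
  unfolding wint_def using assms
  by (intro nn_integral_mono) (auto simp: indicator_def ivl_def intro!: ennreal_leI mult_right_mono powr_mono2)

lemma wint_cong: "(\<And>t. t \<in> ivl R \<Longrightarrow> f t = g t) \<Longrightarrow> wint N p R f = wint N p R g"
  unfolding wint_def by (intro nn_integral_cong) (auto simp: indicator_def)

lemma wint_add_le:
  assumes "set_borel_measurable lborel (ivl R) f" "set_borel_measurable lborel (ivl R) g" "0 \<le> p"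
  shows "wint N p R (\<lambda>t. f t + g t) \<le> ennreal (2 powr p) * (wint N p R f + wint N p R g)"
proof -
  have [measurable]: "(\<lambda>t. indicator (ivl R) t * f t) \<in> borel_measurable borel" "(\<lambda>t. indicator (ivl R) t * g t) \<in> borel_measurable borel"
    using assms by (simp_all add: set_borel_measurable_def)
  have "set_borel_measurable lborel (ivl R) (\<lambda>t. f t + g t)"
    unfolding set_borel_measurable_def real_scaleR_def distrib_left by measurable
  moreover have "(\<integral>\<^sup>+t. ennreal (\<bar>indicator (ivl R) t * f t + indicator (ivl R) t * g t\<bar> powr p) \<partial>wmeas N R)
    \<le> ennreal (2 powr p) * ((\<integral>\<^sup>+t. ennreal (\<bar>indicator (ivl R) t * f t\<bar> powr p) \<partial>wmeas N R) + (\<integral>\<^sup>+t. ennreal (\<bar>indicator (ivl R) t * g t\<bar> powr p) \<partial>wmeas N R))"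
    by (rule nn_integral_powr_add_le) (use assms in auto)
  ultimately show ?thesis using assms by (simp only: wint_eq_wmeas distrib_left[symmetric])
qed

lemma wint_diff_le:
  assumes "set_borel_measurable lborel (ivl R) f" "set_borel_measurable lborel (ivl R) g" "0 \<le> p"
  shows "wint N p R (\<lambda>t. f t - g t) \<le> ennreal (2 powr p) * (wint N p R f + wint N p R g)"
proof -
  have "set_borel_measurable lborel (ivl R) (\<lambda>t. - g t)"
    using assms(2) unfolding set_borel_measurable_def by simp
  from wint_add_le[OF assms(1) this assms(3)] show ?thesis by (simp add: wint_def)
qed

text \<open>The pointwise bound of \<open>\<bar>f t\<bar>\<close> by
  \<open>e + e powr (1 - p) * \<bar>f t\<bar> powr p\<close> replaces Hoelder's inequality. As e
  stays free, a small weighted integral still makes the local integral small. On the interval the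
  weight is at least \<open>sinh a ^ (N - 1)\<close>.\<close>

lemma nn_integral_abs_le_wint:
  assumes "1 \<le> p" "0 < a" "ereal b < R" "0 < e" "a \<le> b"
    and f: "set_borel_measurable lborel (ivl R) f"
  shows "(\<integral>\<^sup>+t\<in>{a..b}. ennreal \<bar>f t\<bar> \<partial>lborel) \<le> ennreal (e * (b - a)) + ennreal (e powr (1 - p) / sinh a ^ (N - 1)) * wint N p R f"
proof -
  have [measurable]: "(\<lambda>t. indicator (ivl R) t * f t) \<in> borel_measurable borel"
    using f by (simp_all add: set_borel_measurable_def)
  have sub: "{a..b} \<subseteq> ivl R" using assms by (intro ivl_subset)
  have sa: "sinh a > 0" using assms by simp
  let ?c = "e powr (1 - p) / sinh a ^ (N - 1)"
  let ?h = "\<lambda>t. ennreal (\<bar>indicator (ivl R) t * f t\<bar> powr p) * ennreal (sinh t ^ (N - 1)) * indicator (ivl R) t"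
  have pt: "ennreal \<bar>f t\<bar> * indicator {a..b} t \<le> ennreal e * indicator {a..b} t + ennreal ?c * ?h t" for t
  proof (cases "t \<in> {a..b}")
    case True
    then have t: "t \<in> ivl R" "a \<le> t" using sub by auto
    have s: "sinh a ^ (N - 1) \<le> sinh t ^ (N - 1)" using t sa by (intro power_mono) auto
    have st: "0 < sinh t ^ (N - 1)" using s sa by (meson less_le_trans zero_less_power)
    have "\<bar>f t\<bar> \<le> e + e powr (1 - p) * \<bar>f t\<bar> powr p"
    proof (cases "\<bar>f t\<bar> \<le> e")
      case False
      have "\<bar>f t\<bar> = e powr (1 - p) * (e powr (p - 1) * \<bar>f t\<bar>)"
        using assms by (simp add: mult.assoc[symmetric] powr_add[symmetric])
      also have "e powr (p - 1) * \<bar>f t\<bar> \<le> \<bar>f t\<bar> powr (p - 1) * \<bar>f t\<bar>"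
        using False assms by (intro mult_right_mono powr_mono2) auto
      also have "\<dots> = \<bar>f t\<bar> powr p"
        using False assms powr_add[of "\<bar>f t\<bar>" "p - 1" 1] by auto
      finally show ?thesis using assms by (simp add: mult_left_mono)
    qed (use assms in \<open>auto intro: order_trans\<close>)
    also have "e powr (1 - p) * \<bar>f t\<bar> powr p \<le> ?c * (\<bar>f t\<bar> powr p * sinh t ^ (N - 1))"
    proof -
      have "1 \<le> sinh t ^ (N - 1) / sinh a ^ (N - 1)" using s sa by simp
      then have "e powr (1 - p) * \<bar>f t\<bar> powr p * 1 \<le> e powr (1 - p) * \<bar>f t\<bar> powr p * (sinh t ^ (N - 1) / sinh a ^ (N - 1))"
        by (intro mult_left_mono) auto
      then show ?thesis by (simp add: mult_ac)
    qed
    finally have "\<bar>f t\<bar> \<le> e + ?c * (\<bar>f t\<bar> powr p * sinh t ^ (N - 1))" by simp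
    then have "ennreal \<bar>f t\<bar> \<le> ennreal e + ennreal ?c * (ennreal (\<bar>f t\<bar> powr p) * ennreal (sinh t ^ (N - 1)))"
      using assms st sa by (simp add: ennreal_mult[symmetric] ennreal_plus[symmetric] ennreal_leI del: ennreal_plus)
    then show ?thesis using True t by simp
  qed simp
  have "(\<integral>\<^sup>+t\<in>{a..b}. ennreal \<bar>f t\<bar> \<partial>lborel) \<le> (\<integral>\<^sup>+t. ennreal e * indicator {a..b} t + ennreal ?c * ?h t \<partial>lborel)"
    by (rule nn_integral_mono) (rule pt)
  also have "\<dots> = ennreal e * ennreal (b - a) + ennreal ?c * (\<integral>\<^sup>+t. ?h t \<partial>lborel)"
    using assms by (simp add: nn_integral_add nn_integral_cmult nn_integral_cmult_indicator)
  also have "(\<integral>\<^sup>+t. ?h t \<partial>lborel) = wint N p R f"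
    unfolding wint_eq_wmeas[OF f] by (subst nn_integral_wmeas) auto
  finally show ?thesis using assms by (simp add: ennreal_mult[symmetric])
qed

lemma wint_finite_loc_int:
  assumes "1 \<le> p" and f: "set_borel_measurable lborel (ivl R) f" and fin: "wint N p R f < \<infinity>"
  shows "loc_int R f"
  unfolding loc_int_def
proof (intro conjI allI impI f)
  fix a b :: real assume ab: "0 < a" "ereal b < R"
  have [measurable]: "(\<lambda>t. indicator (ivl R) t * f t) \<in> borel_measurable borel"
    using f by (simp_all add: set_borel_measurable_def)
  show "set_integrable lborel {a..b} f"
  proof (cases "a \<le> b")
    case True
    have sub: "{a..b} \<subseteq> ivl R" using ab by (intro ivl_subset)
    have eq: "(\<lambda>t. indicator {a..b} t * f t) = (\<lambda>t. indicator {a..b} t * (indicator (ivl R) t * f t))"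
      using sub by (intro ext) (auto simp: indicator_def)
    have "(\<integral>\<^sup>+t\<in>{a..b}. ennreal \<bar>f t\<bar> \<partial>lborel) < \<infinity>"
      using nn_integral_abs_le_wint[OF assms(1) ab zero_less_one True f, of N] fin
      by (auto intro: le_less_trans simp: ennreal_mult_less_top ennreal_add_less_top less_top)
    moreover have "(\<integral>\<^sup>+t. ennreal \<bar>indicator {a..b} t * f t\<bar> \<partial>lborel) = (\<integral>\<^sup>+t\<in>{a..b}. ennreal \<bar>f t\<bar> \<partial>lborel)"
      by (intro nn_integral_cong) (auto simp: indicator_def)
    ultimately show ?thesis unfolding set_integrable_def real_scaleR_def
      by (intro integrableI_bounded) (simp_all add: eq)
  qed (simp add: set_integrable_def)
qed

lemma weak_integral_limit:
  assumes p: "1 \<le> p"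
    and f: "\<And>n. set_borel_measurable lborel (ivl R) (f n)" and w: "set_borel_measurable lborel (ivl R) w"
    and fl: "\<And>n. loc_int R (f n)" and wl: "loc_int R w"
    and lim: "(\<lambda>n. wint N p R (\<lambda>t. f n t - w t)) \<longlonglongrightarrow> 0"
    and \<zeta>: "continuous_on UNIV \<zeta>" "0 < a" "a \<le> b" "ereal b < R" "\<And>t. t \<notin> {a..b} \<Longrightarrow> \<zeta> t = 0"
  shows "(\<lambda>n. LINT t:ivl R|lborel. f n t * \<zeta> t) \<longlonglongrightarrow> (LINT t:ivl R|lborel. w t * \<zeta> t)"
proof -
  have sub: "{a..b} \<subseteq> ivl R" using \<zeta> by (intro ivl_subset)
  have [measurable]: "(\<lambda>t. indicator (ivl R) t * f n t) \<in> borel_measurable borel" for n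
    using f[of n] by (simp_all add: set_borel_measurable_def)
  have [measurable]: "(\<lambda>t. indicator (ivl R) t * w t) \<in> borel_measurable borel"
    using w by (simp_all add: set_borel_measurable_def)
  have restr: "(LINT t:ivl R|lborel. g t * \<zeta> t) = (LINT t:{a..b}|lborel. g t * \<zeta> t)" for g :: "real \<Rightarrow> real"
    by (rule set_lebesgue_integral_restrict[OF sub]) (use \<zeta> in auto)
  have "compact (\<zeta> ` {a..b})" using \<zeta>(1) by (intro compact_continuous_image) (auto intro: continuous_on_subset)
  then obtain B where B: "\<And>t. t \<in> {a..b} \<Longrightarrow> \<bar>\<zeta> t\<bar> \<le> B" "B > 0"
    using compact_imp_bounded[of "\<zeta> ` {a..b}"] unfolding bounded_pos by fastforce
  have [measurable]: "\<zeta> \<in> borel_measurable borel" using \<zeta>(1) by (rule borel_measurable_continuous_onI)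
  have int: "set_integrable lborel {a..b} (\<lambda>t. g t * \<zeta> t)" if "loc_int R g" for g
  proof -
    have g: "set_integrable lborel {a..b} g" using that \<zeta> by (auto simp: loc_int_def)
    then have [measurable]: "(\<lambda>t. indicator {a..b} t * g t) \<in> borel_measurable borel" by (auto simp: set_integrable_def)
    have "(\<lambda>t. indicator {a..b} t * (g t * \<zeta> t)) = (\<lambda>t. (indicator {a..b} t * g t) * \<zeta> t)" by auto
    then have m: "(\<lambda>t. indicator {a..b} t * (g t * \<zeta> t)) \<in> borel_measurable borel" by simp
    have "set_integrable lborel {a..b} (\<lambda>t. B * g t)" using g by simp
    then show ?thesis unfolding set_integrable_def
      by (rule Bochner_Integration.integrable_bound)
        (use m B in \<open>auto simp: indicator_def abs_mult mult.commute[of "\<bar>g _\<bar>"] intro!: AE_I2 mult_right_mono\<close>)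
  qed
  have "(\<lambda>n. (LINT t:{a..b}|lborel. f n t * \<zeta> t) - (LINT t:{a..b}|lborel. w t * \<zeta> t)) \<longlonglongrightarrow> 0"
  proof (rule tendstoI)
    fix e :: real assume e: "e > 0"
    \<comment> \<open>After multiplication by \<open>B\<close> the first part of the bound stays
      below e / 2 and the second equals e / 2. The extra 1 keeps the denominator positive when
      \<open>a = b\<close>.\<close>
    define \<delta> where "\<delta> = e / (2 * B * (b - a + 1))"
    have \<delta>: "\<delta> > 0" using e B \<zeta> by (simp add: \<delta>_def)
    define c where "c = \<delta> powr (1 - p) / sinh a ^ (N - 1)"
    have c: "c > 0" using \<delta> \<zeta> by (simp add: c_def)
    have "\<forall>\<^sub>F n in sequentially. wint N p R (\<lambda>t. f n t - w t) < ennreal (e / (2 * B * c))"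
      by (rule order_tendstoD(2)[OF lim]) (use e B c in auto)
    then show "\<forall>\<^sub>F n in sequentially. dist ((LINT t:{a..b}|lborel. f n t * \<zeta> t) - (LINT t:{a..b}|lborel. w t * \<zeta> t)) 0 < e"
    proof eventually_elim
      case (elim n)
      have dm: "set_borel_measurable lborel (ivl R) (\<lambda>t. f n t - w t)"
        unfolding set_borel_measurable_def real_scaleR_def right_diff_distrib by measurable
      have "(\<integral>\<^sup>+t\<in>{a..b}. ennreal \<bar>f n t - w t\<bar> \<partial>lborel) \<le> ennreal (\<delta> * (b - a)) + ennreal c * wint N p R (\<lambda>t. f n t - w t)"
        unfolding c_def by (rule nn_integral_abs_le_wint[OF p \<zeta>(2,4) \<delta> \<zeta>(3) dm])
      also have "\<dots> \<le> ennreal (\<delta> * (b - a)) + ennreal c * ennreal (e / (2 * B * c))"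
        using elim by (intro add_left_mono mult_left_mono) auto
      also have "\<dots> = ennreal (\<delta> * (b - a) + c * (e / (2 * B * c)))"
        using c e B \<delta> \<zeta> by (simp add: ennreal_mult[symmetric] ennreal_plus[symmetric] del: ennreal_plus)
      finally have 1: "(\<integral>\<^sup>+t\<in>{a..b}. ennreal \<bar>f n t - w t\<bar> \<partial>lborel) \<le> ennreal (\<delta> * (b - a) + e / (2 * B))"
        using c by simp
      have di: "set_integrable lborel {a..b} (\<lambda>t. f n t - w t)"
        using fl[of n] wl \<zeta> by (intro set_integral_diff) (auto simp: loc_int_def)
      have 0: "ennreal (LINT t:{a..b}|lborel. \<bar>f n t - w t\<bar>) = (\<integral>\<^sup>+t\<in>{a..b}. ennreal \<bar>f n t - w t\<bar> \<partial>lborel)"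
        using set_integrable_abs[OF di] unfolding set_lebesgue_integral_def set_integrable_def
        by (subst nn_integral_eq_integral[symmetric]) (auto intro!: nn_integral_cong simp: indicator_def)
      have 2: "(LINT t:{a..b}|lborel. \<bar>f n t - w t\<bar>) \<le> \<delta> * (b - a) + e / (2 * B)"
      proof -
        have "0 \<le> \<delta> * (b - a) + e / (2 * B)" using \<delta> \<zeta>(3) e B(2) by (intro add_nonneg_nonneg) auto
        then show ?thesis using 1[folded 0] by (simp only: ennreal_le_iff)
      qed
      have "(LINT t:{a..b}|lborel. f n t * \<zeta> t) - (LINT t:{a..b}|lborel. w t * \<zeta> t) = (LINT t:{a..b}|lborel. (f n t - w t) * \<zeta> t)"
        using set_integral_diff(2)[OF int[OF fl[of n]] int[OF wl]] by (simp add: algebra_simps)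
      also have "\<bar>\<dots>\<bar> \<le> (LINT t:{a..b}|lborel. \<bar>(f n t - w t) * \<zeta> t\<bar>)"
        unfolding set_lebesgue_integral_def by (rule order_trans[OF integral_abs_bound]) (simp add: abs_mult)
      also have "\<dots> \<le> (LINT t:{a..b}|lborel. B * \<bar>f n t - w t\<bar>)"
      proof (rule set_integral_mono)
        have "set_integrable lborel {a..b} (\<lambda>t. f n t * \<zeta> t - w t * \<zeta> t)" by (intro set_integral_diff int fl wl)
        then show "set_integrable lborel {a..b} (\<lambda>t. \<bar>(f n t - w t) * \<zeta> t\<bar>)"
          using set_integrable_abs by (simp add: algebra_simps)
        show "set_integrable lborel {a..b} (\<lambda>t. B * \<bar>f n t - w t\<bar>)" using set_integrable_abs[OF di] by simp
        show "\<bar>(f n x - w x) * \<zeta> x\<bar> \<le> B * \<bar>f n x - w x\<bar>" if "x \<in> {a..b}" for x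
          using B(1)[OF that] by (simp add: abs_mult mult.commute mult_right_mono)
      qed
      also have "\<dots> = B * (LINT t:{a..b}|lborel. \<bar>f n t - w t\<bar>)" by simp
      also have "\<dots> \<le> B * (\<delta> * (b - a) + e / (2 * B))" using 2 B by (intro mult_left_mono) auto
      also have "\<dots> < e"
      proof -
        have "B * (\<delta> * (b - a)) < B * (\<delta> * (b - a + 1))" using B \<delta> by simp
        also have "\<dots> = e / 2"
        proof -
          have "b - a + 1 > 0" using \<zeta> by simp
          then show ?thesis using B by (simp add: \<delta>_def)
        qed
        finally show ?thesis using B by (simp add: distrib_left)
      qed
      finally show ?case by simp
    qed
  qed
  then show ?thesis unfolding restr by (subst (asm) LIM_zero_iff)
qed

text \<open>Both sides of the integration by parts identity pass to the limit, because a test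
  function and its derivatives are bounded with support away from both ends of the interval.\<close>

lemma weak_deriv_limit:
  assumes p: "1 \<le> p" and f: "\<And>n. smooth_fam (ivl R) (f n)"
    and w: "\<And>j. j \<le> k \<Longrightarrow> set_borel_measurable lborel (ivl R) (w j)"
    and fin: "\<And>j. j \<le> k \<Longrightarrow> wint N p R (w j) < \<infinity>"
    and lim: "\<And>j. j \<le> k \<Longrightarrow> (\<lambda>n. wint N p R (\<lambda>t. f n j t - w j t)) \<longlonglongrightarrow> 0"
    and j: "j \<le> k"
  shows "weak_deriv R j (w 0) (w j)"
  unfolding weak_deriv_def
proof (intro conjI allI impI)
  show l: "loc_int R (w 0)" "loc_int R (w j)"
    using wint_finite_loc_int[OF p w fin] j by auto
  fix \<phi> assume \<phi>: "test_fn R \<phi>"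
  obtain a b where ab: "0 < a" "a < b" "ereal b < R" "\<And>m t. t \<notin> {a<..<b} \<Longrightarrow> (deriv ^^ m) \<phi> t = 0"
    and d: "\<And>m t. ((deriv ^^ m) \<phi> has_real_derivative (deriv ^^ Suc m) \<phi> t) (at t)"
    using test_fnE[OF \<phi>] by metis
  have c: "continuous_on UNIV ((deriv ^^ m) \<phi>)" for m
    using d by (intro continuous_at_imp_continuous_on) (auto intro: DERIV_isCont)
  have "(\<lambda>n. LINT t:ivl R|lborel. f n i t * (deriv ^^ m) \<phi> t) \<longlonglongrightarrow> (LINT t:ivl R|lborel. w i t * (deriv ^^ m) \<phi> t)" if "i = 0 \<or> i = j" for i m
    by (rule weak_integral_limit[OF p smooth_fam_measurable[OF f] _ smooth_fam_loc_int[OF f] _ _ c ab(1) less_imp_le[OF ab(2)] ab(3), where N=N])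
      (use that w j l lim ab(4) in auto)
  from this[of 0 j] tendsto_mult[OF tendsto_const[of "(-1) ^ j"] this[of j 0]]
  show "(LINT t:ivl R|lborel. w 0 t * (deriv ^^ j) \<phi> t) = (-1) ^ j * (LINT t:ivl R|lborel. w j t * \<phi> t)"
    using smooth_fam_weak[OF f \<phi>, of _ j] by (intro LIMSEQ_unique) auto
qed

section \<open>Radial functions in the hyperbolic space are in the weighted space\<close>

definition hmeas :: "ereal \<Rightarrow> (real^'n::finite) measure" where
  "hmeas R = density lborel (\<lambda>x. ennreal (lam x ^ CARD('n)) * indicator (hball R) x)"

lemma sets_hmeas [measurable_cong, simp]: "sets (hmeas R) = sets borel"
  by (simp add: hmeas_def)

lemma nn_integral_hmeas:
  fixes f :: "real^'n::finite \<Rightarrow> ennreal"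
  assumes [measurable]: "f \<in> borel_measurable borel"
  shows "(\<integral>\<^sup>+x. f x \<partial>hmeas R) = (\<integral>\<^sup>+x\<in>hball R. (f x * ennreal (lam x ^ CARD('n))) \<partial>lborel)"
  unfolding hmeas_def by (subst nn_integral_density) (auto intro!: nn_integral_cong simp: mult_ac)

lemma measurable_wmeas_slice:
  fixes f :: "real^'n::finite \<Rightarrow> ennreal"
  assumes [measurable]: "f \<in> borel_measurable borel"
  shows "(\<lambda>y. \<integral>\<^sup>+t. f (gam y t) \<partial>wmeas N R) \<in> borel_measurable borel"
proof -
  have 1: "(\<lambda>y. \<integral>\<^sup>+t\<in>ivl R. (f (gam y t) * ennreal (sinh t ^ (N - 1))) \<partial>lborel) \<in> borel_measurable borel"
    by measurable
  have "(\<lambda>t. f (gam y t)) \<in> borel_measurable borel" for y by measurable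
  then show ?thesis using 1 by (simp only: nn_integral_wmeas)
qed

lemma nn_integral_hmeas_polar:
  fixes f :: "real^'n::finite \<Rightarrow> ennreal"
  assumes [measurable]: "f \<in> borel_measurable borel"
  shows "(\<integral>\<^sup>+x. f x \<partial>hmeas R) = of_nat CARD('n) * (\<integral>\<^sup>+y\<in>ball 0 1. (\<integral>\<^sup>+t. f (gam y t) \<partial>wmeas CARD('n) R) \<partial>lborel)"
proof -
  have "(\<lambda>t. f (gam y t)) \<in> borel_measurable borel" for y by measurable
  then show ?thesis
    by (simp only: nn_integral_hmeas[OF assms] hpolar_nn_integral[OF assms] nn_integral_wmeas)
qed

lemma sinh_power_nonneg: "t \<in> ivl R \<Longrightarrow> 0 \<le> sinh t ^ n"
  by (auto simp: ivl_def)

lemma lam_power_nonneg: "x \<in> hball R \<Longrightarrow> 0 \<le> lam x ^ n"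
  using lam_pos[of x] by (auto simp: hball_def intro!: zero_le_power less_imp_le)

lemma nn_integral_hmeas_le_hint:
  fixes f :: "real^'n::finite \<Rightarrow> real"
  assumes [measurable]: "f \<in> borel_measurable borel" and "0 \<le> p" "\<And>x. x \<in> hball R \<Longrightarrow> \<bar>f x\<bar> \<le> gnorm j u x"
  shows "(\<integral>\<^sup>+x. ennreal (\<bar>f x\<bar> powr p) \<partial>hmeas R) \<le> hint p R j u"
  unfolding hint_def using assms(2,3)
  by (subst nn_integral_hmeas, measurable, intro nn_integral_mono)
    (auto simp: indicator_def lam_power_nonneg ennreal_mult''[symmetric] intro!: ennreal_leI mult_right_mono powr_mono2)

lemma Drad_measurable:
  fixes u :: "real^'n::finite \<Rightarrow> real"
  assumes "hsmooth (hball R) u"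
  shows "(\<lambda>x. indicator (hball R) x * Drad u j x) \<in> borel_measurable borel"
proof -
  have [measurable]: "(\<lambda>x. indicator (hball R) x * cov u is x) \<in> borel_measurable borel" for "is"
    using borel_measurable_continuous_on_indicator[OF measurable_hball hsmooth_continuous[OF hsmooth_cov[OF open_hball hball_subset assms]]]
    by simp
  have [measurable]: "(\<lambda>x::real^'n. prod_list (map (\<lambda>i. x $ i / (norm x * lam x)) is)) \<in> borel_measurable borel" for "is"
    by (induction "is") auto
  have "(\<lambda>x. indicator (hball R) x * Drad u j x) =
     (\<lambda>x. \<Sum>is | length is = j. (indicator (hball R) x * cov u is x) * prod_list (map (\<lambda>i. x $ i / (norm x * lam x)) is))"
    by (simp add: Drad_def sum_distrib_left mult.assoc fun_eq_iff)
  then show ?thesis by simp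
qed

lemma Drad_diff:
  assumes "hsmooth (hball R) u" "hsmooth (hball R) v" "x \<in> hball R"
  shows "Drad (\<lambda>x. u x - v x) j x = Drad u j x - Drad v j x"
  unfolding Drad_def using cov_diff[OF open_hball hball_subset assms]
  by (simp add: sum_subtractf[symmetric] left_diff_distrib)

lemma Drad_0: "Drad u 0 x = u x"
  by (simp add: Drad_def)

lemma emeasure_unit_ball:
  "emeasure lborel (ball (0::real^'n::finite) 1) = ennreal (measure lborel (ball (0::real^'n) 1))" "0 < measure lborel (ball (0::real^'n) 1)"
  using content_ball_pos[of 1 "0::real^'n"] emeasure_lborel_ball_finite[of "0::real^'n" 1]
  by (auto simp: emeasure_eq_ennreal_measure)

text \<open>The area of the unit sphere, in the form in which \<open>hpolar_nn_integral\<close>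
  produces it.\<close>

definition radK :: "'n::finite itself \<Rightarrow> real" where
  "radK _ = CARD('n) * measure lborel (ball (0::real^'n) 1)"

lemma radK_pos: "0 < radK TYPE('n::finite)"
  unfolding radK_def using emeasure_unit_ball(2)[where 'n='n] by simp

lemma smooth_fam_Drad:
  assumes "hsmooth (hball R) u" "y \<noteq> 0"
  shows "smooth_fam (ivl R) (\<lambda>j t. Drad u j (gam y t))"
  unfolding smooth_fam_def using has_derivative_Drad_gam[OF assms] by blast

lemma ennreal_sum_enn2real:
  assumes "\<And>j. j \<in> A \<Longrightarrow> f j < \<infinity>"
  shows "ennreal (\<Sum>j\<in>A. enn2real (f j)) = (\<Sum>j\<in>A. f j)"
  using assms by (subst sum_ennreal[symmetric]) (auto intro!: sum.cong)

lemma hsnorm_powr: "0 < p \<Longrightarrow> hsnorm k p R f powr p = (\<Sum>j\<le>k. enn2real (hint p R j f))"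
  unfolding hsnorm_def by (simp add: powr_powr sum_nonneg)

lemma set_borel_measurable_radial:
  fixes v :: "real \<Rightarrow> real"
  assumes "set_borel_measurable lborel (hball R) (\<lambda>x::real^'n::finite. v (hdist x))"
  shows "set_borel_measurable lborel (ivl R) v"
proof -
  define y :: "real^'n" where "y = axis undefined 1"
  have y: "y \<noteq> 0" by (simp add: y_def axis_eq_0_iff)
  have [measurable]: "(\<lambda>x::real^'n. indicator (hball R) x * v (hdist x)) \<in> borel_measurable borel"
    using assms by (simp add: set_borel_measurable_def)
  have "(\<lambda>t. indicator (ivl R) t * v t) = (\<lambda>t. indicator (ivl R) t * (\<lambda>x. indicator (hball R) x * v (hdist x)) (gam y t))"
    using y by (auto simp: fun_eq_iff indicator_def gam_in_hball gam_simps ivl_def)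
  then show ?thesis by (simp add: set_borel_measurable_def)
qed

text \<open>The radial components of the approximants converge on the ball. Polar coordinates turn
  this into convergence on almost every ray along a subsequence, and a ray is picked whose energy is
  at most the average. On that ray the components are successive derivatives of a smooth function,
  so \<open>weak_deriv_limit\<close> applies.\<close>

lemma happrox_imp_wvalid:
  fixes v :: "real \<Rightarrow> real"
  assumes p: "1 \<le> p" and u: "set_borel_measurable lborel (hball R) (\<lambda>x::real^'n::finite. v (hdist x))"
    and ap: "happrox k p R \<phi> (\<lambda>x::real^'n. v (hdist x))"
    and lim: "(\<lambda>n. hsnorm k p R (\<phi> n)) \<longlonglongrightarrow> c"
  shows "\<exists>w. wvalid CARD('n) k p R v w \<and>
    (\<Sum>j\<le>k. enn2real (wint CARD('n) p R (w j))) powr (1 / p) \<le> (2 / radK TYPE('n) powr (1 / p)) * c"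
proof -
  let ?N = "CARD('n)"
  let ?u = "\<lambda>x::real^'n. v (hdist x)"
  have sm: "hsmooth (hball R) (\<phi> n)" and fin: "j \<le> k \<Longrightarrow> hint p R j (\<phi> n) < \<infinity>" for n j
    using ap by (auto simp: happrox_def)
  define F where "F n j x = indicator (hball R) x * Drad (\<phi> n) j x" for n j and x :: "real^'n"
  have [measurable]: "F n j \<in> borel_measurable borel" for n j
    unfolding F_def[abs_def] by (rule Drad_measurable[OF sm])
  have [measurable]: "(\<lambda>x. indicator (hball R) x * ?u x) \<in> borel_measurable borel"
    using u by (simp add: set_borel_measurable_def)
  have Fle: "(\<integral>\<^sup>+x. ennreal (\<bar>F n j x\<bar> powr p) \<partial>hmeas R) \<le> hint p R j (\<phi> n)" for n j
  proof (rule nn_integral_hmeas_le_hint)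
    fix x :: "real^'n" assume x: "x \<in> hball R"
    then have "norm x < 1" by (simp add: hball_def)
    then show "\<bar>F n j x\<bar> \<le> gnorm j (\<phi> n) x" using x by (simp add: F_def abs_Drad_le_gnorm)
  qed (use p in auto)
  have Fdle: "(\<integral>\<^sup>+x. ennreal (\<bar>F m j x - F n j x\<bar> powr p) \<partial>hmeas R) \<le> hint p R j (\<lambda>x. \<phi> m x - \<phi> n x)" for m n j
  proof (rule nn_integral_hmeas_le_hint)
    fix x :: "real^'n" assume x: "x \<in> hball R"
    then have n: "norm x < 1" by (simp add: hball_def)
    have "F m j x - F n j x = Drad (\<lambda>x. \<phi> m x - \<phi> n x) j x" using x by (simp add: F_def Drad_diff[OF sm sm x])
    then show "\<bar>F m j x - F n j x\<bar> \<le> gnorm j (\<lambda>x. \<phi> m x - \<phi> n x) x" using abs_Drad_le_gnorm[OF n] by simp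
  qed (use p in auto)
  \<comment> \<open>For \<open>j = 0\<close> the limit is prescribed to be the given function; for
    higher orders it comes from completeness, with no claim that it is radial.\<close>
  have "\<exists>G. \<forall>j\<le>k. G j \<in> borel_measurable borel \<and> (\<lambda>n. \<integral>\<^sup>+x. ennreal (\<bar>F n j x - G j x\<bar> powr p) \<partial>hmeas R) \<longlonglongrightarrow> 0
     \<and> (j = 0 \<longrightarrow> G j = (\<lambda>x. indicator (hball R) x * ?u x))"
  proof (intro choice allI)
    fix j
    show "\<exists>g. j \<le> k \<longrightarrow> g \<in> borel_measurable borel \<and> (\<lambda>n. \<integral>\<^sup>+x. ennreal (\<bar>F n j x - g x\<bar> powr p) \<partial>hmeas R) \<longlonglongrightarrow> 0
     \<and> (j = 0 \<longrightarrow> g = (\<lambda>x. indicator (hball R) x * ?u x))"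
    proof (cases "j = 0")
      case True
      have "(\<integral>\<^sup>+x. ennreal (\<bar>F n 0 x - indicator (hball R) x * ?u x\<bar> powr p) \<partial>hmeas R)
        = (\<integral>\<^sup>+x\<in>hball R. ennreal (\<bar>\<phi> n x - ?u x\<bar> powr p * lam x ^ ?N) \<partial>lborel)" for n
        by (subst nn_integral_hmeas, measurable, intro nn_integral_cong)
          (auto simp: F_def Drad_0 indicator_def ennreal_mult'' lam_power_nonneg)
      then show ?thesis using ap True by (intro exI[of _ "\<lambda>x. indicator (hball R) x * ?u x"]) (auto simp: happrox_def)
    next
      case False
      show ?thesis
      proof (cases "j \<le> k")
        case True
        obtain g where "g \<in> borel_measurable (hmeas R)" "(\<lambda>n. \<integral>\<^sup>+x. ennreal (\<bar>F n j x - g x\<bar> powr p) \<partial>hmeas R) \<longlonglongrightarrow> 0"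
        proof (rule Lp_complete[of "\<lambda>n. F n j" "hmeas R" p])
          fix e :: real assume "e > 0"
          with ap True obtain K where K: "\<And>m n. m \<ge> K \<Longrightarrow> n \<ge> K \<Longrightarrow> hint p R j (\<lambda>x. \<phi> m x - \<phi> n x) < ennreal e"
            unfolding happrox_def by meson
          show "\<exists>K. \<forall>m\<ge>K. \<forall>n\<ge>K. (\<integral>\<^sup>+x. ennreal (\<bar>F m j x - F n j x\<bar> powr p) \<partial>hmeas R) < ennreal e"
            using K le_less_trans[OF Fdle] by (intro exI[of _ K]) auto
        qed (use p in auto)
        then show ?thesis using False by (intro exI[of _ g]) auto
      qed auto
    qed
  qed
  then obtain G where G0: "\<And>j. j \<le> k \<Longrightarrow> G j \<in> borel_measurable borel"
    and Glim: "\<And>j. j \<le> k \<Longrightarrow> (\<lambda>n. \<integral>\<^sup>+x. ennreal (\<bar>F n j x - G j x\<bar> powr p) \<partial>hmeas R) \<longlonglongrightarrow> 0"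
    and Gu: "G 0 = (\<lambda>x. indicator (hball R) x * ?u x)" by blast
  \<comment> \<open>Extended by zero beyond \<open>k\<close>, so that measurability holds for every
    index.\<close>
  define H where "H j = (if j \<le> k then G j else (\<lambda>x. 0))" for j
  have [measurable]: "H j \<in> borel_measurable borel" for j using G0 by (auto simp: H_def)
  define B where "B n = (\<Sum>j\<le>k. \<integral>\<^sup>+x. ennreal (\<bar>F n j x - H j x\<bar> powr p) \<partial>hmeas R)" for n
  have Blim: "B \<longlonglongrightarrow> 0"
    unfolding B_def[abs_def] using tendsto_sum[of "{..k}" "\<lambda>j n. \<integral>\<^sup>+x. ennreal (\<bar>F n j x - H j x\<bar> powr p) \<partial>hmeas R" "\<lambda>j. 0" sequentially] Glim
    by (simp add: H_def)
  have c: "0 \<le> c" using lim by (rule LIMSEQ_le_const) (auto simp: hsnorm_def)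
  \<comment> \<open>The factor \<open>2 powr p\<close> is the price of comparing the limit with the
    sequence by \<open>nn_integral_powr_add_le\<close>; it becomes the 2 in the final
    constant.\<close>
  have total: "(\<Sum>j\<le>k. \<integral>\<^sup>+x. ennreal (\<bar>H j x\<bar> powr p) \<partial>hmeas R) \<le> ennreal (2 powr p * c powr p)"
  proof (rule LIMSEQ_le_const)
    have "(\<lambda>n. ennreal (2 powr p) * (ennreal (hsnorm k p R (\<phi> n) powr p) + B n)) \<longlonglongrightarrow> ennreal (2 powr p) * (ennreal (c powr p) + 0)"
      using p by (intro ennreal_tendsto_cmult tendsto_add tendsto_ennrealI tendsto_powr' lim Blim tendsto_const) (auto simp: hsnorm_def)
    then show "(\<lambda>n. ennreal (2 powr p) * (ennreal (hsnorm k p R (\<phi> n) powr p) + B n)) \<longlonglongrightarrow> ennreal (2 powr p * c powr p)"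
      by (simp add: ennreal_mult)
    have "(\<Sum>j\<le>k. \<integral>\<^sup>+x. ennreal (\<bar>H j x\<bar> powr p) \<partial>hmeas R) \<le> ennreal (2 powr p) * (ennreal (hsnorm k p R (\<phi> n) powr p) + B n)" for n
    proof -
      have "(\<integral>\<^sup>+x. ennreal (\<bar>H j x\<bar> powr p) \<partial>hmeas R) \<le> ennreal (2 powr p) * (hint p R j (\<phi> n) + (\<integral>\<^sup>+x. ennreal (\<bar>F n j x - H j x\<bar> powr p) \<partial>hmeas R))" for j
      proof -
        have "(\<integral>\<^sup>+x. ennreal (\<bar>H j x\<bar> powr p) \<partial>hmeas R) = (\<integral>\<^sup>+x. ennreal (\<bar>F n j x + - (F n j x - H j x)\<bar> powr p) \<partial>hmeas R)" by simp
        also have "\<dots> \<le> ennreal (2 powr p) * ((\<integral>\<^sup>+x. ennreal (\<bar>F n j x\<bar> powr p) \<partial>hmeas R) + (\<integral>\<^sup>+x. ennreal (\<bar>- (F n j x - H j x)\<bar> powr p) \<partial>hmeas R))"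
          using p by (intro nn_integral_powr_add_le) auto
        also have "(\<integral>\<^sup>+x. ennreal (\<bar>- (F n j x - H j x)\<bar> powr p) \<partial>hmeas R) = (\<integral>\<^sup>+x. ennreal (\<bar>F n j x - H j x\<bar> powr p) \<partial>hmeas R)"
          by (simp only: abs_minus_cancel)
        finally show ?thesis by (rule order_trans) (intro mult_left_mono add_mono Fle order_refl, simp)
      qed
      then have "(\<Sum>j\<le>k. \<integral>\<^sup>+x. ennreal (\<bar>H j x\<bar> powr p) \<partial>hmeas R) \<le> (\<Sum>j\<le>k. ennreal (2 powr p) * (hint p R j (\<phi> n) + (\<integral>\<^sup>+x. ennreal (\<bar>F n j x - H j x\<bar> powr p) \<partial>hmeas R)))"
        by (intro sum_mono)
      also have "\<dots> = ennreal (2 powr p) * ((\<Sum>j\<le>k. hint p R j (\<phi> n)) + B n)"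
        by (simp add: B_def sum_distrib_left[symmetric] sum.distrib)
      also have "(\<Sum>j\<le>k. hint p R j (\<phi> n)) = ennreal (hsnorm k p R (\<phi> n) powr p)"
        using p ennreal_sum_enn2real[of "{..k}" "\<lambda>j. hint p R j (\<phi> n)"] fin by (simp add: hsnorm_powr)
      finally show ?thesis .
    qed
    then show "\<exists>M. \<forall>n\<ge>M. (\<Sum>j\<le>k. \<integral>\<^sup>+x. ennreal (\<bar>H j x\<bar> powr p) \<partial>hmeas R) \<le> ennreal (2 powr p) * (ennreal (hsnorm k p R (\<phi> n) powr p) + B n)" by blast
  qed
  \<comment> \<open>\<open>S y\<close> is the energy of the limits along the ray through y, and
    \<open>b n y\<close> the distance of the n-th approximant from them on that ray.\<close>
  define S where "S y = (\<Sum>j\<le>k. \<integral>\<^sup>+t. ennreal (\<bar>H j (gam y t)\<bar> powr p) \<partial>wmeas ?N R)" for y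
  define b where "b n y = (\<Sum>j\<le>k. \<integral>\<^sup>+t. ennreal (\<bar>F n j (gam y t) - H j (gam y t)\<bar> powr p) \<partial>wmeas ?N R) * indicator (ball 0 1) y" for n y
  have [measurable]: "S \<in> borel_measurable borel"
    unfolding S_def[abs_def]
    by (intro borel_measurable_sum measurable_wmeas_slice[where f="\<lambda>x. ennreal (\<bar>H _ x\<bar> powr p)"]) measurable
  have m2[measurable]: "(\<lambda>y. \<integral>\<^sup>+t. ennreal (\<bar>F n j (gam y t) - H j (gam y t)\<bar> powr p) \<partial>wmeas ?N R) \<in> borel_measurable borel" for n j
    by (rule measurable_wmeas_slice[where f="\<lambda>x. ennreal (\<bar>F n j x - H j x\<bar> powr p)"]) measurable
  have m3[measurable]: "(\<lambda>y. \<integral>\<^sup>+t. ennreal (\<bar>H j (gam y t)\<bar> powr p) \<partial>wmeas ?N R) \<in> borel_measurable borel" for j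
    by (rule measurable_wmeas_slice[where f="\<lambda>x. ennreal (\<bar>H j x\<bar> powr p)"]) measurable
  have [measurable]: "b n \<in> borel_measurable borel" for n
    unfolding b_def[abs_def] by measurable
  have intS: "of_nat ?N * (\<integral>\<^sup>+y\<in>ball 0 1. S y \<partial>lborel) = (\<Sum>j\<le>k. \<integral>\<^sup>+x. ennreal (\<bar>H j x\<bar> powr p) \<partial>hmeas R)"
  proof -
    have "(\<integral>\<^sup>+y\<in>ball 0 1. S y \<partial>lborel) = (\<Sum>j\<le>k. \<integral>\<^sup>+y\<in>ball 0 1. (\<integral>\<^sup>+t. ennreal (\<bar>H j (gam y t)\<bar> powr p) \<partial>wmeas ?N R) \<partial>lborel)"
      unfolding S_def sum_distrib_right by (rule nn_integral_sum) measurable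
    moreover have "(\<integral>\<^sup>+x. ennreal (\<bar>H j x\<bar> powr p) \<partial>hmeas R)
      = of_nat ?N * (\<integral>\<^sup>+y\<in>ball 0 1. (\<integral>\<^sup>+t. ennreal (\<bar>H j (gam y t)\<bar> powr p) \<partial>wmeas ?N R) \<partial>lborel)" for j
      by (rule nn_integral_hmeas_polar) measurable
    ultimately show ?thesis by (simp only: sum_distrib_left)
  qed
  have intb: "of_nat ?N * (\<integral>\<^sup>+y. b n y \<partial>lborel) = B n" for n
  proof -
    have "(\<integral>\<^sup>+y. b n y \<partial>lborel) = (\<Sum>j\<le>k. \<integral>\<^sup>+y\<in>ball 0 1. (\<integral>\<^sup>+t. ennreal (\<bar>F n j (gam y t) - H j (gam y t)\<bar> powr p) \<partial>wmeas ?N R) \<partial>lborel)"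
      unfolding b_def sum_distrib_right by (rule nn_integral_sum) measurable
    moreover have "(\<integral>\<^sup>+x. ennreal (\<bar>F n j x - H j x\<bar> powr p) \<partial>hmeas R)
      = of_nat ?N * (\<integral>\<^sup>+y\<in>ball 0 1. (\<integral>\<^sup>+t. ennreal (\<bar>F n j (gam y t) - H j (gam y t)\<bar> powr p) \<partial>wmeas ?N R) \<partial>lborel)" for j
      by (rule nn_integral_hmeas_polar) measurable
    ultimately show ?thesis by (simp only: sum_distrib_left B_def)
  qed
  have "(\<lambda>n. \<integral>\<^sup>+y. b n y \<partial>lborel) \<longlonglongrightarrow> 0"
  proof (rule tendsto_sandwich[OF _ _ tendsto_const Blim])
    show "\<forall>\<^sub>F n in sequentially. (\<integral>\<^sup>+y. b n y \<partial>lborel) \<le> B n"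
    proof (intro always_eventually allI)
      fix n
      have "1 * (\<integral>\<^sup>+y. b n y \<partial>lborel) \<le> of_nat ?N * (\<integral>\<^sup>+y. b n y \<partial>lborel)"
        by (intro mult_right_mono) (auto simp: Suc_le_eq)
      then show "(\<integral>\<^sup>+y. b n y \<partial>lborel) \<le> B n" by (simp add: intb)
    qed
  qed auto
  from nn_integral_tendsto_zero_AE_subseq[OF _ this]
  obtain r where r: "strict_mono r" "AE y in lborel. (\<lambda>n. b (r n) y) \<longlonglongrightarrow> 0" by auto
  have "AE y in lborel. (\<lambda>n. b (r n) y) \<longlonglongrightarrow> 0 \<and> y \<noteq> 0" using r(2) AE_lborel_neq[of 0] by eventually_elim auto
  then obtain E where E: "{y \<in> space lborel. \<not> ((\<lambda>n. b (r n) y) \<longlonglongrightarrow> 0 \<and> y \<noteq> 0)} \<subseteq> E" "emeasure lborel E = 0" "E \<in> sets lborel"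
    by (rule AE_E)
  \<comment> \<open>The bad directions form a null set, so \<open>A\<close> has the measure of the
    full ball and still contains a ray of at most average energy.\<close>
  define A where "A = ball (0::real^'n) 1 - E"
  have [measurable]: "E \<in> sets borel" using E(3) by simp
  have [measurable]: "A \<in> sets borel" unfolding A_def by measurable
  have mA: "emeasure lborel A = ennreal (measure lborel (ball (0::real^'n) 1))"
    unfolding A_def using emeasure_Diff_null_set[of E lborel "ball 0 1"] E emeasure_unit_ball(1)[where 'n='n] by (auto simp: null_sets_def)
  obtain y where y: "y \<in> A" "S y * emeasure lborel A \<le> (\<integral>\<^sup>+y\<in>A. S y \<partial>lborel)"
    using exists_le_average[of A lborel S] mA emeasure_unit_ball(2)[where 'n='n] by auto
  have y0: "y \<noteq> 0" "(\<lambda>n. b (r n) y) \<longlonglongrightarrow> 0" "y \<in> ball 0 1" using y E unfolding A_def by auto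
  have "(\<integral>\<^sup>+y\<in>A. S y \<partial>lborel) \<le> (\<integral>\<^sup>+y\<in>ball 0 1. S y \<partial>lborel)"
    by (intro nn_integral_mono) (auto simp: A_def indicator_def)
  with y(2) have "S y * emeasure lborel A \<le> (\<integral>\<^sup>+y\<in>ball 0 1. S y \<partial>lborel)" by (rule order_trans)
  then have "of_nat ?N * (S y * emeasure lborel A) \<le> of_nat ?N * (\<integral>\<^sup>+y\<in>ball 0 1. S y \<partial>lborel)" by (rule mult_left_mono) simp
  also have "\<dots> \<le> ennreal (2 powr p * c powr p)" unfolding intS by (rule total)
  also have "of_nat ?N * (S y * emeasure lborel A) = S y * ennreal (radK TYPE('n))"
    unfolding mA radK_def by (simp add: ennreal_mult ennreal_of_nat_eq_real_of_nat mult_ac)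
  finally have Sy: "S y * ennreal (radK TYPE('n)) \<le> ennreal (2 powr p * c powr p)" .
  \<comment> \<open>\<open>wvalid\<close> asks for \<open>w 0 = v\<close> on the whole line, whereas
    the ray reproduces \<open>v\<close> only on \<open>ivl R\<close>; hence the case
    distinction.\<close>
  define w where "w j = (if j = 0 then v else (\<lambda>t. H j (gam y t)))" for j
  have wH: "w j t = H j (gam y t)" if "t \<in> ivl R" for j t
    using that y0 gam_in_hball[OF y0(1) that] by (auto simp: w_def H_def Gu gam_simps ivl_def)
  have wm: "set_borel_measurable lborel (ivl R) (w j)" for j
    using set_borel_measurable_radial[OF u] by (auto simp: w_def set_borel_measurable_def)
  have wint_w: "wint ?N p R (w j) = (\<integral>\<^sup>+t. ennreal (\<bar>H j (gam y t)\<bar> powr p) \<partial>wmeas ?N R)" for j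
  proof -
    have "wint ?N p R (w j) = wint ?N p R (\<lambda>t. H j (gam y t))" by (intro wint_cong wH)
    also have "\<dots> = (\<integral>\<^sup>+t. ennreal (\<bar>H j (gam y t)\<bar> powr p) \<partial>wmeas ?N R)"
      unfolding wint_def by (subst nn_integral_wmeas, measurable, intro nn_integral_cong)
        (auto simp: indicator_def sinh_power_nonneg ennreal_mult'')
    finally show ?thesis .
  qed
  have Sy_eq: "S y = (\<Sum>j\<le>k. wint ?N p R (w j))" by (simp add: S_def wint_w)
  have Sfin: "S y < \<infinity>"
  proof (rule ccontr)
    assume "\<not> S y < \<infinity>"
    then have "S y = \<infinity>" using top.not_eq_extremum[of "S y"] by auto
    then show False using Sy radK_pos[where 'n='n] by (simp add: ennreal_top_mult top_unique)
  qed
  then have wfin: "wint ?N p R (w j) < \<infinity>" if "j \<le> k" for j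
    using that unfolding Sy_eq by (meson finite_atMost member_le_sum atMost_iff zero_le le_less_trans)
  have wlim: "(\<lambda>n. wint ?N p R (\<lambda>t. Drad (\<phi> (r n)) j (gam y t) - w j t)) \<longlonglongrightarrow> 0" if j: "j \<le> k" for j
  proof (rule tendsto_sandwich[OF _ _ tendsto_const y0(2)])
    show "\<forall>\<^sub>F n in sequentially. wint ?N p R (\<lambda>t. Drad (\<phi> (r n)) j (gam y t) - w j t) \<le> b (r n) y"
    proof (intro always_eventually allI)
      fix n
      have "wint ?N p R (\<lambda>t. Drad (\<phi> (r n)) j (gam y t) - w j t) = wint ?N p R (\<lambda>t. F (r n) j (gam y t) - H j (gam y t))"
        using gam_in_hball[OF y0(1)] by (intro wint_cong) (auto simp: F_def wH)
      also have "\<dots> = (\<integral>\<^sup>+t. ennreal (\<bar>F (r n) j (gam y t) - H j (gam y t)\<bar> powr p) \<partial>wmeas ?N R)"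
        unfolding wint_def by (subst nn_integral_wmeas, measurable, intro nn_integral_cong)
          (auto simp: indicator_def sinh_power_nonneg ennreal_mult'')
      also have "\<dots> \<le> b (r n) y"
        unfolding b_def using y0(3) j
        by (simp add: member_le_sum[of j "{..k}" "\<lambda>j. \<integral>\<^sup>+t. ennreal (\<bar>F (r n) j (gam y t) - H j (gam y t)\<bar> powr p) \<partial>wmeas ?N R"])
      finally show "wint ?N p R (\<lambda>t. Drad (\<phi> (r n)) j (gam y t) - w j t) \<le> b (r n) y" .
    qed
  qed auto
  have weak: "weak_deriv R j v (w j)" if "j \<le> k" for j
    using weak_deriv_limit[where f="\<lambda>n j t. Drad (\<phi> (r n)) j (gam y t)", OF p smooth_fam_Drad[OF sm y0(1)] wm wfin wlim that]
    by (simp add: w_def)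
  have "wvalid ?N k p R v w"
    unfolding wvalid_def using weak wfin w_def[of 0] by simp
  moreover have "(\<Sum>j\<le>k. enn2real (wint ?N p R (w j))) powr (1 / p) \<le> (2 / radK TYPE('n) powr (1 / p)) * c"
  proof -
    let ?s = "\<Sum>j\<le>k. enn2real (wint ?N p R (w j))"
    have s0: "0 \<le> ?s" by (intro sum_nonneg) auto
    have "ennreal ?s = S y" using ennreal_sum_enn2real[of "{..k}" "\<lambda>j. wint ?N p R (w j)"] wfin by (simp add: Sy_eq)
    then have "ennreal (?s * radK TYPE('n)) \<le> ennreal (2 powr p * c powr p)"
      using Sy s0 radK_pos[where 'n='n] by (simp add: ennreal_mult)
    then have "?s * radK TYPE('n) \<le> 2 powr p * c powr p" by (simp add: ennreal_le_iff)
    then have "?s \<le> (2 * c) powr p / radK TYPE('n)" using radK_pos[where 'n='n] c by (simp add: field_simps powr_mult)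
    then have "?s powr (1 / p) \<le> ((2 * c) powr p / radK TYPE('n)) powr (1 / p)" using s0 p by (intro powr_mono2) auto
    also have "\<dots> = 2 / radK TYPE('n) powr (1 / p) * c"
      using c p radK_pos[where 'n='n] by (simp add: powr_divide powr_powr)
    finally show ?thesis .
  qed
  ultimately show ?thesis by blast
qed

section \<open>The seminorms and the norm of the completion\<close>

lemma gnorm_measurable:
  fixes u :: "real^'n::finite \<Rightarrow> real"
  assumes "hsmooth (hball R) u"
  shows "(\<lambda>x. indicator (hball R) x * gnorm j u x) \<in> borel_measurable borel"
proof -
  have [measurable]: "(\<lambda>x. indicator (hball R) x * cov u is x) \<in> borel_measurable borel" for "is"
    using borel_measurable_continuous_on_indicator[OF measurable_hball hsmooth_continuous[OF hsmooth_cov[OF open_hball hball_subset assms]]]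
    by simp
  have "(\<lambda>x. indicator (hball R) x * gnorm j u x) =
     (\<lambda>x. lam x powr (- real j) * sqrt (\<Sum>is | length is = j. (indicator (hball R) x * cov u is x)\<^sup>2))"
    by (auto simp: gnorm_def indicator_def fun_eq_iff)
  then show ?thesis by simp
qed

lemma gnorm_nonneg: "0 \<le> gnorm j u x"
  by (simp add: gnorm_def sum_nonneg)

lemma hint_eq_hmeas:
  fixes u :: "real^'n::finite \<Rightarrow> real"
  assumes "hsmooth (hball R) u"
  shows "hint p R j u = (\<integral>\<^sup>+x. ennreal (\<bar>indicator (hball R) x * gnorm j u x\<bar> powr p) \<partial>hmeas R)"
proof -
  note gnorm_measurable[OF assms, measurable]
  show ?thesis unfolding hint_def
    by (subst nn_integral_hmeas, measurable, intro nn_integral_cong)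
      (auto simp: indicator_def gnorm_nonneg lam_power_nonneg ennreal_mult'')
qed

lemma gnorm_triangle:
  fixes u :: "real^'n::finite \<Rightarrow> real"
  assumes "hsmooth (hball R) u" "hsmooth (hball R) v" "x \<in> hball R"
  shows "gnorm j u x \<le> gnorm j (\<lambda>x. u x - v x) x + gnorm j v x"
proof -
  let ?L = "{is::'n list. length is = j}"
  have "L2_set (\<lambda>is. cov u is x) ?L = L2_set (\<lambda>is. cov (\<lambda>x. u x - v x) is x + cov v is x) ?L"
    using cov_diff[OF open_hball hball_subset assms] by simp
  also have "\<dots> \<le> L2_set (\<lambda>is. cov (\<lambda>x. u x - v x) is x) ?L + L2_set (\<lambda>is. cov v is x) ?L"
    by (rule L2_set_triangle_ineq)
  finally have "lam x powr (- real j) * L2_set (\<lambda>is. cov u is x) ?L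
     \<le> lam x powr (- real j) * (L2_set (\<lambda>is. cov (\<lambda>x. u x - v x) is x) ?L + L2_set (\<lambda>is. cov v is x) ?L)"
    by (rule mult_left_mono) simp
  then show ?thesis unfolding gnorm_def L2_set_def by (simp add: distrib_left)
qed

lemma hint_triangle:
  fixes u :: "real^'n::finite \<Rightarrow> real"
  assumes u: "hsmooth (hball R) u" and v: "hsmooth (hball R) v" and p: "0 \<le> p"
  shows "hint p R j u \<le> ennreal (2 powr p) * (hint p R j (\<lambda>x. u x - v x) + hint p R j v)"
proof -
  have d: "hsmooth (hball R) (\<lambda>x. u x - v x)" by (rule hsmooth_diff[OF open_hball u v])
  note [measurable] = gnorm_measurable[OF u] gnorm_measurable[OF v] gnorm_measurable[OF d]
  have "hint p R j u \<le> (\<integral>\<^sup>+x. ennreal (\<bar>indicator (hball R) x * gnorm j (\<lambda>x. u x - v x) x + indicator (hball R) x * gnorm j v x\<bar> powr p) \<partial>hmeas R)"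
    unfolding hint_eq_hmeas[OF u] using gnorm_triangle[OF u v] p
    by (intro nn_integral_mono ennreal_leI powr_mono2) (auto simp: indicator_def gnorm_nonneg)
  also have "\<dots> \<le> ennreal (2 powr p) * (hint p R j (\<lambda>x. u x - v x) + hint p R j v)"
    unfolding hint_eq_hmeas[OF d] hint_eq_hmeas[OF v] using p by (intro nn_integral_powr_add_le) auto
  finally show ?thesis .
qed

lemma happrox_subseq:
  assumes a: "happrox k p R \<phi> u" and r: "strict_mono r"
  shows "happrox k p R (\<lambda>n. \<phi> (r n)) u"
  unfolding happrox_def
proof (intro conjI allI impI)
  fix j and e :: real assume "j \<le> k" "0 < e"
  then obtain M where M: "\<And>m n. m \<ge> M \<Longrightarrow> n \<ge> M \<Longrightarrow> hint p R j (\<lambda>x. \<phi> m x - \<phi> n x) < ennreal e"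
    using a unfolding happrox_def by meson
  show "\<exists>M. \<forall>m\<ge>M. \<forall>n\<ge>M. hint p R j (\<lambda>x. \<phi> (r m) x - \<phi> (r n) x) < ennreal e"
    using M seq_suble[OF r] by (intro exI[of _ M]) (meson order_trans)
next
  let ?f = "\<lambda>n. \<integral>\<^sup>+x\<in>hball R. ennreal (\<bar>\<phi> n x - u x\<bar> powr p * lam x ^ CARD('a)) \<partial>lborel"
  have "?f \<longlonglongrightarrow> 0" using a unfolding happrox_def by blast
  from LIMSEQ_subseq_LIMSEQ[OF this r]
  show "(\<lambda>n. ?f (r n)) \<longlonglongrightarrow> 0" by (simp add: o_def)
qed (use a in \<open>auto simp: happrox_def\<close>)

text \<open>\<open>hnormW\<close> is an infimum over sequences whose norms converge; compactness of
  \<open>{0..B}\<close> extracts one from any approximating sequence with bounded norms.\<close>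

lemma happrox_norm_limit:
  assumes a: "happrox k p R \<phi> u" and b: "\<And>n. hsnorm k p R (\<phi> n) \<le> B"
  obtains \<psi> c where "happrox k p R \<psi> u" "(\<lambda>n. hsnorm k p R (\<psi> n)) \<longlonglongrightarrow> c" "c \<le> B"
proof -
  have "\<forall>n. hsnorm k p R (\<phi> n) \<in> {0..B}" using b by (auto simp: hsnorm_def)
  then obtain c r where "c \<in> {0..B}" "strict_mono r" "((\<lambda>n. hsnorm k p R (\<phi> n)) \<circ> r) \<longlonglongrightarrow> c"
    using compact_imp_seq_compact[OF compact_Icc[of 0 B], unfolded seq_compact_def, rule_format, of "\<lambda>n. hsnorm k p R (\<phi> n)"] by blast
  then show thesis using that[OF happrox_subseq[OF a]] by (auto simp: o_def)
qed

lemma hnormW_le: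
  assumes a: "happrox k p R \<phi> u" and b: "\<And>n. hsnorm k p R (\<phi> n) \<le> B"
  shows "hnormW k p R u \<le> B"
proof -
  obtain \<psi> c where c: "happrox k p R \<psi> u" "(\<lambda>n. hsnorm k p R (\<psi> n)) \<longlonglongrightarrow> c" "c \<le> B"
    using happrox_norm_limit[OF assms] .
  have "hnormW k p R u \<le> c" unfolding hnormW_def
  proof (rule cInf_lower)
    show "bdd_below {c. \<exists>\<phi>. happrox k p R \<phi> u \<and> (\<lambda>n. hsnorm k p R (\<phi> n)) \<longlonglongrightarrow> c}"
      by (rule bdd_belowI[of _ 0]) (auto intro: LIMSEQ_le_const simp: hsnorm_def)
  qed (use c in auto)
  then show ?thesis using c by simp
qed

text \<open>The Cauchy property compares every late member with the \<open>K\<close>-th one, where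
  \<open>K\<close> serves all orders up to \<open>k\<close> at once.\<close>

lemma happrox_bounded:
  fixes u :: "real^'n::finite \<Rightarrow> real"
  assumes a: "happrox k p R \<phi> u" and p: "0 < p"
  obtains M B where "\<And>n. n \<ge> M \<Longrightarrow> hsnorm k p R (\<phi> n) \<le> B"
proof -
  have sm: "hsmooth (hball R) (\<phi> n)" and fin: "j \<le> k \<Longrightarrow> hint p R j (\<phi> n) < \<infinity>" for n j
    using a by (auto simp: happrox_def)
  have "\<exists>M. \<forall>m\<ge>M. \<forall>n\<ge>M. hint p R j (\<lambda>x. \<phi> m x - \<phi> n x) < ennreal 1" if "j \<le> k" for j
    using a that unfolding happrox_def by (meson zero_less_one)
  then obtain M where M: "\<And>j m n. j \<le> k \<Longrightarrow> m \<ge> M j \<Longrightarrow> n \<ge> M j \<Longrightarrow> hint p R j (\<lambda>x. \<phi> m x - \<phi> n x) < ennreal 1"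
    by metis
  define K where "K = Max (M ` {..k})"
  have K: "M j \<le> K" if "j \<le> k" for j unfolding K_def using that by (intro Max_ge) auto
  define B where "B = (\<Sum>j\<le>k. 2 powr p * (1 + enn2real (hint p R j (\<phi> K)))) powr (1 / p)"
  have "hsnorm k p R (\<phi> n) \<le> B" if n: "n \<ge> K" for n
    unfolding hsnorm_def B_def
  proof (intro powr_mono2 sum_mono sum_nonneg)
    fix j assume "j \<in> {..k}"
    then have j: "j \<le> k" by simp
    have "hint p R j (\<phi> n) \<le> ennreal (2 powr p) * (hint p R j (\<lambda>x. \<phi> n x - \<phi> K x) + hint p R j (\<phi> K))"
      using p by (intro hint_triangle sm) auto
    also have "\<dots> \<le> ennreal (2 powr p) * (ennreal 1 + ennreal (enn2real (hint p R j (\<phi> K))))"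
      using M[OF j order_trans[OF K[OF j] n] K[OF j]] fin[OF j, of K] by (intro mult_left_mono add_mono) auto
    also have "\<dots> = ennreal (2 powr p * (1 + enn2real (hint p R j (\<phi> K))))"
      by (simp add: ennreal_mult del: ennreal_1)
    finally show "enn2real (hint p R j (\<phi> n)) \<le> 2 powr p * (1 + enn2real (hint p R j (\<phi> K)))"
      by (intro enn2real_leI) auto
  qed (use p in auto)
  then show thesis by (rule that)
qed

text \<open>Every constant that competes in the infimum for \<open>hnormW\<close> bounds
  \<open>wnorm\<close> up to a factor. The infimum has to range over a nonempty set, which is why a
  tail with convergent norms is extracted.\<close>

lemma hW_imp_wW:
  fixes v :: "real \<Rightarrow> real"
  assumes p: "1 \<le> p" and u: "(\<lambda>x::real^'n::finite. v (hdist x)) \<in> hW k p R"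
  shows "v \<in> wW CARD('n) k p R"
    and "wnorm CARD('n) k p R v \<le> (2 / radK TYPE('n) powr (1 / p)) * hnormW k p R (\<lambda>x::real^'n. v (hdist x))"
proof -
  let ?u = "\<lambda>x::real^'n. v (hdist x)"
  let ?C = "2 / radK TYPE('n) powr (1 / p)"
  let ?A = "{c. \<exists>\<phi>. happrox k p R \<phi> ?u \<and> (\<lambda>n. hsnorm k p R (\<phi> n)) \<longlonglongrightarrow> c}"
  from u have m: "set_borel_measurable lborel (hball R) ?u" and "\<exists>\<phi>. happrox k p R \<phi> ?u" by (auto simp: hW_def)
  then obtain \<phi> where \<phi>: "happrox k p R \<phi> ?u" by blast
  have C: "?C > 0" using radK_pos[where 'n='n] by simp
  obtain M B where MB: "\<And>n. n \<ge> M \<Longrightarrow> hsnorm k p R (\<phi> n) \<le> B" using happrox_bounded[OF \<phi>] p by auto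
  have "happrox k p R (\<lambda>n. \<phi> (n + M)) ?u" by (rule happrox_subseq[OF \<phi>]) (simp add: strict_mono_def)
  then obtain \<psi> c where c: "happrox k p R \<psi> ?u" "(\<lambda>n. hsnorm k p R (\<psi> n)) \<longlonglongrightarrow> c"
    by (rule happrox_norm_limit[of _ _ _ _ _ B]) (use MB in auto)
  then have ne: "?A \<noteq> {}" by blast
  show "v \<in> wW CARD('n) k p R" using happrox_imp_wvalid[OF p m c] by (auto simp: wW_def)
  have bdd: "bdd_below {(\<Sum>j\<le>k. enn2real (wint CARD('n) p R (w j))) powr (1 / p) | w. wvalid CARD('n) k p R v w}"
    by (rule bdd_belowI[of _ 0]) auto
  have "wnorm CARD('n) k p R v / ?C \<le> Inf ?A"
  proof (rule cInf_greatest[OF ne])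
    fix c assume "c \<in> ?A"
    then obtain \<phi> where "happrox k p R \<phi> ?u" "(\<lambda>n. hsnorm k p R (\<phi> n)) \<longlonglongrightarrow> c" by blast
    from happrox_imp_wvalid[OF p m this] obtain w where w: "wvalid CARD('n) k p R v w"
      "(\<Sum>j\<le>k. enn2real (wint CARD('n) p R (w j))) powr (1 / p) \<le> ?C * c" by blast
    have "wnorm CARD('n) k p R v \<le> (\<Sum>j\<le>k. enn2real (wint CARD('n) p R (w j))) powr (1 / p)"
      unfolding wnorm_def using w(1) by (intro cInf_lower bdd) auto
    then show "wnorm CARD('n) k p R v / ?C \<le> c" using w(2) C by (simp only: pos_divide_le_eq mult.commute)
  qed
  then show "wnorm CARD('n) k p R v \<le> ?C * hnormW k p R ?u"
    unfolding hnormW_def using C by (simp only: pos_divide_le_eq mult.commute)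
qed

section \<open>Covariant derivatives of radial functions\<close>

text \<open>\<open>symb s\<close>: functions that are \<open>O(|x|\<^sup>-\<^sup>s)\<close> at the origin and whose derivatives lose one power each.\<close>
inductive symb :: "real \<Rightarrow> (real^'n::finite \<Rightarrow> real) \<Rightarrow> bool" where
  const: "symb 0 (\<lambda>x. c)"
| coord: "symb (-1) (\<lambda>x. x $ i)"
| conf: "symb 0 (\<lambda>x. 1 / (1 - (norm x)\<^sup>2))"
| rinv: "symb 1 (\<lambda>x. 1 / norm x)"
| add: "symb s a \<Longrightarrow> symb s b \<Longrightarrow> symb s (\<lambda>x. a x + b x)"
| mult: "symb s a \<Longrightarrow> symb t b \<Longrightarrow> symb (s + t) (\<lambda>x. a x * b x)"
| weaken: "symb s a \<Longrightarrow> s \<le> t \<Longrightarrow> symb t a"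

lemma norm_shift: "norm (x + s *\<^sub>R axis i 1) = sqrt ((norm x)\<^sup>2 + 2 * s * x $ i + s\<^sup>2)" for x :: "real^'n::finite"
  using norm_sq_shift[of x s i] by (metis norm_ge_zero real_sqrt_unique)

lemma has_pd_norm:
  fixes x :: "real^'n::finite"
  assumes "x \<noteq> 0"
  shows "has_pd norm i (x $ i * (1 / norm x)) x"
proof -
  have "(norm x)\<^sup>2 > 0" using assms by simp
  then show ?thesis unfolding norm_shift
    by (auto intro!: derivative_eq_intros simp: divide_simps)
qed

lemma has_pd_rinv:
  fixes x :: "real^'n::finite"
  assumes "x \<noteq> 0"
  shows "has_pd (\<lambda>x. 1 / norm x) i (- 1 * (x $ i * (1 / norm x * (1 / norm x * (1 / norm x))))) x"
  using assms DERIV_inverse_fun[OF has_pd_norm[OF assms, of i]]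
  by (simp add: inverse_eq_divide power2_eq_square field_simps)

lemma has_pd_hdist:
  fixes x :: "real^'n::finite"
  assumes "x \<noteq> 0" "norm x < 1"
  shows "has_pd hdist i (2 * (1 / (1 - (norm x)\<^sup>2)) * (x $ i * (1 / norm x))) x"
proof -
  have p: "0 < 1 + norm x" "0 < 1 - norm x" using assms by (auto intro: add_pos_nonneg)
  have "((\<lambda>r. ln ((1 + r) / (1 - r))) has_real_derivative 2 / (1 - (norm x)\<^sup>2)) (at (norm x))"
    using p one_minus_norm_sq_pos[OF assms(2)]
    by (auto intro!: derivative_eq_intros simp: power2_eq_square divide_simps) (simp add: algebra_simps)
  then have "((\<lambda>r. ln ((1 + r) / (1 - r))) has_real_derivative 2 / (1 - (norm x)\<^sup>2)) (at (norm (x + 0 *\<^sub>R axis i 1)))"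
    by simp
  from DERIV_chain2[OF this has_pd_norm[OF assms(1), of i]]
  show ?thesis unfolding hdist_def by simp
qed

text \<open>\<open>const\<close> gives order 0 and \<open>weaken\<close> only raises the order; for
  negative orders zero is therefore produced as a product with coordinates, each of which lowers the
  order by one.\<close>

lemma symb_zero: "symb s (\<lambda>x. 0)"
proof (cases "0 \<le> s")
  case True
  then show ?thesis using symb.weaken[OF symb.const] by blast
next
  case False
  define n where "n = nat \<lceil>- s\<rceil>"
  have "symb (- real m) (\<lambda>x::real^'n. 0)" for m
  proof (induction m)
    case (Suc m)
    from symb.mult[OF Suc symb.coord[of undefined]] show ?case by (simp add: algebra_simps)
  qed (use symb.const[of 0] in simp)
  moreover have "- real n \<le> s" unfolding n_def by linarith
  ultimately show ?thesis by (rule symb.weaken)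
qed

lemma symb_has_pd:
  fixes a :: "real^'n::finite \<Rightarrow> real"
  assumes "symb s a"
  shows "\<exists>b. symb (s + 1) b \<and> (\<forall>x. x \<noteq> 0 \<longrightarrow> norm x < 1 \<longrightarrow> has_pd a i (b x) x)"
  using assms
proof induction
  case (const c)
  show ?case by (rule exI[of _ "\<lambda>x. 0"]) (use symb_zero in auto)
next
  case (coord j)
  have "symb (- 1 + 1) (\<lambda>x::real^'n. if i = j then 1 else 0)" using symb.const[of "if i = j then 1 else 0"] by (simp only: neg_eq_iff_add_eq_0 add.left_inverse)
  then show ?case using has_pd_coord by blast
next
  case conf
  let ?q = "\<lambda>x::real^'n. 1 / (1 - (norm x)\<^sup>2)"
  have "symb (0 + (-1) + 0 + 0) (\<lambda>x. 2 * x $ i * ?q x * ?q x)"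
    by (intro symb.mult symb.const symb.coord symb.conf)
  then have "symb (0 + 1) (\<lambda>x. 2 * x $ i * ?q x * ?q x)" by (rule symb.weaken) simp
  then show ?case using has_pd_conf by blast
next
  case rinv
  have "symb (0 + (-1 + (1 + (1 + 1)))) (\<lambda>x::real^'n. - 1 * (x $ i * (1 / norm x * (1 / norm x * (1 / norm x)))))"
    by (intro symb.mult symb.const symb.coord symb.rinv)
  then have "symb (1 + 1) (\<lambda>x::real^'n. - 1 * (x $ i * (1 / norm x * (1 / norm x * (1 / norm x)))))" by simp
  then show ?case using has_pd_rinv by blast
next
  case (add s a b)
  then obtain a' b' where "symb (s + 1) a'" "\<forall>x. x \<noteq> 0 \<longrightarrow> norm x < 1 \<longrightarrow> has_pd a i (a' x) x"
     "symb (s + 1) b'" "\<forall>x. x \<noteq> 0 \<longrightarrow> norm x < 1 \<longrightarrow> has_pd b i (b' x) x" by blast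
  then show ?case by (intro exI[of _ "\<lambda>x. a' x + b' x"]) (auto intro: symb.add DERIV_add)
next
  case (mult s a t b)
  then obtain a' b' where h: "symb (s + 1) a'" "\<forall>x. x \<noteq> 0 \<longrightarrow> norm x < 1 \<longrightarrow> has_pd a i (a' x) x"
     "symb (t + 1) b'" "\<forall>x. x \<noteq> 0 \<longrightarrow> norm x < 1 \<longrightarrow> has_pd b i (b' x) x" by blast
  have "symb (s + t + 1) (\<lambda>x. a' x * b x)" "symb (s + t + 1) (\<lambda>x. b' x * a x)"
    using symb.mult[OF h(1) mult(2)] symb.mult[OF h(3) mult(1)] by (simp_all add: algebra_simps)
  then have "symb (s + t + 1) (\<lambda>x. a' x * b x + b' x * a x)" by (rule symb.add)
  moreover have "has_pd (\<lambda>x. a x * b x) i (a' x * b x + b' x * a x) x" if "x \<noteq> 0" "norm x < 1" for x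
    using DERIV_mult[of "\<lambda>s. a (x + s *\<^sub>R axis i 1)" "a' x" 0 UNIV "\<lambda>s. b (x + s *\<^sub>R axis i 1)" "b' x"] h that by simp
  ultimately show ?case by (intro exI[of _ "\<lambda>x. a' x * b x + b' x * a x"]) auto
next
  case (weaken s a t)
  then obtain b where "symb (s + 1) b" "\<forall>x. x \<noteq> 0 \<longrightarrow> norm x < 1 \<longrightarrow> has_pd a i (b x) x" by blast
  then show ?case using symb.weaken[of "s + 1" b "t + 1"] weaken by (intro exI[of _ b]) auto
qed

text \<open>A radius below 1 enters twice: it bounds the conformal factor, and there a larger order
  means a larger power of 1 / |x|, as the rule \<open>weaken\<close> demands.\<close>

lemma symb_bound:
  fixes a :: "real^'n::finite \<Rightarrow> real"
  assumes "symb s a" and \<rho>: "\<rho> < 1"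
  shows "\<exists>C\<ge>0. \<forall>x. x \<noteq> 0 \<longrightarrow> norm x \<le> \<rho> \<longrightarrow> \<bar>a x\<bar> \<le> C * norm x powr (- s)"
  using assms(1)
proof induction
  case (const c)
  show ?case by (rule exI[of _ "\<bar>c\<bar>"]) auto
next
  case (coord i)
  show ?case by (rule exI[of _ 1]) (auto simp: component_le_norm_cart)
next
  case conf
  show ?case
  proof (intro exI[of _ "1 / (1 - (max \<rho> 0)\<^sup>2)"] conjI allI impI)
    have "max \<rho> 0 < 1" using \<rho> by simp
    then have m: "(max \<rho> 0)\<^sup>2 < 1" by (simp add: abs_square_less_1)
    then show "0 \<le> 1 / (1 - (max \<rho> 0)\<^sup>2)" by simp
    fix x :: "real^'n" assume x: "x \<noteq> 0" "norm x \<le> \<rho>"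
    then have "(norm x)\<^sup>2 \<le> (max \<rho> 0)\<^sup>2" by (intro power_mono) auto
    then have "1 - (norm x)\<^sup>2 \<ge> 1 - (max \<rho> 0)\<^sup>2" "1 - (max \<rho> 0)\<^sup>2 > 0" using m by auto
    then have "1 / (1 - (norm x)\<^sup>2) \<le> 1 / (1 - (max \<rho> 0)\<^sup>2)" "0 \<le> 1 / (1 - (norm x)\<^sup>2)"
      using frac_le[of 1 1 "1 - (max \<rho> 0)\<^sup>2" "1 - (norm x)\<^sup>2"] by (simp_all only: zero_le_divide_1_iff)
    then show "\<bar>1 / (1 - (norm x)\<^sup>2)\<bar> \<le> 1 / (1 - (max \<rho> 0)\<^sup>2) * norm x powr - 0" using x by simp
  qed
next
  case rinv
  show ?case by (rule exI[of _ 1]) (auto simp: powr_minus inverse_eq_divide)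
next
  case (add s a b)
  then obtain A B where "A \<ge> 0" "B \<ge> 0" "\<forall>x. x \<noteq> 0 \<longrightarrow> norm x \<le> \<rho> \<longrightarrow> \<bar>a x\<bar> \<le> A * norm x powr (- s)"
    "\<forall>x. x \<noteq> 0 \<longrightarrow> norm x \<le> \<rho> \<longrightarrow> \<bar>b x\<bar> \<le> B * norm x powr (- s)" by blast
  then show ?case
    by (intro exI[of _ "A + B"]) (auto simp: distrib_right intro!: order_trans[OF abs_triangle_ineq] add_mono)
next
  case (mult s a t b)
  then obtain A B where h: "A \<ge> 0" "B \<ge> 0" "\<forall>x. x \<noteq> 0 \<longrightarrow> norm x \<le> \<rho> \<longrightarrow> \<bar>a x\<bar> \<le> A * norm x powr (- s)"
    "\<forall>x. x \<noteq> 0 \<longrightarrow> norm x \<le> \<rho> \<longrightarrow> \<bar>b x\<bar> \<le> B * norm x powr (- t)" by blast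
  show ?case
  proof (intro exI[of _ "A * B"] conjI allI impI)
    fix x :: "real^'n" assume x: "x \<noteq> 0" "norm x \<le> \<rho>"
    have "\<bar>a x * b x\<bar> \<le> (A * norm x powr (- s)) * (B * norm x powr (- t))"
      unfolding abs_mult using h x by (intro mult_mono) auto
    also have "\<dots> = A * B * norm x powr - (s + t)"
    proof -
      have "norm x powr - (s + t) = norm x powr (- s) * norm x powr (- t)" by (simp add: powr_add[symmetric])
      then show ?thesis by simp
    qed
    finally show "\<bar>a x * b x\<bar> \<le> A * B * norm x powr - (s + t)" .
  qed (use h in auto)
next
  case (weaken s a t)
  then obtain A where h: "A \<ge> 0" "\<forall>x. x \<noteq> 0 \<longrightarrow> norm x \<le> \<rho> \<longrightarrow> \<bar>a x\<bar> \<le> A * norm x powr (- s)" by blast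
  show ?case
  proof (intro exI[of _ A] conjI allI impI)
    fix x :: "real^'n" assume x: "x \<noteq> 0" "norm x \<le> \<rho>"
    have "norm x powr - s \<le> norm x powr - t" using x \<rho> weaken by (intro powr_mono') auto
    then show "\<bar>a x\<bar> \<le> A * norm x powr - t" using h x by (meson mult_left_mono order_trans)
  qed (use h in auto)
qed

lemma symb_hdist_pd: "symb 0 (\<lambda>x::real^'n::finite. 2 * (1 / (1 - (norm x)\<^sup>2)) * (x $ i * (1 / norm x)))"
proof -
  have "symb (0 + 0 + (- 1 + 1)) (\<lambda>x::real^'n. 2 * (1 / (1 - (norm x)\<^sup>2)) * (x $ i * (1 / norm x)))"
    by (intro symb.mult symb.const symb.coord symb.rinv symb.conf)
  then show ?thesis by simp
qed

section \<open>Smoothness of radial functions\<close>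

lemma hdist_in_ivl: "x \<in> hball R - {0} \<Longrightarrow> hdist x \<in> ivl R"
  by (auto simp: hball_def ivl_def hdist_pos)

lemma has_pd_radial:
  fixes x :: "real^'n::finite"
  assumes f: "smooth_fam (ivl R) f" and x: "x \<in> hball R - {0}"
  shows "has_pd (\<lambda>x. f j (hdist x)) i (f (Suc j) (hdist x) * (2 * (1 / (1 - (norm x)\<^sup>2)) * (x $ i * (1 / norm x)))) x"
proof -
  have "(f j has_real_derivative f (Suc j) (hdist x)) (at (hdist (x + 0 *\<^sub>R axis i 1)))"
    using smooth_famD[OF f hdist_in_ivl[OF x]] by simp
  from DERIV_chain2[OF this has_pd_hdist[of x i]] x show ?thesis by (auto simp: hball_def)
qed

lemma open_punctured_hball: "open (hball R - {0})"
  by (intro open_Diff open_hball) simp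

text \<open>The generators are the conformal factor, 1 / |x|, the coordinates and all members of the
  family composed with the distance; their partial derivatives are polynomials in them.\<close>

lemma hsmooth_radial_punctured:
  assumes f: "smooth_fam (ivl R) f"
  shows "hsmooth (hball R - {0}) (\<lambda>x::real^'n::finite. f 0 (hdist x))"
proof -
  let ?S = "hball R - {0} :: (real^'n) set"
  let ?q = "\<lambda>x::real^'n. 1 / (1 - (norm x)\<^sup>2)"
  let ?r = "\<lambda>x::real^'n. 1 / norm x"
  define B where "B = insert ?q (insert ?r (range (\<lambda>j x. x $ j) \<union> range (\<lambda>i x. f i (hdist x))))"
  have qB: "?q \<in> galg B" "?r \<in> galg B" "(\<lambda>x. x $ j) \<in> galg B" "(\<lambda>x. f m (hdist x)) \<in> galg B" for j m
    by (rule galg.base; simp add: B_def)+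
  have n1: "norm x < 1" "x \<noteq> 0" if "x \<in> ?S" for x using that by (auto simp: hball_def)
  show ?thesis
  proof (rule galg_hsmooth[OF open_punctured_hball, of B])
    fix b i assume "b \<in> B"
    then consider "b = ?q" | "b = ?r" | j where "b = (\<lambda>x. x $ j)" | j where "b = (\<lambda>x. f j (hdist x))"
      unfolding B_def by auto
    then show "\<exists>g\<in>galg B. \<forall>x\<in>?S. has_pd b i (g x) x"
    proof cases
      case 1
      show ?thesis unfolding 1
        by (rule bexI[of _ "\<lambda>x. 2 * x $ i * ?q x * ?q x"], intro ballI has_pd_conf n1, assumption, intro galg.mult galg.const qB)
    next
      case 2
      show ?thesis unfolding 2
        by (rule bexI[of _ "\<lambda>x. - 1 * (x $ i * (?r x * (?r x * ?r x)))"], intro ballI has_pd_rinv n1, assumption, intro galg.mult galg.const qB)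
    next
      case (3 j)
      show ?thesis unfolding 3
        by (rule bexI[OF _ galg.const[of "if i = j then 1 else 0"]]) (intro ballI has_pd_coord)
    next
      case (4 j)
      show ?thesis unfolding 4
        by (rule bexI[of _ "\<lambda>x. f (Suc j) (hdist x) * (2 * ?q x * (x $ i * ?r x))"], rule ballI, rule has_pd_radial[OF f], assumption, intro galg.mult galg.const qB)
    qed
  next
    fix b assume "b \<in> B"
    then consider "b = ?q" | "b = ?r" | j where "b = (\<lambda>x. x $ j)" | j where "b = (\<lambda>x. f j (hdist x))"
      unfolding B_def by auto
    then show "continuous_on ?S b"
    proof cases
      case 1
      have "1 - (norm x)\<^sup>2 \<noteq> 0" if "x \<in> ?S" for x using one_minus_norm_sq_pos[OF n1(1)[OF that]] by simp
      then show ?thesis unfolding 1 by (intro continuous_intros) auto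
    next
      case (4 j)
      show ?thesis unfolding 4
        by (rule continuous_on_compose2[OF smooth_fam_continuous[OF f] continuous_on_subset[OF continuous_on_hdist]])
          (use hdist_in_ivl hball_subset in auto)
    qed (auto intro!: continuous_intros)
  qed (rule qB)
qed

lemma hsmooth_Un:
  assumes "open S" "open T" "hsmooth S f" "hsmooth T f"
  shows "hsmooth (S \<union> T) f"
  using assms unfolding hsmooth_def by (auto intro: continuous_on_open_Un)

text \<open>Constancy near the origin removes the only singular point of the distance, and
  smoothness is glued from a neighbourhood of the origin and the punctured ball.\<close>

lemma hsmooth_radial:
  assumes f: "smooth_fam (ivl R) f" and \<delta>: "\<delta> > 0" and c: "\<And>t. t < \<delta> \<Longrightarrow> f 0 t = c"
  shows "hsmooth (hball R) (\<lambda>x::real^'n::finite. f 0 (hdist x))"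
proof -
  let ?U = "hball (ereal \<delta>) :: (real^'n) set"
  have "hsmooth ?U (\<lambda>x. f 0 (hdist x))"
    by (rule hsmooth_cong[OF open_hball _ hsmooth_const[OF open_hball, of _ c]]) (auto simp: hball_def c)
  from hsmooth_Un[OF open_hball open_punctured_hball this hsmooth_radial_punctured[OF f]]
  have "hsmooth (?U \<union> (hball R - {0})) (\<lambda>x. f 0 (hdist x))" .
  moreover have "0 \<in> ?U" using \<delta> by (simp add: hball_def hdist_def)
  ultimately show ?thesis by (elim hsmooth_subset) auto
qed

text \<open>Expressions of the kind found in covariant derivatives of order \<open>J\<close>, taken
  as functions of the profile so that later constants are uniform in it. The restriction
  \<open>1 \<le> i\<close> excludes the undifferentiated profile and thereby limits the order of the
  singular coefficients to \<open>J - 1\<close>.\<close>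

inductive rexp :: "nat \<Rightarrow> ((nat \<Rightarrow> real \<Rightarrow> real) \<Rightarrow> real^'n::finite \<Rightarrow> real) \<Rightarrow> bool" for J where
  single: "1 \<le> i \<Longrightarrow> i \<le> J \<Longrightarrow> symb (real J - real i) a \<Longrightarrow> rexp J (\<lambda>f x. f i (hdist x) * a x)"
| zero: "rexp J (\<lambda>f x. 0)"
| add: "rexp J G \<Longrightarrow> rexp J H \<Longrightarrow> rexp J (\<lambda>f x. G f x + H f x)"

lemma rexp_sum: "(\<And>i. i \<in> I \<Longrightarrow> rexp J (G i)) \<Longrightarrow> rexp J (\<lambda>f x. \<Sum>i\<in>I. G i f x)"
  by (induction I rule: infinite_finite_induct) (auto intro: rexp.intros)

lemma rexp_mult:
  assumes "rexp J G" "symb s b" "s \<le> 1"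
  shows "rexp (Suc J) (\<lambda>f x. b x * G f x)"
  using assms(1)
proof induction
  case (single i a)
  have "symb (s + (real J - real i)) (\<lambda>x. b x * a x)" by (rule symb.mult[OF assms(2) single(3)])
  then have "symb (real (Suc J) - real i) (\<lambda>x. b x * a x)" by (rule symb.weaken) (use assms in simp)
  from rexp.single[OF single(1) _ this] single(2) show ?case by (simp add: mult_ac)
qed (auto simp: distrib_left intro: rexp.intros)

text \<open>A derivative either falls on the profile, raising i with a coefficient of order 0, or on
  the coefficient, raising its order by one; the difference \<open>J - i\<close> accounts for
  both.\<close>

lemma rexp_has_pd:
  assumes "rexp J G"
  shows "\<exists>H. rexp (Suc J) H \<and> (\<forall>f R. smooth_fam (ivl R) f \<longrightarrow> (\<forall>x\<in>hball R - {0}. has_pd (G f) m (H f x) x))"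
  using assms
proof induction
  case (single i a)
  let ?e = "\<lambda>x::real^'a. 2 * (1 / (1 - (norm x)\<^sup>2)) * (x $ m * (1 / norm x))"
  obtain b where b: "symb (real J - real i + 1) b" "\<forall>x. x \<noteq> 0 \<longrightarrow> norm x < 1 \<longrightarrow> has_pd a m (b x) x"
    using symb_has_pd[OF single(3)] by blast
  have "symb (0 + (real J - real i)) (\<lambda>x. ?e x * a x)" by (rule symb.mult[OF symb_hdist_pd single(3)])
  then have "rexp (Suc J) (\<lambda>f x. f (Suc i) (hdist x) * (?e x * a x))" by (intro rexp.single) (use single in auto)
  moreover have "rexp (Suc J) (\<lambda>f x. f i (hdist x) * b x)" using b by (intro rexp.single) (use single in \<open>auto simp: algebra_simps\<close>)
  ultimately have "rexp (Suc J) (\<lambda>f x. f (Suc i) (hdist x) * (?e x * a x) + f i (hdist x) * b x)" by (rule rexp.add)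
  moreover have "has_pd (\<lambda>x. f i (hdist x) * a x) m (f (Suc i) (hdist x) * (?e x * a x) + f i (hdist x) * b x) x"
    if f: "smooth_fam (ivl R) f" and x: "x \<in> hball R - {0}" for f R x
  proof -
    have "has_pd a m (b x) x" using x b by (auto simp: hball_def)
    from DERIV_mult[OF has_pd_radial[OF f x, of i m] this] show ?thesis by (simp add: algebra_simps)
  qed
  ultimately show ?case by (intro exI[of _ "\<lambda>f x. f (Suc i) (hdist x) * (?e x * a x) + f i (hdist x) * b x"]) auto
next
  case zero
  show ?case by (intro exI[of _ "\<lambda>f x. 0"]) (auto intro: rexp.intros)
next
  case (add G H)
  then obtain G' H' where "rexp (Suc J) G'" "rexp (Suc J) H'"
    "\<forall>f R. smooth_fam (ivl R) f \<longrightarrow> (\<forall>x\<in>hball R - {0}. has_pd (G f) m (G' f x) x)"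
    "\<forall>f R. smooth_fam (ivl R) f \<longrightarrow> (\<forall>x\<in>hball R - {0}. has_pd (H f) m (H' f x) x)" by blast
  then show ?case by (intro exI[of _ "\<lambda>f x. G' f x + H' f x"]) (auto intro!: rexp.intros DERIV_add)
qed

lemma symb_chr: "symb 1 (chr s a b)"
proof -
  have d: "symb 1 (dlog i)" for i :: 'a
  proof -
    have "symb (0 + -1 + 0) (dlog i)" unfolding dlog_eq by (intro symb.mult symb.const symb.coord symb.conf)
    then show ?thesis by (rule symb.weaken) simp
  qed
  have m: "symb 1 (\<lambda>x. c * dlog i x)" for c and i :: 'a using symb.mult[OF symb.const[of c] d[of i]] by simp
  have eq: "chr s a b = (\<lambda>x. ((if a = s then 1 else 0) * dlog b x + (if b = s then 1 else 0) * dlog a x)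
     + (if a = b then - 1 else 0) * dlog s x)"
    by (auto simp: chr_def fun_eq_iff)
  show ?thesis unfolding eq by (intro symb.add m)
qed

text \<open>Strong induction on the length: the Christoffel symbols have order 1, just the loss that
  one further derivative is allowed, and they multiply covariant derivatives whose index lists are
  as long as the tail.\<close>

lemma cov_radial_rexp:
  fixes "is" :: "'n::finite list"
  assumes "is \<noteq> []"
  shows "\<exists>G. rexp (length is) G \<and> (\<forall>f R. smooth_fam (ivl R) f \<longrightarrow>
     (\<forall>x\<in>hball R - {0}. cov (\<lambda>x. f 0 (hdist x)) is x = G f x))"
  using assms
proof (induction "length is" arbitrary: "is" rule: less_induct)
  case less
  then obtain m js where js: "is = m # js" by (cases "is") auto
  show ?case
  \<comment> \<open>The first derivative is treated directly: it has no Christoffel terms, and the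
    undifferentiated profile below it is not of the form \<open>rexp\<close>.\<close>
  proof (cases "js = []")
    case True
    let ?e = "\<lambda>x::real^'n. 2 * (1 / (1 - (norm x)\<^sup>2)) * (x $ m * (1 / norm x))"
    have "rexp (Suc 0) (\<lambda>f x. f (Suc 0) (hdist x) * ?e x)" by (rule rexp.single) (use symb_hdist_pd in auto)
    moreover have "cov (\<lambda>x. f 0 (hdist x)) is x = f (Suc 0) (hdist x) * ?e x"
      if f: "smooth_fam (ivl R) f" and x: "x \<in> hball R - {0}" for f R x
    proof -
      have "cov (\<lambda>x. f 0 (hdist x)) [] = (\<lambda>x::real^'n. f 0 (hdist x))" by (rule ext) simp
      then show ?thesis using has_pd_imp_pd[OF has_pd_radial[OF f x, of 0 m]] by (simp add: js True)
    qed
    ultimately show ?thesis unfolding js True by (intro exI[of _ "\<lambda>f x. f (Suc 0) (hdist x) * ?e x"]) (auto simp: js True)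
  next
    case False
    have "\<exists>G. \<forall>ks::'n list. ks \<noteq> [] \<and> length ks = length js \<longrightarrow> rexp (length ks) (G ks) \<and> (\<forall>f R. smooth_fam (ivl R) f \<longrightarrow>
     (\<forall>x\<in>hball R - {0}. cov (\<lambda>x. f 0 (hdist x)) ks x = G ks f x))"
    proof (rule choice, rule allI)
      fix ks :: "'n list"
      show "\<exists>G. ks \<noteq> [] \<and> length ks = length js \<longrightarrow> rexp (length ks) G \<and> (\<forall>f R. smooth_fam (ivl R) f \<longrightarrow>
         (\<forall>x\<in>hball R - {0}. cov (\<lambda>x. f 0 (hdist x)) ks x = G f x))"
      proof (cases "ks \<noteq> [] \<and> length ks = length js")
        case True
        then have "length ks < length is" using js by simp
        from less.hyps[OF this] True show ?thesis by blast
      qed blast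
    qed
    then obtain G where G: "\<And>ks::'n list. ks \<noteq> [] \<Longrightarrow> length ks = length js \<Longrightarrow> rexp (length js) (G ks)"
      "\<And>(ks::'n list) f R x. ks \<noteq> [] \<Longrightarrow> length ks = length js \<Longrightarrow> smooth_fam (ivl R) f \<Longrightarrow> x\<in>hball R - {0} \<Longrightarrow> cov (\<lambda>x. f 0 (hdist x)) ks x = G ks f x"
      by metis
    obtain H where H: "rexp (Suc (length js)) H" "\<And>f R x. smooth_fam (ivl R) f \<Longrightarrow> x\<in>hball R - {0} \<Longrightarrow> has_pd (G js f) m (H f x) x"
      using rexp_has_pd[OF G(1)[OF False refl]] by blast
    have up: "js[l := s] \<noteq> []" "length (js[l := s]) = length js" for l s using False by auto
    let ?K = "\<lambda>f x. H f x + (\<Sum>l<length js. \<Sum>s\<in>UNIV. (- 1 * chr s m (js ! l) x) * G (js[l := s]) f x)"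
    have s1: "symb 1 (\<lambda>x. - 1 * chr s m (js ! l) x)" for s l using symb.mult[OF symb.const[of "-1"] symb_chr] by simp
    have "rexp (Suc (length js)) ?K"
      by (intro rexp.add H rexp_sum rexp_mult[OF _ s1] G up order_refl)
    moreover have "cov (\<lambda>x. f 0 (hdist x)) is x = ?K f x" if f: "smooth_fam (ivl R) f" and x: "x \<in> hball R - {0}" for f R x
    proof -
      have "pd m (cov (\<lambda>x. f 0 (hdist x)) js) x = pd m (G js f) x"
        by (rule pd_cong[OF open_punctured_hball x]) (rule G(2)[OF False refl f])
      also have "\<dots> = H f x" by (rule has_pd_imp_pd[OF H(2)[OF f x]])
      finally show ?thesis using G(2)[OF up f x] by (simp add: js sum_negf)
    qed
    ultimately show ?thesis by (intro exI[of _ ?K]) (auto simp: js simp del: cov.simps)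
  qed
qed

lemma rexp_bound:
  assumes "rexp J G" and \<rho>: "\<rho> < 1"
  shows "\<exists>C\<ge>0. \<forall>f x. x \<noteq> 0 \<longrightarrow> norm x \<le> \<rho> \<longrightarrow> \<bar>G f x\<bar> \<le> C * (\<Sum>i=1..J. \<bar>f i (hdist x)\<bar> * norm x powr (- (real J - real i)))"
  using assms(1)
proof induction
  case (single i a)
  obtain C where C: "C \<ge> 0" "\<forall>x. x \<noteq> 0 \<longrightarrow> norm x \<le> \<rho> \<longrightarrow> \<bar>a x\<bar> \<le> C * norm x powr (- (real J - real i))"
    using symb_bound[OF single(3) \<rho>] by blast
  have "\<bar>f i (hdist x) * a x\<bar> \<le> C * (\<Sum>i=1..J. \<bar>f i (hdist x)\<bar> * norm x powr (- (real J - real i)))"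
    if x: "x \<noteq> 0" "norm x \<le> \<rho>" for f x
  proof -
    have "\<bar>f i (hdist x) * a x\<bar> \<le> C * (\<bar>f i (hdist x)\<bar> * norm x powr (- (real J - real i)))"
      using mult_left_mono[OF C(2)[rule_format, OF x], of "\<bar>f i (hdist x)\<bar>"] by (simp add: abs_mult mult_ac)
    also have "\<dots> \<le> C * (\<Sum>i=1..J. \<bar>f i (hdist x)\<bar> * norm x powr (- (real J - real i)))"
      using C(1) single by (intro mult_left_mono member_le_sum[of i "{1..J}" "\<lambda>i. \<bar>f i (hdist x)\<bar> * norm x powr (- (real J - real i))"]) auto
    finally show ?thesis .
  qed
  then show ?case using C(1) by blast
next
  case zero
  show ?case by (rule exI[of _ 0]) auto
next
  case (add G H)
  then obtain A B where "A \<ge> 0" "B \<ge> 0" "\<forall>f x. x \<noteq> 0 \<longrightarrow> norm x \<le> \<rho> \<longrightarrow> \<bar>G f x\<bar> \<le> A * (\<Sum>i=1..J. \<bar>f i (hdist x)\<bar> * norm x powr (- (real J - real i)))"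
    "\<forall>f x. x \<noteq> 0 \<longrightarrow> norm x \<le> \<rho> \<longrightarrow> \<bar>H f x\<bar> \<le> B * (\<Sum>i=1..J. \<bar>f i (hdist x)\<bar> * norm x powr (- (real J - real i)))" by blast
  then show ?case
    by (intro exI[of _ "A + B"]) (auto simp only: distrib_right intro!: add_nonneg_nonneg order_trans[OF abs_triangle_ineq] add_mono)
qed

text \<open>The constant collects the finitely many index lists and is uniform in the profile and in
  \<open>R\<close>. The factor \<open>lam x powr (- real j)\<close> is simply bounded by
  one.\<close>

lemma gnorm_radial_bound:
  assumes \<rho>: "\<rho> < 1" and j: "1 \<le> j"
  shows "\<exists>C\<ge>0. \<forall>f R. smooth_fam (ivl R) f \<longrightarrow> (\<forall>x::real^'n::finite. x \<in> hball R - {0} \<longrightarrow> norm x \<le> \<rho> \<longrightarrow>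
    gnorm j (\<lambda>x. f 0 (hdist x)) x \<le> C * (\<Sum>i=1..j. \<bar>f i (hdist x)\<bar> * norm x powr (- (real j - real i))))"
proof -
  let ?L = "{is::'n list. length is = j}"
  define Q where "Q is C \<longleftrightarrow> 0 \<le> C \<and> (\<forall>f R. smooth_fam (ivl R) f \<longrightarrow> (\<forall>x. x \<in> hball R - {0} \<longrightarrow> norm x \<le> \<rho> \<longrightarrow>
    \<bar>cov (\<lambda>x. f 0 (hdist x)) is x\<bar> \<le> C * (\<Sum>i=1..j. \<bar>f i (hdist x)\<bar> * norm x powr (- (real j - real i)))))"
    for "is" :: "'n list" and C
  have "\<forall>is\<in>?L. \<exists>C. Q is C"
  proof
    fix "is" :: "'n list" assume "is \<in> ?L"
    then have l: "length is = j" "is \<noteq> []" using j by auto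
    from cov_radial_rexp[OF l(2)] obtain G where G: "rexp j G" "\<And>f R x. smooth_fam (ivl R) f \<Longrightarrow> x \<in> hball R - {0} \<Longrightarrow> cov (\<lambda>x. f 0 (hdist x)) is x = G f x"
      unfolding l(1) by blast
    from rexp_bound[OF G(1) \<rho>] obtain C where C: "C \<ge> 0" "\<And>f x. x \<noteq> 0 \<Longrightarrow> norm x \<le> \<rho> \<Longrightarrow>
      \<bar>G f x\<bar> \<le> C * (\<Sum>i=1..j. \<bar>f i (hdist x)\<bar> * norm x powr (- (real j - real i)))" by blast
    have "Q is C" unfolding Q_def
    proof (intro conjI allI impI C(1))
      fix f R and x :: "real^'n" assume h: "smooth_fam (ivl R) f" "x \<in> hball R - {0}" "norm x \<le> \<rho>"
      show "\<bar>cov (\<lambda>x. f 0 (hdist x)) is x\<bar> \<le> C * (\<Sum>i=1..j. \<bar>f i (hdist x)\<bar> * norm x powr (- (real j - real i)))"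
        unfolding G(2)[OF h(1,2)] by (rule C(2)) (use h in auto)
    qed
    then show "\<exists>C. Q is C" ..
  qed
  from bchoice[OF this] obtain C where QC: "\<And>is. is \<in> ?L \<Longrightarrow> Q is (C is)" by blast
  have C0: "C is \<ge> 0" if "is \<in> ?L" for "is" using QC[OF that] unfolding Q_def by simp
  have C: "\<bar>cov (\<lambda>x. f 0 (hdist x)) is x\<bar> \<le> C is * (\<Sum>i=1..j. \<bar>f i (hdist x)\<bar> * norm x powr (- (real j - real i)))"
    if "is \<in> ?L" "smooth_fam (ivl R) f" "x \<in> hball R - {0}" "norm x \<le> \<rho>" for "is" f R x
    using QC[OF that(1)] that(2-4) unfolding Q_def by simp
  show ?thesis
  proof (intro exI[of _ "\<Sum>is\<in>?L. C is"] conjI allI impI)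
    show "0 \<le> (\<Sum>is\<in>?L. C is)" using C0 by (intro sum_nonneg)
    fix f R and x :: "real^'n" assume f: "smooth_fam (ivl R) f" and x: "x \<in> hball R - {0}" "norm x \<le> \<rho>"
    let ?S = "\<Sum>i=1..j. \<bar>f i (hdist x)\<bar> * norm x powr (- (real j - real i))"
    have "gnorm j (\<lambda>x. f 0 (hdist x)) x = lam x powr (- real j) * L2_set (\<lambda>is. cov (\<lambda>x. f 0 (hdist x)) is x) ?L"
      by (simp add: gnorm_def L2_set_def)
    also have "\<dots> \<le> 1 * L2_set (\<lambda>is. cov (\<lambda>x. f 0 (hdist x)) is x) ?L"
    proof (rule mult_right_mono)
      have "2 \<le> lam x" using x by (intro lam_ge_2) (auto simp: hball_def)
      then show "lam x powr (- real j) \<le> 1" using powr_mono[of "- real j" 0 "lam x"] by simp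
    qed simp
    also have "1 * L2_set (\<lambda>is. cov (\<lambda>x. f 0 (hdist x)) is x) ?L \<le> (\<Sum>is\<in>?L. \<bar>cov (\<lambda>x. f 0 (hdist x)) is x\<bar>)"
      using L2_set_le_sum_abs by simp
    also have "\<dots> \<le> (\<Sum>is\<in>?L. C is * ?S)" using C[OF _ f x] by (intro sum_mono) auto
    also have "\<dots> = (\<Sum>is\<in>?L. C is) * ?S" by (simp add: sum_distrib_right)
    finally show "gnorm j (\<lambda>x. f 0 (hdist x)) x \<le> (\<Sum>is\<in>?L. C is) * ?S" .
  qed
qed

lemma gnorm_0: "norm x < 1 \<Longrightarrow> gnorm 0 u x = \<bar>u x\<bar>"
  using lam_pos[of x] by (simp add: gnorm_def)

text \<open>An equality, because the distance function has a g-gradient of length one. With no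
  constant and no restriction to a smaller ball it also serves infinite \<open>R\<close>.\<close>

lemma gnorm_1_radial:
  fixes x :: "real^'n::finite"
  assumes f: "smooth_fam (ivl R) f" and x: "x \<in> hball R - {0}"
  shows "gnorm 1 (\<lambda>x. f 0 (hdist x)) x = \<bar>f 1 (hdist x)\<bar>"
proof -
  let ?e = "\<lambda>m. 2 * (1 / (1 - (norm x)\<^sup>2)) * (x $ m * (1 / norm x))"
  have n: "norm x < 1" "x \<noteq> 0" using x by (auto simp: hball_def)
  have c0: "cov (\<lambda>x. f 0 (hdist x)) [] = (\<lambda>x::real^'n. f 0 (hdist x))" by (rule ext) simp
  have c: "cov (\<lambda>x. f 0 (hdist x)) [m] x = f 1 (hdist x) * (lam x * (x $ m / norm x))" for m
    using has_pd_imp_pd[OF has_pd_radial[OF f x, of 0 m]] by (simp add: c0 lam_def)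
  have nx: "(\<Sum>m\<in>UNIV. (x $ m)\<^sup>2) = (norm x)\<^sup>2" by (simp add: norm_vec_def L2_set_def sum_nonneg)
  have "(\<Sum>is | length is = Suc 0. (cov (\<lambda>x. f 0 (hdist x)) is x)\<^sup>2) = (\<Sum>m\<in>UNIV. (cov (\<lambda>x. f 0 (hdist x)) [m] x)\<^sup>2)"
    unfolding sum_lists_Suc by simp
  also have "\<dots> = (f 1 (hdist x))\<^sup>2 * (lam x)\<^sup>2 / (norm x)\<^sup>2 * (\<Sum>m\<in>UNIV. (x $ m)\<^sup>2)"
    unfolding c sum_distrib_left by (intro sum.cong) (auto simp: power_mult_distrib power_divide)
  also have "\<dots> = (f 1 (hdist x) * lam x)\<^sup>2" using n by (simp add: nx power_mult_distrib)
  finally show ?thesis using lam_pos[OF n(1)] unfolding gnorm_def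
    by (simp add: abs_mult powr_minus)
qed

section \<open>Weighted Hardy inequality\<close>

lemma nn_integral_Icc_continuous:
  fixes F :: "real \<Rightarrow> real"
  assumes c: "continuous_on {a..b} F" and n: "\<And>t. t \<in> {a..b} \<Longrightarrow> 0 \<le> F t"
  shows "(\<integral>\<^sup>+t\<in>{a..b}. ennreal (F t) \<partial>lborel) = ennreal (integral {a..b} F)"
proof -
  have i: "set_integrable lborel {a..b} F" by (rule borel_integrable_atLeastAtMost'[OF c])
  have "(\<integral>\<^sup>+t\<in>{a..b}. ennreal (F t) \<partial>lborel) = (\<integral>\<^sup>+t. ennreal (indicator {a..b} t *\<^sub>R F t) \<partial>lborel)"
    by (intro nn_integral_cong) (auto simp: indicator_def)
  also have "\<dots> = ennreal (LINT t:{a..b}|lborel. F t)"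
    using i unfolding set_integrable_def set_lebesgue_integral_def
    by (intro nn_integral_eq_integral) (auto simp: indicator_def n)
  also have "(LINT t:{a..b}|lborel. F t) = integral {a..b} F" by (rule set_borel_integral_eq_integral(2)[OF i])
  finally show ?thesis .
qed

text \<open>A case distinction suffices: either \<open>p * Y\<close> is at most
  \<open>\<kappa> * X\<close> and the first term dominates, or \<open>X\<close> is at most
  \<open>(p / \<kappa>) * Y\<close> and the second does.\<close>

lemma powr_Young:
  fixes X Y p \<kappa> :: real
  assumes p: "1 \<le> p" and \<kappa>: "0 < \<kappa>" and "0 < X" "0 \<le> Y"
  shows "p * X powr (p - 1) * Y \<le> \<kappa> * X powr p + p * (p / \<kappa>) powr (p - 1) * Y powr p"
proof (cases "p * Y \<le> \<kappa> * X")
  case True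
  have "p * X powr (p - 1) * Y = X powr (p - 1) * (p * Y)" by simp
  also have "\<dots> \<le> X powr (p - 1) * (\<kappa> * X)" using True by (intro mult_left_mono) auto
  also have "\<dots> = \<kappa> * X powr p" using powr_mult_base[of X "p - 1"] assms by (simp add: mult_ac)
  also have "\<dots> \<le> \<kappa> * X powr p + p * (p / \<kappa>) powr (p - 1) * Y powr p" using assms by simp
  finally show ?thesis .
next
  case False
  then have Y: "Y > 0" using assms by (cases "Y = 0") auto
  have X: "X \<le> (p / \<kappa>) * Y" using False \<kappa> by (simp add: field_simps)
  have "p * X powr (p - 1) * Y \<le> p * ((p / \<kappa>) * Y) powr (p - 1) * Y"
    using X assms by (intro mult_right_mono mult_left_mono powr_mono2) auto
  also have "\<dots> = p * (p / \<kappa>) powr (p - 1) * Y powr p"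
    using powr_mult_base[of Y "p - 1"] assms Y by (simp add: powr_mult powr_divide mult_ac)
  also have "\<dots> \<le> \<kappa> * X powr p + p * (p / \<kappa>) powr (p - 1) * Y powr p" using assms by simp
  finally show ?thesis .
qed

text \<open>\<open>E t\<close> is the integral of e from t to b. In the integrated derivative of
  \<open>t powr \<alpha> * E t powr p\<close> the term at b vanishes, the term at a has the
  favourable sign, and half of the main term is absorbed by \<open>powr_Young\<close> with
  \<open>\<kappa> = \<alpha> / 2\<close>. The constant does not depend on a or b.\<close>

lemma hardy_tail_integral:
  fixes e :: "real \<Rightarrow> real"
  assumes p: "1 \<le> p" and \<alpha>: "0 < \<alpha>" and ab: "0 < a" "a \<le> b"
    and e: "continuous_on {a..b} e" "\<And>t. t \<in> {a..b} \<Longrightarrow> 0 \<le> e t"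
  defines "E \<equiv> \<lambda>t. integral {a..b} e - integral {a..t} e"
  shows "\<alpha> / 2 * integral {a..b} (\<lambda>t. t powr (\<alpha> - 1) * E t powr p)
     \<le> p * (p / (\<alpha> / 2)) powr (p - 1) * integral {a..b} (\<lambda>t. t powr (\<alpha> - 1 + p) * e t powr p)"
proof -
  let ?w = "\<lambda>E t. t powr (\<alpha> - 1) * E t powr p" and ?v = "\<lambda>t. t powr (\<alpha> - 1 + p) * e t powr p"
  define D where "D = p * (p / (\<alpha> / 2)) powr (p - 1)"
  have dE: "(E has_real_derivative - e t) (at t within {a..b})" if "t \<in> {a..b}" for t
    unfolding E_def using integral_has_real_derivative[OF e(1) that] by (auto intro!: derivative_eq_intros)
  have cE: "continuous_on {a..b} E" by (rule DERIV_continuous_on[OF dE])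
  have Eb: "E b = 0" by (simp add: E_def)
  have E0: "0 \<le> E t" if t: "t \<in> {a..b}" for t
  proof -
    have "integral {a..t} e + integral {t..b} e = integral {a..b} e"
      using t by (intro Henstock_Kurzweil_Integration.integral_combine integrable_continuous_real e(1)) auto
    moreover have "0 \<le> integral {t..b} e"
      using t by (intro Henstock_Kurzweil_Integration.integral_nonneg integrable_continuous_real continuous_on_subset[OF e(1)] e(2)) auto
    ultimately show ?thesis by (simp add: E_def)
  qed
  have pos: "t > 0" if "t \<in> {a..b}" for t using that ab by auto
  have cp: "continuous_on {a..b} (\<lambda>t. t powr q)" for q
    using ab by (intro continuous_intros) auto
  have ce: "continuous_on {a..b} (\<lambda>t. e t powr p)"
    using p e by (intro continuous_on_powr' continuous_intros) auto
  have main: "\<alpha> / 2 * integral {a..b} (?w E)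
     \<le> b powr \<alpha> * \<epsilon> powr p + D * integral {a..b} ?v" if \<epsilon>: "\<epsilon> > 0" for \<epsilon>
  proof -
    \<comment> \<open>The shift by \<epsilon> keeps the base positive, so that the power is
      differentiable; \<epsilon> tends to 0 at the end.\<close>
    define X where "X t = E t + \<epsilon>" for t
    have X: "X t > 0" if "t \<in> {a..b}" for t using E0[OF that] \<epsilon> by (simp add: X_def)
    have cX: "continuous_on {a..b} (\<lambda>t. X t powr q)" for q
      using X cE unfolding X_def by (intro continuous_intros) force+
    let ?H' = "\<lambda>t. \<alpha> * (t powr (\<alpha> - 1) * X t powr p) - t powr \<alpha> * (p * X t powr (p - 1) * e t)"
    have "(?H' has_integral (b powr \<alpha> * X b powr p - a powr \<alpha> * X a powr p)) {a..b}"
    proof (rule fundamental_theorem_of_calculus[OF ab(2)])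
      fix t assume t: "t \<in> {a..b}"
      have dX: "(X has_real_derivative - e t) (at t within {a..b})"
        unfolding X_def using dE[OF t] by (auto intro!: derivative_eq_intros)
      have d1: "((\<lambda>t. X t powr p) has_real_derivative p * X t powr (p - 1) * (- e t)) (at t within {a..b})"
        by (rule DERIV_chain2[OF has_real_derivative_powr[OF X[OF t]] dX])
      have d2: "((\<lambda>t. t powr \<alpha>) has_real_derivative \<alpha> * t powr (\<alpha> - 1)) (at t within {a..b})"
        by (rule has_field_derivative_at_within, rule has_real_derivative_powr) (rule pos[OF t])
      show "((\<lambda>t. t powr \<alpha> * X t powr p) has_vector_derivative ?H' t) (at t within {a..b})"
        unfolding has_real_derivative_iff_has_vector_derivative[symmetric]
        using DERIV_mult[OF d2 d1] by (simp add: algebra_simps)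
    qed
    then have H': "integral {a..b} ?H' = b powr \<alpha> * X b powr p - a powr \<alpha> * X a powr p" by (rule integral_unique)
    have i1: "(?w X) integrable_on {a..b}"
      by (intro integrable_continuous_real continuous_intros cp cX)
    have i1': "(\<lambda>t. c * (t powr (\<alpha> - 1) * X t powr p)) integrable_on {a..b}" for c
      by (intro integrable_continuous_real continuous_intros cp cX)
    have i2: "(\<lambda>t. t powr \<alpha> * (p * X t powr (p - 1) * e t)) integrable_on {a..b}"
      by (intro integrable_continuous_real continuous_intros cp cX e)
    have i3': "(\<lambda>t. c * (t powr (\<alpha> - 1 + p) * e t powr p)) integrable_on {a..b}" for c
      by (intro integrable_continuous_real continuous_intros cp ce)
    have "\<alpha> * integral {a..b} (?w X) - integral {a..b} (\<lambda>t. t powr \<alpha> * (p * X t powr (p - 1) * e t))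
      = integral {a..b} ?H'"
      using Henstock_Kurzweil_Integration.integral_diff[OF i1' i2] by simp
    also have "\<dots> \<le> b powr \<alpha> * \<epsilon> powr p" unfolding H' by (simp add: X_def Eb)
    finally have 1: "\<alpha> * integral {a..b} (?w X) \<le> b powr \<alpha> * \<epsilon> powr p + integral {a..b} (\<lambda>t. t powr \<alpha> * (p * X t powr (p - 1) * e t))"
      by simp
    have "integral {a..b} (\<lambda>t. t powr \<alpha> * (p * X t powr (p - 1) * e t))
      \<le> integral {a..b} (\<lambda>t. \<alpha> / 2 * (t powr (\<alpha> - 1) * X t powr p) + D * (t powr (\<alpha> - 1 + p) * e t powr p))"
    proof (rule integral_le[OF i2])
      show "(\<lambda>t. \<alpha> / 2 * (t powr (\<alpha> - 1) * X t powr p) + D * (t powr (\<alpha> - 1 + p) * e t powr p)) integrable_on {a..b}"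
        by (intro integrable_continuous_real continuous_intros cp cX ce)
      fix t assume t: "t \<in> {a..b}"
      have t0: "t > 0" by (rule pos[OF t])
      have "p * X t powr (p - 1) * (t * e t) \<le> \<alpha> / 2 * X t powr p + D * (t * e t) powr p"
        unfolding D_def using p \<alpha> X[OF t] e(2)[OF t] t0 by (intro powr_Young) auto
      then have "t powr (\<alpha> - 1) * (p * X t powr (p - 1) * (t * e t)) \<le> t powr (\<alpha> - 1) * (\<alpha> / 2 * X t powr p + D * (t * e t) powr p)"
        by (rule mult_left_mono) simp
      moreover have "t powr \<alpha> = t powr (\<alpha> - 1) * t" using powr_mult_base[of t "\<alpha> - 1"] t0 by (simp add: mult.commute)
      moreover have "t powr (\<alpha> - 1 + p) = t powr (\<alpha> - 1) * t powr p" by (simp add: powr_add)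
      moreover have "(t * e t) powr p = t powr p * e t powr p" using t0 e(2)[OF t] by (simp add: powr_mult)
      ultimately show "t powr \<alpha> * (p * X t powr (p - 1) * e t) \<le> \<alpha> / 2 * (t powr (\<alpha> - 1) * X t powr p) + D * (t powr (\<alpha> - 1 + p) * e t powr p)"
        by (simp add: algebra_simps)
    qed
    also have "\<dots> = \<alpha> / 2 * integral {a..b} (?w X) + D * integral {a..b} ?v"
      using Henstock_Kurzweil_Integration.integral_add[OF i1' i3', of "\<alpha> / 2" D] by simp
    finally have 2: "\<alpha> / 2 * integral {a..b} (?w X) \<le> b powr \<alpha> * \<epsilon> powr p + D * integral {a..b} ?v"
      using 1 by simp
    have "integral {a..b} (?w E) \<le> integral {a..b} (?w X)"
    proof (rule integral_le[OF _ i1])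
      show "(?w E) integrable_on {a..b}"
        using E0 cE p by (intro integrable_continuous_real continuous_on_mult cp continuous_on_powr' continuous_intros) auto
      show "t powr (\<alpha> - 1) * E t powr p \<le> t powr (\<alpha> - 1) * X t powr p" if "t \<in> {a..b}" for t
        using E0[OF that] p \<epsilon> by (intro mult_left_mono powr_mono2) (auto simp: X_def)
    qed
    then have "\<alpha> / 2 * integral {a..b} (?w E) \<le> \<alpha> / 2 * integral {a..b} (?w X)"
      using \<alpha> by (intro mult_left_mono) auto
    then show ?thesis using 2 by simp
  qed
  have "((\<lambda>\<epsilon>. b powr \<alpha> * \<epsilon> powr p + D * integral {a..b} ?v) \<longlongrightarrow>
     b powr \<alpha> * 0 powr p + D * integral {a..b} ?v) (at_right 0)"
    using p by (intro tendsto_add tendsto_mult tendsto_const tendsto_powr' tendsto_ident_at)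
      (auto simp: eventually_at_right_field intro!: exI[of _ 1])
  moreover have "\<forall>\<^sub>F \<epsilon> in at_right 0. \<alpha> / 2 * integral {a..b} (?w E)
     \<le> b powr \<alpha> * \<epsilon> powr p + D * integral {a..b} ?v"
    using eventually_at_right_less[of 0] by eventually_elim (rule main)
  ultimately have "\<alpha> / 2 * integral {a..b} (?w E)
     \<le> b powr \<alpha> * 0 powr p + D * integral {a..b} ?v"
    by (rule tendsto_lowerbound) simp
  then show ?thesis using p unfolding D_def by simp
qed

lemma sinh_ge_self: "0 \<le> t \<Longrightarrow> t \<le> sinh t" for t :: real
proof -
  assume t: "0 \<le> t"
  have "(\<lambda>t::real. sinh t - t) 0 \<le> (\<lambda>t. sinh t - t) t"
  proof (rule DERIV_nonneg_imp_nondecreasing[OF t], intro exI conjI)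
    fix x :: real
    show "((\<lambda>t. sinh t - t) has_real_derivative cosh x - 1) (at x)" by (auto intro!: derivative_eq_intros)
    show "0 \<le> cosh x - 1" by (simp add: cosh_real_ge_1)
  qed
  then show ?thesis by simp
qed

lemma sinh_le_mult_cosh: "0 \<le> t \<Longrightarrow> sinh t \<le> t * cosh t" for t :: real
proof -
  assume t: "0 \<le> t"
  have "(\<lambda>t::real. t * cosh t - sinh t) 0 \<le> (\<lambda>t. t * cosh t - sinh t) t"
  proof (rule DERIV_nonneg_imp_nondecreasing[OF t], intro exI conjI)
    fix x :: real assume "0 \<le> x" "x \<le> t"
    show "((\<lambda>t. t * cosh t - sinh t) has_real_derivative x * sinh x) (at x)" by (auto intro!: derivative_eq_intros)
    show "0 \<le> x * sinh x" using \<open>0 \<le> x\<close> by simp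
  qed
  then show ?thesis by simp
qed

definition Iw :: "nat \<Rightarrow> real \<Rightarrow> real \<Rightarrow> real \<Rightarrow> (real \<Rightarrow> real) \<Rightarrow> ennreal" where
  "Iw N p \<rho> s g = (\<integral>\<^sup>+t\<in>ivl (ereal \<rho>). ennreal (\<bar>g t\<bar> powr p * t powr (- s * p) * sinh t ^ (N - 1)) \<partial>lborel)"

lemma Iw_0: "Iw N p \<rho> 0 g = wint N p (ereal \<rho>) g"
  unfolding Iw_def wint_def by (intro nn_integral_cong) (auto simp: indicator_def ivl_def)

text \<open>The function is compared with its value at a point b of the outer half, chosen so that
  this value is controlled by the weighted norm. Vanishing near 0 allows the integration to start at
  a positive a, while the constant stays independent of \<delta>. On a bounded interval sinh is
  comparable to the identity.\<close>

lemma hardy: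
  fixes \<rho> p s :: real and N :: nat
  assumes p: "1 \<le> p" and N: "1 \<le> N" "s * p < N" and s: "0 \<le> s" and \<rho>: "0 < \<rho>"
  shows "\<exists>C\<ge>0. \<forall>g g' \<delta>. 0 < \<delta> \<longrightarrow> (\<forall>t. 0 < t \<longrightarrow> t < \<delta> \<longrightarrow> g t = 0) \<longrightarrow> continuous_on {0<..<\<rho>} g' \<longrightarrow>
     (\<forall>t\<in>{0<..<\<rho>}. (g has_real_derivative g' t) (at t)) \<longrightarrow>
     Iw N p \<rho> s g \<le> ennreal C * (Iw N p \<rho> (s - 1) g' + Iw N p \<rho> 0 g)"
proof -
  \<comment> \<open>\<open>t powr (- s * p) * t ^ (N - 1)\<close> equals
    \<open>t powr (\<alpha> - 1)\<close>; its integrability at 0 is the hypothesis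
    \<open>s * p < N\<close>.\<close>
  define \<alpha> where "\<alpha> = N - s * p"
  have \<alpha>: "\<alpha> > 0" using N by (simp add: \<alpha>_def)
  define L where "L = cosh \<rho> ^ (N - 1)"
  have L: "L \<ge> 1" unfolding L_def by (simp add: one_le_power cosh_real_ge_1)
  define D where "D = p * (p / (\<alpha> / 2)) powr (p - 1)"
  have D: "D \<ge> 0" using p by (simp add: D_def)
  \<comment> \<open>\<open>C1\<close> bounds the singular weight beyond b, \<open>C2\<close> belongs
    to the derivative term and \<open>C3\<close> to the value at b.\<close>
  define C1 where "C1 = (\<rho> / 2) powr (- s * p)"
  define C2 where "C2 = L * 2 powr p * (2 * D / \<alpha>)"
  define C3 where "C3 = L * 2 powr p * (\<rho> powr \<alpha> / \<alpha>) * (2 / \<rho>) / (\<rho> / 2) ^ (N - 1)"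
  have C: "C1 \<ge> 0" "C2 \<ge> 0" "C3 \<ge> 0" using L D \<alpha> \<rho> by (auto simp: C1_def C2_def C3_def)
  have wt: "t ^ (N - 1) \<le> sinh t ^ (N - 1)" "sinh t ^ (N - 1) \<le> L * t ^ (N - 1)" if "0 < t" "t < \<rho>" for t
  proof -
    show "t ^ (N - 1) \<le> sinh t ^ (N - 1)" using that sinh_ge_self[of t] by (intro power_mono) auto
    have "sinh t \<le> t * cosh \<rho>"
      using sinh_le_mult_cosh[of t] that cosh_real_nonneg_le_iff[of t \<rho>] by (smt (verit) mult_left_mono)
    then have "sinh t ^ (N - 1) \<le> (t * cosh \<rho>) ^ (N - 1)" using that by (intro power_mono) auto
    then show "sinh t ^ (N - 1) \<le> L * t ^ (N - 1)" by (simp add: L_def power_mult_distrib mult.commute)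
  qed
  have tpow: "t powr q * t ^ (N - 1) = t powr (q + N - 1)" if "0 < t" for t q :: real
    using that N by (simp add: powr_add powr_diff powr_realpow[symmetric] of_nat_diff)
  have main: "Iw N p \<rho> s g \<le> ennreal (C1 + C2 + C3) * (Iw N p \<rho> (s - 1) g' + Iw N p \<rho> 0 g)"
    if \<delta>: "0 < \<delta>" "\<And>t. 0 < t \<Longrightarrow> t < \<delta> \<Longrightarrow> g t = 0" and g': "continuous_on {0<..<\<rho>} g'"
      and d: "\<And>t. t \<in> {0<..<\<rho>} \<Longrightarrow> (g has_real_derivative g' t) (at t)" for g g' \<delta>
  proof -
    let ?w = "\<lambda>s g t. \<bar>g t\<bar> powr p * t powr (- s * p) * sinh t ^ (N - 1)"
    have cg: "continuous_on {0<..<\<rho>} g" by (intro continuous_at_imp_continuous_on ballI DERIV_isCont[OF d])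
    let ?I = "{\<rho>/2..<\<rho>}"
    have ivl: "ivl (ereal \<rho>) = {0<..<\<rho>}" by (auto simp: ivl_def)
    have [measurable]: "(\<lambda>t. indicator {0<..<\<rho>} t * g t) \<in> borel_measurable borel"
      using borel_measurable_continuous_on_indicator[OF _ cg] by simp
    have [measurable]: "(\<lambda>t. indicator {0<..<\<rho>} t * g' t) \<in> borel_measurable borel"
      using borel_measurable_continuous_on_indicator[OF _ g'] by simp
    \<comment> \<open>The truncation is measurable on the whole line, whereas nothing is known about
      g outside the interval.\<close>
    define h where "h t = indicator {0<..<\<rho>} t * g t" for t
    have [measurable]: "h \<in> borel_measurable borel" unfolding h_def by measurable
    obtain b where b: "b \<in> ?I" "ennreal (\<bar>h b\<bar> powr p) * emeasure lborel ?I \<le> (\<integral>\<^sup>+t\<in>?I. ennreal (\<bar>h t\<bar> powr p) \<partial>lborel)"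
      using exists_le_average[of ?I lborel "\<lambda>t. ennreal (\<bar>h t\<bar> powr p)"] \<rho> by auto
    have b': "0 < b" "b < \<rho>" "\<rho>/2 \<le> b" using b \<rho> by auto
    \<comment> \<open>Nothing is lost below a, since g vanishes there; the minimum with b ensures
      \<open>a \<le> b\<close>.\<close>
    define a where "a = min (\<delta>/2) b"
    have a: "0 < a" "a < \<delta>" "a \<le> b" using \<delta> b' by (auto simp: a_def)
    have sub: "{a..b} \<subseteq> {0<..<\<rho>}" using a b' by auto
    let ?e = "\<lambda>t. \<bar>g' t\<bar>"
    have ce: "continuous_on {a..b} ?e" by (intro continuous_on_rabs continuous_on_subset[OF g' sub])
    define E where "E t = integral {a..b} ?e - integral {a..t} ?e" for t
    let ?Za = "Iw N p \<rho> 0 g" and ?Zb = "Iw N p \<rho> (s - 1) g'"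
    have cp: "continuous_on {a..b} (\<lambda>t. t powr q)" for q using a by (intro continuous_intros) auto
    have cgab: "continuous_on {a..b} g" by (rule continuous_on_subset[OF cg sub])
    have gE: "\<bar>g t\<bar> \<le> \<bar>g b\<bar> + E t" if t: "t \<in> {a..b}" for t
    proof -
      have "(g' has_integral (g b - g t)) {t..b}"
      proof (rule fundamental_theorem_of_calculus)
        show "t \<le> b" using t by simp
        fix x assume "x \<in> {t..b}"
        then have "x \<in> {0<..<\<rho>}" using t a b' by auto
        from has_field_derivative_at_within[OF d[OF this], of "{t..b}"]
        show "(g has_vector_derivative g' x) (at x within {t..b})" by (simp only: has_real_derivative_iff_has_vector_derivative)
      qed
      then have 1: "g b - g t = integral {t..b} g'" by (simp add: integral_unique)
      have ct: "continuous_on {t..b} g'" using t a b' by (intro continuous_on_subset[OF g']) auto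
      have "\<bar>integral {t..b} g'\<bar> \<le> integral {t..b} ?e"
        using integral_norm_bound_integral[of g' "{t..b}" ?e] ct
        by (simp add: integrable_continuous_real continuous_on_rabs)
      also have "integral {t..b} ?e = E t"
        using Henstock_Kurzweil_Integration.integral_combine[of a t b ?e] t ce unfolding E_def
        by (auto simp: integrable_continuous_real)
      finally show ?thesis using 1 by linarith
    qed
    have E0: "0 \<le> E t" if t: "t \<in> {a..b}" for t
    proof -
      have "integral {a..t} ?e + integral {t..b} ?e = integral {a..b} ?e"
        using t by (intro Henstock_Kurzweil_Integration.integral_combine integrable_continuous_real ce) auto
      moreover have "0 \<le> integral {t..b} ?e"
        using t by (intro Henstock_Kurzweil_Integration.integral_nonneg integrable_continuous_real continuous_on_subset[OF ce]) auto
      ultimately show ?thesis by (simp add: E_def)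
    qed
    have cE: "continuous_on {a..b} E"
      unfolding E_def by (intro continuous_intros indefinite_integral_continuous_1 integrable_continuous_real ce)
    let ?J = "integral {a..b} (\<lambda>t. t powr (\<alpha> - 1 + p) * ?e t powr p)"
    have ipow: "integral {a..b} (\<lambda>t. t powr (\<alpha> - 1)) \<le> \<rho> powr \<alpha> / \<alpha>"
    proof -
      have "((\<lambda>t. t powr (\<alpha> - 1)) has_integral (b powr \<alpha> / \<alpha> - a powr \<alpha> / \<alpha>)) {a..b}"
      proof (rule fundamental_theorem_of_calculus[OF a(3)])
        fix t assume "t \<in> {a..b}"
        then have "t > 0" using a by auto
        then have "((\<lambda>t. t powr \<alpha> / \<alpha>) has_real_derivative t powr (\<alpha> - 1)) (at t)"
          using \<alpha> by (auto intro!: derivative_eq_intros)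
        then show "((\<lambda>t. t powr \<alpha> / \<alpha>) has_vector_derivative t powr (\<alpha> - 1)) (at t within {a..b})"
          by (simp add: has_real_derivative_iff_has_vector_derivative[symmetric] has_field_derivative_at_within)
      qed
      then have "integral {a..b} (\<lambda>t. t powr (\<alpha> - 1)) = b powr \<alpha> / \<alpha> - a powr \<alpha> / \<alpha>" by (rule integral_unique)
      also have "\<dots> \<le> b powr \<alpha> / \<alpha>" using \<alpha> by simp
      also have "\<dots> \<le> \<rho> powr \<alpha> / \<alpha>" using \<alpha> b' by (intro divide_right_mono powr_mono2) auto
      finally show ?thesis .
    qed
    have "integral {a..b} (\<lambda>t. t powr (\<alpha> - 1) * \<bar>g t\<bar> powr p)
      \<le> integral {a..b} (\<lambda>t. 2 powr p * \<bar>g b\<bar> powr p * t powr (\<alpha> - 1) + 2 powr p * (t powr (\<alpha> - 1) * E t powr p))"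
    proof (rule integral_le)
      show "(\<lambda>t. t powr (\<alpha> - 1) * \<bar>g t\<bar> powr p) integrable_on {a..b}"
        using p by (intro integrable_continuous_real continuous_on_mult cp continuous_on_powr' continuous_intros cgab) auto
      show "(\<lambda>t. 2 powr p * \<bar>g b\<bar> powr p * t powr (\<alpha> - 1) + 2 powr p * (t powr (\<alpha> - 1) * E t powr p)) integrable_on {a..b}"
        using p E0 by (intro integrable_continuous_real continuous_on_add continuous_on_mult cp continuous_on_powr' continuous_on_const cE) auto
      fix t assume t: "t \<in> {a..b}"
      have "\<bar>g t\<bar> powr p \<le> \<bar>\<bar>g b\<bar> + E t\<bar> powr p" using gE[OF t] E0[OF t] p by (intro powr_mono2) auto
      also have "\<dots> \<le> 2 powr p * (\<bar>\<bar>g b\<bar>\<bar> powr p + \<bar>E t\<bar> powr p)" using p by (intro abs_add_powr_le) auto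
      finally have "\<bar>g t\<bar> powr p \<le> 2 powr p * (\<bar>g b\<bar> powr p + E t powr p)" using E0[OF t] by simp
      from mult_left_mono[OF this, of "t powr (\<alpha> - 1)"]
      show "t powr (\<alpha> - 1) * \<bar>g t\<bar> powr p \<le> 2 powr p * \<bar>g b\<bar> powr p * t powr (\<alpha> - 1) + 2 powr p * (t powr (\<alpha> - 1) * E t powr p)"
        by (simp add: algebra_simps)
    qed
    also have "\<dots> = 2 powr p * \<bar>g b\<bar> powr p * integral {a..b} (\<lambda>t. t powr (\<alpha> - 1)) + 2 powr p * integral {a..b} (\<lambda>t. t powr (\<alpha> - 1) * E t powr p)"
    proof (subst Henstock_Kurzweil_Integration.integral_add)
      show "(\<lambda>t. 2 powr p * (t powr (\<alpha> - 1) * E t powr p)) integrable_on {a..b}"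
        using p E0 by (intro integrable_continuous_real continuous_on_add continuous_on_mult cp continuous_on_powr' continuous_on_const cE) auto
      show "(\<lambda>t. 2 powr p * \<bar>g b\<bar> powr p * t powr (\<alpha> - 1)) integrable_on {a..b}"
        by (intro integrable_continuous_real continuous_on_mult cp continuous_on_const)
    qed simp
    also have "\<dots> \<le> 2 powr p * \<bar>g b\<bar> powr p * (\<rho> powr \<alpha> / \<alpha>) + 2 powr p * (2 * D / \<alpha> * ?J)"
    proof (intro add_mono mult_left_mono ipow)
      have "\<alpha> / 2 * integral {a..b} (\<lambda>t. t powr (\<alpha> - 1) * E t powr p) \<le> D * ?J"
        unfolding D_def E_def using hardy_tail_integral[OF p \<alpha> a(1,3) ce] by simp
      then show "integral {a..b} (\<lambda>t. t powr (\<alpha> - 1) * E t powr p) \<le> 2 * D / \<alpha> * ?J" using \<alpha> by (simp add: field_simps)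
    qed auto
    finally have real: "integral {a..b} (\<lambda>t. t powr (\<alpha> - 1) * \<bar>g t\<bar> powr p) \<le> 2 powr p * (\<rho> powr \<alpha> / \<alpha>) * \<bar>g b\<bar> powr p + 2 powr p * (2 * D / \<alpha>) * ?J"
      by (simp add: mult_ac)
    have J: "ennreal ?J \<le> ?Zb"
    proof -
      have "ennreal ?J = (\<integral>\<^sup>+t\<in>{a..b}. ennreal (t powr (\<alpha> - 1 + p) * ?e t powr p) \<partial>lborel)"
        using p by (intro nn_integral_Icc_continuous[symmetric] continuous_on_mult cp continuous_on_powr' continuous_on_const ce) auto
      also have "\<dots> \<le> ?Zb" unfolding Iw_def ivl
      proof (intro nn_integral_mono)
        fix t
        show "ennreal (t powr (\<alpha> - 1 + p) * ?e t powr p) * indicator {a..b} t \<le> ennreal (?w (s - 1) g' t) * indicator {0<..<\<rho>} t"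
        proof (cases "t \<in> {a..b}")
          case True
          then have t: "0 < t" "t < \<rho>" using a b' by auto
          have "t powr (\<alpha> - 1 + p) = t powr (- (s - 1) * p) * t ^ (N - 1)"
            unfolding tpow[OF t(1)] by (simp add: \<alpha>_def algebra_simps)
          also have "\<dots> \<le> t powr (- (s - 1) * p) * sinh t ^ (N - 1)" using wt[OF t] by (intro mult_left_mono) auto
          finally have "t powr (\<alpha> - 1 + p) * ?e t powr p \<le> t powr (- (s - 1) * p) * sinh t ^ (N - 1) * ?e t powr p" by (rule mult_right_mono) simp
          then show ?thesis using True t by (auto intro!: ennreal_leI simp: mult_ac)
        qed simp
      qed
      finally show ?thesis .
    qed
    have gb: "ennreal (\<bar>g b\<bar> powr p) \<le> ennreal (2 / \<rho> / (\<rho> / 2) ^ (N - 1)) * ?Za"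
    proof -
      have "ennreal (\<bar>g b\<bar> powr p) * ennreal (\<rho> / 2) \<le> (\<integral>\<^sup>+t\<in>?I. ennreal (\<bar>h t\<bar> powr p) \<partial>lborel)"
        using b b' \<rho> by (simp add: h_def)
      also have "\<dots> \<le> (\<integral>\<^sup>+t. ennreal (1 / (\<rho> / 2) ^ (N - 1)) * (ennreal (?w 0 g t) * indicator {0<..<\<rho>} t) \<partial>lborel)"
      proof (intro nn_integral_mono)
        fix t
        show "ennreal (\<bar>h t\<bar> powr p) * indicator ?I t \<le> ennreal (1 / (\<rho> / 2) ^ (N - 1)) * (ennreal (?w 0 g t) * indicator {0<..<\<rho>} t)"
        proof (cases "t \<in> ?I")
          case True
          then have t: "0 < t" "t < \<rho>" "\<rho> / 2 \<le> t" using \<rho> by auto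
          have "(\<rho> / 2) ^ (N - 1) \<le> sinh t ^ (N - 1)" using t \<rho> sinh_ge_self[of t] by (intro power_mono) auto
          then have "1 \<le> 1 / (\<rho> / 2) ^ (N - 1) * sinh t ^ (N - 1)" using \<rho> by (simp add: field_simps)
          from mult_left_mono[OF this, of "\<bar>g t\<bar> powr p"]
          have "\<bar>g t\<bar> powr p \<le> 1 / (\<rho> / 2) ^ (N - 1) * (\<bar>g t\<bar> powr p * sinh t ^ (N - 1))" by (simp add: mult_ac)
          then show ?thesis using True t \<rho> by (simp add: h_def ennreal_mult[symmetric] ennreal_leI)
        qed simp
      qed
      also have "\<dots> = ennreal (1 / (\<rho> / 2) ^ (N - 1)) * ?Za"
      proof -
        have "(\<lambda>t. ennreal (?w 0 g t) * indicator {0<..<\<rho>} t) = (\<lambda>t. ennreal (?w 0 h t) * indicator {0<..<\<rho>} t)"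
          by (auto simp: h_def indicator_def fun_eq_iff)
        then show ?thesis unfolding Iw_def ivl by (subst nn_integral_cmult) (simp_all only:, measurable)
      qed
      finally have "ennreal (2 / \<rho>) * (ennreal (\<bar>g b\<bar> powr p) * ennreal (\<rho> / 2)) \<le> ennreal (2 / \<rho>) * (ennreal (1 / (\<rho> / 2) ^ (N - 1)) * ?Za)"
        by (rule mult_left_mono) simp
      moreover have "ennreal (2 / \<rho>) * (ennreal (\<bar>g b\<bar> powr p) * ennreal (\<rho> / 2)) = ennreal (\<bar>g b\<bar> powr p)"
        using \<rho> by (simp add: ennreal_mult[symmetric])
      moreover have "ennreal (2 / \<rho>) * (ennreal (1 / (\<rho> / 2) ^ (N - 1)) * ?Za) = ennreal (2 / \<rho> / (\<rho> / 2) ^ (N - 1)) * ?Za"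
        using \<rho> by (simp add: mult.assoc[symmetric] ennreal_mult[symmetric])
      ultimately show ?thesis by simp
    qed
    have left: "(\<integral>\<^sup>+t\<in>{a..b}. ennreal (?w s g t) \<partial>lborel) \<le> ennreal C3 * ?Za + ennreal C2 * ?Zb"
    proof -
      have "(\<integral>\<^sup>+t\<in>{a..b}. ennreal (?w s g t) \<partial>lborel)
        \<le> (\<integral>\<^sup>+t\<in>{a..b}. ennreal (L * (t powr (\<alpha> - 1) * \<bar>g t\<bar> powr p)) \<partial>lborel)"
      proof (intro nn_integral_mono)
        fix t
        show "ennreal (?w s g t) * indicator {a..b} t \<le> ennreal (L * (t powr (\<alpha> - 1) * \<bar>g t\<bar> powr p)) * indicator {a..b} t"
        proof (cases "t \<in> {a..b}")
          case True
          then have t: "0 < t" "t < \<rho>" using a b' by auto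
          have "t powr (- s * p) * sinh t ^ (N - 1) \<le> t powr (- s * p) * (L * t ^ (N - 1))" using wt[OF t] by (intro mult_left_mono) auto
          also have "\<dots> = L * t powr (\<alpha> - 1)"
            using tpow[OF t(1), of "- s * p"] by (simp add: \<alpha>_def algebra_simps)
          finally have "\<bar>g t\<bar> powr p * (t powr (- s * p) * sinh t ^ (N - 1)) \<le> \<bar>g t\<bar> powr p * (L * t powr (\<alpha> - 1))" by (rule mult_left_mono) simp
          then show ?thesis using True by (auto intro!: ennreal_leI simp: mult_ac)
        qed simp
      qed
      also have "\<dots> = ennreal (integral {a..b} (\<lambda>t. L * (t powr (\<alpha> - 1) * \<bar>g t\<bar> powr p)))"
        using p L by (intro nn_integral_Icc_continuous continuous_on_mult cp continuous_on_powr' continuous_on_const continuous_intros cgab) auto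
      also have "\<dots> \<le> ennreal (L * (2 powr p * (\<rho> powr \<alpha> / \<alpha>)) * \<bar>g b\<bar> powr p + C2 * ?J)"
        using mult_left_mono[OF real, of L] L by (intro ennreal_leI) (simp add: C2_def algebra_simps)
      also have "\<dots> = ennreal (L * (2 powr p * (\<rho> powr \<alpha> / \<alpha>))) * ennreal (\<bar>g b\<bar> powr p) + ennreal C2 * ennreal ?J"
      proof -
        have 1: "0 \<le> ?J" using p by (intro Henstock_Kurzweil_Integration.integral_nonneg integrable_continuous_real continuous_on_mult cp continuous_on_powr' continuous_on_const ce) auto
        have 2: "0 \<le> L * (2 powr p * (\<rho> powr \<alpha> / \<alpha>))" using L \<alpha> by simp
        have 3: "ennreal (x * y + z * u) = ennreal x * ennreal y + ennreal z * ennreal u"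
          if "0 \<le> x" "0 \<le> y" "0 \<le> z" "0 \<le> u" for x y z u :: real
          using that by (simp add: ennreal_mult)
        show ?thesis by (rule 3) (use C(2) 1 2 in auto)
      qed
      also have "\<dots> \<le> ennreal (L * (2 powr p * (\<rho> powr \<alpha> / \<alpha>))) * (ennreal (2 / \<rho> / (\<rho> / 2) ^ (N - 1)) * ?Za) + ennreal C2 * ?Zb"
        by (intro add_mono mult_left_mono gb J) auto
      also have "\<dots> = ennreal C3 * ?Za + ennreal C2 * ?Zb"
        using L \<alpha> \<rho> by (simp add: mult.assoc[symmetric] ennreal_mult[symmetric] C3_def)
      finally show ?thesis .
    qed
    have right: "(\<integral>\<^sup>+t\<in>{b<..<\<rho>}. ennreal (?w s g t) \<partial>lborel) \<le> ennreal C1 * ?Za"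
    proof -
      have "(\<integral>\<^sup>+t\<in>{b<..<\<rho>}. ennreal (?w s g t) \<partial>lborel)
        \<le> (\<integral>\<^sup>+t. ennreal C1 * (ennreal (?w 0 h t) * indicator {0<..<\<rho>} t) \<partial>lborel)"
      proof (intro nn_integral_mono)
        fix t
        show "ennreal (?w s g t) * indicator {b<..<\<rho>} t
          \<le> ennreal C1 * (ennreal (?w 0 h t) * indicator {0<..<\<rho>} t)"
        proof (cases "t \<in> {b<..<\<rho>}")
          case True
          then have t: "0 < t" "t < \<rho>" "\<rho> / 2 \<le> t" using b' by auto
          have "t powr (- s * p) \<le> C1" unfolding C1_def using t \<rho> s p by (intro powr_mono2') auto
          then have "\<bar>g t\<bar> powr p * sinh t ^ (N - 1) * t powr (- s * p) \<le> \<bar>g t\<bar> powr p * sinh t ^ (N - 1) * C1"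
            using t by (intro mult_left_mono mult_nonneg_nonneg zero_le_power) auto
          then show ?thesis using True t C by (auto simp: h_def ennreal_mult[symmetric] mult_ac intro!: ennreal_leI)
        qed simp
      qed
      also have "\<dots> = ennreal C1 * (\<integral>\<^sup>+t. ennreal (?w 0 h t) * indicator {0<..<\<rho>} t \<partial>lborel)"
        by (rule nn_integral_cmult) measurable
      also have "(\<integral>\<^sup>+t. ennreal (?w 0 h t) * indicator {0<..<\<rho>} t \<partial>lborel) = ?Za"
        unfolding Iw_def ivl by (intro nn_integral_cong) (auto simp: h_def indicator_def)
      finally show ?thesis .
    qed
    have "Iw N p \<rho> s g = (\<integral>\<^sup>+t. ennreal (?w s h t) * indicator {a..b} t
      + ennreal (?w s h t) * indicator {b<..<\<rho>} t \<partial>lborel)"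
      unfolding Iw_def ivl using a b' \<delta>(2) by (intro nn_integral_cong) (auto simp: h_def indicator_def not_le)
    also have "\<dots> = (\<integral>\<^sup>+t\<in>{a..b}. ennreal (?w s h t) \<partial>lborel)
      + (\<integral>\<^sup>+t\<in>{b<..<\<rho>}. ennreal (?w s h t) \<partial>lborel)"
      by (rule nn_integral_add) measurable
    also have "(\<integral>\<^sup>+t\<in>{a..b}. ennreal (?w s h t) \<partial>lborel) = (\<integral>\<^sup>+t\<in>{a..b}. ennreal (?w s g t) \<partial>lborel)"
      using a b' by (intro nn_integral_cong) (auto simp: h_def indicator_def)
    also have "(\<integral>\<^sup>+t\<in>{b<..<\<rho>}. ennreal (?w s h t) \<partial>lborel) = (\<integral>\<^sup>+t\<in>{b<..<\<rho>}. ennreal (?w s g t) \<partial>lborel)"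
      using b' by (intro nn_integral_cong) (auto simp: h_def indicator_def)
    finally have "Iw N p \<rho> s g \<le> (ennreal C3 * ?Za + ennreal C2 * ?Zb) + ennreal C1 * ?Za"
      using add_mono[OF left right] by simp
    also have "\<dots> \<le> ennreal (C1 + C2 + C3) * (?Zb + ?Za)"
    proof -
      have "ennreal (C1 + C2 + C3) * (?Zb + ?Za) = (ennreal C3 * ?Za + ennreal C2 * ?Zb) + ennreal C1 * ?Za + (ennreal C1 * ?Zb + ennreal C3 * ?Zb + ennreal C2 * ?Za)"
        using C by (simp add: algebra_simps ennreal_plus)
      then show ?thesis by simp
    qed
    finally show ?thesis .
  qed
  show ?thesis
    by (intro exI[of _ "C1 + C2 + C3"] conjI allI impI) (use C main in auto)
qed

section \<open>From Hardy's inequality to the norms of radial functions\<close>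

lemma nn_integral_hmeas_radial:
  assumes [measurable]: "h \<in> borel_measurable borel"
  shows "(\<integral>\<^sup>+x. h (hdist x) \<partial>(hmeas R :: (real^'n::finite) measure)) = ennreal (radK TYPE('n)) * (\<integral>\<^sup>+t. h t \<partial>wmeas CARD('n) R)"
proof -
  let ?N = "CARD('n)"
  let ?c = "\<integral>\<^sup>+t. h t \<partial>wmeas ?N R"
  have [measurable]: "(\<lambda>t. h (hdist (gam y t))) \<in> borel_measurable borel" for y :: "real^'n" by measurable
  have eq: "(\<integral>\<^sup>+t. h (hdist (gam y t)) \<partial>wmeas ?N R) = ?c" if "y \<noteq> 0" for y :: "real^'n"
    using that by (subst nn_integral_wmeas, measurable, subst nn_integral_wmeas, measurable, intro nn_integral_cong)
      (auto simp: indicator_def ivl_def gam_simps(4))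
  have "(\<integral>\<^sup>+x. h (hdist x) \<partial>(hmeas R :: (real^'n) measure)) = of_nat ?N * (\<integral>\<^sup>+y\<in>ball 0 1. (\<integral>\<^sup>+t. h (hdist (gam (y::real^'n) t)) \<partial>wmeas ?N R) \<partial>lborel)"
    by (rule nn_integral_hmeas_polar) measurable
  also have "(\<integral>\<^sup>+y\<in>ball 0 1. (\<integral>\<^sup>+t. h (hdist (gam (y::real^'n) t)) \<partial>wmeas ?N R) \<partial>lborel) = (\<integral>\<^sup>+y\<in>ball (0::real^'n) 1. ?c \<partial>lborel)"
    using AE_lborel_neq[of "0::real^'n"] by (intro nn_integral_cong_AE) (auto elim!: eventually_mono simp: eq)
  also have "\<dots> = ?c * ennreal (measure lborel (ball (0::real^'n) 1))"
    by (subst nn_integral_cmult_indicator) (auto simp: emeasure_unit_ball(1))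
  finally show ?thesis unfolding radK_def by (simp add: ennreal_mult ennreal_of_nat_eq_real_of_nat mult_ac)
qed

lemma hint_le_radial:
  fixes u :: "real^'n::finite \<Rightarrow> real"
  assumes h: "set_borel_measurable lborel (ivl R) h" and p: "0 \<le> p"
    and le: "\<And>x. x \<in> hball R - {0} \<Longrightarrow> gnorm j u x \<le> \<bar>h (hdist x)\<bar>"
  shows "hint p R j u \<le> ennreal (radK TYPE('n)) * wint CARD('n) p R h"
proof -
  have [measurable]: "(\<lambda>t. indicator (ivl R) t * h t) \<in> borel_measurable borel"
    using h by (simp add: set_borel_measurable_def)
  let ?H = "\<lambda>t. ennreal (\<bar>indicator (ivl R) t * h t\<bar> powr p)"
  have "hint p R j u \<le> (\<integral>\<^sup>+x\<in>hball R. (?H (hdist (x::real^'n)) * ennreal (lam x ^ CARD('n))) \<partial>lborel)"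
    unfolding hint_def
  proof (rule nn_integral_mono_AE)
    show "AE x in lborel. ennreal (gnorm j u x powr p * lam x ^ CARD('n)) * indicator (hball R) x \<le> ?H (hdist x) * ennreal (lam x ^ CARD('n)) * indicator (hball R) x"
      using AE_lborel_neq[of 0]
    proof eventually_elim
      case (elim x)
      show ?case
      proof (cases "x \<in> hball R")
        case True
        then have x: "x \<in> hball R - {0}" using elim by simp
        have "gnorm j u x powr p \<le> \<bar>h (hdist x)\<bar> powr p" using le[OF x] p gnorm_nonneg by (intro powr_mono2) auto
        then show ?thesis using True hdist_in_ivl[OF x] lam_power_nonneg[OF True]
          by (auto simp: ennreal_mult''[symmetric] intro!: ennreal_leI mult_right_mono)
      qed simp
    qed
  qed
  also have "\<dots> = (\<integral>\<^sup>+x. ?H (hdist x) \<partial>(hmeas R :: (real^'n) measure))" by (rule nn_integral_hmeas[symmetric]) measurable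
  also have "\<dots> = ennreal (radK TYPE('n)) * (\<integral>\<^sup>+t. ?H t \<partial>wmeas CARD('n) R)" by (rule nn_integral_hmeas_radial) measurable
  also have "(\<integral>\<^sup>+t. ?H t \<partial>wmeas CARD('n) R) = wint CARD('n) p R h" by (rule wint_eq_wmeas[OF h, symmetric])
  finally show ?thesis .
qed

lemma hint_radial_le_1:
  assumes f: "smooth_fam (ivl R) f" and p: "0 \<le> p" and j: "j \<le> 1"
  shows "hint p R j (\<lambda>x::real^'n::finite. f 0 (hdist x)) \<le> ennreal (radK TYPE('n)) * wint CARD('n) p R (f j)"
proof (rule hint_le_radial[OF smooth_fam_measurable[OF f] p])
  fix x :: "real^'n" assume x: "x \<in> hball R - {0}"
  then have n: "norm x < 1" by (auto simp: hball_def)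
  show "gnorm j (\<lambda>x. f 0 (hdist x)) x \<le> \<bar>f j (hdist x)\<bar>"
  proof (cases "j = 0")
    case False
    then have "j = 1" using j by simp
    then show ?thesis using gnorm_1_radial[OF f x] by simp
  qed (use gnorm_0[OF n] in simp)
qed

text \<open>The conditions reach t = 0, the value of \<open>hdist\<close> at the origin, where a
  family that is smooth on \<open>ivl R\<close> is not constrained.\<close>

definition flat :: "(nat \<Rightarrow> real \<Rightarrow> real) \<Rightarrow> bool" where
  "flat f \<longleftrightarrow> (\<exists>\<delta>>0. \<exists>c. (\<forall>t<\<delta>. f 0 t = c) \<and> (\<forall>i\<ge>1. \<forall>t<\<delta>. f i t = 0))"

text \<open>Each application trades one power of 1 / t for one derivative. Because \<open>i\<close>
  is at least 1, \<open>s\<close> never exceeds \<open>k - 1\<close>, so the hypothesis on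
  \<open>N\<close> covers every application.\<close>

lemma hardy_iterate:
  fixes N k :: nat
  assumes p: "1 \<le> p" and N: "1 \<le> N" "real (k - 1) * p < N" and \<rho>: "0 < \<rho>" and i: "1 \<le> i" "i + s \<le> k"
  shows "\<exists>C\<ge>0. \<forall>f. smooth_fam (ivl (ereal \<rho>)) f \<longrightarrow> flat f \<longrightarrow>
    Iw N p \<rho> (real s) (f i) \<le> ennreal C * (\<Sum>l\<le>k. wint N p (ereal \<rho>) (f l))"
  using i
proof (induction s arbitrary: i)
  case 0
  have "Iw N p \<rho> (real 0) (f i) \<le> ennreal 1 * (\<Sum>l\<le>k. wint N p (ereal \<rho>) (f l))" for f :: "nat \<Rightarrow> real \<Rightarrow> real"
    using 0 member_le_sum[of i "{..k}" "\<lambda>l. wint N p (ereal \<rho>) (f l)"] by (simp add: Iw_0)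
  then show ?case by (intro exI[of _ 1]) auto
next
  case (Suc s)
  obtain C where C: "C \<ge> 0" "\<And>f. smooth_fam (ivl (ereal \<rho>)) f \<Longrightarrow> flat f \<Longrightarrow>
    Iw N p \<rho> (real s) (f (Suc i)) \<le> ennreal C * (\<Sum>l\<le>k. wint N p (ereal \<rho>) (f l))"
    using Suc.IH[of "Suc i"] Suc.prems by auto
  have "real (Suc s) * p \<le> real (k - 1) * p" using Suc.prems p by (intro mult_right_mono) auto
  then have sN: "real (Suc s) * p < N" using N by simp
  from hardy[OF p N(1) sN _ \<rho>] obtain D where D: "D \<ge> 0" "\<And>g g' \<delta>. 0 < \<delta> \<Longrightarrow> (\<forall>t. 0 < t \<longrightarrow> t < \<delta> \<longrightarrow> g t = 0) \<Longrightarrow>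
     continuous_on {0<..<\<rho>} g' \<Longrightarrow> (\<forall>t\<in>{0<..<\<rho>}. (g has_real_derivative g' t) (at t)) \<Longrightarrow>
     Iw N p \<rho> (real (Suc s)) g \<le> ennreal D * (Iw N p \<rho> (real (Suc s) - 1) g' + Iw N p \<rho> 0 g)"
    by auto
  have "Iw N p \<rho> (real (Suc s)) (f i) \<le> ennreal (D * (C + 1)) * (\<Sum>l\<le>k. wint N p (ereal \<rho>) (f l))"
    if f: "smooth_fam (ivl (ereal \<rho>)) f" "flat f" for f
  proof -
    let ?S = "\<Sum>l\<le>k. wint N p (ereal \<rho>) (f l)"
    have iv: "{0<..<\<rho>} = ivl (ereal \<rho>)" by (auto simp: ivl_def)
    obtain \<delta> where \<delta>: "\<delta> > 0" "\<forall>i\<ge>1. \<forall>t<\<delta>. f i t = 0" using f(2) unfolding flat_def by blast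
    have "Iw N p \<rho> (real (Suc s)) (f i) \<le> ennreal D * (Iw N p \<rho> (real (Suc s) - 1) (f (Suc i)) + Iw N p \<rho> 0 (f i))"
      using \<delta> Suc.prems by (intro D(2)[OF \<delta>(1)])
        (auto simp: iv intro: smooth_famD[OF f(1)] smooth_fam_continuous[OF f(1)])
    also have "real (Suc s) - 1 = real s" by simp
    also have "ennreal D * (Iw N p \<rho> (real s) (f (Suc i)) + Iw N p \<rho> 0 (f i)) \<le> ennreal D * (ennreal C * ?S + ?S)"
      using Suc.prems member_le_sum[of i "{..k}" "\<lambda>l. wint N p (ereal \<rho>) (f l)"]
      by (intro mult_left_mono add_mono C(2)[OF f]) (auto simp: Iw_0)
    also have "\<dots> = ennreal (D * (C + 1)) * ?S"
      using C(1) D(1) by (simp add: ennreal_mult ennreal_plus algebra_simps)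
    finally show ?thesis .
  qed
  then show ?case using C(1) D(1) by (intro exI[of _ "D * (C + 1)"]) auto
qed

lemma tanh_half_ge:
  assumes "0 \<le> t" "t \<le> \<rho>"
  shows "t / (2 * cosh (\<rho> / 2)) \<le> tanh (t / 2 :: real)"
proof -
  have "t / 2 \<le> sinh (t / 2)" using assms by (intro sinh_ge_self) auto
  moreover have "cosh (t / 2) \<le> cosh (\<rho> / 2)" using assms by (subst cosh_real_nonneg_le_iff) auto
  moreover have "cosh (t / 2) > 0" by (rule cosh_real_pos)
  ultimately have "(t / 2) / cosh (\<rho> / 2) \<le> sinh (t / 2) / cosh (t / 2)" using assms by (intro frac_le) auto
  then show ?thesis by (simp add: tanh_def mult.commute)
qed

text \<open>On a bounded ball |x| is comparable to the distance t, so the singular coefficients in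
  \<open>gnorm_radial_bound\<close> become powers of 1 / t, which \<open>hardy_iterate\<close>
  exchanges for derivatives.\<close>

lemma hint_radial_bound:
  fixes k :: nat
  assumes p: "1 \<le> p" and N: "real (k - 1) * p < CARD('n)" and \<rho>: "0 < \<rho>" and j: "j \<le> k"
  shows "\<exists>C\<ge>0. \<forall>f. smooth_fam (ivl (ereal \<rho>)) f \<longrightarrow> flat f \<longrightarrow>
    hint p (ereal \<rho>) j (\<lambda>x::real^'n::finite. f 0 (hdist x)) \<le> ennreal C * (\<Sum>l\<le>k. wint CARD('n) p (ereal \<rho>) (f l))"
proof (cases "j = 0")
  case True
  have "hint p (ereal \<rho>) j (\<lambda>x::real^'n. f 0 (hdist x)) \<le> ennreal (radK TYPE('n)) * (\<Sum>l\<le>k. wint CARD('n) p (ereal \<rho>) (f l))"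
    if "smooth_fam (ivl (ereal \<rho>)) f" for f
    unfolding True using p member_le_sum[of 0 "{..k}" "\<lambda>l. wint CARD('n) p (ereal \<rho>) (f l)"]
    by (intro order_trans[OF hint_radial_le_1[OF that, of p 0]] mult_left_mono) auto
  then show ?thesis using radK_pos[where 'n='n] by (intro exI[of _ "radK TYPE('n)"]) (auto intro: less_imp_le)
next
  case False
  let ?N = "CARD('n)"
  have j1: "1 \<le> j" using False by simp
  define \<rho>' where "\<rho>' = tanh (\<rho> / 2)"
  have "\<rho>' < 1" unfolding \<rho>'_def by (rule tanh_real_lt_1)
  from gnorm_radial_bound[OF this j1, where 'n='n] obtain C where C: "C \<ge> 0"
    "\<And>f R x. smooth_fam (ivl R) f \<Longrightarrow> (x::real^'n) \<in> hball R - {0} \<Longrightarrow> norm x \<le> \<rho>' \<Longrightarrow>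
    gnorm j (\<lambda>x. f 0 (hdist x)) x \<le> C * (\<Sum>i=1..j. \<bar>f i (hdist x)\<bar> * norm x powr (- (real j - real i)))" by blast
  \<comment> \<open>Chosen so that \<open>c * hdist x \<le> norm x\<close> on the ball;
    \<open>c \<le> 1\<close> lets all powers of c be replaced by the worst one.\<close>
  define c where "c = 1 / (2 * cosh (\<rho> / 2))"
  have c: "0 < c" "c \<le> 1" using cosh_real_ge_1[of "\<rho> / 2"] by (auto simp: c_def field_simps)
  define B where "B = C * c powr (- real j)"
  have B: "B \<ge> 0" using C by (simp add: B_def)
  have "\<forall>i\<in>{1..j}. \<exists>A. A \<ge> 0 \<and> (\<forall>f. smooth_fam (ivl (ereal \<rho>)) f \<longrightarrow> flat f \<longrightarrow>
    Iw ?N p \<rho> (real (j - i)) (f i) \<le> ennreal A * (\<Sum>l\<le>k. wint ?N p (ereal \<rho>) (f l)))"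
  proof
    fix i assume "i \<in> {1..j}"
    then have "1 \<le> i" "i + (j - i) \<le> k" using j by auto
    from hardy_iterate[OF p _ N \<rho> this] show "\<exists>A. A \<ge> 0 \<and> (\<forall>f. smooth_fam (ivl (ereal \<rho>)) f \<longrightarrow> flat f \<longrightarrow>
      Iw ?N p \<rho> (real (j - i)) (f i) \<le> ennreal A * (\<Sum>l\<le>k. wint ?N p (ereal \<rho>) (f l)))"
      by (simp add: Suc_le_eq del: of_nat_diff)
  qed
  from bchoice[OF this] obtain A where A: "\<And>i. i \<in> {1..j} \<Longrightarrow> A i \<ge> 0"
    "\<And>i f. i \<in> {1..j} \<Longrightarrow> smooth_fam (ivl (ereal \<rho>)) f \<Longrightarrow> flat f \<Longrightarrow>
    Iw ?N p \<rho> (real (j - i)) (f i) \<le> ennreal (A i) * (\<Sum>l\<le>k. wint ?N p (ereal \<rho>) (f l))" by blast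
  define Q where "Q = radK TYPE('n) * ((real j powr p * B powr p) * (\<Sum>i=1..j. A i))"
  have "hint p (ereal \<rho>) j (\<lambda>x::real^'n. f 0 (hdist x)) \<le> ennreal Q * (\<Sum>l\<le>k. wint ?N p (ereal \<rho>) (f l))"
    if f: "smooth_fam (ivl (ereal \<rho>)) f" "flat f" for f
  proof -
    let ?S = "\<Sum>l\<le>k. wint ?N p (ereal \<rho>) (f l)"
    define h where "h t = (\<Sum>i=1..j. B * (\<bar>f i t\<bar> * t powr (- real (j - i))))" for t
    have hm: "set_borel_measurable lborel (ivl (ereal \<rho>)) h"
    proof -
      have "continuous_on (ivl (ereal \<rho>)) h" unfolding h_def
        by (intro continuous_intros smooth_fam_continuous[OF f(1)]) (auto simp: ivl_def)
      from borel_measurable_continuous_on_indicator[OF measurable_ivl this] show ?thesis by (simp add: set_borel_measurable_def)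
    qed
    have "hint p (ereal \<rho>) j (\<lambda>x::real^'n. f 0 (hdist x)) \<le> ennreal (radK TYPE('n)) * wint ?N p (ereal \<rho>) h"
    proof (rule hint_le_radial[OF hm])
      fix x :: "real^'n" assume x: "x \<in> hball (ereal \<rho>) - {0}"
      define t where "t = hdist x"
      have n: "norm x < 1" using x by (auto simp: hball_def)
      have t: "0 < t" "t < \<rho>" using hdist_in_ivl[OF x] by (auto simp: ivl_def t_def)
      have nx: "norm x = tanh (t / 2)" unfolding t_def by (rule tanh_half_hdist[OF n, symmetric])
      have ct: "c * t \<le> norm x" using tanh_half_ge[of t \<rho>] t by (simp add: nx c_def)
      have "gnorm j (\<lambda>x. f 0 (hdist x)) x \<le> C * (\<Sum>i=1..j. \<bar>f i t\<bar> * norm x powr (- (real j - real i)))"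
        unfolding t_def by (rule C(2)[OF f(1) x]) (use t in \<open>auto simp: nx \<rho>'_def\<close>)
      also have "\<dots> \<le> C * (\<Sum>i=1..j. \<bar>f i t\<bar> * (c powr (- real j) * t powr (- real (j - i))))"
      proof (intro mult_left_mono sum_mono C(1))
        fix i assume i: "i \<in> {1..j}"
        have "norm x powr (- (real j - real i)) \<le> (c * t) powr (- (real j - real i))"
          using ct c t i by (intro powr_mono2') auto
        also have "\<dots> = c powr (- (real j - real i)) * t powr (- real (j - i))"
          using c t i by (simp add: powr_mult of_nat_diff)
        also have "\<dots> \<le> c powr (- real j) * t powr (- real (j - i))"
          using c by (intro mult_right_mono powr_mono') auto
        finally show "norm x powr (- (real j - real i)) \<le> c powr (- real j) * t powr (- real (j - i))" .
      qed auto
      also have "\<dots> = h t" by (simp add: h_def B_def sum_distrib_left mult_ac)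
      finally show "gnorm j (\<lambda>x. f 0 (hdist x)) x \<le> \<bar>h (hdist x)\<bar>" by (simp add: t_def)
    qed (use p in auto)
    also have "wint ?N p (ereal \<rho>) h \<le> ennreal ((real j powr p * B powr p) * (\<Sum>i=1..j. A i)) * ?S"
    proof -
      have mi: "(\<lambda>t. ennreal (\<bar>f i t\<bar> powr p * t powr (- real (j - i) * p) * sinh t ^ (?N - 1)) * indicator (ivl (ereal \<rho>)) t) \<in> borel_measurable lborel" for i
      proof -
        have [measurable]: "(\<lambda>t. indicator (ivl (ereal \<rho>)) t * f i t) \<in> borel_measurable borel"
          using smooth_fam_measurable[OF f(1)] by (simp add: set_borel_measurable_def)
        have "(\<lambda>t. ennreal (\<bar>f i t\<bar> powr p * t powr (- real (j - i) * p) * sinh t ^ (?N - 1)) * indicator (ivl (ereal \<rho>)) t)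
          = (\<lambda>t. ennreal (\<bar>indicator (ivl (ereal \<rho>)) t * f i t\<bar> powr p * t powr (- real (j - i) * p) * sinh t ^ (?N - 1)) * indicator (ivl (ereal \<rho>)) t)"
          by (auto simp: fun_eq_iff indicator_def)
        also have "\<dots> \<in> borel_measurable lborel" by measurable
        finally show ?thesis .
      qed
      let ?g = "\<lambda>i t. ennreal (\<bar>f i t\<bar> powr p * t powr (- real (j - i) * p) * sinh t ^ (?N - 1)) * indicator (ivl (ereal \<rho>)) t"
      have "wint ?N p (ereal \<rho>) h \<le> (\<integral>\<^sup>+t. ennreal (real j powr p * B powr p) * (\<Sum>i=1..j. ?g i t) \<partial>lborel)"
        unfolding wint_def
      proof (intro nn_integral_mono)
        fix t
        show "ennreal (\<bar>h t\<bar> powr p * sinh t ^ (?N - 1)) * indicator (ivl (ereal \<rho>)) t \<le> ennreal (real j powr p * B powr p) * (\<Sum>i=1..j. ?g i t)"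
        proof (cases "t \<in> ivl (ereal \<rho>)")
          case True
          then have t: "t > 0" by (simp add: ivl_def)
          have "\<bar>h t\<bar> powr p \<le> real (card {1..j}) powr p * (\<Sum>i=1..j. \<bar>B * (\<bar>f i t\<bar> * t powr (- real (j - i)))\<bar> powr p)"
            unfolding h_def using p by (intro abs_sum_powr_le) auto
          also have "(\<Sum>i=1..j. \<bar>B * (\<bar>f i t\<bar> * t powr (- real (j - i)))\<bar> powr p) = (\<Sum>i=1..j. B powr p * (\<bar>f i t\<bar> powr p * t powr (- real (j - i) * p)))"
            using B by (intro sum.cong) (auto simp: abs_mult powr_mult powr_powr)
          finally have "\<bar>h t\<bar> powr p \<le> (real j powr p * B powr p) * (\<Sum>i=1..j. \<bar>f i t\<bar> powr p * t powr (- real (j - i) * p))"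
            by (simp add: sum_distrib_left[symmetric] mult.assoc)
          from mult_right_mono[OF this, of "sinh t ^ (?N - 1)"]
          have "\<bar>h t\<bar> powr p * sinh t ^ (?N - 1) \<le> (real j powr p * B powr p) * (\<Sum>i=1..j. \<bar>f i t\<bar> powr p * t powr (- real (j - i) * p) * sinh t ^ (?N - 1))"
            using t by (simp add: sum_distrib_right mult.assoc)
          then have "ennreal (\<bar>h t\<bar> powr p * sinh t ^ (?N - 1)) \<le> ennreal (real j powr p * B powr p) * ennreal (\<Sum>i=1..j. \<bar>f i t\<bar> powr p * t powr (- real (j - i) * p) * sinh t ^ (?N - 1))"
            using t by (subst ennreal_mult[symmetric]) (auto intro!: sum_nonneg ennreal_leI)
          also have "ennreal (\<Sum>i=1..j. \<bar>f i t\<bar> powr p * t powr (- real (j - i) * p) * sinh t ^ (?N - 1)) = (\<Sum>i=1..j. ?g i t)"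
            using t True by (subst sum_ennreal[symmetric]) auto
          finally show ?thesis using True by simp
        qed simp
      qed
      also have "\<dots> = ennreal (real j powr p * B powr p) * (\<Sum>i=1..j. \<integral>\<^sup>+t. ?g i t \<partial>lborel)"
      proof -
        have "(\<integral>\<^sup>+t. ennreal (real j powr p * B powr p) * (\<Sum>i=1..j. ?g i t) \<partial>lborel) = ennreal (real j powr p * B powr p) * (\<integral>\<^sup>+t. (\<Sum>i=1..j. ?g i t) \<partial>lborel)"
          by (rule nn_integral_cmult, rule borel_measurable_sum, rule mi)
        also have "(\<integral>\<^sup>+t. (\<Sum>i=1..j. ?g i t) \<partial>lborel) = (\<Sum>i=1..j. \<integral>\<^sup>+t. ?g i t \<partial>lborel)"
          by (rule nn_integral_sum, rule mi)
        finally show ?thesis .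
      qed
      also have "(\<Sum>i=1..j. \<integral>\<^sup>+t. ?g i t \<partial>lborel) = (\<Sum>i=1..j. Iw ?N p \<rho> (real (j - i)) (f i))"
        by (simp add: Iw_def)
      also have "\<dots> \<le> (\<Sum>i=1..j. ennreal (A i) * ?S)" using A(2)[OF _ f] by (intro sum_mono) auto
      also have "\<dots> = ennreal (\<Sum>i=1..j. A i) * ?S"
        using A(1) by (subst sum_ennreal[symmetric]) (auto simp: sum_distrib_right)
      finally have "wint ?N p (ereal \<rho>) h \<le> ennreal (real j powr p * B powr p) * (ennreal (\<Sum>i=1..j. A i) * ?S)" by (blast intro: mult_left_mono zero_le)
      also have "\<dots> = ennreal ((real j powr p * B powr p) * (\<Sum>i=1..j. A i)) * ?S"
        using A(1) by (subst (2) ennreal_mult) (auto intro!: sum_nonneg simp: mult.assoc)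
      finally show ?thesis .
    qed
    finally have "hint p (ereal \<rho>) j (\<lambda>x::real^'n. f 0 (hdist x)) \<le> ennreal (radK TYPE('n)) * (ennreal ((real j powr p * B powr p) * (\<Sum>i=1..j. A i)) * ?S)"
      by (blast intro: mult_left_mono zero_le)
    also have "\<dots> = ennreal Q * ?S"
      unfolding Q_def using radK_pos[where 'n='n] A(1) by (subst (2) ennreal_mult) (auto intro!: sum_nonneg mult_nonneg_nonneg simp: mult.assoc intro: less_imp_le)
    finally show ?thesis .
  qed
  moreover have "Q \<ge> 0" unfolding Q_def using radK_pos[where 'n='n] A(1) by (auto intro!: mult_nonneg_nonneg sum_nonneg intro: less_imp_le)
  ultimately show ?thesis by blast
qed

section \<open>Families of derivatives and cutoffs\<close>

text \<open>The Leibniz rule as a binary recursion instead of a binomial sum: each step shifts one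
  of the two families.\<close>

fun prodfam :: "nat \<Rightarrow> (nat \<Rightarrow> real \<Rightarrow> real) \<Rightarrow> (nat \<Rightarrow> real \<Rightarrow> real) \<Rightarrow> real \<Rightarrow> real" where
  "prodfam 0 f g t = f 0 t * g 0 t"
| "prodfam (Suc m) f g t = prodfam m (\<lambda>i. f (Suc i)) g t + prodfam m f (\<lambda>i. g (Suc i)) t"

lemma smooth_fam_shift: "smooth_fam S f \<Longrightarrow> smooth_fam S (\<lambda>i. f (Suc i))"
  by (simp add: smooth_fam_def)

lemma smooth_fam_prodfam:
  assumes "smooth_fam S f" "smooth_fam S g"
  shows "smooth_fam S (\<lambda>m. prodfam m f g)"
proof -
  have "(prodfam m f g has_real_derivative prodfam (Suc m) f g t) (at t)"
    if "smooth_fam S f" "smooth_fam S g" "t \<in> S" for m t f g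
    using that
  proof (induction m arbitrary: f g)
    case 0
    have "((\<lambda>t. f 0 t * g 0 t) has_real_derivative f (Suc 0) t * g 0 t + g (Suc 0) t * f 0 t) (at t)"
      by (rule DERIV_mult[OF smooth_famD[OF 0(1,3)] smooth_famD[OF 0(2,3)]])
    moreover have "prodfam 0 f g = (\<lambda>t. f 0 t * g 0 t)" by (rule ext) simp
    ultimately show ?case by (simp add: algebra_simps)
  next
    case (Suc m)
    have "((\<lambda>t. prodfam m (\<lambda>i. f (Suc i)) g t + prodfam m f (\<lambda>i. g (Suc i)) t) has_real_derivative
      prodfam (Suc m) (\<lambda>i. f (Suc i)) g t + prodfam (Suc m) f (\<lambda>i. g (Suc i)) t) (at t)"
      by (intro DERIV_add Suc.IH smooth_fam_shift Suc.prems)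
    moreover have "prodfam (Suc m) f g = (\<lambda>t. prodfam m (\<lambda>i. f (Suc i)) g t + prodfam m f (\<lambda>i. g (Suc i)) t)" by (rule ext) simp
    ultimately show ?case by simp
  qed
  then show ?thesis using assms unfolding smooth_fam_def by blast
qed

text \<open>The recursion has \<open>2 ^ m\<close> leaves. The growth \<open>n ^ i\<close> is that
  of a cutoff rescaled to the length 1 / n.\<close>

lemma prodfam_bound:
  assumes "\<And>i. i \<le> m \<Longrightarrow> \<bar>f i t\<bar> \<le> A * n ^ i" "\<And>i. i \<le> m \<Longrightarrow> \<bar>g i t\<bar> \<le> B" "0 \<le> A" "0 \<le> B" "1 \<le> n"
  shows "\<bar>prodfam m f g t\<bar> \<le> 2 ^ m * A * B * n ^ m"
  using assms
proof (induction m arbitrary: f g A)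
  case 0
  then show ?case using mult_mono[of "\<bar>f 0 t\<bar>" A "\<bar>g 0 t\<bar>" B] by (simp add: abs_mult)
next
  case (Suc m)
  have 1: "\<bar>prodfam m (\<lambda>i. f (Suc i)) g t\<bar> \<le> 2 ^ m * (A * n) * B * n ^ m"
    using Suc.prems(1)[of "Suc _"] Suc.prems by (intro Suc.IH) (auto simp: mult.assoc)
  have 2: "\<bar>prodfam m f (\<lambda>i. g (Suc i)) t\<bar> \<le> 2 ^ m * A * B * n ^ m"
    using Suc.prems by (intro Suc.IH) auto
  also have "\<dots> \<le> 2 ^ m * A * B * n ^ m * n"
    using mult_left_mono[of 1 n "2 ^ m * A * B * n ^ m"] Suc.prems by simp
  finally show ?case using 1 by (simp add: algebra_simps)
qed

lemma prodfam_zero: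
  assumes "\<And>i. i \<le> m \<Longrightarrow> f i t = 0"
  shows "prodfam m f g t = 0"
  using assms by (induction m arbitrary: f g) auto

lemma prodfam_zero_right:
  assumes "\<And>i. i \<le> m \<Longrightarrow> g i t = 0"
  shows "prodfam m f g t = 0"
  using assms by (induction m arbitrary: f g) auto

text \<open>The constant 1 has only a zeroth member, so subtracting it from the cutoff subtracts g
  itself from the product. The error of a cutoff thereby becomes a product that vanishes where the
  cutoff is 1.\<close>

lemma prodfam_diff_one: "prodfam m (\<lambda>i t. f i t - (if i = 0 then 1 else 0)) g t = prodfam m f g t - g m t"
proof (induction m arbitrary: g)
  case (Suc m)
  have "prodfam (Suc m) (\<lambda>i t. f i t - (if i = 0 then 1 else 0)) g t
    = prodfam m (\<lambda>i. f (Suc i)) g t + prodfam m (\<lambda>i t. f i t - (if i = 0 then 1 else 0)) (\<lambda>i. g (Suc i)) t"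
    by simp
  then show ?case unfolding Suc by simp
qed (simp add: algebra_simps)

lemma smooth_fam_affine:
  assumes "smooth_fam UNIV f"
  shows "smooth_fam UNIV (\<lambda>i t. c ^ i * f i (c * t + d))"
  unfolding smooth_fam_def
proof (intro allI ballI)
  fix i t
  have "((\<lambda>t. f i (c * t + d)) has_real_derivative f (Suc i) (c * t + d) * c) (at t)"
    by (rule DERIV_chain2[OF smooth_famD[OF assms]]) (auto intro!: derivative_eq_intros)
  from DERIV_cmult[OF this, of "c ^ i"]
  show "((\<lambda>t. c ^ i * f i (c * t + d)) has_real_derivative c ^ Suc i * f (Suc i) (c * t + d)) (at t)"
    by (simp add: mult_ac)
qed

lemma smooth_fam_diff: "smooth_fam S f \<Longrightarrow> smooth_fam S g \<Longrightarrow> smooth_fam S (\<lambda>i t. f i t - g i t)"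
  unfolding smooth_fam_def by (auto intro!: DERIV_diff)

lemma smooth_fam_poly: "smooth_fam S (\<lambda>i. poly ((pderiv ^^ i) q))"
  unfolding smooth_fam_def by (auto intro: poly_DERIV)

lemma ex_antideriv:
  fixes f :: "real \<Rightarrow> real"
  assumes "continuous_on UNIV f"
  shows "\<exists>G. (\<forall>t. (G has_real_derivative f t) (at t)) \<and> G \<rho> = c"
proof -
  define G where "G u = (LBINT y=0..u. f y)" for u :: real
  have "(G has_real_derivative f x) (at x)" for x
  proof -
    let ?b = "\<bar>x\<bar> + 1"
    have "((\<lambda>u. LBINT y=0..u. f y) has_vector_derivative f x) (at x within {-?b..?b})"
      using interval_integral_FTC2[of "-?b" 0 ?b f x] continuous_on_subset[OF assms, of "{-?b..?b}"]
      by (simp add: zero_ereal_def)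
    moreover have "at x within {-?b..?b} = at x" by (rule at_within_interior) auto
    ultimately show ?thesis unfolding G_def has_real_derivative_iff_has_vector_derivative by simp
  qed
  then have "((\<lambda>t. G t + (c - G \<rho>)) has_real_derivative f t) (at t)" for t
    by (auto intro!: derivative_eq_intros)
  then show ?thesis by (intro exI[of _ "\<lambda>t. G t + (c - G \<rho>)"]) auto
qed

lemma ex_antideriv_fam:
  assumes "smooth_fam UNIV F"
  shows "\<exists>G. smooth_fam UNIV G \<and> (\<forall>i. G (Suc i) = F i) \<and> G 0 \<rho> = c"
proof -
  obtain G0 where G0: "\<And>t. (G0 has_real_derivative F 0 t) (at t)" "G0 \<rho> = c"
    using ex_antideriv[OF smooth_fam_continuous[OF assms]] by blast
  define G where "G i = (case i of 0 \<Rightarrow> G0 | Suc m \<Rightarrow> F m)" for i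
  have "(G i has_real_derivative G (Suc i) t) (at t)" for i t
    using G0 smooth_famD[OF assms] by (cases i) (auto simp: G_def)
  then show ?thesis using G0(2) by (intro exI[of _ G]) (auto simp: G_def smooth_fam_def)
qed

section \<open>A smooth cutoff function\<close>

definition flatexp :: "real poly \<Rightarrow> real \<Rightarrow> real" where
  "flatexp q t = (if 0 < t then poly q (1 / t) * exp (- (1 / t)) else 0)"

lemma poly_times_exp_minus_tendsto_0:
  fixes q :: "real poly"
  shows "((\<lambda>z. poly q z * exp (- z)) \<longlongrightarrow> 0) at_top"
proof -
  have "((\<lambda>z. \<Sum>i\<le>degree q. coeff q i * (z ^ i / exp z)) \<longlongrightarrow> (\<Sum>i\<le>degree q. coeff q i * 0)) at_top"
    by (intro tendsto_sum tendsto_mult tendsto_const tendsto_power_div_exp_0)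
  moreover have "(\<lambda>z. poly q z * exp (- z)) = (\<lambda>z. \<Sum>i\<le>degree q. coeff q i * (z ^ i / exp z))"
    by (simp add: fun_eq_iff poly_altdef sum_distrib_right exp_minus divide_inverse mult.assoc)
  ultimately show ?thesis by simp
qed

text \<open>With z = 1 / t the class q(z) exp(-z) is closed under differentiation, q becoming z^2 (q
  - q'). At 0 the right difference quotient is z q(z) exp(-z), which decays as z grows.\<close>

lemma flatexp_deriv: "(flatexp q has_real_derivative flatexp ([:0, 0, 1:] * (q - pderiv q)) t) (at t)"
proof -
  consider "t > 0" | "t < 0" | "t = 0" by linarith
  then show ?thesis
  proof cases
    case 1
    have i: "((\<lambda>t. 1 / t) has_real_derivative - (1 / t) * (1 / t)) (at t)"
      using 1 by (auto intro!: derivative_eq_intros simp: field_simps)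
    have "((\<lambda>t. poly q (1 / t)) has_real_derivative poly (pderiv q) (1 / t) * (- (1 / t) * (1 / t))) (at t)"
      by (rule DERIV_chain2[OF poly_DERIV i])
    moreover have "((\<lambda>t. exp (- (1 / t))) has_real_derivative exp (- (1 / t)) * (- (- (1 / t) * (1 / t)))) (at t)"
      by (rule DERIV_chain2[OF DERIV_exp DERIV_minus[OF i]])
    ultimately have "((\<lambda>t. poly q (1 / t) * exp (- (1 / t))) has_real_derivative
       poly (pderiv q) (1 / t) * (- (1 / t) * (1 / t)) * exp (- (1 / t)) + exp (- (1 / t)) * (- (- (1 / t) * (1 / t))) * poly q (1 / t)) (at t)"
      by (rule DERIV_mult)
    also have "poly (pderiv q) (1 / t) * (- (1 / t) * (1 / t)) * exp (- (1 / t)) + exp (- (1 / t)) * (- (- (1 / t) * (1 / t))) * poly q (1 / t)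
       = flatexp ([:0, 0, 1:] * (q - pderiv q)) t"
      using 1 by (simp add: flatexp_def algebra_simps)
    finally have "((\<lambda>t. poly q (1 / t) * exp (- (1 / t))) has_real_derivative flatexp ([:0, 0, 1:] * (q - pderiv q)) t) (at t)" .
    moreover have "\<forall>\<^sub>F s in nhds t. poly q (1 / s) * exp (- (1 / s)) = flatexp q s"
      using eventually_nhds_in_open[of "{0<..}" t] 1 by (auto elim!: eventually_mono simp: flatexp_def)
    ultimately show ?thesis using DERIV_cong_ev[OF refl _ refl, of "\<lambda>t. poly q (1 / t) * exp (- (1 / t))" "flatexp q" t] by blast
  next
    case 2
    have "\<forall>\<^sub>F s in nhds t. 0 = flatexp q s"
      using eventually_nhds_in_open[of "{..<0}" t] 2 by (auto elim!: eventually_mono simp: flatexp_def)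
    from DERIV_cong_ev[OF refl this refl, of 0] have "(flatexp q has_real_derivative 0) (at t)" by simp
    then show ?thesis using 2 by (simp add: flatexp_def[of _ t])
  next
    case 3
    have r: "((\<lambda>h. poly ([:0, 1:] * q) (inverse h) * exp (- inverse h)) \<longlongrightarrow> 0) (at_right 0)"
      by (rule filterlim_compose[OF poly_times_exp_minus_tendsto_0 filterlim_inverse_at_top_right])
    have "((\<lambda>h. (flatexp q (0 + h) - flatexp q 0) / h) \<longlongrightarrow> 0) (at_right 0)"
      by (rule Lim_transform_eventually[OF r])
        (auto simp: eventually_at_right_field flatexp_def field_simps intro!: exI[of _ 1])
    moreover have "((\<lambda>h. (flatexp q (0 + h) - flatexp q 0) / h) \<longlongrightarrow> 0) (at_left 0)"
      by (rule Lim_transform_eventually[OF tendsto_const])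
        (auto simp: eventually_at_left_field flatexp_def intro!: exI[of _ "-1"])
    ultimately have "((\<lambda>h. (flatexp q (0 + h) - flatexp q 0) / h) \<longlongrightarrow> 0) (at 0)" by (simp add: filterlim_split_at)
    then show ?thesis using 3 by (simp add: DERIV_def flatexp_def)
  qed
qed

text \<open>A primitive of the bump e(t - 1) e(2 - t), where e is the flat exponential, divided by
  its total mass. The bump is positive exactly between 1 and 2, which makes the mass positive and
  the primitive constant elsewhere.\<close>

lemma ex_cutoff:
  "\<exists>cut. smooth_fam UNIV cut \<and> (\<forall>t\<le>1. cut 0 t = 0) \<and> (\<forall>t\<ge>2. cut 0 t = 1) \<and> (\<forall>t. 0 \<le> cut 0 t \<and> cut 0 t \<le> (1::real)) \<and>
     (\<forall>i\<ge>1. \<forall>t. t \<notin> {1<..<2} \<longrightarrow> cut i t = 0)"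
proof -
  define Q where "Q i = ((\<lambda>q. [:0, 0, 1:] * (q - pderiv q)) ^^ i) [:1::real:]" for i
  define e where "e i = flatexp (Q i)" for i
  have e: "smooth_fam UNIV e"
    unfolding smooth_fam_def e_def using flatexp_deriv by (simp add: Q_def)
  have e0: "e i t = 0" if "t \<le> 0" for i t using that by (simp add: e_def flatexp_def)
  have epos: "e 0 t > 0" if "t > 0" for t using that by (simp add: e_def flatexp_def Q_def)
  have e1: "smooth_fam UNIV (\<lambda>i t. 1 ^ i * e i (1 * t + (- 1)))" and e2: "smooth_fam UNIV (\<lambda>i t. (- 1) ^ i * e i ((- 1) * t + 2))"
    by (rule smooth_fam_affine[OF e])+
  define \<beta> where "\<beta> m = prodfam m (\<lambda>i t. 1 ^ i * e i (1 * t + (- 1))) (\<lambda>i t. (- 1) ^ i * e i ((- 1) * t + 2))" for m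
  have \<beta>: "smooth_fam UNIV \<beta>" unfolding \<beta>_def by (rule smooth_fam_prodfam[OF e1 e2])
  have \<beta>0: "\<beta> m t = 0" if "t \<notin> {1<..<2}" for m t
  proof (cases "t \<le> 1")
    case True
    then show ?thesis unfolding \<beta>_def by (intro prodfam_zero) (simp add: e0)
  next
    case False
    then have "t \<ge> 2" using that by auto
    then show ?thesis unfolding \<beta>_def by (intro prodfam_zero_right) (simp add: e0)
  qed
  have \<beta>pos: "\<beta> 0 t > 0" if "t \<in> {1<..<2}" for t using that by (simp add: \<beta>_def epos)
  have \<beta>nn: "\<beta> 0 t \<ge> 0" for t using \<beta>0[of t 0] \<beta>pos[of t] by (cases "t \<in> {1<..<2}") auto
  obtain G where G: "smooth_fam UNIV G" "\<And>i. G (Suc i) = \<beta> i" "G 0 1 = 0"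
    using ex_antideriv_fam[OF \<beta>, of 1 0] by blast
  have dG: "(G 0 has_real_derivative \<beta> 0 t) (at t)" for t using smooth_famD[OF G(1), of t 0] by (simp add: G(2))
  have mono: "G 0 s \<le> G 0 t" if "s \<le> t" for s t
    by (rule DERIV_nonneg_imp_nondecreasing[OF that]) (use dG \<beta>nn in blast)
  have const1: "G 0 t = 0" if "t \<le> 1" for t
  proof -
    have "G 0 1 = G 0 t"
    proof (cases "t = 1")
      case False
      then have "t < 1" using that by simp
      from MVT2[OF this, of "G 0" "\<beta> 0"] dG obtain z where "t < z" "z < 1" "G 0 1 - G 0 t = (1 - t) * \<beta> 0 z" by blast
      then show ?thesis using \<beta>0[of z 0] by simp
    qed simp
    then show ?thesis using G(3) by simp
  qed
  have const2: "G 0 t = G 0 2" if "2 \<le> t" for t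
  proof (cases "t = 2")
    case False
    then have "2 < t" using that by simp
    from MVT2[OF this, of "G 0" "\<beta> 0"] dG obtain z where "2 < z" "z < t" "G 0 t - G 0 2 = (t - 2) * \<beta> 0 z" by blast
    then show ?thesis using \<beta>0[of z 0] by simp
  qed simp
  define Z where "Z = G 0 2"
  have Z: "Z > 0"
  proof -
    from MVT2[of 1 2 "G 0" "\<beta> 0"] dG obtain z where "1 < z" "z < 2" "G 0 2 - G 0 1 = (2 - 1) * \<beta> 0 z" by force
    then show ?thesis using \<beta>pos[of z] G(3) by (simp add: Z_def)
  qed
  define cut where "cut i t = G i t / Z" for i t
  have s: "smooth_fam UNIV cut" unfolding smooth_fam_def cut_def
    using smooth_famD[OF G(1)] by (auto intro!: DERIV_cdivide)
  have b: "0 \<le> cut 0 t \<and> cut 0 t \<le> 1" for t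
  proof -
    have "0 \<le> G 0 t" using const1[of t] mono[of 1 t] G(3) by (cases "t \<le> 1") auto
    moreover have "G 0 t \<le> Z" unfolding Z_def using const2[of t] mono[of t 2] by (cases "2 \<le> t") auto
    ultimately show ?thesis using Z by (simp add: cut_def)
  qed
  have i: "cut i t = 0" if "i \<ge> 1" "t \<notin> {1<..<2}" for i t
    using that \<beta>0[of t "i - 1"] G(2)[of "i - 1"] by (simp add: cut_def)
  have c1: "cut 0 t = 0" if "t \<le> 1" for t using const1[OF that] by (simp add: cut_def)
  have c2: "cut 0 t = 1" if "2 \<le> t" for t using const2[OF that] Z by (simp add: cut_def Z_def)
  show ?thesis
    by (intro exI[of _ cut] conjI allI impI s c1 c2 i b[THEN conjunct1] b[THEN conjunct2])
qed

section \<open>Approximation on the interval\<close>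

text \<open>Integrating from the outer end expresses the value at t through points s beyond t, where
  the weight is at least as large. Jensen's inequality contributes
  \<open>\<rho> powr (p - 1)\<close> and the length of the range of t another \<rho>.\<close>

lemma wint_antideriv_le:
  fixes e g :: "real \<Rightarrow> real"
  assumes p: "1 \<le> p" and \<rho>: "0 < \<rho>" and e: "continuous_on UNIV e"
    and g: "\<And>t. (g has_real_derivative e t) (at t)" and g0: "g \<rho> = 0"
  shows "wint N p (ereal \<rho>) g \<le> ennreal (\<rho> powr p) * wint N p (ereal \<rho>) e"
proof -
  have [measurable]: "e \<in> borel_measurable borel" by (rule borel_measurable_continuous_onI[OF e])
  have iv: "ivl (ereal \<rho>) = {0<..<\<rho>}" by (auto simp: ivl_def)
  \<comment> \<open>The integrand over 0 < t <= s <= \<rho> left by Jensen's inequality; after the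
    exchange of integrals \<open>sinh t\<close> is bounded by \<open>sinh s\<close>.\<close>
  let ?k = "\<lambda>t s. ennreal (sinh t ^ (N - 1)) * ennreal (\<bar>e s\<bar> powr p) * (if 0 < t \<and> t \<le> s \<and> s \<le> \<rho> then 1 else 0)"
  have jensen: "ennreal (\<bar>g t\<bar> powr p) \<le> ennreal (\<rho> powr (p - 1)) * (\<integral>\<^sup>+s\<in>{t..\<rho>}. ennreal (\<bar>e s\<bar> powr p) \<partial>lborel)"
    if t: "0 < t" "t < \<rho>" for t
  proof -
    let ?M = "restrict_space lborel {t..\<rho>}"
    have i: "set_integrable lborel {t..\<rho>} (\<lambda>s. \<bar>e s\<bar>)"
      by (intro borel_integrable_atLeastAtMost' continuous_on_rabs continuous_on_subset[OF e]) auto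
    have I: "integrable ?M (\<lambda>s. \<bar>e s\<bar>)"
      using i by (simp add: integrable_restrict_space set_integrable_def)
    have V: "emeasure ?M (space ?M) = ennreal (\<rho> - t)" using t by (simp add: emeasure_restrict_space space_restrict_space)
    have "(e has_integral (g \<rho> - g t)) {t..\<rho>}"
      by (rule fundamental_theorem_of_calculus) (use t g in \<open>auto simp: has_real_derivative_iff_has_vector_derivative[symmetric] has_field_derivative_at_within\<close>)
    then have "\<bar>g t\<bar> = \<bar>integral {t..\<rho>} e\<bar>" using g0 by (simp add: integral_unique)
    also have "\<dots> \<le> integral {t..\<rho>} (\<lambda>s. \<bar>e s\<bar>)"
      using integral_norm_bound_integral[of e "{t..\<rho>}" "\<lambda>s. \<bar>e s\<bar>"] continuous_on_subset[OF e]
      by (simp add: integrable_continuous_real continuous_on_rabs)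
    also have "\<dots> = (LINT s:{t..\<rho>}|lborel. \<bar>e s\<bar>)" by (rule set_borel_integral_eq_integral(2)[OF i, symmetric])
    also have "\<dots> = (\<integral>s. \<bar>e s\<bar> \<partial>?M)" by (simp add: integral_restrict_space set_lebesgue_integral_def)
    finally have "\<bar>g t\<bar> powr p \<le> (\<integral>s. \<bar>e s\<bar> \<partial>?M) powr p" using p by (intro powr_mono2) auto
    then have "ennreal (\<bar>g t\<bar> powr p) \<le> ennreal ((\<integral>s. \<bar>e s\<bar> \<partial>?M) powr p)" by (rule ennreal_leI)
    also have "\<dots> \<le> ennreal ((\<rho> - t) powr (p - 1)) * (\<integral>\<^sup>+s. ennreal (\<bar>e s\<bar> powr p) \<partial>?M)"
      by (rule powr_integral_le[OF I _ p V]) (use t in auto)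
    also have "\<dots> \<le> ennreal (\<rho> powr (p - 1)) * (\<integral>\<^sup>+s. ennreal (\<bar>e s\<bar> powr p) \<partial>?M)"
      using t p by (intro mult_right_mono ennreal_leI powr_mono2) auto
    also have "(\<integral>\<^sup>+s. ennreal (\<bar>e s\<bar> powr p) \<partial>?M) = (\<integral>\<^sup>+s\<in>{t..\<rho>}. ennreal (\<bar>e s\<bar> powr p) \<partial>lborel)"
      by (rule nn_integral_restrict_space) simp
    finally show ?thesis .
  qed
  have "wint N p (ereal \<rho>) g \<le> (\<integral>\<^sup>+t. ennreal (\<rho> powr (p - 1)) * (\<integral>\<^sup>+s. ?k t s \<partial>lborel) \<partial>lborel)"
    unfolding wint_def iv
  proof (rule nn_integral_mono)
    fix t
    show "ennreal (\<bar>g t\<bar> powr p * sinh t ^ (N - 1)) * indicator {0<..<\<rho>} t \<le> ennreal (\<rho> powr (p - 1)) * (\<integral>\<^sup>+s. ?k t s \<partial>lborel)"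
    proof (cases "t \<in> {0<..<\<rho>}")
      case True
      then have t: "0 < t" "t < \<rho>" by auto
      have "(\<integral>\<^sup>+s. ?k t s \<partial>lborel) = (\<integral>\<^sup>+s. ennreal (sinh t ^ (N - 1)) * (ennreal (\<bar>e s\<bar> powr p) * indicator {t..\<rho>} s) \<partial>lborel)"
        using t by (intro nn_integral_cong) (auto simp: indicator_def)
      also have "\<dots> = ennreal (sinh t ^ (N - 1)) * (\<integral>\<^sup>+s\<in>{t..\<rho>}. ennreal (\<bar>e s\<bar> powr p) \<partial>lborel)"
        by (rule nn_integral_cmult) measurable
      finally have "ennreal (\<rho> powr (p - 1)) * (\<integral>\<^sup>+s. ?k t s \<partial>lborel) = ennreal (sinh t ^ (N - 1)) * (ennreal (\<rho> powr (p - 1)) * (\<integral>\<^sup>+s\<in>{t..\<rho>}. ennreal (\<bar>e s\<bar> powr p) \<partial>lborel))"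
        by (simp add: mult_ac)
      then show ?thesis using True mult_left_mono[OF jensen[OF t], of "ennreal (sinh t ^ (N - 1))"]
        by (simp add: ennreal_mult mult.commute)
    qed simp
  qed
  also have "\<dots> = ennreal (\<rho> powr (p - 1)) * (\<integral>\<^sup>+t. (\<integral>\<^sup>+s. ?k t s \<partial>lborel) \<partial>lborel)"
    by (rule nn_integral_cmult) measurable
  also have "(\<integral>\<^sup>+t. (\<integral>\<^sup>+s. ?k t s \<partial>lborel) \<partial>lborel) = (\<integral>\<^sup>+s. (\<integral>\<^sup>+t. ?k t s \<partial>lborel) \<partial>lborel)"
    by (rule lborel_pair.Fubini'[symmetric]) measurable
  also have "\<dots> \<le> (\<integral>\<^sup>+s. ennreal \<rho> * (ennreal (\<bar>e s\<bar> powr p * sinh s ^ (N - 1)) * indicator {0<..<\<rho>} s) \<partial>lborel)"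
  proof (rule nn_integral_mono_AE)
    show "AE s in lborel. (\<integral>\<^sup>+t. ?k t s \<partial>lborel) \<le> ennreal \<rho> * (ennreal (\<bar>e s\<bar> powr p * sinh s ^ (N - 1)) * indicator {0<..<\<rho>} s)"
      using AE_lborel_singleton[of \<rho>]
    proof eventually_elim
      case (elim s)
      show ?case
      proof (cases "s \<in> {0<..<\<rho>}")
        case True
        have "(\<integral>\<^sup>+t. ?k t s \<partial>lborel) \<le> (\<integral>\<^sup>+t. ennreal (\<bar>e s\<bar> powr p * sinh s ^ (N - 1)) * indicator {0..s} t \<partial>lborel)"
          using True by (intro nn_integral_mono)
            (auto simp: indicator_def ennreal_mult[symmetric] mult.commute[of "sinh _ ^ _"] intro!: ennreal_leI mult_left_mono power_mono)
        also have "\<dots> = ennreal (\<bar>e s\<bar> powr p * sinh s ^ (N - 1)) * ennreal s"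
          using True by (subst nn_integral_cmult_indicator) auto
        also have "\<dots> \<le> ennreal (\<bar>e s\<bar> powr p * sinh s ^ (N - 1)) * ennreal \<rho>"
          using True by (intro mult_left_mono ennreal_leI) auto
        finally show ?thesis using True by (simp add: mult.commute)
      next
        case False
        then have z: "?k t s = 0" for t using elim by auto
        have "(\<integral>\<^sup>+t. ?k t s \<partial>lborel) = 0" by (simp only: z nn_integral_const mult_zero_left)
        then show ?thesis by simp
      qed
    qed
  qed
  also have "\<dots> = ennreal \<rho> * wint N p (ereal \<rho>) e"
    unfolding wint_def iv by (rule nn_integral_cmult) measurable
  finally have "wint N p (ereal \<rho>) g \<le> ennreal (\<rho> powr (p - 1)) * (ennreal \<rho> * wint N p (ereal \<rho>) e)" by (blast intro: mult_left_mono zero_le)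
  also have "\<dots> = ennreal (\<rho> powr (p - 1) * \<rho>) * wint N p (ereal \<rho>) e" using \<rho> by (simp add: ennreal_mult mult.assoc)
  also have "\<rho> powr (p - 1) * \<rho> = \<rho> powr p" using powr_mult_base[of \<rho> "p - 1"] \<rho> by (simp add: mult.commute)
  finally show ?thesis .
qed

section \<open>Density of polynomials in the weighted space\<close>

lemma wint_bounded:
  assumes \<rho>: "0 < \<rho>" and p: "0 \<le> p" and b: "\<And>t. t \<in> ivl (ereal \<rho>) \<Longrightarrow> \<bar>f t\<bar> \<le> c"
  shows "wint N p (ereal \<rho>) f \<le> ennreal (c powr p * (sinh \<rho> ^ (N - 1) * \<rho>))"
proof -
  have "wint N p (ereal \<rho>) f \<le> (\<integral>\<^sup>+t. ennreal (c powr p * sinh \<rho> ^ (N - 1)) * indicator {0..\<rho>} t \<partial>lborel)"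
    unfolding wint_def using b p
    by (intro nn_integral_mono) (auto simp: indicator_def ivl_def intro!: ennreal_leI mult_mono powr_mono2 power_mono)
  also have "\<dots> = ennreal (c powr p * sinh \<rho> ^ (N - 1)) * ennreal \<rho>"
    using \<rho> by (subst nn_integral_cmult_indicator) auto
  finally show ?thesis using \<rho> by (simp add: ennreal_mult[symmetric] mult.assoc)
qed

text \<open>Truncating continuous approximants at the level \<open>M\<close> preserves convergence,
  because the limit itself has values between \<open>- M\<close> and \<open>M\<close>.\<close>

lemma bounded_measurable_continuous_approx:
  fixes \<sigma> :: "real \<Rightarrow> real"
  assumes \<sigma>: "\<sigma> \<in> borel_measurable borel" and b: "\<And>t. \<bar>\<sigma> t\<bar> \<le> M"
  obtains g where "\<And>n. continuous_on UNIV (g n)" "\<And>n t. \<bar>g n t\<bar> \<le> M" "AE t in lborel. (\<lambda>n. g n t) \<longlonglongrightarrow> \<sigma> t"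
proof -
  have "\<sigma> \<in> borel_measurable lebesgue" using \<sigma> by (simp add: measurable_completion)
  then have "\<sigma> measurable_on UNIV" by (intro lebesgue_measurable_imp_measurable_on_real) auto
  then obtain N h where h: "negligible N" "\<And>n. continuous_on UNIV (h n)" "\<And>x. x \<notin> N \<Longrightarrow> (\<lambda>n. h n x) \<longlonglongrightarrow> \<sigma> x"
    unfolding measurable_on_def by auto
  define g where "g n t = max (- M) (min M (h n t))" for n :: nat and t
  have M: "0 \<le> M" using b[of 0] by (meson abs_ge_zero order_trans)
  have "AE t in lebesgue. t \<notin> N" using h(1) by (simp add: negligible_iff_null_sets AE_not_in)
  then have ae: "AE t in lborel. t \<notin> N" by (simp add: AE_completion_iff)
  show thesis
  proof (rule that[of g])
    show "continuous_on UNIV (g n)" for n unfolding g_def by (intro continuous_intros h)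
    show "\<bar>g n t\<bar> \<le> M" for n t using M by (auto simp: g_def)
    show "AE t in lborel. (\<lambda>n. g n t) \<longlonglongrightarrow> \<sigma> t" using ae
    proof eventually_elim
      case (elim t)
      have "(\<lambda>n. g n t) \<longlonglongrightarrow> max (- M) (min M (\<sigma> t))" unfolding g_def by (intro tendsto_intros h elim)
      moreover have "max (- M) (min M (\<sigma> t)) = \<sigma> t" using b[of t] by auto
      ultimately show ?case by simp
    qed
  qed
qed

lemma Weierstrass_poly:
  fixes g :: "real \<Rightarrow> real"
  assumes "continuous_on {a..b} g" "0 < e"
  shows "\<exists>q. \<forall>t\<in>{a..b}. \<bar>g t - poly q t\<bar> < e"
proof -
  obtain h where h: "real_polynomial_function h" "\<And>t. t \<in> {a..b} \<Longrightarrow> \<bar>g t - h t\<bar> < e"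
    using Stone_Weierstrass_real_polynomial_function[OF _ assms] by auto
  from h(1) obtain c n where hc: "h = (\<lambda>x. \<Sum>i\<le>n. c i * x ^ i)" unfolding real_polynomial_function_iff_sum by blast
  define q where "q = (\<Sum>i\<le>n. monom (c i) i)"
  have "poly q t = h t" for t by (simp add: q_def hc poly_sum poly_monom)
  then show ?thesis using h(2) by (intro exI[of _ q]) auto
qed

text \<open>Three approximations: truncation of the values, continuous functions, polynomials. The
  first two converge by dominated convergence, the last uniformly on the bounded interval.\<close>

lemma poly_dense:
  assumes p: "1 \<le> p" and \<rho>: "0 < \<rho>" and w: "set_borel_measurable lborel (ivl (ereal \<rho>)) w"
    and fin: "wint N p (ereal \<rho>) w < \<infinity>" and e: "0 < e"
  shows "\<exists>q. wint N p (ereal \<rho>) (\<lambda>t. poly q t - w t) < ennreal e"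
proof -
  let ?R = "ereal \<rho>"
  define W where "W t = indicator (ivl ?R) t * w t" for t
  have W[measurable]: "W \<in> borel_measurable borel" using w unfolding W_def by (simp add: set_borel_measurable_def)
  have sbm: "set_borel_measurable lborel (ivl ?R) h" if "h \<in> borel_measurable borel" for h :: "real \<Rightarrow> real"
    using that unfolding set_borel_measurable_def by simp
  have wW: "wint N p ?R (\<lambda>t. h t - w t) = wint N p ?R (\<lambda>t. h t - W t)" for h
    by (rule wint_cong) (simp add: W_def)
  have wint_m: "wint N p ?R h = (\<integral>\<^sup>+t. ennreal (\<bar>h t\<bar> powr p) \<partial>wmeas N ?R)" if [measurable]: "h \<in> borel_measurable borel" for h
    unfolding wint_def by (subst nn_integral_wmeas, measurable, intro nn_integral_cong) (auto simp: indicator_def ivl_def ennreal_mult'')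
  define V where "V n t = max (- real n) (min (real n) (W t))" for n :: nat and t
  have V[measurable]: "V n \<in> borel_measurable borel" for n unfolding V_def by measurable
  \<comment> \<open>Two errors of size c pass through two applications of \<open>wint_add_le\<close>
    and together cost e / 4; the polynomial error costs another e / 4.\<close>
  define c where "c = e / (8 * 2 powr p * 2 powr p)"
  have c: "c > 0" using e by (simp add: c_def)
  have lim1: "(\<lambda>n. wint N p ?R (\<lambda>t. V n t - W t)) \<longlonglongrightarrow> 0"
  proof -
    have "(\<lambda>n. \<integral>\<^sup>+t. ennreal (\<bar>V n t - W t\<bar> powr p) \<partial>wmeas N ?R) \<longlonglongrightarrow> (\<integral>\<^sup>+t. 0 \<partial>wmeas N ?R)"
    proof (rule nn_integral_dominated_convergence[where w="\<lambda>t. ennreal (\<bar>W t\<bar> powr p)"])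
      show "(\<integral>\<^sup>+t. ennreal (\<bar>W t\<bar> powr p) \<partial>wmeas N ?R) < \<infinity>"
        using fin wint_cong[of ?R w W N p] wint_m[OF W] by (metis (no_types, lifting) W_def indicator_simps(1) mult_1)
      show "AE t in wmeas N ?R. ennreal (\<bar>V n t - W t\<bar> powr p) \<le> ennreal (\<bar>W t\<bar> powr p)" for n
        using p by (intro AE_I2 ennreal_leI powr_mono2) (auto simp: V_def)
      show "AE t in wmeas N ?R. (\<lambda>n. ennreal (\<bar>V n t - W t\<bar> powr p)) \<longlonglongrightarrow> 0"
      proof (intro AE_I2)
        fix t
        obtain m :: nat where m: "\<bar>W t\<bar> \<le> real m" using real_arch_simple by blast
        have "\<forall>\<^sub>F n in sequentially. ennreal (\<bar>V n t - W t\<bar> powr p) = 0"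
          using eventually_ge_at_top[of m]
        proof eventually_elim
          case (elim n)
          then have "\<bar>W t\<bar> \<le> real n" using m by linarith
          then have "V n t = W t" by (auto simp: V_def)
          then show ?case by simp
        qed
        then show "(\<lambda>n. ennreal (\<bar>V n t - W t\<bar> powr p)) \<longlonglongrightarrow> 0" by (rule tendsto_eventually)
      qed
    qed auto
    then show ?thesis by (simp add: wint_m)
  qed
  have "\<forall>\<^sub>F n in sequentially. wint N p ?R (\<lambda>t. V n t - W t) < ennreal c"
    by (rule order_tendstoD(2)[OF lim1]) (use c in simp)
  then obtain n where n: "wint N p ?R (\<lambda>t. V n t - W t) < ennreal c" using eventually_happens by fastforce
  obtain g where g: "\<And>m. continuous_on UNIV (g m)" "\<And>m t. \<bar>g m t\<bar> \<le> real n" "AE t in lborel. (\<lambda>m. g m t) \<longlonglongrightarrow> V n t"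
    by (rule bounded_measurable_continuous_approx[OF V[of n], of "real n"]) (auto simp: V_def)
  have gm[measurable]: "g m \<in> borel_measurable borel" for m by (rule borel_measurable_continuous_onI[OF g(1)])
  have lim2: "(\<lambda>m. wint N p ?R (\<lambda>t. g m t - V n t)) \<longlonglongrightarrow> 0"
  proof -
    have "(\<lambda>m. \<integral>\<^sup>+t. ennreal (\<bar>g m t - V n t\<bar> powr p) \<partial>wmeas N ?R) \<longlonglongrightarrow> (\<integral>\<^sup>+t. 0 \<partial>wmeas N ?R)"
    proof (rule nn_integral_dominated_convergence[where w="\<lambda>t. ennreal (\<bar>2 * real n\<bar> powr p)"])
      have "wint N p ?R (\<lambda>t. 2 * real n) \<le> ennreal ((2 * real n) powr p * (sinh \<rho> ^ (N - 1) * \<rho>))"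
        using p by (intro wint_bounded[OF \<rho>]) auto
      then show "(\<integral>\<^sup>+t. ennreal (\<bar>2 * real n\<bar> powr p) \<partial>wmeas N ?R) < \<infinity>"
        using wint_m[of "\<lambda>t. 2 * real n"] by (auto intro: le_less_trans)
      show "AE t in wmeas N ?R. ennreal (\<bar>g m t - V n t\<bar> powr p) \<le> ennreal (\<bar>2 * real n\<bar> powr p)" for m
      proof (intro AE_I2 ennreal_leI powr_mono2)
        fix t
        have "\<bar>V n t\<bar> \<le> real n" by (auto simp: V_def)
        then show "\<bar>g m t - V n t\<bar> \<le> \<bar>2 * real n\<bar>" using g(2)[of m t] by linarith
      qed (use p in auto)
      have "AE t in lborel. (\<lambda>m. ennreal (\<bar>g m t - V n t\<bar> powr p)) \<longlonglongrightarrow> 0" using g(3)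
      proof eventually_elim
        case (elim t)
        have "(\<lambda>m. ennreal (\<bar>g m t - V n t\<bar> powr p)) \<longlonglongrightarrow> ennreal (\<bar>V n t - V n t\<bar> powr p)"
          using elim p by (intro tendsto_ennrealI tendsto_powr' tendsto_intros) auto
        then show ?case by simp
      qed
      then show "AE t in wmeas N ?R. (\<lambda>m. ennreal (\<bar>g m t - V n t\<bar> powr p)) \<longlonglongrightarrow> 0"
        unfolding wmeas_def by (subst AE_density) auto
    qed auto
    then show ?thesis by (simp add: wint_m)
  qed
  have "\<forall>\<^sub>F m in sequentially. wint N p ?R (\<lambda>t. g m t - V n t) < ennreal c"
    by (rule order_tendstoD(2)[OF lim2]) (use c in simp)
  then obtain m where m: "wint N p ?R (\<lambda>t. g m t - V n t) < ennreal c" using eventually_happens by fastforce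
  define \<mu> where "\<mu> = sinh \<rho> ^ (N - 1) * \<rho> + 1"
  have \<mu>: "\<mu> > 0" using \<rho> by (simp add: \<mu>_def add_nonneg_pos)
  define d where "d = (e / (4 * 2 powr p * \<mu>)) powr (1 / p)"
  have d: "d > 0" using e \<mu> by (simp add: d_def)
  have dp: "d powr p = e / (4 * 2 powr p * \<mu>)" using e \<mu> p by (simp add: d_def powr_powr)
  obtain q where q: "\<And>t. t \<in> {0..\<rho>} \<Longrightarrow> \<bar>g m t - poly q t\<bar> < d"
    using Weierstrass_poly[OF continuous_on_subset[OF g(1)] d] by blast
  have qm: "poly q \<in> borel_measurable borel" by (intro borel_measurable_continuous_onI continuous_intros)
  note [measurable] = qm
  have 3: "wint N p ?R (\<lambda>t. poly q t - g m t) \<le> ennreal (e / (4 * 2 powr p))"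
  proof -
    have "wint N p ?R (\<lambda>t. poly q t - g m t) \<le> ennreal (d powr p * (sinh \<rho> ^ (N - 1) * \<rho>))"
      using p q by (intro wint_bounded[OF \<rho>]) (auto simp: ivl_def abs_minus_commute less_imp_le)
    also have "\<dots> \<le> ennreal (d powr p * \<mu>)" by (intro ennreal_leI mult_left_mono) (auto simp: \<mu>_def)
    also have "d powr p * \<mu> = e / (4 * 2 powr p)" unfolding dp using \<mu> by simp
    finally show ?thesis .
  qed
  have "wint N p ?R (\<lambda>t. (poly q t - g m t) + (g m t - W t)) \<le> ennreal (2 powr p) * (wint N p ?R (\<lambda>t. poly q t - g m t) + wint N p ?R (\<lambda>t. g m t - W t))"
    using p by (intro wint_add_le sbm) auto
  also have "wint N p ?R (\<lambda>t. g m t - W t) = wint N p ?R (\<lambda>t. (g m t - V n t) + (V n t - W t))" by simp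
  also have "\<dots> \<le> ennreal (2 powr p) * (wint N p ?R (\<lambda>t. g m t - V n t) + wint N p ?R (\<lambda>t. V n t - W t))"
    using p by (intro wint_add_le sbm) auto
  finally have "wint N p ?R (\<lambda>t. poly q t - W t) \<le> ennreal (2 powr p) * (wint N p ?R (\<lambda>t. poly q t - g m t) + ennreal (2 powr p) * (wint N p ?R (\<lambda>t. g m t - V n t) + wint N p ?R (\<lambda>t. V n t - W t)))"
    by (simp add: mult_left_mono add_left_mono)
  also have "\<dots> \<le> ennreal (2 powr p) * (ennreal (e / (4 * 2 powr p)) + ennreal (2 powr p) * (ennreal c + ennreal c))"
    using m n 3 by (intro mult_left_mono add_mono) auto
  also have "ennreal c + ennreal c = ennreal (2 * c)" using c by (simp add: ennreal_plus[symmetric] del: ennreal_plus)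
  also have "ennreal (2 powr p) * (ennreal (e / (4 * 2 powr p)) + ennreal (2 powr p) * ennreal (2 * c)) = ennreal (2 powr p * (e / (4 * 2 powr p) + 2 powr p * (2 * c)))"
    using c e by (simp add: ennreal_mult[symmetric] ennreal_plus[symmetric] del: ennreal_plus)
  also have "2 powr p * (e / (4 * 2 powr p) + 2 powr p * (2 * c)) = e / 2"
    by (simp add: c_def field_simps)
  also have "ennreal (e / 2) < ennreal e" using e by (simp add: ennreal_less_iff)
  finally show ?thesis using wW by (intro exI[of _ q]) simp
qed

section \<open>Test functions, the fundamental lemma and the lemma of du Bois-Reymond\<close>

lemma ex_bump:
  assumes "a' < a" "a \<le> b" "b < b'"
  shows "\<exists>\<beta>. smooth_fam UNIV \<beta> \<and> (\<forall>t\<in>{a..b}. \<beta> 0 t = 1) \<and> (\<forall>i t. t \<notin> {a'..b'} \<longrightarrow> \<beta> i t = 0) \<and> (\<forall>t. 0 \<le> \<beta> 0 t \<and> \<beta> 0 t \<le> (1::real))"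
proof -
  obtain cut where cut: "smooth_fam UNIV cut" "\<And>t. t \<le> 1 \<Longrightarrow> cut 0 t = 0" "\<And>t. t \<ge> 2 \<Longrightarrow> cut 0 t = 1"
    "\<And>t. 0 \<le> cut 0 t" "\<And>t. cut 0 t \<le> (1::real)" "\<And>i t. i \<ge> 1 \<Longrightarrow> t \<notin> {1<..<2} \<Longrightarrow> cut i t = 0"
    using ex_cutoff by blast
  have cz: "cut i t = 0" if "t \<le> 1" for i t using cut(2)[OF that] cut(6)[of i t] that by (cases "i = 0") auto
  \<comment> \<open>Slopes of the affine maps that carry \<open>{a'..a}\<close> to
    \<open>{1..2}\<close> for the rising edge and \<open>{b..b'}\<close> to \<open>{1..2}\<close>
    with reversed orientation for the falling edge.\<close>
  define c d where "c = 1 / (a - a')" and "d = 1 / (b' - b)"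
  have cd: "c > 0" "d > 0" using assms by (auto simp: c_def d_def)
  define f where "f i t = c ^ i * cut i (c * t + (1 - c * a'))" for i t
  define g where "g i t = (- d) ^ i * cut i (- d * t + (1 + d * b'))" for i t
  have fg: "smooth_fam UNIV f" "smooth_fam UNIV g"
    unfolding f_def[abs_def] g_def[abs_def] by (rule smooth_fam_affine[OF cut(1)])+
  have f0: "f i t = 0" if "t < a'" for i t
  proof -
    have "c * t \<le> c * a'" using that cd by (intro mult_left_mono) auto
    then show ?thesis unfolding f_def by (simp add: cz)
  qed
  have g0: "g i t = 0" if "t > b'" for i t
  proof -
    have "d * b' \<le> d * t" using that cd by (intro mult_left_mono) auto
    then show ?thesis unfolding g_def by (simp add: cz)
  qed
  have f1: "f 0 t = 1" if "t \<ge> a" for t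
  proof -
    have "c * (a - a') \<le> c * (t - a')" using that cd by (intro mult_left_mono) auto
    moreover have "c * (a - a') = 1" using assms by (simp add: c_def)
    ultimately show ?thesis unfolding f_def by (simp add: cut(3) algebra_simps)
  qed
  have g1: "g 0 t = 1" if "t \<le> b" for t
  proof -
    have "d * (b' - b) \<le> d * (b' - t)" using that cd by (intro mult_left_mono) auto
    moreover have "d * (b' - b) = 1" using assms by (simp add: d_def)
    ultimately show ?thesis unfolding g_def by (simp add: cut(3) algebra_simps)
  qed
  have r: "0 \<le> f 0 t" "f 0 t \<le> 1" "0 \<le> g 0 t" "g 0 t \<le> 1" for t using cut(4,5) by (auto simp: f_def g_def)
  show ?thesis
  proof (intro exI[of _ "\<lambda>m. prodfam m f g"] conjI ballI allI impI)
    show "smooth_fam UNIV (\<lambda>m. prodfam m f g)" by (rule smooth_fam_prodfam[OF fg])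
    show "prodfam 0 f g t = 1" if "t \<in> {a..b}" for t using that f1 g1 by simp
    show "prodfam i f g t = 0" if "t \<notin> {a'..b'}" for i t
    proof (cases "t < a'")
      case True
      then show ?thesis by (intro prodfam_zero f0)
    next
      case False
      then show ?thesis using that by (intro prodfam_zero_right g0) auto
    qed
    show "0 \<le> prodfam 0 f g t" "prodfam 0 f g t \<le> 1" for t using r[of t] by (auto intro: mult_le_one)
  qed
qed

lemma smooth_fam_deriv_funpow: "smooth_fam UNIV f \<Longrightarrow> (deriv ^^ m) (f 0) = f m"
proof (induction m)
  case (Suc m)
  have "deriv (f m) = f (Suc m)" by (rule ext, rule DERIV_imp_deriv[OF smooth_famD[OF Suc.prems]]) simp
  then show ?case using Suc by simp
qed simp

lemma test_fnI:
  assumes f: "smooth_fam UNIV f" and ab: "0 < a" "a \<le> b" "ereal b < R" "\<And>t. t \<notin> {a..b} \<Longrightarrow> f 0 t = 0"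
  shows "test_fn R (f 0)"
  unfolding test_fn_def smooth_fam_deriv_funpow[OF f] using smooth_famD[OF f] ab by blast

text \<open>Test functions approximate the sign of \<open>g\<close> boundedly almost everywhere.\<close>
lemma fundamental_lemma:
  assumes g: "loc_int R g" and z: "\<And>\<phi>. test_fn R \<phi> \<Longrightarrow> (LINT t:ivl R|lborel. g t * \<phi> t) = 0"
  shows "AE t in lborel. t \<in> ivl R \<longrightarrow> g t = 0"
proof -
  have gm: "(\<lambda>t. indicator (ivl R) t * g t) \<in> borel_measurable borel"
    using g by (simp add: loc_int_def set_borel_measurable_def)
  define G where "G t = indicator (ivl R) t * g t" for t
  have [measurable]: "G \<in> borel_measurable borel" unfolding G_def by (rule gm)
  have main: "AE t in lborel. t \<in> {a..b} \<longrightarrow> G t = 0" if ab: "0 < a" "a \<le> b" "ereal b < R" for a b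
  proof -
    obtain b' where b': "b < b'" "ereal b' < R" using ereal_dense2[OF ab(3)] by auto
    define a' where "a' = a / 2"
    have a': "0 < a'" "a' < a" using ab by (auto simp: a'_def)
    obtain \<beta> where \<beta>: "smooth_fam UNIV \<beta>" "\<And>t. t \<in> {a..b} \<Longrightarrow> \<beta> 0 t = 1" "\<And>i t. t \<notin> {a'..b'} \<Longrightarrow> \<beta> i t = 0"
      "\<And>t. 0 \<le> \<beta> 0 t" "\<And>t. \<beta> 0 t \<le> (1::real)"
      using ex_bump[OF a'(2) ab(2) b'(1)] by blast
    define \<sigma> where "\<sigma> t = sgn (G t) * indicator {a..b} t" for t
    have "\<sigma> \<in> borel_measurable borel" "\<And>t. \<bar>\<sigma> t\<bar> \<le> 1" unfolding \<sigma>_def by (auto simp: indicator_def sgn_if)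
    then obtain h where h: "\<And>n. continuous_on UNIV (h n)" "\<And>n t. \<bar>h n t\<bar> \<le> 1" "AE t in lborel. (\<lambda>n. h n t) \<longlonglongrightarrow> \<sigma> t"
      by (rule bounded_measurable_continuous_approx) blast
    have "\<exists>q. \<forall>t\<in>{a'..b'}. \<bar>h n t - poly q t\<bar> < 1 / real (Suc n)" for n
      by (rule Weierstrass_poly[OF continuous_on_subset[OF h(1)]]) auto
    then obtain q where q: "\<And>n t. t \<in> {a'..b'} \<Longrightarrow> \<bar>h n t - poly (q n) t\<bar> < 1 / real (Suc n)" by metis
    \<comment> \<open>Polynomials become test functions after multiplication by the bump, and remain
      bounded by 2, which supplies the dominating function.\<close>
    define \<phi> where "\<phi> n m = prodfam m \<beta> (\<lambda>i. poly ((pderiv ^^ i) (q n)))" for n m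
    have \<phi>s: "smooth_fam UNIV (\<phi> n)" for n unfolding \<phi>_def[abs_def] by (rule smooth_fam_prodfam[OF \<beta>(1) smooth_fam_poly])
    have \<phi>0: "\<phi> n 0 t = \<beta> 0 t * poly (q n) t" for n t by (simp add: \<phi>_def)
    have \<phi>z: "\<phi> n 0 t = 0" if "t \<notin> {a'..b'}" for n t using \<beta>(3)[OF that] by (simp add: \<phi>0)
    have tst: "test_fn R (\<phi> n 0)" for n
      by (rule test_fnI[OF \<phi>s a'(1) _ b'(2) \<phi>z]) (use a' ab b' in auto)
    have [measurable]: "\<phi> n 0 \<in> borel_measurable borel" for n
      by (rule borel_measurable_continuous_onI[OF smooth_fam_continuous[OF \<phi>s]])
    have \<phi>b: "\<bar>\<phi> n 0 t\<bar> \<le> 2 * indicator {a'..b'} t" for n t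
    proof (cases "t \<in> {a'..b'}")
      case True
      have "1 / real (Suc n) \<le> 1" by simp
      then have "\<bar>poly (q n) t\<bar> \<le> 2" using q[OF True, of n] h(2)[of n t] by linarith
      then have "\<beta> 0 t * \<bar>poly (q n) t\<bar> \<le> 1 * 2" using \<beta>(4,5)[of t] by (intro mult_mono) auto
      then show ?thesis using True \<beta>(4)[of t] by (simp add: \<phi>0 abs_mult)
    qed (use \<phi>z in auto)
    have \<phi>lim: "AE t in lborel. (\<lambda>n. \<phi> n 0 t) \<longlonglongrightarrow> \<sigma> t" using h(3)
    proof eventually_elim
      case (elim t)
      show ?case
      proof (cases "t \<in> {a'..b'}")
        case True
        have "(\<lambda>n. h n t - poly (q n) t) \<longlonglongrightarrow> 0"
          by (rule Lim_null_comparison[OF _ LIMSEQ_inverse_real_of_nat])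
            (use q[OF True] in \<open>auto simp: inverse_eq_divide less_imp_le intro!: always_eventually\<close>)
        from tendsto_diff[OF elim this] have "(\<lambda>n. poly (q n) t) \<longlonglongrightarrow> \<sigma> t" by simp
        from tendsto_mult[OF tendsto_const[of "\<beta> 0 t"] this] have "(\<lambda>n. \<phi> n 0 t) \<longlonglongrightarrow> \<beta> 0 t * \<sigma> t" by (simp add: \<phi>0)
        moreover have "\<beta> 0 t * \<sigma> t = \<sigma> t" using \<beta>(2)[of t] by (auto simp: \<sigma>_def indicator_def)
        ultimately show ?thesis by simp
      next
        case False
        then have "\<sigma> t = 0" using a' b' by (auto simp: \<sigma>_def)
        then show ?thesis using \<phi>z[OF False] by simp
      qed
    qed
    have Gi: "integrable lborel (\<lambda>t. indicator {a'..b'} t * G t)"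
    proof -
      have "set_integrable lborel {a'..b'} g" using g a'(1) b'(2) by (simp add: loc_int_def)
      moreover have "(\<lambda>t. indicator {a'..b'} t * G t) = (\<lambda>t. indicator {a'..b'} t * g t)"
        using ivl_subset[OF a'(1) b'(2)] by (auto simp: G_def indicator_def fun_eq_iff)
      ultimately show ?thesis by (simp add: set_integrable_def)
    qed
    have "(\<lambda>n. \<integral>t. G t * \<phi> n 0 t \<partial>lborel) \<longlonglongrightarrow> (\<integral>t. G t * \<sigma> t \<partial>lborel)"
    proof (rule integral_dominated_convergence[where w="\<lambda>t. 2 * \<bar>indicator {a'..b'} t * G t\<bar>"])
      show "(\<lambda>t. G t * \<sigma> t) \<in> borel_measurable lborel" unfolding \<sigma>_def by measurable
      show "integrable lborel (\<lambda>t. 2 * \<bar>indicator {a'..b'} t * G t\<bar>)" using Gi by simp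
      show "AE t in lborel. (\<lambda>n. G t * \<phi> n 0 t) \<longlonglongrightarrow> G t * \<sigma> t"
        using \<phi>lim by eventually_elim (intro tendsto_mult tendsto_const)
      show "AE t in lborel. norm (G t * \<phi> n 0 t) \<le> 2 * \<bar>indicator {a'..b'} t * G t\<bar>" for n
      proof (intro AE_I2)
        fix t
        show "norm (G t * \<phi> n 0 t) \<le> 2 * \<bar>indicator {a'..b'} t * G t\<bar>"
          using mult_left_mono[OF \<phi>b[of n t], of "\<bar>G t\<bar>"] by (simp add: abs_mult mult_ac)
      qed
    qed measurable
    moreover have "(\<integral>t. G t * \<phi> n 0 t \<partial>lborel) = 0" for n
      using z[OF tst[of n]] unfolding set_lebesgue_integral_def G_def by (simp add: mult.assoc)
    ultimately have "(\<lambda>n::nat. 0) \<longlonglongrightarrow> (\<integral>t. G t * \<sigma> t \<partial>lborel)" by simp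
    then have 0: "(\<integral>t. G t * \<sigma> t \<partial>lborel) = 0" by (simp add: LIMSEQ_const_iff)
    have eq: "G t * \<sigma> t = indicator {a..b} t * \<bar>G t\<bar>" for t by (auto simp: \<sigma>_def indicator_def sgn_if)
    have "integrable lborel (\<lambda>t. indicator {a..b} t * \<bar>G t\<bar>)"
      by (rule Bochner_Integration.integrable_bound[OF Gi]) (use a' b' in \<open>auto simp: indicator_def\<close>)
    then have "AE t in lborel. indicator {a..b} t * \<bar>G t\<bar> = 0"
      using 0 unfolding eq by (subst (asm) integral_nonneg_eq_0_iff_AE) auto
    then show ?thesis by eventually_elim (auto simp: indicator_def)
  qed
  \<comment> \<open>Right end points of countably many compact intervals that exhaust
    \<open>ivl R\<close>; infinite \<open>R\<close> has to be treated separately.\<close>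
  define bb where "bb n = (if R = \<infinity> then real (Suc n) else real_of_ereal R - 1 / real (Suc n))" for n
  have "AE t in lborel. \<forall>n. t \<in> {1 / real (Suc n)..bb n} \<longrightarrow> G t = 0"
  proof (subst AE_all_countable, intro allI)
    fix n
    show "AE t in lborel. t \<in> {1 / real (Suc n)..bb n} \<longrightarrow> G t = 0"
    proof (cases "1 / real (Suc n) \<le> bb n")
      case True
      have "ereal (bb n) < R"
      proof (cases R)
        case (real r)
        then show ?thesis by (simp add: bb_def)
      next
        case MInf
        then show ?thesis using True by (simp add: bb_def)
      qed (simp add: bb_def)
      then show ?thesis using True by (intro main) auto
    qed (auto intro!: AE_I2)
  qed
  then show ?thesis
  proof eventually_elim
    case (elim t)
    show ?case
    proof
      assume t: "t \<in> ivl R"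
      then have t0: "0 < t" "ereal t < R" by (auto simp: ivl_def)
      obtain n where n: "1 / real (Suc n) \<le> t" "t \<le> bb n"
      proof -
        define d where "d = (if R = \<infinity> then t else min t (real_of_ereal R - t))"
        have d: "d > 0" using t0 by (cases R) (auto simp: d_def)
        obtain n1 :: nat where n1: "t \<le> real n1" using real_arch_simple by blast
        obtain n2 where n2: "1 / real (Suc n2) < d" using reals_Archimedean[OF d] by (auto simp: inverse_eq_divide)
        define n where "n = max n1 n2"
        have "1 / real (Suc n) \<le> 1 / real (Suc n2)" by (intro divide_left_mono) (auto simp: n_def)
        then have a: "1 / real (Suc n) \<le> d" using n2 by simp
        have "t \<le> bb n" using a n1 by (auto simp: bb_def d_def n_def)
        moreover have "1 / real (Suc n) \<le> t" using a by (auto simp: d_def split: if_splits)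
        ultimately show ?thesis using that by blast
      qed
      then show "g t = 0" using elim t by (auto simp: G_def)
    qed
  qed
qed

lemma test_fn_smooth_fam:
  assumes "test_fn R \<phi>"
  shows "smooth_fam UNIV (\<lambda>i. (deriv ^^ i) \<phi>)"
  using assms by (auto simp: test_fn_def smooth_fam_def)

lemma loc_int_mult_integrable:
  assumes f: "loc_int R f" and \<zeta>: "continuous_on UNIV \<zeta>" "0 < a" "a \<le> b" "ereal b < R" "\<And>t. t \<notin> {a..b} \<Longrightarrow> \<zeta> t = 0"
  shows "set_integrable lborel (ivl R) (\<lambda>t. f t * \<zeta> t)"
proof -
  have sub: "{a..b} \<subseteq> ivl R" using \<zeta> by (intro ivl_subset)
  have [measurable]: "\<zeta> \<in> borel_measurable borel" by (rule borel_measurable_continuous_onI[OF \<zeta>(1)])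
  have [measurable]: "(\<lambda>t. indicator (ivl R) t * f t) \<in> borel_measurable borel"
    using f by (simp add: loc_int_def set_borel_measurable_def)
  have "compact (\<zeta> ` {a..b})" using \<zeta>(1) by (intro compact_continuous_image) (auto intro: continuous_on_subset)
  then obtain B where B: "\<And>t. t \<in> {a..b} \<Longrightarrow> \<bar>\<zeta> t\<bar> \<le> B" "B > 0"
    using compact_imp_bounded[of "\<zeta> ` {a..b}"] unfolding bounded_pos by fastforce
  have "set_integrable lborel {a..b} f" using f \<zeta> by (simp add: loc_int_def)
  then have i: "integrable lborel (\<lambda>t. B * (indicator {a..b} t * f t))" by (simp add: set_integrable_def)
  have eq: "(\<lambda>t. indicator (ivl R) t *\<^sub>R (f t * \<zeta> t)) = (\<lambda>t. (indicator (ivl R) t * f t) * \<zeta> t)" by auto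
  show ?thesis unfolding set_integrable_def
  proof (rule Bochner_Integration.integrable_bound[OF i])
    show "(\<lambda>t. indicator (ivl R) t *\<^sub>R (f t * \<zeta> t)) \<in> borel_measurable lborel" unfolding eq by measurable
    show "AE t in lborel. norm (indicator (ivl R) t *\<^sub>R (f t * \<zeta> t)) \<le> norm (B * (indicator {a..b} t * f t))"
    proof (intro AE_I2)
      fix t
      show "norm (indicator (ivl R) t *\<^sub>R (f t * \<zeta> t)) \<le> norm (B * (indicator {a..b} t * f t))"
      proof (cases "t \<in> {a..b}")
        case True
        then show ?thesis using sub B(1)[OF True] B(2) mult_right_mono[OF B(1)[OF True], of "\<bar>f t\<bar>"] by (auto simp: abs_mult mult_ac)
      qed (use \<zeta>(5) in auto)
    qed
  qed
qed

lemma deriv_zero_const: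
  fixes h h' :: "real \<Rightarrow> real"
  assumes "\<And>x. (h has_real_derivative h' x) (at x)" "\<And>x. s < x \<Longrightarrow> x < t \<Longrightarrow> h' x = 0" "s \<le> t"
  shows "h s = h t"
proof (cases "s = t")
  case False
  then have "s < t" using assms(3) by simp
  from MVT2[OF this, of h h'] assms(1) obtain z where "s < z" "z < t" "h t - h s = (t - s) * h' z" by blast
  then show ?thesis using assms(2) by simp
qed simp

text \<open>With \<omega> a normalised bump, \<phi> minus its integral times \<omega> is the
  derivative of a test function. Testing f with this difference shows that f and the constant c, the
  integral of f \<omega>, agree against every \<phi>.\<close>

lemma du_Bois_Reymond:
  assumes R: "0 < R" and f: "loc_int R f" and z: "\<And>\<phi>. test_fn R \<phi> \<Longrightarrow> (LINT t:ivl R|lborel. f t * deriv \<phi> t) = 0"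
  shows "\<exists>c. AE t in lborel. t \<in> ivl R \<longrightarrow> f t = c"
proof -
  obtain r where r: "0 < r" "ereal r < R" using ereal_dense2[OF R] by (auto simp: zero_ereal_def)
  obtain \<beta> where \<beta>: "smooth_fam UNIV \<beta>" "\<And>t. t \<in> {r/2..r/2} \<Longrightarrow> \<beta> 0 t = 1" "\<And>i t. t \<notin> {r/4..3*r/4} \<Longrightarrow> \<beta> i t = 0"
    "\<And>t. 0 \<le> \<beta> 0 t" "\<And>t. \<beta> 0 t \<le> (1::real)"
    using ex_bump[of "r/4" "r/2" "r/2" "3*r/4"] r by fastforce
  have "r / 4 < 3 * r / 4" using r by simp
  obtain Bf where Bf: "smooth_fam UNIV Bf" "\<And>i. Bf (Suc i) = \<beta> i" "Bf 0 (r/4) = 0"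
    using ex_antideriv_fam[OF \<beta>(1), of "r/4" 0] by blast
  define Z where "Z = Bf 0 (3*r/4)"
  have dB: "(Bf 0 has_real_derivative \<beta> 0 t) (at t)" for t using smooth_famD[OF Bf(1), of t 0] by (simp add: Bf(2))
  \<comment> \<open>A vanishing mass would make the monotone primitive constant near r / 2, where
    its derivative is 1.\<close>
  have Zpos: "Z > 0"
  proof -
    have mono: "Bf 0 s \<le> Bf 0 t" if "s \<le> t" for s t
      by (rule DERIV_nonneg_imp_nondecreasing[OF that]) (use dB \<beta>(4) in blast)
    have "Z \<noteq> 0"
    proof
      assume "Z = 0"
      then have c: "Bf 0 t = 0" if "t \<in> {r/4..3*r/4}" for t using mono[of "r/4" t] mono[of t "3*r/4"] that Bf(3) by (simp add: Z_def)
      have "\<forall>\<^sub>F s in nhds (r/2). 0 = Bf 0 s"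
        using eventually_nhds_in_open[of "{r/4<..<3*r/4}" "r/2"] r by (auto elim!: eventually_mono simp: c)
      from DERIV_cong_ev[OF refl this refl, of 0] have "(Bf 0 has_real_derivative 0) (at (r/2))" by simp
      from DERIV_unique[OF this dB] show False using \<beta>(2)[of "r/2"] by simp
    qed
    then show ?thesis using mono[of "r/4" "3*r/4"] Bf(3) r by (simp add: Z_def)
  qed
  have fm: "(\<lambda>t. indicator (ivl R) t * f t) \<in> borel_measurable borel"
    using f by (simp add: loc_int_def set_borel_measurable_def)
  note int = loc_int_mult_integrable[OF f]
  define \<omega> where "\<omega> t = \<beta> 0 t / Z" for t
  define c where "c = (LINT t:ivl R|lborel. f t * \<omega> t)"
  have "AE t in lborel. t \<in> ivl R \<longrightarrow> f t - c = 0"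
  proof (rule fundamental_lemma)
    show lc: "loc_int R (\<lambda>t. f t - c)"
      unfolding loc_int_def
    proof (intro conjI allI impI)
      note fm[measurable]
      show "set_borel_measurable lborel (ivl R) (\<lambda>t. f t - c)"
        unfolding set_borel_measurable_def real_scaleR_def right_diff_distrib by measurable
      fix a b :: real assume "0 < a" "ereal b < R"
      then show "set_integrable lborel {a..b} (\<lambda>t. f t - c)" using f
        by (intro set_integral_diff) (auto simp: loc_int_def intro!: borel_integrable_atLeastAtMost')
    qed
    fix \<phi> assume \<phi>: "test_fn R \<phi>"
    obtain a b where ab: "0 < a" "a < b" "ereal b < R" "\<And>m t. t \<notin> {a<..<b} \<Longrightarrow> (deriv ^^ m) \<phi> t = 0"
      using test_fnE[OF \<phi>] by metis
    have \<phi>z: "\<phi> t = 0" if "t \<notin> {a<..<b}" for t using ab(4)[OF that, of 0] by simp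
    note sf = test_fn_smooth_fam[OF \<phi>]
    have c\<phi>: "continuous_on UNIV \<phi>" using smooth_fam_continuous[OF sf, of 0] by simp
    obtain Pf where Pf: "smooth_fam UNIV Pf" "\<And>i. Pf (Suc i) = (deriv ^^ i) \<phi>" "Pf 0 a = 0"
      using ex_antideriv_fam[OF sf, of a 0] by blast
    define I where "I = Pf 0 b"
    have dP: "(Pf 0 has_real_derivative \<phi> t) (at t)" for t using smooth_famD[OF Pf(1), of t 0] Pf(2)[of 0] by simp
    note const = deriv_zero_const
    have P1: "Pf 0 t = 0" if "t \<le> a" for t using const[of "Pf 0" \<phi>, OF dP _ that] \<phi>z Pf(3) by simp
    have P2: "Pf 0 t = I" if "b \<le> t" for t using const[of "Pf 0" \<phi>, OF dP _ that] \<phi>z by (simp add: I_def)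
    have B1: "Bf 0 t = 0" if "t \<le> r/4" for t using const[of "Bf 0" "\<beta> 0", OF dB _ that] \<beta>(3) Bf(3) by simp
    have B2: "Bf 0 t = Z" if "3*r/4 \<le> t" for t using const[of "Bf 0" "\<beta> 0", OF dB _ that] \<beta>(3) by (simp add: Z_def)
    \<comment> \<open>To the right of both supports the primitive of \<phi> equals I and that of the
      bump equals Z, so this combination vanishes there.\<close>
    define \<zeta> where "\<zeta> i t = Pf i t - (I / Z) * Bf i t" for i t
    have \<zeta>s: "smooth_fam UNIV \<zeta>"
      unfolding smooth_fam_def \<zeta>_def by (intro allI ballI DERIV_diff DERIV_cmult smooth_famD[OF Pf(1)] smooth_famD[OF Bf(1)])
    define A B where "A = min a (r/4)" and "B = max b (3*r/4)"
    have AB: "0 < A" "A \<le> B" "ereal B < R" using ab r by (auto simp: A_def B_def max_def intro: less_trans[of _ "ereal r"])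
    have \<zeta>z: "\<zeta> 0 t = 0" if "t \<notin> {A..B}" for t
    proof (cases "t < A")
      case True
      then show ?thesis using P1[of t] B1[of t] by (simp add: \<zeta>_def A_def)
    next
      case False
      then have "t > B" using that by simp
      then show ?thesis using P2[of t] B2[of t] Zpos by (simp add: \<zeta>_def B_def)
    qed
    have "test_fn R (\<zeta> 0)" by (rule test_fnI[OF \<zeta>s AB \<zeta>z])
    from z[OF this] have "(LINT t:ivl R|lborel. f t * deriv (\<zeta> 0) t) = 0" .
    moreover have "deriv (\<zeta> 0) t = \<phi> t - I * \<omega> t" for t
      using smooth_fam_deriv_funpow[OF \<zeta>s, of 1] Pf(2)[of 0] Bf(2)[of 0] by (simp add: \<zeta>_def[of "Suc 0"] \<omega>_def fun_eq_iff)
    ultimately have "(LINT t:ivl R|lborel. f t * \<phi> t - I * (f t * \<omega> t)) = 0" by (simp add: algebra_simps)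
    moreover have i1: "set_integrable lborel (ivl R) (\<lambda>t. f t * \<phi> t)"
      by (rule int[OF c\<phi> ab(1) less_imp_le[OF ab(2)] ab(3)]) (use \<phi>z in auto)
    moreover have i2: "set_integrable lborel (ivl R) (\<lambda>t. f t * \<omega> t)"
    proof (rule int)
      show "continuous_on UNIV \<omega>" unfolding \<omega>_def using smooth_fam_continuous[OF \<beta>(1)] Zpos by (intro continuous_intros) auto
      show "0 < r/4" "r/4 \<le> 3*r/4" using r by auto
      have "ereal (3*r/4) \<le> ereal r" using r by simp
      then show "ereal (3*r/4) < R" using r(2) by (rule le_less_trans)
      show "\<omega> t = 0" if "t \<notin> {r/4..3*r/4}" for t using \<beta>(3)[OF that] by (simp add: \<omega>_def)
    qed
    ultimately have e1: "(LINT t:ivl R|lborel. f t * \<phi> t) = I * c"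
      using set_integral_diff(2)[OF i1 set_integrable_mult_right[of I, OF i2]] by (simp add: c_def)
    have "(LINT t:ivl R|lborel. \<phi> t) = (LINT t:{a..b}|lborel. \<phi> t)"
      by (rule set_lebesgue_integral_restrict[OF ivl_subset[OF ab(1,3)]]) (use \<phi>z in auto)
    also have "\<dots> = Pf 0 b - Pf 0 a" unfolding set_lebesgue_integral_def
    proof (rule integral_FTC_Icc)
      show "(Pf 0 has_vector_derivative \<phi> x) (at x within {a..b})" for x
        using has_field_derivative_at_within[OF dP] by (simp add: has_real_derivative_iff_has_vector_derivative)
    qed (use ab c\<phi> in \<open>auto intro: continuous_on_subset\<close>)
    finally have e2: "(LINT t:ivl R|lborel. \<phi> t) = I" by (simp add: I_def Pf(3))
    have i3: "set_integrable lborel (ivl R) \<phi>"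
    proof -
      have "set_integrable lborel {a..b} \<phi>" by (intro borel_integrable_atLeastAtMost' continuous_on_subset[OF c\<phi>]) auto
      moreover have "(\<lambda>t. indicator (ivl R) t *\<^sub>R \<phi> t) = (\<lambda>t. indicator {a..b} t *\<^sub>R \<phi> t)"
        using ivl_subset[OF ab(1,3)] \<phi>z by (auto simp: indicator_def fun_eq_iff)
      ultimately show ?thesis by (simp add: set_integrable_def)
    qed
    show "(LINT t:ivl R|lborel. (f t - c) * \<phi> t) = 0"
      using set_integral_diff(2)[OF i1 set_integrable_mult_right[of c, OF i3]] e1 e2 by (simp add: algebra_simps)
  qed
  then show ?thesis by (intro exI[of _ c]) (auto elim!: eventually_mono)
qed

section \<open>Smooth approximation of weak derivatives on a bounded interval\<close>

lemma wint_cong_AE: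
  assumes "AE t in lborel. t \<in> ivl R \<longrightarrow> f t = g t"
  shows "wint N p R f = wint N p R g"
  unfolding wint_def using assms by (intro nn_integral_cong_AE) (auto elim!: eventually_mono simp: indicator_def)

lemma wvalid_measurable:
  assumes "wvalid N k p R v w" "1 \<le> k" "j \<le> k"
  shows "loc_int R (w j)" "set_borel_measurable lborel (ivl R) (w j)" "wint N p R (w j) < \<infinity>"
proof -
  show l: "loc_int R (w j)"
  proof (cases "j = 0")
    case True
    have "weak_deriv R 1 v (w 1)" using assms by (simp add: wvalid_def)
    then show ?thesis using True assms by (simp add: wvalid_def weak_deriv_def)
  next
    case False
    then have "weak_deriv R j v (w j)" using assms by (simp add: wvalid_def)
    then show ?thesis by (simp add: weak_deriv_def)
  qed
  then show "set_borel_measurable lborel (ivl R) (w j)" by (simp add: loc_int_def)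
  show "wint N p R (w j) < \<infinity>" using assms by (simp add: wvalid_def)
qed

lemma test_fn_deriv:
  assumes "test_fn R \<phi>"
  shows "test_fn R (deriv \<phi>)"
proof -
  obtain a b where ab: "0 < a" "a < b" "ereal b < R" "\<And>m t. t \<notin> {a<..<b} \<Longrightarrow> (deriv ^^ m) \<phi> t = 0"
    and d: "\<And>m t. ((deriv ^^ m) \<phi> has_real_derivative (deriv ^^ Suc m) \<phi> t) (at t)"
    using test_fnE[OF assms] by metis
  have "smooth_fam UNIV (\<lambda>i. (deriv ^^ Suc i) \<phi>)" using test_fn_smooth_fam[OF assms] by (rule smooth_fam_shift)
  moreover have "(deriv ^^ Suc 0) \<phi> t = 0" if "t \<notin> {a..b}" for t using ab(4)[of t "Suc 0"] that by auto
  ultimately show ?thesis using test_fnI[of "\<lambda>i. (deriv ^^ Suc i) \<phi>" a b R] ab by simp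
qed

text \<open>\<open>wvalid\<close> relates each \<open>w j\<close> only to \<open>v\<close>. Since
  the derivative of a test function is again one, consecutive members are related as well.\<close>

lemma wvalid_weak_step:
  assumes w: "wvalid N k p R v w" and j: "Suc j \<le> k" and \<phi>: "test_fn R \<phi>"
  shows "(LINT t:ivl R|lborel. w j t * deriv \<phi> t) = - (LINT t:ivl R|lborel. w (Suc j) t * \<phi> t)"
proof -
  have w0: "w 0 = v" using w by (simp add: wvalid_def)
  have a: "(LINT t:ivl R|lborel. v t * (deriv ^^ j) (deriv \<phi>) t) = (-1) ^ j * (LINT t:ivl R|lborel. w j t * deriv \<phi> t)"
  proof (cases "j = 0")
    case False
    then have "weak_deriv R j v (w j)" using w j by (simp add: wvalid_def)
    then show ?thesis using test_fn_deriv[OF \<phi>] by (simp add: weak_deriv_def)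
  qed (simp add: w0)
  have "weak_deriv R (Suc j) v (w (Suc j))" using w j by (simp add: wvalid_def)
  then have b: "(LINT t:ivl R|lborel. v t * (deriv ^^ Suc j) \<phi> t) = (-1) ^ Suc j * (LINT t:ivl R|lborel. w (Suc j) t * \<phi> t)"
    using \<phi> unfolding weak_deriv_def by blast
  have "(deriv ^^ j) (deriv \<phi>) = (deriv ^^ Suc j) \<phi>" by (simp add: funpow_swap1)
  with a b have "(-1) ^ j * (LINT t:ivl R|lborel. w j t * deriv \<phi> t) = (-1) ^ Suc j * (LINT t:ivl R|lborel. w (Suc j) t * \<phi> t)" by simp
  then show ?thesis by (cases "even j") auto
qed

lemma wint_finite_continuous:
  assumes \<rho>: "0 < \<rho>" and p: "0 \<le> p" and f: "continuous_on UNIV f"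
  shows "wint N p (ereal \<rho>) f < \<infinity>"
proof -
  have "compact (f ` {0..\<rho>})" using f by (intro compact_continuous_image) (auto intro: continuous_on_subset)
  then obtain B where "\<And>t. t \<in> {0..\<rho>} \<Longrightarrow> \<bar>f t\<bar> \<le> B"
    using compact_imp_bounded[of "f ` {0..\<rho>}"] unfolding bounded_iff by fastforce
  then have "wint N p (ereal \<rho>) f \<le> ennreal (B powr p * (sinh \<rho> ^ (N - 1) * \<rho>))"
    by (intro wint_bounded[OF \<rho> p]) (auto simp: ivl_def)
  then show ?thesis by (auto intro: le_less_trans)
qed

lemma set_borel_measurable_diff:
  fixes f g :: "real \<Rightarrow> real"
  assumes "set_borel_measurable M A f" "set_borel_measurable M A g"
  shows "set_borel_measurable M A (\<lambda>t. f t - g t)"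
  using assms unfolding set_borel_measurable_def real_scaleR_def right_diff_distrib by simp

text \<open>Induction on the number of integrations: polynomials approximate the member of order k,
  and each step passes to primitives. Their limit has the right weak derivative, hence differs from
  the wanted member only by a constant, which is added back.\<close>

lemma smooth_approx:
  assumes p: "1 \<le> p" and \<rho>: "0 < \<rho>" and k: "1 \<le> k" and w: "wvalid N k p (ereal \<rho>) v w" and m: "m \<le> k"
  shows "\<exists>H. (\<forall>n. smooth_fam UNIV (H n)) \<and> (\<forall>i\<le>m. (\<lambda>n. wint N p (ereal \<rho>) (\<lambda>t. H n i t - w (k - m + i) t)) \<longlonglongrightarrow> 0)"
  using m
proof (induction m)
  case 0
  have "\<exists>q. wint N p (ereal \<rho>) (\<lambda>t. poly q t - w k t) < ennreal (1 / real (Suc n))" for n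
    by (rule poly_dense[OF p \<rho> wvalid_measurable(2,3)[OF w k]]) auto
  then obtain q where q: "\<And>n. wint N p (ereal \<rho>) (\<lambda>t. poly (q n) t - w k t) < ennreal (1 / real (Suc n))" by metis
  have "(\<lambda>n. wint N p (ereal \<rho>) (\<lambda>t. poly (q n) t - w k t)) \<longlonglongrightarrow> 0"
  proof (rule tendsto_zero_ennrealI)
    fix e :: real assume "e > 0"
    then obtain M where M: "1 / real (Suc M) < e" using reals_Archimedean by (auto simp: inverse_eq_divide)
    show "\<forall>\<^sub>F n in sequentially. wint N p (ereal \<rho>) (\<lambda>t. poly (q n) t - w k t) \<le> ennreal e"
      using eventually_ge_at_top[of M]
    proof eventually_elim
      case (elim n)
      have "1 / real (Suc n) \<le> 1 / real (Suc M)" using elim by (intro divide_left_mono) auto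
      then have "ennreal (1 / real (Suc n)) \<le> ennreal e" using M by (intro ennreal_leI) simp
      then show ?case using q[of n] by (meson less_imp_le order_trans)
    qed
  qed
  then show ?case
    by (intro exI[of _ "\<lambda>n i. poly ((pderiv ^^ i) (q n))"]) (auto simp: smooth_fam_poly)
next
  case (Suc m)
  let ?R = "ereal \<rho>"
  define j where "j = k - Suc m"
  have j: "k - m = Suc j" "Suc j \<le> k" using Suc.prems by (auto simp: j_def)
  obtain H where H: "\<And>n. smooth_fam UNIV (H n)" "\<And>i. i \<le> m \<Longrightarrow> (\<lambda>n. wint N p ?R (\<lambda>t. H n i t - w (Suc j + i) t)) \<longlonglongrightarrow> 0"
    using Suc.IH Suc.prems j by auto
  have "\<exists>F. smooth_fam UNIV F \<and> (\<forall>i. F (Suc i) = H n i) \<and> F 0 \<rho> = 0" for n by (rule ex_antideriv_fam[OF H(1)])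
  then obtain F where F: "\<And>n. smooth_fam UNIV (F n)" "\<And>n i. F n (Suc i) = H n i" "\<And>n. F n 0 \<rho> = 0" by metis
  have sf: "smooth_fam (ivl ?R) (F n)" "smooth_fam (ivl ?R) (H n)" for n using F(1) H(1) by (auto intro: smooth_fam_subset)
  have Fm[measurable]: "F n i \<in> borel_measurable borel" for n i
    by (rule borel_measurable_continuous_onI[OF smooth_fam_continuous[OF F(1)]])
  have dF: "(F n 0 has_real_derivative H n 0 t) (at t)" for n t using smooth_famD[OF F(1), of t n 0] by (simp add: F(2))
  let ?W = "w (Suc j)"
  note Wm = wvalid_measurable[OF w k j(2)]
  have lim0: "(\<lambda>n. wint N p ?R (\<lambda>t. H n 0 t - ?W t)) \<longlonglongrightarrow> 0" using H(2)[of 0] by simp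
  have HH: "wint N p ?R (\<lambda>t. H a 0 t - H b 0 t) \<le> ennreal (2 powr p) * (wint N p ?R (\<lambda>t. H a 0 t - ?W t) + wint N p ?R (\<lambda>t. H b 0 t - ?W t))" for a b
  proof -
    have "wint N p ?R (\<lambda>t. (H a 0 t - ?W t) - (H b 0 t - ?W t)) \<le> ennreal (2 powr p) * (wint N p ?R (\<lambda>t. H a 0 t - ?W t) + wint N p ?R (\<lambda>t. H b 0 t - ?W t))"
      using p by (intro wint_diff_le set_borel_measurable_diff smooth_fam_measurable sf Wm) auto
    then show ?thesis by simp
  qed
  have FF: "wint N p ?R (\<lambda>t. F a 0 t - F b 0 t) \<le> ennreal (\<rho> powr p) * wint N p ?R (\<lambda>t. H a 0 t - H b 0 t)" for a b
    by (rule wint_antideriv_le[OF p \<rho>])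
      (auto intro!: continuous_on_diff smooth_fam_continuous[OF H(1)] DERIV_diff dF simp: F(3))
  have wm: "wint N p ?R h = (\<integral>\<^sup>+t. ennreal (\<bar>h t\<bar> powr p) \<partial>wmeas N ?R)" if [measurable]: "h \<in> borel_measurable borel" for h
    unfolding wint_def by (subst nn_integral_wmeas, measurable, intro nn_integral_cong) (auto simp: indicator_def ivl_def ennreal_mult'')
  \<comment> \<open>The primitives vanish at \<rho>, so \<open>wint_antideriv_le\<close> makes them
    a Cauchy sequence.\<close>
  obtain G0 where G0: "G0 \<in> borel_measurable (wmeas N ?R)" "(\<lambda>n. \<integral>\<^sup>+t. ennreal (\<bar>F n 0 t - G0 t\<bar> powr p) \<partial>wmeas N ?R) \<longlonglongrightarrow> 0"
  proof (rule Lp_complete[of "\<lambda>n. F n 0" "wmeas N ?R" p])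
    fix e :: real assume e: "e > 0"
    define d where "d = e / (4 * \<rho> powr p * 2 powr p)"
    have d: "d > 0" using e \<rho> by (simp add: d_def)
    have "\<forall>\<^sub>F n in sequentially. wint N p ?R (\<lambda>t. H n 0 t - ?W t) < ennreal d"
      by (rule order_tendstoD(2)[OF lim0]) (use d in simp)
    then obtain K where K: "\<And>n. n \<ge> K \<Longrightarrow> wint N p ?R (\<lambda>t. H n 0 t - ?W t) < ennreal d" unfolding eventually_sequentially by blast
    show "\<exists>K. \<forall>a\<ge>K. \<forall>b\<ge>K. (\<integral>\<^sup>+t. ennreal (\<bar>F a 0 t - F b 0 t\<bar> powr p) \<partial>wmeas N ?R) < ennreal e"
    proof (intro exI[of _ K] allI impI)
      fix a b assume ab: "a \<ge> K" "b \<ge> K"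
      have "(\<integral>\<^sup>+t. ennreal (\<bar>F a 0 t - F b 0 t\<bar> powr p) \<partial>wmeas N ?R) = wint N p ?R (\<lambda>t. F a 0 t - F b 0 t)" by (simp add: wm)
      also have "\<dots> \<le> ennreal (\<rho> powr p) * (ennreal (2 powr p) * (ennreal d + ennreal d))"
        using K[OF ab(1)] K[OF ab(2)] by (intro order_trans[OF FF] mult_left_mono order_trans[OF HH] add_mono) auto
      also have "ennreal d + ennreal d = ennreal (2 * d)" using d by (simp add: ennreal_plus[symmetric] del: ennreal_plus)
      also have "ennreal (\<rho> powr p) * (ennreal (2 powr p) * ennreal (2 * d)) = ennreal (e / 2)"
      proof -
        have 1: "\<rho> powr p * (2 powr p * (2 * d)) = e / 2" using \<rho> by (simp add: d_def)
        have 2: "ennreal x * (ennreal y * ennreal z) = ennreal (x * (y * z))" if "0 \<le> x" "0 \<le> y" "0 \<le> z" for x y z :: real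
          using that by (simp add: ennreal_mult)
        have "ennreal (\<rho> powr p) * (ennreal (2 powr p) * ennreal (2 * d)) = ennreal (\<rho> powr p * (2 powr p * (2 * d)))"
          by (rule 2) (use d in auto)
        then show ?thesis unfolding 1 .
      qed
      also have "\<dots> < ennreal e" using e by (simp add: ennreal_less_iff)
      finally show "(\<integral>\<^sup>+t. ennreal (\<bar>F a 0 t - F b 0 t\<bar> powr p) \<partial>wmeas N ?R) < ennreal e" .
    qed
  qed (use p in auto)
  have G0m[measurable]: "G0 \<in> borel_measurable borel" using G0(1) by simp
  have G0s: "set_borel_measurable lborel (ivl ?R) G0" unfolding set_borel_measurable_def by simp
  have limG: "(\<lambda>n. wint N p ?R (\<lambda>t. F n 0 t - G0 t)) \<longlonglongrightarrow> 0" using G0(2) by (simp add: wm)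
  have finG: "wint N p ?R G0 < \<infinity>"
  proof -
    have "\<forall>\<^sub>F n in sequentially. wint N p ?R (\<lambda>t. F n 0 t - G0 t) < ennreal 1" by (rule order_tendstoD(2)[OF limG]) simp
    then obtain n where n: "wint N p ?R (\<lambda>t. F n 0 t - G0 t) < ennreal 1" using eventually_happens by fastforce
    have "wint N p ?R (\<lambda>t. F n 0 t - (F n 0 t - G0 t)) \<le> ennreal (2 powr p) * (wint N p ?R (F n 0) + wint N p ?R (\<lambda>t. F n 0 t - G0 t))"
      using p by (intro wint_diff_le set_borel_measurable_diff smooth_fam_measurable sf G0s) auto
    moreover have "wint N p ?R (F n 0) < \<infinity>" using p by (intro wint_finite_continuous[OF \<rho>] smooth_fam_continuous[OF F(1)]) auto
    moreover have "wint N p ?R (\<lambda>t. F n 0 t - G0 t) < \<infinity>" using n by (rule less_trans) simp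
    ultimately show ?thesis by (auto simp: ennreal_mult_less_top ennreal_add_less_top intro: le_less_trans)
  qed
  define w' where "w' i = (if i = 0 then G0 else ?W)" for i :: nat
  have "weak_deriv ?R 1 (w' 0) (w' 1)"
  proof (rule weak_deriv_limit[where f=F and k=1 and w=w' and N=N and j=1, OF p sf(1)])
    fix i :: nat assume "i \<le> 1"
    then have "i = 0 \<or> i = 1" by auto
    then show "set_borel_measurable lborel (ivl ?R) (w' i)" "wint N p ?R (w' i) < \<infinity>"
      "(\<lambda>n. wint N p ?R (\<lambda>t. F n i t - w' i t)) \<longlonglongrightarrow> 0"
      using G0s Wm finG limG lim0 F(2)[of _ 0] by (auto simp: w'_def)
  qed simp
  then have wG: "loc_int ?R G0" "\<And>\<phi>. test_fn ?R \<phi> \<Longrightarrow> (LINT t:ivl ?R|lborel. G0 t * deriv \<phi> t) = - (LINT t:ivl ?R|lborel. ?W t * \<phi> t)"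
    by (auto simp: weak_deriv_def w'_def)
  have jk: "j \<le> k" using j by simp
  note wj = wvalid_measurable[OF w k jk]
  \<comment> \<open>\<open>w j\<close> and \<open>G0\<close> have the same weak derivative.\<close>
  have "\<exists>c. AE t in lborel. t \<in> ivl ?R \<longrightarrow> w j t - G0 t = c"
  proof (rule du_Bois_Reymond)
    show "loc_int ?R (\<lambda>t. w j t - G0 t)"
      using wj(1) wG(1) unfolding loc_int_def by (auto intro: set_borel_measurable_diff)
    fix \<phi> assume \<phi>: "test_fn ?R \<phi>"
    obtain a b where ab: "0 < a" "a < b" "ereal b < ?R" "\<And>m t. t \<notin> {a<..<b} \<Longrightarrow> (deriv ^^ m) \<phi> t = 0"
      using test_fnE[OF \<phi>] by metis
    have c: "continuous_on UNIV (deriv \<phi>)" using smooth_fam_continuous[OF test_fn_smooth_fam[OF \<phi>], of 1] by simp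
    have z: "deriv \<phi> t = 0" if "t \<notin> {a..b}" for t using ab(4)[of t 1] that by auto
    note li = loc_int_mult_integrable[OF _ c ab(1) less_imp_le[OF ab(2)] ab(3) z]
    from set_integral_diff(2)[OF li[OF wj(1)] li[OF wG(1)]] show "(LINT t:ivl ?R|lborel. (w j t - G0 t) * deriv \<phi> t) = 0"
      using wvalid_weak_step[OF w j(2) \<phi>] wG(2)[OF \<phi>] by (simp add: left_diff_distrib)
  qed (use \<rho> in auto)
  then obtain c where c: "AE t in lborel. t \<in> ivl ?R \<longrightarrow> w j t - G0 t = c" by blast
  \<comment> \<open>The constant changes only the zeroth member; the derivatives stay as they
    were.\<close>
  define F' where "F' n i t = (if i = 0 then F n 0 t + c else F n i t)" for n i t
  have F's: "smooth_fam UNIV (F' n)" for n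
    unfolding smooth_fam_def
  proof (intro allI ballI)
    fix i t
    have "F' n i = (if i = 0 then (\<lambda>t. F n 0 t + c) else F n i)" by (auto simp: F'_def fun_eq_iff)
    then show "(F' n i has_real_derivative F' n (Suc i) t) (at t)"
      using DERIV_add[OF smooth_famD[OF F(1)[of n], of t 0] DERIV_const[of c]] smooth_famD[OF F(1)[of n], of t i]
      by (auto simp: F'_def)
  qed
  have "(\<lambda>n. wint N p ?R (\<lambda>t. F' n i t - w (j + i) t)) \<longlonglongrightarrow> 0" if i: "i \<le> Suc m" for i
  proof (cases i)
    case 0
    have "wint N p ?R (\<lambda>t. F' n 0 t - w j t) = wint N p ?R (\<lambda>t. F n 0 t - G0 t)" for n
      by (rule wint_cong_AE) (use c in \<open>auto elim!: eventually_mono simp: F'_def\<close>)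
    then show ?thesis using limG 0 by simp
  next
    case (Suc i')
    then show ?thesis using H(2)[of i'] i by (simp add: F'_def F(2))
  qed
  then show ?case using F's by (intro exI[of _ F']) (auto simp: j_def)
qed

section \<open>Making profiles constant near the origin\<close>

lemma smooth_fam_bounded_Icc:
  assumes "smooth_fam UNIV F"
  shows "\<exists>B\<ge>1. \<forall>i\<le>k. \<forall>t\<in>{a..b}. \<bar>F i t\<bar> \<le> B"
proof (induction k)
  have bd: "\<exists>B\<ge>1. \<forall>t\<in>{a..b}. \<bar>F i t\<bar> \<le> B" for i
  proof -
    have "compact (F i ` {a..b})" using smooth_fam_continuous[OF assms] by (intro compact_continuous_image) (auto intro: continuous_on_subset)
    then obtain B where "\<And>t. t \<in> {a..b} \<Longrightarrow> \<bar>F i t\<bar> \<le> B"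
      using compact_imp_bounded[of "F i ` {a..b}"] unfolding bounded_iff by fastforce
    then show ?thesis by (intro exI[of _ "max B 1"]) fastforce
  qed
  case 0
  then show ?case using bd[of 0] by auto
  case (Suc k)
  obtain B where B: "B \<ge> 1" "\<forall>i\<le>k. \<forall>t\<in>{a..b}. \<bar>F i t\<bar> \<le> B" using Suc by blast
  obtain B' where B': "B' \<ge> 1" "\<forall>t\<in>{a..b}. \<bar>F (Suc k) t\<bar> \<le> B'" using bd by blast
  show ?case by (intro exI[of _ "max B B'"]) (use B B' in \<open>auto simp: le_Suc_eq max_def intro: order_trans\<close>)
qed

text \<open>The cutoff multiplies the first derivative of F, and V is a primitive of the product
  agreeing with F at \<rho>. The error in the derivative of order m + 1 is at most of size n^m on an
  interval of weighted mass n^(-N), and m is at most k - 1. Cutting off F itself would bring in n^k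
  and the stronger condition k p < N.\<close>

lemma cutoff_near_zero:
  fixes N k :: nat
  assumes p: "1 \<le> p" and \<rho>: "0 < \<rho>" and k: "1 \<le> k" and N: "1 \<le> N" "real (k - 1) * p < N" and F: "smooth_fam UNIV F" and e: "0 < e"
  shows "\<exists>V. smooth_fam UNIV V \<and> flat V \<and> (\<forall>j\<le>k. wint N p (ereal \<rho>) (\<lambda>t. V j t - F j t) < ennreal e)"
proof -
  let ?R = "ereal \<rho>"
  obtain cut where cut: "smooth_fam UNIV cut" "\<And>t. t \<le> 1 \<Longrightarrow> cut 0 t = 0" "\<And>t. t \<ge> 2 \<Longrightarrow> cut 0 t = 1"
    "\<And>t. 0 \<le> cut 0 t" "\<And>t. cut 0 t \<le> (1::real)" "\<And>i t. i \<ge> 1 \<Longrightarrow> t \<notin> {1<..<2} \<Longrightarrow> cut i t = 0"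
    using ex_cutoff by blast
  have cz: "cut i t = 0" if "t \<le> 1" for i t using cut(2)[OF that] cut(6)[of i t] that by (cases "i = 0") auto
  obtain A where A: "A \<ge> 1" "\<And>i t. i \<le> k \<Longrightarrow> t \<in> {1..2} \<Longrightarrow> \<bar>cut i t\<bar> \<le> A"
    using smooth_fam_bounded_Icc[OF cut(1), of k 1 2] by blast
  obtain B where B: "B \<ge> 1" "\<And>i t. i \<le> Suc k \<Longrightarrow> t \<in> {0..\<rho>} \<Longrightarrow> \<bar>F i t\<bar> \<le> B"
    using smooth_fam_bounded_Icc[OF F, of "Suc k" 0 \<rho>] by blast
  \<comment> \<open>The cutoff switches on between 1 / n and 2 / n, and its i-th derivative is of
    size n^i.\<close>
  define X where "X n i t = real n ^ i * cut i (real n * t + 0)" for n i t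
  have Xs: "smooth_fam UNIV (X n)" for n unfolding X_def[abs_def] by (rule smooth_fam_affine[OF cut(1)])
  let ?F1 = "\<lambda>i. F (Suc i)"
  have F1s: "smooth_fam UNIV ?F1" by (rule smooth_fam_shift[OF F])
  define Z where "Z n m = prodfam m (X n) ?F1" for n m
  have Zs: "smooth_fam UNIV (Z n)" for n unfolding Z_def[abs_def] by (rule smooth_fam_prodfam[OF Xs F1s])
  have "\<exists>V. smooth_fam UNIV V \<and> (\<forall>i. V (Suc i) = Z n i) \<and> V 0 \<rho> = F 0 \<rho>" for n by (rule ex_antideriv_fam[OF Zs])
  then obtain V where V: "\<And>n. smooth_fam UNIV (V n)" "\<And>n i. V n (Suc i) = Z n i" "\<And>n. V n 0 \<rho> = F 0 \<rho>" by metis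
  have Zdiff: "Z n m t - F (Suc m) t = prodfam m (\<lambda>i t. X n i t - (if i = 0 then 1 else 0)) ?F1 t" for n m t
    unfolding Z_def prodfam_diff_one ..
  define L where "L = cosh \<rho> ^ (N - 1)"
  have L: "L \<ge> 1" unfolding L_def by (simp add: one_le_power cosh_real_ge_1)
  \<comment> \<open>The error lives on t < 2 / n: there \<open>L * (2 / n) ^ (N - 1)\<close> bounds
    the weight, and a further factor 2 / n is the length of the interval.\<close>
  define C where "C m = (2 ^ m * A * B) powr p * L * 2 ^ N" for m
  have wb: "wint N p ?R (\<lambda>t. Z n m t - F (Suc m) t) \<le> ennreal (C m * real n powr (real m * p - real N))" if n: "n \<ge> 1" and m: "m < k" for n m
  proof -
    have n0: "real n > 0" using n by simp
    have zero: "Z n m t - F (Suc m) t = 0" if t: "2 / real n \<le> t" for t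
    proof -
      have "2 \<le> real n * t" using t n0 by (simp add: field_simps)
      then show ?thesis unfolding Zdiff by (intro prodfam_zero) (auto simp: X_def cut(3,6))
    qed
    have bound: "\<bar>Z n m t - F (Suc m) t\<bar> \<le> 2 ^ m * A * B * real n ^ m" if t: "t \<in> {0..\<rho>}" for t
      unfolding Zdiff
    proof (rule prodfam_bound)
      fix i assume i: "i \<le> m"
      show "\<bar>F (Suc i) t\<bar> \<le> B" using B(2)[of "Suc i" t] t i m by simp
      show "\<bar>X n i t - (if i = 0 then 1 else 0)\<bar> \<le> A * real n ^ i"
      proof (cases "i = 0")
        case True
        then show ?thesis using cut(4,5)[of "real n * t"] A(1) by (simp add: X_def abs_le_iff)
      next
        case False
        have "\<bar>cut i (real n * t)\<bar> \<le> A"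
          using A(1) A(2)[of i "real n * t"] cut(6)[of i "real n * t"] False i m by (cases "real n * t \<in> {1<..<2}") auto
        then show ?thesis using False n0 by (simp add: X_def abs_mult mult.commute mult_right_mono)
      qed
    qed (use A B n in auto)
    have "wint N p ?R (\<lambda>t. Z n m t - F (Suc m) t) \<le> (\<integral>\<^sup>+t. ennreal ((2 ^ m * A * B * real n ^ m) powr p * (L * (2 / real n) ^ (N - 1))) * indicator {0..2 / real n} t \<partial>lborel)"
      unfolding wint_def
    proof (intro nn_integral_mono)
      fix t
      show "ennreal (\<bar>Z n m t - F (Suc m) t\<bar> powr p * sinh t ^ (N - 1)) * indicator (ivl ?R) t \<le> ennreal ((2 ^ m * A * B * real n ^ m) powr p * (L * (2 / real n) ^ (N - 1))) * indicator {0..2 / real n} t"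
      proof (cases "t \<in> ivl ?R \<and> t < 2 / real n")
        case True
        then have t: "0 < t" "t < \<rho>" "t < 2 / real n" by (auto simp: ivl_def)
        have "sinh t \<le> t * cosh t" using t by (intro sinh_le_mult_cosh) auto
        also have "\<dots> \<le> (2 / real n) * cosh \<rho>" using t cosh_real_nonneg_le_iff[of t \<rho>] by (intro mult_mono) auto
        finally have "sinh t ^ (N - 1) \<le> ((2 / real n) * cosh \<rho>) ^ (N - 1)" using t by (intro power_mono) auto
        then have "sinh t ^ (N - 1) \<le> L * (2 / real n) ^ (N - 1)" by (simp only: L_def power_mult_distrib mult.commute)
        moreover have "\<bar>Z n m t - F (Suc m) t\<bar> powr p \<le> (2 ^ m * A * B * real n ^ m) powr p"
          using bound[of t] t p by (intro powr_mono2) auto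
        ultimately show ?thesis using True t by (auto intro!: ennreal_leI mult_mono)
      next
        case False
        then show ?thesis using zero[of t] by (auto simp: indicator_def)
      qed
    qed
    also have "\<dots> = ennreal ((2 ^ m * A * B * real n ^ m) powr p * (L * (2 / real n) ^ (N - 1))) * ennreal (2 / real n)"
      by (subst nn_integral_cmult_indicator) auto
    also have "\<dots> = ennreal ((2 ^ m * A * B * real n ^ m) powr p * (L * (2 / real n) ^ (N - 1)) * (2 / real n))"
      using L by (subst ennreal_mult[symmetric]) auto
    also have "(2 ^ m * A * B * real n ^ m) powr p * (L * (2 / real n) ^ (N - 1)) * (2 / real n) = C m * real n powr (real m * p - real N)"
    proof -
      have "(2 / real n) ^ (N - 1) * (2 / real n) = (2 / real n) ^ N" using N(1) by (simp add: power_eq_if[of _ N] mult.commute)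
      also have "\<dots> = 2 ^ N * real n powr (- real N)"
        using n0 by (simp add: power_divide powr_minus powr_realpow divide_inverse power_inverse)
      finally have 1: "(2 / real n) ^ (N - 1) * (2 / real n) = 2 ^ N * real n powr (- real N)" .
      have "(2 ^ m * A * B * real n ^ m) powr p = (2 ^ m * A * B) powr p * (real n ^ m) powr p"
        using A B by (simp add: powr_mult)
      also have "(real n ^ m) powr p = real n powr (real m * p)"
        using n0 by (simp add: powr_realpow[symmetric] powr_powr)
      finally have 2: "(2 ^ m * A * B * real n ^ m) powr p = (2 ^ m * A * B) powr p * real n powr (real m * p)" .
      have "real n powr (real m * p - real N) = real n powr (real m * p) * real n powr (- real N)" by (simp add: powr_add[symmetric])
      moreover have "(P * Q) * (L * U) * W = P * L * (U * W) * Q" for P Q U W :: real by (simp only: mult_ac)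
      ultimately show ?thesis unfolding 2 C_def by (simp only: 1) (simp only: mult_ac)
    qed
    finally show ?thesis .
  qed
  have lim: "(\<lambda>n. ennreal (C m * real n powr (real m * p - real N))) \<longlonglongrightarrow> 0" if m: "m < k" for m
  proof -
    have "real m * p \<le> real (k - 1) * p" using m p by (intro mult_right_mono) auto
    then have "real m * p - real N < 0" using N by simp
    from tendsto_neg_powr[OF this filterlim_real_sequentially] have "(\<lambda>n. real n powr (real m * p - real N)) \<longlonglongrightarrow> 0" .
    from tendsto_mult[OF tendsto_const[of "C m"] this] have "(\<lambda>n. C m * real n powr (real m * p - real N)) \<longlonglongrightarrow> 0" by simp
    then show ?thesis using tendsto_ennrealI by fastforce
  qed
  have limZ: "(\<lambda>n. wint N p ?R (\<lambda>t. Z n m t - F (Suc m) t)) \<longlonglongrightarrow> 0" if m: "m < k" for m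
    by (rule tendsto_sandwich[OF _ _ tendsto_const lim[OF m]])
      (auto simp: eventually_sequentially intro!: exI[of _ 1] wb m)
  have limV: "\<forall>\<^sub>F n in sequentially. wint N p ?R (\<lambda>t. V n j t - F j t) < ennreal e" if j: "j \<le> k" for j
  proof (cases j)
    case (Suc m)
    then have "(\<lambda>n. wint N p ?R (\<lambda>t. V n j t - F j t)) \<longlonglongrightarrow> 0" using limZ[of m] j by (simp add: V(2))
    then show ?thesis by (rule order_tendstoD) (use e in simp)
  next
    case 0
    have le: "wint N p ?R (\<lambda>t. V n 0 t - F 0 t) \<le> ennreal (\<rho> powr p) * wint N p ?R (\<lambda>t. Z n 0 t - F (Suc 0) t)" for n
    proof (rule wint_antideriv_le[OF p \<rho>])
      show "continuous_on UNIV (\<lambda>t. Z n 0 t - F (Suc 0) t)" by (intro continuous_on_diff smooth_fam_continuous[OF Zs] smooth_fam_continuous[OF F])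
      show "((\<lambda>t. V n 0 t - F 0 t) has_real_derivative Z n 0 t - F (Suc 0) t) (at t)" for t
        using DERIV_diff[OF smooth_famD[OF V(1)[of n], of t 0] smooth_famD[OF F, of t 0]] by (simp add: V(2))
    qed (simp add: V(3))
    have "(\<lambda>n. ennreal (\<rho> powr p) * wint N p ?R (\<lambda>t. Z n 0 t - F (Suc 0) t)) \<longlonglongrightarrow> ennreal (\<rho> powr p) * 0"
      using k by (intro ennreal_tendsto_cmult limZ) auto
    then have L0: "(\<lambda>n. ennreal (\<rho> powr p) * wint N p ?R (\<lambda>t. Z n 0 t - F (Suc 0) t)) \<longlonglongrightarrow> 0" by simp
    have "(\<lambda>n. wint N p ?R (\<lambda>t. V n 0 t - F 0 t)) \<longlonglongrightarrow> 0"
      by (rule tendsto_sandwich[OF _ _ tendsto_const L0]) (use le in auto)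
    then show ?thesis unfolding 0 by (rule order_tendstoD) (use e in simp)
  qed
  have "\<forall>\<^sub>F n in sequentially. \<forall>j\<in>{..k}. wint N p ?R (\<lambda>t. V n j t - F j t) < ennreal e"
    using limV by (intro eventually_ball_finite) auto
  then have "\<forall>\<^sub>F n in sequentially. (\<forall>j\<in>{..k}. wint N p ?R (\<lambda>t. V n j t - F j t) < ennreal e) \<and> 1 \<le> n"
    using eventually_ge_at_top by (rule eventually_conj)
  then obtain n where n: "\<forall>j\<le>k. wint N p ?R (\<lambda>t. V n j t - F j t) < ennreal e" "1 \<le> n"
    using eventually_happens by fastforce
  have Z0: "Z n i t = 0" if "t \<le> 1 / real n" for i t
  proof -
    have "real n * t \<le> 1" using that n(2) by (simp add: field_simps)
    then show ?thesis unfolding Z_def by (intro prodfam_zero) (simp add: X_def cz)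
  qed
  have "flat (V n)" unfolding flat_def
  proof (rule exI[of _ "1 / real n"], intro conjI exI[of _ "V n 0 (1 / real n)"] allI impI)
    show "0 < 1 / real n" using n(2) by simp
    show "V n 0 t = V n 0 (1 / real n)" if "t < 1 / real n" for t
    proof (rule deriv_zero_const[where h="V n 0" and h'="Z n 0"])
      show "(V n 0 has_real_derivative Z n 0 x) (at x)" for x using smooth_famD[OF V(1)[of n], of x 0] by (simp add: V(2))
    qed (use that Z0 in auto)
    show "V n i t = 0" if "1 \<le> i" "t < 1 / real n" for i t
      using that V(2)[of n "i - 1"] Z0[of t "i - 1"] by simp
  qed
  then show ?thesis using V(1) n(1) by blast
qed

lemma density_finite:
  fixes N k :: nat
  assumes p: "1 \<le> p" and \<rho>: "0 < \<rho>" and k: "1 \<le> k" and N: "1 \<le> N" "real (k - 1) * p < N"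
    and w: "wvalid N k p (ereal \<rho>) v w" and e: "0 < e"
  shows "\<exists>V. smooth_fam UNIV V \<and> flat V \<and> (\<forall>j\<le>k. wint N p (ereal \<rho>) (\<lambda>t. V j t - w j t) < ennreal e)"
proof -
  let ?R = "ereal \<rho>"
  define d where "d = e / (4 * 2 powr p)"
  have d: "d > 0" using e by (simp add: d_def)
  obtain H where H: "\<And>n. smooth_fam UNIV (H n)" "\<And>i. i \<le> k \<Longrightarrow> (\<lambda>n. wint N p ?R (\<lambda>t. H n i t - w i t)) \<longlonglongrightarrow> 0"
    using smooth_approx[OF p \<rho> k w order_refl] by auto
  have "\<forall>\<^sub>F n in sequentially. \<forall>i\<in>{..k}. wint N p ?R (\<lambda>t. H n i t - w i t) < ennreal d"
    using order_tendstoD(2)[OF H(2)] d by (intro eventually_ball_finite) auto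
  then obtain n where n: "\<And>i. i \<le> k \<Longrightarrow> wint N p ?R (\<lambda>t. H n i t - w i t) < ennreal d"
    using eventually_happens by fastforce
  obtain V where V: "smooth_fam UNIV V" "flat V" "\<And>j. j \<le> k \<Longrightarrow> wint N p ?R (\<lambda>t. V j t - H n j t) < ennreal d"
    using cutoff_near_zero[OF p \<rho> k N H(1) d] by blast
  have "wint N p ?R (\<lambda>t. V j t - w j t) < ennreal e" if j: "j \<le> k" for j
  proof -
    have s: "smooth_fam (ivl ?R) V" "smooth_fam (ivl ?R) (H n)" using V(1) H(1) by (auto intro: smooth_fam_subset)
    have "wint N p ?R (\<lambda>t. (V j t - H n j t) + (H n j t - w j t)) \<le> ennreal (2 powr p) * (wint N p ?R (\<lambda>t. V j t - H n j t) + wint N p ?R (\<lambda>t. H n j t - w j t))"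
      using p by (intro wint_add_le set_borel_measurable_diff smooth_fam_measurable s wvalid_measurable[OF w k j]) auto
    also have "\<dots> \<le> ennreal (2 powr p) * (ennreal d + ennreal d)"
      using n[OF j] V(3)[OF j] by (intro mult_left_mono add_mono) auto
    also have "\<dots> = ennreal (2 powr p * (2 * d))"
      using d by (simp add: ennreal_mult[symmetric] ennreal_plus[symmetric] del: ennreal_plus)
    also have "2 powr p * (2 * d) = e / 2" by (simp add: d_def)
    also have "ennreal (e / 2) < ennreal e" using e by (simp add: ennreal_less_iff)
    finally show ?thesis by simp
  qed
  then show ?thesis using V by blast
qed

section \<open>Density on the half line for order one\<close>

lemma wvalid_restrict:
  assumes w: "wvalid N k p \<infinity> v w"
  shows "wvalid N k p (ereal \<rho>) v w"
proof -
  have sub: "ivl (ereal \<rho>) \<subseteq> ivl \<infinity>" by (auto simp: ivl_def)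
  have l: "loc_int (ereal \<rho>) f" if "loc_int \<infinity> f" for f
    unfolding loc_int_def
  proof (intro conjI allI impI)
    have "(\<lambda>t. indicator (ivl \<infinity>) t * f t) \<in> borel_measurable borel" using that by (simp add: loc_int_def set_borel_measurable_def)
    note [measurable] = this
    have "(\<lambda>t. indicator (ivl (ereal \<rho>)) t * f t) = (\<lambda>t. indicator (ivl (ereal \<rho>)) t * (indicator (ivl \<infinity>) t * f t))"
      using sub by (auto simp: indicator_def fun_eq_iff)
    then show "set_borel_measurable lborel (ivl (ereal \<rho>)) f" by (simp add: set_borel_measurable_def)
  qed (use that in \<open>auto simp: loc_int_def\<close>)
  have wd: "weak_deriv (ereal \<rho>) j v (w j)" if "weak_deriv \<infinity> j v (w j)" for j
    unfolding weak_deriv_def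
  proof (intro conjI allI impI)
    show "loc_int (ereal \<rho>) v" "loc_int (ereal \<rho>) (w j)" using that l by (auto simp: weak_deriv_def)
    fix \<phi> assume \<phi>: "test_fn (ereal \<rho>) \<phi>"
    obtain a b where ab: "0 < a" "a < b" "ereal b < ereal \<rho>" "\<And>m t. t \<notin> {a<..<b} \<Longrightarrow> (deriv ^^ m) \<phi> t = 0"
      using test_fnE[OF \<phi>] by metis
    have "test_fn \<infinity> \<phi>" using \<phi> unfolding test_fn_def by fastforce
    then have eq: "(LINT t:ivl \<infinity>|lborel. v t * (deriv ^^ j) \<phi> t) = (-1) ^ j * (LINT t:ivl \<infinity>|lborel. w j t * \<phi> t)"
      using that by (simp add: weak_deriv_def)
    have r: "(LINT t:ivl \<infinity>|lborel. f t * (deriv ^^ m) \<phi> t) = (LINT t:ivl (ereal \<rho>)|lborel. f t * (deriv ^^ m) \<phi> t)" for f :: "real \<Rightarrow> real" and m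
    proof (rule set_lebesgue_integral_restrict[OF sub])
      fix t assume "t \<in> ivl \<infinity> - ivl (ereal \<rho>)"
      then have "t \<notin> {a<..<b}" using ab(3) by (auto simp: ivl_def)
      then show "f t * (deriv ^^ m) \<phi> t = 0" using ab(4) by simp
    qed
    from eq r[of v j] r[of "w j" 0] show "(LINT t:ivl (ereal \<rho>)|lborel. v t * (deriv ^^ j) \<phi> t) = (-1) ^ j * (LINT t:ivl (ereal \<rho>)|lborel. w j t * \<phi> t)" by simp
  qed
  have "wint N p (ereal \<rho>) f \<le> wint N p \<infinity> f" for f
    unfolding wint_def using sub by (intro nn_integral_mono) (auto simp: indicator_def)
  then show ?thesis using w wd unfolding wvalid_def by (meson le_less_trans)
qed

lemma wint_abs: "wint N p R (\<lambda>t. \<bar>f t\<bar>) = wint N p R f"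
  by (simp add: wint_def)

lemma wint_cmult:
  assumes "set_borel_measurable lborel (ivl R) f" "0 \<le> c"
  shows "wint N p R (\<lambda>t. c * f t) = ennreal (c powr p) * wint N p R f"
proof -
  have [measurable]: "(\<lambda>t. indicator (ivl R) t * f t) \<in> borel_measurable borel"
    using assms by (simp add: set_borel_measurable_def)
  have "set_borel_measurable lborel (ivl R) (\<lambda>t. c * f t)"
  proof -
    have "(\<lambda>t. indicator (ivl R) t * (c * f t)) = (\<lambda>t. c * (indicator (ivl R) t * f t))" by auto
    then show ?thesis by (simp add: set_borel_measurable_def)
  qed
  from wint_eq_wmeas[OF this] have "wint N p R (\<lambda>t. c * f t) = (\<integral>\<^sup>+t. ennreal (c powr p) * ennreal (\<bar>indicator (ivl R) t * f t\<bar> powr p) \<partial>wmeas N R)"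
    using assms(2) by (auto intro!: nn_integral_cong simp: abs_mult powr_mult ennreal_mult mult.left_commute)
  also have "\<dots> = ennreal (c powr p) * wint N p R f"
    unfolding wint_eq_wmeas[OF assms(1)] by (rule nn_integral_cmult) measurable
  finally show ?thesis .
qed

lemma wint_tail:
  assumes f: "set_borel_measurable lborel (ivl R) f" and fin: "wint N p R f < \<infinity>" and p: "0 < p"
  shows "(\<lambda>n. wint N p R (\<lambda>t. if t < real n then 0 else f t)) \<longlonglongrightarrow> 0"
proof -
  define F where "F t = indicator (ivl R) t * f t" for t
  have [measurable]: "F \<in> borel_measurable borel" using f by (simp add: set_borel_measurable_def F_def[abs_def])
  let ?g = "\<lambda>n t. if t < real n then 0 else F t"
  have eq: "wint N p R (\<lambda>t. if t < real n then 0 else f t) = (\<integral>\<^sup>+t. ennreal (\<bar>?g n t\<bar> powr p) \<partial>wmeas N R)" for n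
  proof -
    have "wint N p R (\<lambda>t. if t < real n then 0 else f t) = wint N p R (?g n)"
      by (rule wint_cong) (simp add: F_def)
    also have "\<dots> = (\<integral>\<^sup>+t. ennreal (\<bar>?g n t\<bar> powr p) \<partial>wmeas N R)"
      unfolding wint_def by (subst nn_integral_wmeas, measurable, intro nn_integral_cong) (auto simp: indicator_def ivl_def ennreal_mult'')
    finally show ?thesis .
  qed
  have "(\<lambda>n. \<integral>\<^sup>+t. ennreal (\<bar>?g n t\<bar> powr p) \<partial>wmeas N R) \<longlonglongrightarrow> (\<integral>\<^sup>+t. 0 \<partial>wmeas N R)"
  proof (rule nn_integral_dominated_convergence[where w="\<lambda>t. ennreal (\<bar>F t\<bar> powr p)"])
    show "(\<integral>\<^sup>+t. ennreal (\<bar>F t\<bar> powr p) \<partial>wmeas N R) < \<infinity>" using fin unfolding wint_eq_wmeas[OF f] F_def .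
    show "AE t in wmeas N R. ennreal (\<bar>?g n t\<bar> powr p) \<le> ennreal (\<bar>F t\<bar> powr p)" for n
      using p by (intro AE_I2) auto
    show "AE t in wmeas N R. (\<lambda>n. ennreal (\<bar>?g n t\<bar> powr p)) \<longlonglongrightarrow> 0"
    proof (intro AE_I2)
      fix t
      obtain m :: nat where m: "t < real m" using reals_Archimedean2 by blast
      have "\<forall>\<^sub>F n in sequentially. ennreal (\<bar>?g n t\<bar> powr p) = 0"
        using eventually_ge_at_top[of m] by eventually_elim (use m p in auto)
      then show "(\<lambda>n. ennreal (\<bar>?g n t\<bar> powr p)) \<longlonglongrightarrow> 0" by (rule tendsto_eventually)
    qed
  qed auto
  then show ?thesis by (simp add: eq)
qed

text \<open>A flat approximant on a long bounded interval is multiplied by a cutoff falling over a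
  unit length, whose derivative is bounded independently of the position. The error is that of the
  approximant where it is used, plus the tail of v and of its derivative.\<close>

lemma density_infinite:
  fixes N :: nat
  assumes p: "1 \<le> p" and N: "1 \<le> N" and w: "wvalid N 1 p \<infinity> v w" and e: "0 < e"
  shows "\<exists>V. smooth_fam UNIV V \<and> flat V \<and> (\<forall>j\<le>1. wint N p \<infinity> (\<lambda>t. V j t - w j t) < ennreal e)"
proof -
  obtain cut where cut: "smooth_fam UNIV cut" "\<And>t. t \<le> 1 \<Longrightarrow> cut 0 t = 0" "\<And>t. t \<ge> 2 \<Longrightarrow> cut 0 t = 1"
    "\<And>t. 0 \<le> cut 0 t" "\<And>t. cut 0 t \<le> (1::real)" "\<And>i t. i \<ge> 1 \<Longrightarrow> t \<notin> {1<..<2} \<Longrightarrow> cut i t = 0"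
    using ex_cutoff by blast
  have cz: "cut i t = 0" if "t \<le> 1" for i t using cut(2)[OF that] cut(6)[of i t] that by (cases "i = 0") auto
  obtain A where A: "A \<ge> 1" "\<And>i t. i \<le> 1 \<Longrightarrow> t \<in> {1..2} \<Longrightarrow> \<bar>cut i t\<bar> \<le> A"
    using smooth_fam_bounded_Icc[OF cut(1), of 1 1 2] by blast
  have A': "\<bar>cut 1 t\<bar> \<le> A" for t using A(1) A(2)[of 1 t] cut(6)[of 1 t] by (cases "t \<in> {1<..<2}") auto
  \<comment> \<open>In the transition zone the derivative of the cutoff contributes at most
    \<open>A\<close> times the sum of the four errors, and the remaining terms at most twice that
    sum.\<close>
  define K where "K = A + 2"
  define d where "d = e / (8 * 2 powr p * 2 powr p * K powr p)"
  have K: "K \<ge> 1" "K powr p > 0" using A by (auto simp: K_def)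
  have d: "d > 0" using e K by (simp add: d_def)
  have wm: "set_borel_measurable lborel (ivl \<infinity>) (w j)" "wint N p \<infinity> (w j) < \<infinity>" if "j \<le> 1" for j
    using wvalid_measurable[OF w _ that] by auto
  have "\<forall>\<^sub>F n in sequentially. \<forall>j\<in>{..1}. wint N p \<infinity> (\<lambda>t. if t < real n then 0 else w j t) < ennreal d"
    using order_tendstoD(2)[OF wint_tail[OF wm]] d p by (intro eventually_ball_finite) auto
  then have "\<forall>\<^sub>F n in sequentially. (\<forall>j\<in>{..1}. wint N p \<infinity> (\<lambda>t. if t < real n then 0 else w j t) < ennreal d) \<and> 1 \<le> n"
    using eventually_ge_at_top by (rule eventually_conj)
  then obtain n where n: "\<And>j. j \<le> 1 \<Longrightarrow> wint N p \<infinity> (\<lambda>t. if t < real n then 0 else w j t) < ennreal d" "1 \<le> n"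
    using eventually_happens by fastforce
  \<comment> \<open>The reflected cutoff \<open>\<psi>\<close> is 1 up to n and 0 from n + 1 on, so
    the approximant is used only inside its interval.\<close>
  define \<rho> where "\<rho> = real n + 2"
  have \<rho>: "\<rho> > 0" by (simp add: \<rho>_def)
  obtain V where V: "smooth_fam UNIV V" "flat V" "\<And>j. j \<le> 1 \<Longrightarrow> wint N p (ereal \<rho>) (\<lambda>t. V j t - w j t) < ennreal d"
    using density_finite[OF p \<rho> order_refl N _ wvalid_restrict[OF w] d] N by auto
  define \<psi> where "\<psi> i t = (- 1) ^ i * cut i ((- 1) * t + \<rho>)" for i t
  have \<psi>s: "smooth_fam UNIV \<psi>" unfolding \<psi>_def[abs_def] by (rule smooth_fam_affine[OF cut(1)])
  define Y where "Y m = prodfam m \<psi> V" for m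
  have Ys: "smooth_fam UNIV Y" unfolding Y_def[abs_def] by (rule smooth_fam_prodfam[OF \<psi>s V(1)])
  have YV: "Y m t = V m t" if "t \<le> real n" for m t
  proof -
    have "prodfam m (\<lambda>i t. \<psi> i t - (if i = 0 then 1 else 0)) V t = 0"
      by (rule prodfam_zero) (use that in \<open>auto simp: \<psi>_def \<rho>_def cut(3,6)\<close>)
    then show ?thesis unfolding prodfam_diff_one Y_def by simp
  qed
  have Y0: "Y m t = 0" if "real n + 1 \<le> t" for m t
    unfolding Y_def by (rule prodfam_zero) (use that in \<open>auto simp: \<psi>_def \<rho>_def cz\<close>)
  have flatY: "flat Y"
  proof -
    obtain \<delta> c where \<delta>: "\<delta> > 0" "\<forall>t<\<delta>. V 0 t = c" "\<forall>i\<ge>1. \<forall>t<\<delta>. V i t = 0" using V(2) unfolding flat_def by blast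
    show ?thesis unfolding flat_def
      by (rule exI[of _ "min \<delta> 1"], intro conjI exI[of _ c]) (use \<delta> YV n(2) in \<open>auto\<close>)
  qed
  \<comment> \<open>\<open>a\<close> is the approximation error, cut off at \<rho>, and
    \<open>b\<close> the tail of the given functions.\<close>
  define a where "a j t = (if t < \<rho> then V j t - w j t else 0)" for j t
  define b where "b j t = (if t < real n then 0 else w j t)" for j t
  have pt: "\<bar>Y j t - w j t\<bar> \<le> K * ((\<bar>a 0 t\<bar> + \<bar>a 1 t\<bar>) + (\<bar>b 0 t\<bar> + \<bar>b 1 t\<bar>))" if j: "j \<le> 1" for j t
  proof -
    let ?S = "(\<bar>a 0 t\<bar> + \<bar>a 1 t\<bar>) + (\<bar>b 0 t\<bar> + \<bar>b 1 t\<bar>)"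
    have S0: "0 \<le> ?S" by simp
    have S1: "?S \<le> K * ?S" using mult_right_mono[OF K(1) S0] by simp
    have j01: "j = 0 \<or> j = 1" using j by auto
    consider "t < real n" | "real n \<le> t" "t < real n + 1" | "real n + 1 \<le> t" by linarith
    then show ?thesis
    proof cases
      case 1
      then have "\<bar>Y j t - w j t\<bar> = \<bar>a j t\<bar>" using YV[of t j] by (simp add: a_def \<rho>_def)
      also have "\<dots> \<le> ?S" using j01 by auto
      finally show ?thesis using S1 by linarith
    next
      case 3
      then have "\<bar>Y j t - w j t\<bar> = \<bar>b j t\<bar>" using Y0[of t j] by (simp add: b_def)
      also have "\<dots> \<le> ?S" using j01 by auto
      finally show ?thesis using S1 by linarith
    next
      case 2
      have ab: "a i t = V i t - w i t" "b i t = w i t" for i using 2 by (auto simp: a_def b_def \<rho>_def)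
      have p0: "0 \<le> \<psi> 0 t" "\<psi> 0 t \<le> 1" using cut(4,5) by (auto simp: \<psi>_def)
      have p1: "\<bar>\<psi> 1 t\<bar> \<le> A" using A' by (simp add: \<psi>_def)
      have m0: "\<bar>\<psi> 0 t * V i t - w i t\<bar> \<le> \<bar>a i t\<bar> + 2 * \<bar>b i t\<bar>" for i
      proof -
        have "\<bar>\<psi> 0 t * V i t\<bar> \<le> 1 * \<bar>V i t\<bar>" unfolding abs_mult using p0 by (intro mult_right_mono) auto
        then show ?thesis unfolding ab by linarith
      qed
      have "\<bar>Y j t - w j t\<bar> \<le> A * (\<bar>a 0 t\<bar> + \<bar>b 0 t\<bar>) + (\<bar>a j t\<bar> + 2 * \<bar>b j t\<bar>)"
      proof (cases "j = 0")
        case True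
        then show ?thesis using m0[of 0] A(1) by (simp add: Y_def add_increasing)
      next
        case False
        then have j1: "j = 1" using j by simp
        have "\<bar>\<psi> 1 t * V 0 t\<bar> \<le> A * (\<bar>a 0 t\<bar> + \<bar>b 0 t\<bar>)"
          unfolding abs_mult ab using p1 A(1) by (intro mult_mono) auto
        moreover have "Y 1 t = \<psi> 1 t * V 0 t + \<psi> 0 t * V 1 t" by (simp add: Y_def)
        ultimately show ?thesis unfolding j1 using m0[of 1] by linarith
      qed
      also have "\<dots> \<le> A * ?S + 2 * ?S"
        using j01 A(1) by (intro add_mono mult_left_mono) auto
      finally show ?thesis by (simp add: K_def distrib_right)
    qed
  qed
  have sV: "smooth_fam (ivl \<infinity>) V" "smooth_fam (ivl \<infinity>) Y" using V(1) Ys by (auto intro: smooth_fam_subset)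
  have iffm: "set_borel_measurable lborel (ivl \<infinity>) (\<lambda>t. if t < c then f t else g t)"
    if "set_borel_measurable lborel (ivl \<infinity>) f" "set_borel_measurable lborel (ivl \<infinity>) g" for f g :: "real \<Rightarrow> real" and c
  proof -
    note [measurable] = that[unfolded set_borel_measurable_def real_scaleR_def]
    have "(\<lambda>t. indicator (ivl \<infinity>) t * (if t < c then f t else g t)) = (\<lambda>t. if t < c then indicator (ivl \<infinity>) t * f t else indicator (ivl \<infinity>) t * g t)" by auto
    then show ?thesis using that by (simp add: set_borel_measurable_def)
  qed
  have z: "set_borel_measurable lborel (ivl \<infinity>) (\<lambda>t. 0::real)" by (simp add: set_borel_measurable_def)
  have am: "set_borel_measurable lborel (ivl \<infinity>) (a j)" "set_borel_measurable lborel (ivl \<infinity>) (b j)" if "j \<le> 1" for j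
    unfolding a_def[abs_def] b_def[abs_def] by (intro iffm z set_borel_measurable_diff smooth_fam_measurable sV wm that)+
  have absm: "set_borel_measurable lborel (ivl \<infinity>) (\<lambda>t. \<bar>f t\<bar>)" if "set_borel_measurable lborel (ivl \<infinity>) f" for f :: "real \<Rightarrow> real"
  proof -
    note [measurable] = that[unfolded set_borel_measurable_def real_scaleR_def]
    have "(\<lambda>t. indicator (ivl \<infinity>) t * \<bar>f t\<bar>) = (\<lambda>t. \<bar>indicator (ivl \<infinity>) t * f t\<bar>)" by (auto simp: abs_mult)
    then show ?thesis using that by (simp add: set_borel_measurable_def)
  qed
  have addm: "set_borel_measurable lborel (ivl \<infinity>) (\<lambda>t. f t + g t)"
    if "set_borel_measurable lborel (ivl \<infinity>) f" "set_borel_measurable lborel (ivl \<infinity>) g" for f g :: "real \<Rightarrow> real"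
    using that unfolding set_borel_measurable_def real_scaleR_def distrib_left by simp
  have wa: "wint N p \<infinity> (a j) \<le> ennreal d" if "j \<le> 1" for j
  proof -
    have "wint N p \<infinity> (a j) = wint N p (ereal \<rho>) (\<lambda>t. V j t - w j t)"
      unfolding wint_def using p by (intro nn_integral_cong) (auto simp: a_def indicator_def ivl_def)
    then show ?thesis using V(3)[OF that] by simp
  qed
  have wb: "wint N p \<infinity> (b j) \<le> ennreal d" if "j \<le> 1" for j using n(1)[OF that] by (simp add: b_def[abs_def])
  have "wint N p \<infinity> (\<lambda>t. Y j t - w j t) < ennreal e" if j: "j \<le> 1" for j
  proof -
    let ?S = "\<lambda>t. (\<bar>a 0 t\<bar> + \<bar>a 1 t\<bar>) + (\<bar>b 0 t\<bar> + \<bar>b 1 t\<bar>)"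
    have Sm: "set_borel_measurable lborel (ivl \<infinity>) ?S" by (intro addm absm am) auto
    have "wint N p \<infinity> (\<lambda>t. Y j t - w j t) \<le> wint N p \<infinity> (\<lambda>t. K * ?S t)"
    proof (rule wint_mono)
      fix t
      show "\<bar>Y j t - w j t\<bar> \<le> \<bar>K * ?S t\<bar>" using pt[OF j, of t] by linarith
    qed (use p in auto)
    also have "\<dots> = ennreal (K powr p) * wint N p \<infinity> ?S" using K by (intro wint_cmult Sm) auto
    also have "\<dots> \<le> ennreal (K powr p) * (ennreal (2 powr p) * (ennreal (2 powr p) * (ennreal d + ennreal d) + ennreal (2 powr p) * (ennreal d + ennreal d)))"
    proof (rule mult_left_mono)
      have add: "wint N p \<infinity> (\<lambda>t. f t + g t) \<le> ennreal (2 powr p) * (x + y)"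
        if "wint N p \<infinity> f \<le> x" "wint N p \<infinity> g \<le> y" "set_borel_measurable lborel (ivl \<infinity>) f" "set_borel_measurable lborel (ivl \<infinity>) g" for f g x y
        using p that by (intro order_trans[OF wint_add_le] mult_left_mono add_mono) auto
      show "wint N p \<infinity> ?S \<le> ennreal (2 powr p) * (ennreal (2 powr p) * (ennreal d + ennreal d) + ennreal (2 powr p) * (ennreal d + ennreal d))"
        by (intro add addm absm am) (auto simp: wint_abs wa wb)
    qed simp
    also have "\<dots> = ennreal (K powr p * (2 powr p * (2 powr p * (2 * d) + 2 powr p * (2 * d))))"
      using d by (simp add: ennreal_mult[symmetric] ennreal_plus[symmetric] del: ennreal_plus)
    also have "K powr p * (2 powr p * (2 powr p * (2 * d) + 2 powr p * (2 * d))) = e / 2"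
      using K by (simp add: d_def field_simps)
    also have "ennreal (e / 2) < ennreal e" using e by (simp add: ennreal_less_iff)
    finally show ?thesis .
  qed
  then show ?thesis using Ys flatY by blast
qed

section \<open>Sufficiency\<close>

lemma flat_diff: "flat f \<Longrightarrow> flat g \<Longrightarrow> flat (\<lambda>i t. f i t - g i t)"
proof -
  assume "flat f" "flat g"
  then obtain \<delta> c \<delta>' c' where d: "\<delta> > 0" "\<delta>' > 0"
    and f: "\<forall>t<\<delta>. f 0 t = c" "\<forall>i\<ge>1. \<forall>t<\<delta>. f i t = 0"
    and g: "\<forall>t<\<delta>'. g 0 t = c'" "\<forall>i\<ge>1. \<forall>t<\<delta>'. g i t = 0" unfolding flat_def by blast
  have "0 < min \<delta> \<delta>' \<and> (\<forall>t<min \<delta> \<delta>'. f 0 t - g 0 t = c - c') \<and> (\<forall>i\<ge>1. \<forall>t<min \<delta> \<delta>'. f i t - g i t = 0)"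
    using d f g by simp
  then show ?thesis unfolding flat_def by blast
qed

lemma set_borel_measurable_radial_fun:
  fixes v :: "real \<Rightarrow> real"
  assumes "set_borel_measurable lborel (ivl R) v"
  shows "set_borel_measurable lborel (hball R) (\<lambda>x::real^'n::finite. v (hdist x))"
proof -
  have [measurable]: "(\<lambda>t. indicator (ivl R) t * v t) \<in> borel_measurable borel" using assms by (simp add: set_borel_measurable_def)
  \<comment> \<open>The origin has distance 0, which lies outside \<open>ivl R\<close>, and is
    therefore split off as a single point.\<close>
  have "(\<lambda>x::real^'n. indicator (hball R) x * v (hdist x)) = (\<lambda>x. if x = 0 then indicator (hball R) (0::real^'n) * v (hdist (0::real^'n)) else indicator (hball R) x * (indicator (ivl R) (hdist x) * v (hdist x)))"
    using hdist_in_ivl by (fastforce simp: fun_eq_iff indicator_def)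
  also have "\<dots> \<in> borel_measurable borel" by measurable
  finally show ?thesis by (simp add: set_borel_measurable_def)
qed

lemma radial_Lp_dist:
  fixes v f :: "real \<Rightarrow> real"
  assumes "set_borel_measurable lborel (ivl R) v" "set_borel_measurable lborel (ivl R) f"
  shows "(\<integral>\<^sup>+x\<in>hball R. ennreal (\<bar>f (hdist x) - v (hdist x)\<bar> powr p * lam x ^ CARD('n)) \<partial>(lborel :: (real^'n::finite) measure))
     = ennreal (radK TYPE('n)) * wint CARD('n) p R (\<lambda>t. f t - v t)"
proof -
  have m: "set_borel_measurable lborel (ivl R) (\<lambda>t. f t - v t)" using assms by (rule set_borel_measurable_diff[rotated])
  have [measurable]: "(\<lambda>t. indicator (ivl R) t * (f t - v t)) \<in> borel_measurable borel" using m by (simp add: set_borel_measurable_def)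
  let ?H = "\<lambda>t. ennreal (\<bar>indicator (ivl R) t * (f t - v t)\<bar> powr p)"
  have "(\<integral>\<^sup>+x\<in>hball R. ennreal (\<bar>f (hdist x) - v (hdist x)\<bar> powr p * lam x ^ CARD('n)) \<partial>(lborel :: (real^'n) measure))
    = (\<integral>\<^sup>+x\<in>hball R. (?H (hdist x) * ennreal (lam x ^ CARD('n))) \<partial>(lborel :: (real^'n) measure))"
  proof (rule nn_integral_cong_AE)
    show "AE x in (lborel :: (real^'n) measure). ennreal (\<bar>f (hdist x) - v (hdist x)\<bar> powr p * lam x ^ CARD('n)) * indicator (hball R) x
       = ?H (hdist x) * ennreal (lam x ^ CARD('n)) * indicator (hball R) x"
      using AE_lborel_neq[of "0::real^'n"]
    proof eventually_elim
      case (elim x)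
      show ?case
      proof (cases "x \<in> hball R")
        case True
        then have "hdist x \<in> ivl R" using elim by (intro hdist_in_ivl) auto
        then show ?thesis using True lam_power_nonneg[OF True] by (simp add: ennreal_mult'')
      qed simp
    qed
  qed
  also have "\<dots> = (\<integral>\<^sup>+x. ?H (hdist x) \<partial>(hmeas R :: (real^'n) measure))" by (rule nn_integral_hmeas[symmetric]) measurable
  also have "\<dots> = ennreal (radK TYPE('n)) * (\<integral>\<^sup>+t. ?H t \<partial>wmeas CARD('n) R)" by (rule nn_integral_hmeas_radial) measurable
  also have "(\<integral>\<^sup>+t. ?H t \<partial>wmeas CARD('n) R) = wint CARD('n) p R (\<lambda>t. f t - v t)" by (rule wint_eq_wmeas[OF m, symmetric])
  finally show ?thesis .
qed

text \<open>Norm bound and density are taken as hypotheses, so that one argument serves order one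
  with arbitrary \<open>R\<close> and higher orders with finite \<open>R\<close>. Since differences
  of flat profiles are flat, the same bound yields the Cauchy property of the radial
  approximants.\<close>

lemma wvalid_imp_hW:
  fixes v :: "real \<Rightarrow> real"
  assumes p: "1 \<le> p" and k: "1 \<le> k" and C: "0 < C"
    and bound: "\<And>f j. smooth_fam (ivl R) f \<Longrightarrow> flat f \<Longrightarrow> j \<le> k \<Longrightarrow>
       hint p R j (\<lambda>x::real^'n::finite. f 0 (hdist x)) \<le> ennreal C * (\<Sum>l\<le>k. wint CARD('n) p R (f l))"
    and dens: "\<And>e. 0 < e \<Longrightarrow> \<exists>V. smooth_fam (ivl R) V \<and> flat V \<and> (\<forall>j\<le>k. wint CARD('n) p R (\<lambda>t. V j t - w j t) < ennreal e)"
    and w: "wvalid CARD('n) k p R v w"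
  shows "(\<lambda>x::real^'n. v (hdist x)) \<in> hW k p R"
    and "hnormW k p R (\<lambda>x::real^'n. v (hdist x)) \<le>
       (real (Suc k) * C * 2 powr p) powr (1 / p) * (\<Sum>j\<le>k. enn2real (wint CARD('n) p R (w j))) powr (1 / p)"
proof -
  let ?q = "\<lambda>m n. 2 powr p * (1 / real (Suc m) + 1 / real (Suc n))"
  let ?N = "CARD('n)"
  let ?u = "\<lambda>x::real^'n. v (hdist x)"
  note wm = wvalid_measurable[OF w k]
  have w0: "w 0 = v" using w by (simp add: wvalid_def)
  have "\<exists>V. smooth_fam (ivl R) V \<and> flat V \<and> (\<forall>j\<le>k. wint ?N p R (\<lambda>t. V j t - w j t) < ennreal (1 / real (Suc n)))" for n
    by (rule dens) simp
  then obtain V where V: "\<And>n. smooth_fam (ivl R) (V n)" "\<And>n. flat (V n)"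
    "\<And>n j. j \<le> k \<Longrightarrow> wint ?N p R (\<lambda>t. V n j t - w j t) < ennreal (1 / real (Suc n))" by metis
  define \<phi> where "\<phi> n = (\<lambda>x::real^'n. V n 0 (hdist x))" for n
  have sm: "hsmooth (hball R) (\<phi> n)" for n
  proof -
    obtain \<delta> c where "\<delta> > 0" "\<forall>t<\<delta>. V n 0 t = c" using V(2)[of n] unfolding flat_def by blast
    then show ?thesis unfolding \<phi>_def by (intro hsmooth_radial[OF V(1)]) auto
  qed
  have Vm: "set_borel_measurable lborel (ivl R) (V n j)" for n j by (rule smooth_fam_measurable[OF V(1)])
  have wV: "wint ?N p R (V n l) \<le> ennreal (2 powr p * (1 / real (Suc n) + enn2real (wint ?N p R (w l))))" if l: "l \<le> k" for n l
  proof -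
    have "wint ?N p R (\<lambda>t. (V n l t - w l t) + w l t) \<le> ennreal (2 powr p) * (wint ?N p R (\<lambda>t. V n l t - w l t) + wint ?N p R (w l))"
      using p by (intro wint_add_le set_borel_measurable_diff Vm wm l) auto
    also have "\<dots> \<le> ennreal (2 powr p) * (ennreal (1 / real (Suc n)) + ennreal (enn2real (wint ?N p R (w l))))"
      using V(3)[OF l, of n] wm(3)[OF l] by (intro mult_left_mono add_mono) auto
    also have "\<dots> = ennreal (2 powr p * (1 / real (Suc n) + enn2real (wint ?N p R (w l))))"
      by (simp add: ennreal_mult[symmetric] ennreal_plus[symmetric] del: ennreal_plus)
    finally show ?thesis by simp
  qed
  have hb: "hint p R j (\<phi> n) \<le> ennreal (C * (\<Sum>l\<le>k. 2 powr p * (1 / real (Suc n) + enn2real (wint ?N p R (w l)))))" if j: "j \<le> k" for j n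
  proof -
    have "hint p R j (\<phi> n) \<le> ennreal C * (\<Sum>l\<le>k. wint ?N p R (V n l))" unfolding \<phi>_def by (rule bound[OF V(1,2) j])
    also have "\<dots> \<le> ennreal C * (\<Sum>l\<le>k. ennreal (2 powr p * (1 / real (Suc n) + enn2real (wint ?N p R (w l)))))"
      using wV by (intro mult_left_mono sum_mono) auto
    also have "\<dots> = ennreal (C * (\<Sum>l\<le>k. 2 powr p * (1 / real (Suc n) + enn2real (wint ?N p R (w l)))))"
      using C by (subst sum_ennreal) (auto intro!: ennreal_mult[symmetric] sum_nonneg)
    finally show ?thesis .
  qed
  have hd: "hint p R j (\<lambda>x. \<phi> m x - \<phi> n x) \<le> ennreal (C * (real (Suc k) * ?q m n))" if j: "j \<le> k" for j m n
  proof -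
    have "hint p R j (\<lambda>x. \<phi> m x - \<phi> n x) \<le> ennreal C * (\<Sum>l\<le>k. wint ?N p R (\<lambda>t. V m l t - V n l t))"
      unfolding \<phi>_def using bound[OF smooth_fam_diff[OF V(1)[of m] V(1)[of n]] flat_diff[OF V(2)[of m] V(2)[of n]] j] .
    also have "\<dots> \<le> ennreal C * (\<Sum>l\<le>k. ennreal (?q m n))"
    proof (intro mult_left_mono sum_mono)
      fix l assume "l \<in> {..k}"
      then have l: "l \<le> k" by simp
      have "wint ?N p R (\<lambda>t. (V m l t - w l t) - (V n l t - w l t)) \<le> ennreal (2 powr p) * (wint ?N p R (\<lambda>t. V m l t - w l t) + wint ?N p R (\<lambda>t. V n l t - w l t))"
        using p by (intro wint_diff_le set_borel_measurable_diff Vm wm l) auto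
      also have "\<dots> \<le> ennreal (2 powr p) * (ennreal (1 / real (Suc m)) + ennreal (1 / real (Suc n)))"
        using V(3)[OF l, of n] V(3)[OF l, of m] by (intro mult_left_mono add_mono) auto
      also have "\<dots> = ennreal (?q m n)"
        by (simp add: ennreal_mult[symmetric] ennreal_plus[symmetric] del: ennreal_plus)
      finally show "wint ?N p R (\<lambda>t. V m l t - V n l t) \<le> ennreal (?q m n)" by simp
    qed auto
    also have "\<dots> = ennreal (C * (real (Suc k) * ?q m n))"
    proof -
      have "(\<Sum>l\<le>k. ennreal (?q m n)) = ennreal (\<Sum>l\<le>k. 2 powr p * (1 / real (Suc m) + 1 / real (Suc n)))"
        by (rule sum_ennreal) simp
      also have "(\<Sum>l\<le>k. 2 powr p * (1 / real (Suc m) + 1 / real (Suc n))) = real (Suc k) * ?q m n" by simp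
      finally show ?thesis using C by (simp only:) (rule ennreal_mult[symmetric], auto)
    qed
    finally show ?thesis .
  qed
  have ap: "happrox k p R \<phi> ?u"
    unfolding happrox_def
  proof (intro conjI allI impI)
    show "hsmooth (hball R) (\<phi> n)" for n by (rule sm)
    show "hint p R j (\<phi> n) < \<infinity>" if "j \<le> k" for j n using hb[OF that, of n] by (auto intro: le_less_trans)
    show "\<exists>M. \<forall>m\<ge>M. \<forall>n\<ge>M. hint p R j (\<lambda>x. \<phi> m x - \<phi> n x) < ennreal e" if j: "j \<le> k" and e: "0 < e" for j e
    proof -
      define D where "D = C * (real (Suc k) * (2 powr p * 2))"
      have D: "D > 0" using C by (simp add: D_def)
      obtain M where M: "1 / real (Suc M) < e / D" using reals_Archimedean[of "e / D"] e D by (auto simp: inverse_eq_divide)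
      show ?thesis
      proof (intro exI[of _ M] allI impI)
        fix m n assume mn: "m \<ge> M" "n \<ge> M"
        have i: "1 / real (Suc m) \<le> 1 / real (Suc M)" "1 / real (Suc n) \<le> 1 / real (Suc M)" using mn by (auto intro!: divide_left_mono)
        have "C * (real (Suc k) * ?q m n) \<le> C * (real (Suc k) * (2 powr p * (1 / real (Suc M) + 1 / real (Suc M))))"
          using C i by (intro mult_left_mono add_mono) auto
        also have "\<dots> = D * (1 / real (Suc M))" unfolding D_def by (simp only: mult_2_right distrib_left distrib_right mult.assoc mult_1_right)
        also have "\<dots> < D * (e / D)" using M D by (intro mult_strict_left_mono)
        also have "\<dots> = e" using D by simp
        finally show "hint p R j (\<lambda>x. \<phi> m x - \<phi> n x) < ennreal e"
          using hd[OF j, of m n] e by (auto intro!: le_less_trans[OF hd[OF j, of m n]] simp: ennreal_less_iff C less_imp_le)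
      qed
    qed
    show "(\<lambda>n. \<integral>\<^sup>+x\<in>hball R. ennreal (\<bar>\<phi> n x - v (hdist x)\<bar> powr p * lam x ^ ?N) \<partial>lborel) \<longlonglongrightarrow> 0"
    proof -
      have eq: "(\<integral>\<^sup>+x\<in>hball R. ennreal (\<bar>\<phi> n x - v (hdist x)\<bar> powr p * lam x ^ ?N) \<partial>lborel) = ennreal (radK TYPE('n)) * wint ?N p R (\<lambda>t. V n 0 t - w 0 t)" for n
        unfolding \<phi>_def w0 by (rule radial_Lp_dist[OF _ Vm]) (use wm(2)[of 0] w0 in simp)
      have "(\<lambda>n. ennreal (1 / real (Suc n))) \<longlonglongrightarrow> ennreal 0"
        using LIMSEQ_inverse_real_of_nat by (intro tendsto_ennrealI) (simp add: inverse_eq_divide)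
      then have l0: "(\<lambda>n. ennreal (1 / real (Suc n))) \<longlonglongrightarrow> 0" by simp
      have "(\<lambda>n. wint ?N p R (\<lambda>t. V n 0 t - w 0 t)) \<longlonglongrightarrow> 0"
        by (rule tendsto_sandwich[OF _ _ tendsto_const l0]) (use V(3)[of 0] in \<open>auto intro!: always_eventually less_imp_le\<close>)
      from ennreal_tendsto_cmult[OF _ this, of "ennreal (radK TYPE('n))"] show ?thesis by (simp add: eq)
    qed
  qed
  have um: "set_borel_measurable lborel (hball R) ?u"
    by (rule set_borel_measurable_radial_fun) (use wm(2)[of 0] w0 in simp)
  show "?u \<in> hW k p R" unfolding hW_def using um ap by blast
  define S where "S = (\<Sum>j\<le>k. enn2real (wint ?N p R (w j)))"
  have S0: "0 \<le> S" unfolding S_def by (intro sum_nonneg) auto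
  define D where "D = real (Suc k) * C * 2 powr p"
  have D: "D > 0" using C by (simp add: D_def)
  \<comment> \<open>The energy of the approximants exceeds the expected bound by an error that tends
    to 0; \<delta> absorbs it once finitely many terms are dropped, and then tends to 0
    itself.\<close>
  have key: "hnormW k p R ?u \<le> (D * (S + \<delta>)) powr (1 / p)" if \<delta>: "0 < \<delta>" for \<delta>
  proof -
    obtain M where M: "1 / real (Suc M) < \<delta> / real (Suc k)" using reals_Archimedean[of "\<delta> / real (Suc k)"] \<delta> by (auto simp: inverse_eq_divide)
    have ap': "happrox k p R (\<lambda>n. \<phi> (n + M)) ?u" by (rule happrox_subseq[OF ap]) (simp add: strict_mono_def)
    show ?thesis
    proof (rule hnormW_le[OF ap'])
      fix n
      define T where "T = C * (\<Sum>l\<le>k. 2 powr p * (1 / real (Suc (n + M)) + enn2real (wint ?N p R (w l))))"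
      have "1 / real (Suc (n + M)) \<le> 1 / real (Suc M)" by (intro divide_left_mono) auto
      then have sm: "real (Suc k) * (1 / real (Suc (n + M))) \<le> \<delta>" using M mult_left_mono[of "1 / real (Suc (n + M))" "\<delta> / real (Suc k)" "real (Suc k)"] by simp
      have Teq: "T = C * (2 powr p * (real (Suc k) * (1 / real (Suc (n + M))) + S))"
        unfolding T_def S_def by (simp only: sum_distrib_left[symmetric] sum.distrib sum_constant card_atMost)
      have "T \<le> C * (2 powr p * (\<delta> + S))" unfolding Teq using C sm by (intro mult_left_mono add_mono) auto
      then have T: "T \<le> C * 2 powr p * (S + \<delta>)" by (simp add: algebra_simps)
      have T0: "0 \<le> T" unfolding Teq using C S0 by simp
      have "(\<Sum>j\<le>k. enn2real (hint p R j (\<phi> (n + M)))) \<le> (\<Sum>j\<le>k. T)"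
      proof (intro sum_mono enn2real_leI T0)
        fix j assume "j \<in> {..k}"
        then have "j \<le> k" by simp
        from hb[OF this, of "n + M"] show "hint p R j (\<phi> (n + M)) \<le> ennreal T" unfolding T_def .
      qed
      also have "\<dots> = real (Suc k) * T" by simp
      also have "\<dots> \<le> real (Suc k) * (C * 2 powr p * (S + \<delta>))" using T by (intro mult_left_mono) auto
      also have "\<dots> = D * (S + \<delta>)" by (simp add: D_def mult_ac)
      finally show "hsnorm k p R (\<phi> (n + M)) \<le> (D * (S + \<delta>)) powr (1 / p)"
        unfolding hsnorm_def using p by (intro powr_mono2) (auto intro!: sum_nonneg)
    qed
  qed
  have "((\<lambda>\<delta>. (D * (S + \<delta>)) powr (1 / p)) \<longlongrightarrow> (D * (S + 0)) powr (1 / p)) (at_right 0)"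
    using p D S0 by (intro tendsto_powr' tendsto_intros) (auto simp: eventually_at_right_field intro!: exI[of _ 1])
  moreover have "\<forall>\<^sub>F \<delta> in at_right 0. hnormW k p R ?u \<le> (D * (S + \<delta>)) powr (1 / p)"
    using eventually_at_right_less[of 0] by eventually_elim (rule key)
  ultimately have "hnormW k p R ?u \<le> (D * (S + 0)) powr (1 / p)" by (rule tendsto_lowerbound) simp
  then show "hnormW k p R ?u \<le> (real (Suc k) * C * 2 powr p) powr (1 / p) * (\<Sum>j\<le>k. enn2real (wint ?N p R (w j))) powr (1 / p)"
    using D S0 by (simp add: powr_mult D_def S_def)
qed

text \<open>The constants are independent of the chosen weak derivatives \<open>w\<close>, so the
  estimate passes to the infimum defining \<open>wnorm\<close>; membership guarantees that this
  infimum is over a nonempty set.\<close>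

lemma rad_equivI:
  assumes p: "1 \<le> p" and k: "1 \<le> k" and C: "0 < C"
    and bound: "\<And>f j. smooth_fam (ivl R) f \<Longrightarrow> flat f \<Longrightarrow> j \<le> k \<Longrightarrow>
       hint p R j (\<lambda>x::real^'n::finite. f 0 (hdist x)) \<le> ennreal C * (\<Sum>l\<le>k. wint CARD('n) p R (f l))"
    and dens: "\<And>v w e. wvalid CARD('n) k p R v w \<Longrightarrow> 0 < e \<Longrightarrow> \<exists>V. smooth_fam (ivl R) V \<and> flat V \<and> (\<forall>j\<le>k. wint CARD('n) p R (\<lambda>t. V j t - w j t) < ennreal e)"
  shows "rad_equiv TYPE('n) k p R"
proof -
  let ?N = "CARD('n)"
  define D where "D = (real (Suc k) * C * 2 powr p) powr (1 / p)"
  have D: "D > 0" using C by (simp add: D_def)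
  define c where "c = 1 / (2 / radK TYPE('n) powr (1 / p))"
  have c: "c > 0" using radK_pos[where 'n='n] by (simp add: c_def)
  have "((\<lambda>x::real^'n. v (hdist x)) \<in> hW k p R \<longleftrightarrow> v \<in> wW ?N k p R) \<and>
     ((\<lambda>x::real^'n. v (hdist x)) \<in> hW k p R \<longrightarrow>
        c * wnorm ?N k p R v \<le> hnormW k p R (\<lambda>x::real^'n. v (hdist x)) \<and>
        hnormW k p R (\<lambda>x::real^'n. v (hdist x)) \<le> D * wnorm ?N k p R v)" for v
  proof (intro conjI impI iffI)
    let ?u = "\<lambda>x::real^'n. v (hdist x)"
    show "v \<in> wW ?N k p R" if "?u \<in> hW k p R" by (rule hW_imp_wW(1)[OF p that])
    show "?u \<in> hW k p R" if "v \<in> wW ?N k p R"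
    proof -
      obtain w where w: "wvalid ?N k p R v w" using \<open>v \<in> wW ?N k p R\<close> by (auto simp: wW_def)
      show ?thesis by (rule wvalid_imp_hW(1)[OF p k C bound dens[OF w] w])
    qed
    assume u: "?u \<in> hW k p R"
    show "c * wnorm ?N k p R v \<le> hnormW k p R ?u"
      using hW_imp_wW(2)[OF p u] radK_pos[where 'n='n] by (simp add: c_def field_simps)
    have "hnormW k p R ?u / D \<le> wnorm ?N k p R v" unfolding wnorm_def
    proof (rule cInf_greatest)
      show "{(\<Sum>j\<le>k. enn2real (wint ?N p R (w j))) powr (1 / p) | w. wvalid ?N k p R v w} \<noteq> {}"
        using hW_imp_wW(1)[OF p u] by (auto simp: wW_def)
      fix x assume "x \<in> {(\<Sum>j\<le>k. enn2real (wint ?N p R (w j))) powr (1 / p) | w. wvalid ?N k p R v w}"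
      then obtain w where w: "wvalid ?N k p R v w" and x: "x = (\<Sum>j\<le>k. enn2real (wint ?N p R (w j))) powr (1 / p)" by blast
      have "hnormW k p R ?u \<le> D * x" unfolding x D_def by (rule wvalid_imp_hW(2)[OF p k C bound dens[OF w] w])
      then show "hnormW k p R ?u / D \<le> x" using D by (simp add: pos_divide_le_eq mult.commute)
    qed
    then show "hnormW k p R ?u \<le> D * wnorm ?N k p R v" using D by (simp add: pos_divide_le_eq mult.commute)
  qed
  then show ?thesis unfolding rad_equiv_def using c D by blast
qed

text \<open>In order one the pointwise identity for the gradient holds on every ball, so infinite
  \<open>R\<close> requires only the density on the half line.\<close>

lemma rad_equiv_1:
  assumes p: "1 \<le> p" and R: "0 < R"
  shows "rad_equiv TYPE('n::finite) 1 p R"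
proof (rule rad_equivI[OF p order_refl radK_pos])
  fix f :: "nat \<Rightarrow> real \<Rightarrow> real" and j :: nat assume f: "smooth_fam (ivl R) f" and j: "j \<le> 1"
  have "hint p R j (\<lambda>x::real^'n. f 0 (hdist x)) \<le> ennreal (radK TYPE('n)) * wint CARD('n) p R (f j)"
    by (rule hint_radial_le_1[OF f _ j]) (use p in simp)
  also have "\<dots> \<le> ennreal (radK TYPE('n)) * (\<Sum>l\<le>1. wint CARD('n) p R (f l))"
    using j by (intro mult_left_mono member_le_sum[of j "{..1}" "\<lambda>l. wint CARD('n) p R (f l)"]) auto
  finally show "hint p R j (\<lambda>x::real^'n. f 0 (hdist x)) \<le> ennreal (radK TYPE('n)) * (\<Sum>l\<le>1. wint CARD('n) p R (f l))" .
next
  fix v w and e :: real assume w: "wvalid CARD('n) 1 p R v w" and e: "0 < e"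
  have N: "1 \<le> CARD('n)" by (simp add: Suc_le_eq)
  have "\<exists>V. smooth_fam UNIV V \<and> flat V \<and> (\<forall>j\<le>1. wint CARD('n) p R (\<lambda>t. V j t - w j t) < ennreal e)"
  proof (cases R)
    case (real r)
    then have "0 < r" using R by simp
    from density_finite[OF p this order_refl N _ _ e] w show ?thesis unfolding real by simp
  next
    case PInf
    then show ?thesis using density_infinite[OF p N _ e] w by simp
  next
    case MInf
    then show ?thesis using R by simp
  qed
  then show "\<exists>V. smooth_fam (ivl R) V \<and> flat V \<and> (\<forall>j\<le>1. wint CARD('n) p R (\<lambda>t. V j t - w j t) < ennreal e)"
    using smooth_fam_subset[OF _ subset_UNIV] by blast
qed

lemma rad_equiv_finite:
  assumes p: "1 \<le> p" and k: "1 \<le> k" and \<rho>: "0 < \<rho>" and N: "real (k - 1) * p < CARD('n)"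
  shows "rad_equiv TYPE('n::finite) k p (ereal \<rho>)"
proof -
  let ?N = "CARD('n)"
  have "\<forall>j\<in>{..k}. \<exists>C. C \<ge> 0 \<and> (\<forall>f. smooth_fam (ivl (ereal \<rho>)) f \<longrightarrow> flat f \<longrightarrow>
    hint p (ereal \<rho>) j (\<lambda>x::real^'n. f 0 (hdist x)) \<le> ennreal C * (\<Sum>l\<le>k. wint ?N p (ereal \<rho>) (f l)))"
    using hint_radial_bound[OF p N \<rho>] by (metis atMost_iff)
  from bchoice[OF this] obtain C where C: "\<And>j. j \<le> k \<Longrightarrow> C j \<ge> 0" "\<And>j f. j \<le> k \<Longrightarrow> smooth_fam (ivl (ereal \<rho>)) f \<Longrightarrow> flat f \<Longrightarrow>
    hint p (ereal \<rho>) j (\<lambda>x::real^'n. f 0 (hdist x)) \<le> ennreal (C j) * (\<Sum>l\<le>k. wint ?N p (ereal \<rho>) (f l))" by auto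
  define B where "B = (\<Sum>j\<le>k. C j) + 1"
  have "0 \<le> (\<Sum>j\<le>k. C j)" using C(1) by (intro sum_nonneg) auto
  then have B: "B > 0" by (simp add: B_def)
  show ?thesis
  proof (rule rad_equivI[OF p k B])
    fix f :: "nat \<Rightarrow> real \<Rightarrow> real" and j :: nat assume f: "smooth_fam (ivl (ereal \<rho>)) f" "flat f" and j: "j \<le> k"
    have "C j \<le> (\<Sum>j\<le>k. C j)" using j C(1) by (intro member_le_sum[of j "{..k}" C]) auto
    then have "C j \<le> B" by (simp add: B_def)
    then show "hint p (ereal \<rho>) j (\<lambda>x::real^'n. f 0 (hdist x)) \<le> ennreal B * (\<Sum>l\<le>k. wint ?N p (ereal \<rho>) (f l))"
      by (intro order_trans[OF C(2)[OF j f]] mult_right_mono ennreal_leI) auto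
  next
    fix v w and e :: real assume w: "wvalid ?N k p (ereal \<rho>) v w" and e: "0 < e"
    have "1 \<le> ?N" by (simp add: Suc_le_eq)
    from density_finite[OF p \<rho> k this N w e]
    show "\<exists>V. smooth_fam (ivl (ereal \<rho>)) V \<and> flat V \<and> (\<forall>j\<le>k. wint ?N p (ereal \<rho>) (\<lambda>t. V j t - w j t) < ennreal e)"
      using smooth_fam_subset[OF _ subset_UNIV] by blast
  qed
qed

section \<open>Necessity\<close>

text \<open>The converse bookkeeping to \<open>cov\<close>: partial derivatives are to be expressed
  through covariant ones. The combinations are operators in \<phi> with coefficients smooth on the
  whole ball, so their bounds are uniform in \<phi>.\<close>

inductive covcomb :: "nat \<Rightarrow> ((real^'n::finite \<Rightarrow> real) \<Rightarrow> real^'n \<Rightarrow> real) \<Rightarrow> bool" for n where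
  cov: "length js \<le> n \<Longrightarrow> hsmooth (ball 0 1) a \<Longrightarrow> covcomb n (\<lambda>\<phi> x. a x * cov \<phi> js x)"
| add: "covcomb n G \<Longrightarrow> covcomb n H \<Longrightarrow> covcomb n (\<lambda>\<phi> x. G \<phi> x + H \<phi> x)"

lemma covcomb_zero: "covcomb n (\<lambda>\<phi> x. 0)"
  using covcomb.cov[of "[]" n "\<lambda>x. 0"] by (simp add: hsmooth_const)

lemma covcomb_sum: "(\<And>i. i \<in> I \<Longrightarrow> covcomb n (G i)) \<Longrightarrow> covcomb n (\<lambda>\<phi> x. \<Sum>i\<in>I. G i \<phi> x)"
  by (induction I rule: infinite_finite_induct) (auto intro: covcomb_zero covcomb.add)

text \<open>The recursion of \<open>cov\<close> is solved for the partial derivative: it equals a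
  covariant derivative of one order more plus Christoffel terms of the old order.\<close>

lemma covcomb_has_pd:
  fixes G :: "(real^'n::finite \<Rightarrow> real) \<Rightarrow> real^'n \<Rightarrow> real"
  assumes "covcomb n G"
  shows "\<exists>H. covcomb (Suc n) H \<and> (\<forall>S \<phi> x. open S \<longrightarrow> S \<subseteq> ball 0 1 \<longrightarrow> hsmooth S \<phi> \<longrightarrow> x \<in> S \<longrightarrow> has_pd (G \<phi>) i (H \<phi> x) x)"
  using assms
proof induction
  case (cov js a)
  define H where "H = (\<lambda>\<phi> x. pd i a x * cov \<phi> js x + (a x * cov \<phi> (i # js) x
     + (\<Sum>l<length js. \<Sum>s\<in>UNIV. (a x * chr s i (js ! l) x) * cov \<phi> (js[l := s]) x)))"
  have ob: "open (ball (0::real^'n) 1)" by simp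
  have "covcomb (Suc n) H"
    unfolding H_def using cov
    by (intro covcomb.add covcomb_sum covcomb.cov hsmooth_pd hsmooth_mult[OF ob] hsmooth_chr[OF ob]) auto
  moreover have "has_pd (\<lambda>x. a x * cov \<phi> js x) i (H \<phi> x) x"
    if S: "open S" "S \<subseteq> ball 0 1" and \<phi>: "hsmooth S \<phi>" and x: "x \<in> S" for S \<phi> x
  proof -
    have "has_pd (\<lambda>x. a x * cov \<phi> js x) i (pd i a x * cov \<phi> js x + pd i (cov \<phi> js) x * a x) x"
      using DERIV_mult[OF hsmooth_has_pd'[OF cov(2), of x i] hsmooth_has_pd'[OF hsmooth_cov[OF S \<phi>] x, of js i]] x S by auto
    also have "pd i a x * cov \<phi> js x + pd i (cov \<phi> js) x * a x = H \<phi> x"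
      by (simp add: H_def sum_distrib_left algebra_simps)
    finally show ?thesis .
  qed
  ultimately show ?case by blast
next
  case (add G H)
  from add.IH obtain G' H' where G': "covcomb (Suc n) G'" "\<forall>S \<phi> x. open S \<longrightarrow> S \<subseteq> ball 0 1 \<longrightarrow> hsmooth S \<phi> \<longrightarrow> x \<in> S \<longrightarrow> has_pd (G \<phi>) i (G' \<phi> x) x"
    and H': "covcomb (Suc n) H'" "\<forall>S \<phi> x. open S \<longrightarrow> S \<subseteq> ball 0 1 \<longrightarrow> hsmooth S \<phi> \<longrightarrow> x \<in> S \<longrightarrow> has_pd (H \<phi>) i (H' \<phi> x) x"
    by blast
  then show ?case
    by (intro exI[of _ "\<lambda>\<phi> x. G' \<phi> x + H' \<phi> x"]) (auto intro!: covcomb.add DERIV_add)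
qed

lemma covcomb_pds:
  fixes "is" :: "'n::finite list"
  shows "\<exists>G. covcomb (length is) G \<and> (\<forall>S \<phi> x. open S \<longrightarrow> S \<subseteq> ball 0 1 \<longrightarrow> hsmooth S \<phi> \<longrightarrow> x \<in> S \<longrightarrow> pds is \<phi> x = G \<phi> x)"
proof (induction "is")
  case Nil
  have "covcomb 0 (\<lambda>\<phi> x::real^'n. 1 * cov \<phi> [] x)" by (intro covcomb.cov hsmooth_const) auto
  then show ?case by (intro exI[of _ "\<lambda>\<phi> x. 1 * cov \<phi> [] x"]) simp
next
  case (Cons i "is")
  then obtain G where G: "covcomb (length is) G" "\<And>S \<phi> x. open S \<Longrightarrow> S \<subseteq> ball 0 1 \<Longrightarrow> hsmooth S \<phi> \<Longrightarrow> x \<in> S \<Longrightarrow> pds is \<phi> x = G \<phi> x"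
    by blast
  from covcomb_has_pd[OF G(1), of i] obtain H where H: "covcomb (Suc (length is)) H"
    "\<And>S \<phi> x. open S \<Longrightarrow> S \<subseteq> ball 0 1 \<Longrightarrow> hsmooth S \<phi> \<Longrightarrow> x \<in> S \<Longrightarrow> has_pd (G \<phi>) i (H \<phi> x) x" by blast
  have "pds (i # is) \<phi> x = H \<phi> x" if "open S" "S \<subseteq> ball 0 1" "hsmooth S \<phi>" "x \<in> S" for S \<phi> x
  proof -
    have "pd i (pds is \<phi>) x = pd i (G \<phi>) x" by (rule pd_cong[OF that(1,4)]) (rule G(2)[OF that(1-3)])
    then show ?thesis using has_pd_imp_pd[OF H(2)[OF that]] by simp
  qed
  then show ?case using H(1) by auto
qed

text \<open>On the compact ball of radius 1/2 the coefficients are bounded and \<open>lam\<close> is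
  at most 8/3, so undoing the normalisation in \<open>gnorm\<close> costs at most a factor 3 per
  index.\<close>

lemma covcomb_bound:
  fixes G :: "(real^'n::finite \<Rightarrow> real) \<Rightarrow> real^'n \<Rightarrow> real"
  assumes "covcomb n G"
  shows "\<exists>C\<ge>0. \<forall>\<phi> x. norm x \<le> 1/2 \<longrightarrow> \<bar>G \<phi> x\<bar> \<le> C * (\<Sum>j\<le>n. gnorm j \<phi> x)"
  using assms
proof induction
  case (cov js a)
  have "continuous_on (cball 0 (1/2)) a" using hsmooth_continuous[OF cov(2)] by (rule continuous_on_subset) auto
  then have "bounded (a ` cball 0 (1/2))" by (intro compact_imp_bounded compact_continuous_image) auto
  then obtain B where "\<forall>y\<in>a ` cball 0 (1/2). norm y \<le> B" unfolding bounded_iff by blast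
  then have B: "\<And>x. norm x \<le> 1/2 \<Longrightarrow> \<bar>a x\<bar> \<le> B" by simp
  have B0: "0 \<le> B" using B[of 0] by simp
  have "\<bar>a x * cov \<phi> js x\<bar> \<le> (B * 3 ^ length js) * (\<Sum>j\<le>n. gnorm j \<phi> x)" if x: "norm x \<le> 1/2" for \<phi> x
  proof -
    have x2: "(norm x)\<^sup>2 \<le> 1/4" using power_mono[OF x, of 2] by (simp add: power2_eq_square)
    have l: "0 < lam x" "lam x \<le> 3" using lam_pos[of x] x x2 by (auto simp: lam_def field_simps)
    have "\<bar>cov \<phi> js x\<bar> = sqrt ((cov \<phi> js x)\<^sup>2)" by simp
    also have "\<dots> \<le> sqrt (\<Sum>is | length is = length js. (cov \<phi> is x)\<^sup>2)"
      using member_le_sum[of js "{is. length is = length js}" "\<lambda>is. (cov \<phi> is x)\<^sup>2"] by (intro real_sqrt_le_mono) simp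
    also have "\<dots> = lam x ^ length js * gnorm (length js) \<phi> x"
      using l by (simp add: gnorm_def powr_minus powr_realpow)
    also have "\<dots> \<le> 3 ^ length js * (\<Sum>j\<le>n. gnorm j \<phi> x)"
      using l cov(1) by (intro mult_mono power_mono member_le_sum[of "length js" "{..n}" "\<lambda>j. gnorm j \<phi> x"]) (auto simp: gnorm_nonneg)
    finally have "\<bar>cov \<phi> js x\<bar> \<le> 3 ^ length js * (\<Sum>j\<le>n. gnorm j \<phi> x)" .
    from mult_mono[OF B[OF x] this B0] show ?thesis by (simp add: abs_mult mult.assoc)
  qed
  then show ?case using B0 by (intro exI[of _ "B * 3 ^ length js"]) simp
next
  case (add G H)
  from add.IH obtain C D where C: "C \<ge> 0" "D \<ge> 0" "\<forall>\<phi> x. norm x \<le> 1/2 \<longrightarrow> \<bar>G \<phi> x\<bar> \<le> C * (\<Sum>j\<le>n. gnorm j \<phi> x)"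
    "\<forall>\<phi> x. norm x \<le> 1/2 \<longrightarrow> \<bar>H \<phi> x\<bar> \<le> D * (\<Sum>j\<le>n. gnorm j \<phi> x)" by blast
  have "\<bar>G \<phi> x + H \<phi> x\<bar> \<le> (C + D) * (\<Sum>j\<le>n. gnorm j \<phi> x)" if "norm x \<le> 1/2" for \<phi> x
    using C(3,4)[rule_format, OF that, of \<phi>] unfolding distrib_right by linarith
  then show ?case using C(1,2) by (intro exI[of _ "C + D"]) auto
qed

section \<open>Euclidean partial derivatives on small balls\<close>

definition ball_int :: "real \<Rightarrow> real \<Rightarrow> (real^'n::finite \<Rightarrow> real) \<Rightarrow> ennreal" where
  "ball_int p r f = (\<integral>\<^sup>+x\<in>ball 0 r. ennreal (\<bar>f x\<bar> powr p) \<partial>lborel)"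

lemma ball_int_measurable:
  fixes f :: "real^'n::finite \<Rightarrow> real"
  assumes "continuous_on (ball 0 r) f"
  shows "(\<lambda>x. ennreal (\<bar>f x\<bar> powr p) * indicator (ball 0 r) x) \<in> borel_measurable borel"
proof -
  have [measurable]: "(\<lambda>x. indicator (ball 0 r) x * f x) \<in> borel_measurable borel"
    using borel_measurable_continuous_on_indicator[OF _ assms] by simp
  have "(\<lambda>x. ennreal (\<bar>f x\<bar> powr p) * indicator (ball 0 r) x) = (\<lambda>x. ennreal (\<bar>indicator (ball 0 r) x * f x\<bar> powr p) * indicator (ball 0 r) x)"
    by (auto simp: indicator_def fun_eq_iff)
  also have "\<dots> \<in> borel_measurable borel" by measurable
  finally show ?thesis .
qed

lemma ball_int_mono: "r \<le> s \<Longrightarrow> ball_int p r f \<le> ball_int p s f"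
  unfolding ball_int_def by (intro nn_integral_mono) (auto simp: indicator_def)

lemma ball_int_cong: "(\<And>x. norm x < r \<Longrightarrow> f x = g x) \<Longrightarrow> ball_int p r f = ball_int p r g"
  unfolding ball_int_def by (intro nn_integral_cong) (auto simp: indicator_def)

lemma ball_int_add_le:
  fixes f g :: "real^'n::finite \<Rightarrow> real"
  assumes p: "0 \<le> p" and c: "continuous_on (ball 0 r) f" "continuous_on (ball 0 r) g"
  shows "ball_int p r (\<lambda>x. f x + g x) \<le> ennreal (2 powr p) * (ball_int p r f + ball_int p r g)"
proof -
  note [measurable] = ball_int_measurable[OF c(1)] ball_int_measurable[OF c(2)]
  have "ball_int p r (\<lambda>x. f x + g x) \<le> (\<integral>\<^sup>+x. ennreal (2 powr p) * (ennreal (\<bar>f x\<bar> powr p) * indicator (ball 0 r) x + ennreal (\<bar>g x\<bar> powr p) * indicator (ball 0 r) x) \<partial>lborel)"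
    unfolding ball_int_def using abs_add_powr_le[OF p]
    by (intro nn_integral_mono) (auto simp: indicator_def ennreal_plus[symmetric] ennreal_mult[symmetric] ennreal_leI simp del: ennreal_plus)
  then show ?thesis by (simp add: ball_int_def nn_integral_cmult nn_integral_add)
qed

text \<open>Near the origin hyperbolic and Euclidean quantities are uniformly comparable. The lower
  orders on the right come from the Christoffel symbols.\<close>

lemma ball_int_pds_le_hint:
  fixes "is" :: "'n::finite list"
  assumes p: "0 \<le> p" and \<delta>: "\<delta> \<le> 1/2" "ball 0 \<delta> \<subseteq> (hball R :: (real^'n) set)"
  shows "\<exists>C\<ge>0. \<forall>\<phi>. hsmooth (hball R) \<phi> \<longrightarrow> ball_int p \<delta> (pds is \<phi>) \<le> ennreal C * (\<Sum>j\<le>length is. hint p R j \<phi>)"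
proof -
  let ?n = "length is"
  obtain G where G: "covcomb ?n G" "\<And>S \<phi> x. open S \<Longrightarrow> S \<subseteq> ball 0 1 \<Longrightarrow> hsmooth S \<phi> \<Longrightarrow> x \<in> S \<Longrightarrow> pds is \<phi> x = G \<phi> x"
    using covcomb_pds by blast
  obtain C where C: "C \<ge> 0" "\<And>\<phi> x. norm x \<le> 1/2 \<Longrightarrow> \<bar>G \<phi> x\<bar> \<le> C * (\<Sum>j\<le>?n. gnorm j \<phi> x)"
    using covcomb_bound[OF G(1)] by blast
  define D where "D = C powr p * real (Suc ?n) powr p"
  have "ball_int p \<delta> (pds is \<phi>) \<le> ennreal D * (\<Sum>j\<le>?n. hint p R j \<phi>)" if \<phi>: "hsmooth (hball R) \<phi>" for \<phi>
  proof -
    let ?h = "\<lambda>j x. ennreal (gnorm j \<phi> x powr p * lam x ^ CARD('n)) * indicator (hball R) x"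
    have [measurable]: "?h j \<in> borel_measurable borel" for j
    proof -
      note gnorm_measurable[OF \<phi>, measurable]
      have "?h j = (\<lambda>x. ennreal ((indicator (hball R) x * gnorm j \<phi> x) powr p * lam x ^ CARD('n)) * indicator (hball R) x)"
        by (auto simp: indicator_def fun_eq_iff)
      also have "\<dots> \<in> borel_measurable borel" by measurable
      finally show ?thesis .
    qed
    have "\<bar>pds is \<phi> x\<bar> powr p \<le> D * (\<Sum>j\<le>?n. gnorm j \<phi> x powr p * lam x ^ CARD('n))" if x: "x \<in> ball 0 \<delta>" for x
    proof -
      have xR: "x \<in> hball R" using \<delta>(2) x by (rule subsetD)
      have n: "norm x \<le> 1/2" using x \<delta>(1) by simp
      have l: "1 \<le> lam x ^ CARD('n)" using lam_ge_2[of x] n by (intro one_le_power) auto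
      have "\<bar>pds is \<phi> x\<bar> powr p \<le> (C * (\<Sum>j\<le>?n. gnorm j \<phi> x)) powr p"
        using C(2)[OF n, of \<phi>] G(2)[OF open_hball hball_subset \<phi> xR] p by (intro powr_mono2) auto
      also have "\<dots> = C powr p * \<bar>\<Sum>j\<le>?n. gnorm j \<phi> x\<bar> powr p"
        using C(1) by (simp add: powr_mult sum_nonneg gnorm_nonneg)
      also have "\<dots> \<le> C powr p * (real (Suc ?n) powr p * (\<Sum>j\<le>?n. \<bar>gnorm j \<phi> x\<bar> powr p))"
        using abs_sum_powr_le[OF p, of "{..?n}" "\<lambda>j. gnorm j \<phi> x"] by (intro mult_left_mono) auto
      also have "\<dots> \<le> D * (\<Sum>j\<le>?n. gnorm j \<phi> x powr p * lam x ^ CARD('n))"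
        unfolding D_def mult.assoc using mult_left_mono[OF l]
        by (intro mult_left_mono sum_mono) (auto simp: gnorm_nonneg)
      finally show ?thesis .
    qed
    then have pt: "\<bar>pds is \<phi> x\<bar> powr p \<le> D * (\<Sum>j\<le>?n. gnorm j \<phi> x powr p * lam x ^ CARD('n))" if "x \<in> ball 0 \<delta>" for x
      using that by blast
    have "ball_int p \<delta> (pds is \<phi>) \<le> (\<integral>\<^sup>+x. ennreal D * (\<Sum>j\<le>?n. ?h j x) \<partial>lborel)"
      unfolding ball_int_def
    proof (intro nn_integral_mono)
      fix x :: "real^'n"
      show "ennreal (\<bar>pds is \<phi> x\<bar> powr p) * indicator (ball 0 \<delta>) x \<le> ennreal D * (\<Sum>j\<le>?n. ?h j x)"
      proof (cases "x \<in> ball 0 \<delta>")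
        case True
        then have x: "x \<in> hball R" using \<delta>(2) by blast
        have nn: "0 \<le> gnorm j \<phi> x powr p * lam x ^ CARD('n)" for j using lam_power_nonneg[OF x] by simp
        have "ennreal D * (\<Sum>j\<le>?n. ?h j x) = ennreal (D * (\<Sum>j\<le>?n. gnorm j \<phi> x powr p * lam x ^ CARD('n)))"
          using x nn C(1) by (simp add: D_def ennreal_mult sum_nonneg sum_ennreal)
        then show ?thesis using pt[OF True] True by (simp add: ennreal_leI)
      qed simp
    qed
    also have "\<dots> = ennreal D * (\<integral>\<^sup>+x. (\<Sum>j\<le>?n. ?h j x) \<partial>lborel)" by (rule nn_integral_cmult) measurable
    also have "(\<integral>\<^sup>+x. (\<Sum>j\<le>?n. ?h j x) \<partial>lborel) = (\<Sum>j\<le>?n. hint p R j \<phi>)"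
      unfolding hint_def by (rule nn_integral_sum) measurable
    finally show ?thesis .
  qed
  then show ?thesis by (intro exI[of _ D]) (auto simp: D_def)
qed

section \<open>Finite differences along an axis\<close>

definition fdiff :: "'n::finite \<Rightarrow> real \<Rightarrow> (real^'n \<Rightarrow> real) \<Rightarrow> real^'n \<Rightarrow> real" where
  "fdiff i h f x = f (x + h *\<^sub>R axis i 1) - f x"

lemma norm_shift_less:
  fixes x :: "real^'n::finite"
  shows "norm x < r \<Longrightarrow> 0 \<le> s \<Longrightarrow> s \<le> h \<Longrightarrow> norm (x + s *\<^sub>R axis i 1) < r + h"
  using norm_triangle_ineq[of x "s *\<^sub>R axis i 1"] by simp

lemma continuous_on_shift:
  fixes f :: "real^'n::finite \<Rightarrow> real"
  assumes "continuous_on (ball 0 (r + h)) f" "0 \<le> h"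
  shows "continuous_on (ball 0 r) (\<lambda>x. f (x + h *\<^sub>R axis i 1))"
  by (rule continuous_on_compose2[OF assms(1)])
    (use assms(2) norm_shift_less[of _ r h h i] in \<open>auto intro!: continuous_intros\<close>)

lemma continuous_on_fdiff:
  fixes f :: "real^'n::finite \<Rightarrow> real"
  assumes "continuous_on (ball 0 (r + h)) f" "0 \<le> h"
  shows "continuous_on (ball 0 r) (fdiff i h f)"
  unfolding fdiff_def
  by (intro continuous_on_diff continuous_on_shift assms continuous_on_subset[OF assms(1)]) (use assms(2) in auto)

lemma ball_int_shift_le:
  fixes f :: "real^'n::finite \<Rightarrow> real"
  assumes c: "continuous_on (ball 0 (r + h)) f" and s: "0 \<le> s" "s \<le> h"
  shows "(\<integral>\<^sup>+x\<in>ball 0 r. ennreal (\<bar>f (x + s *\<^sub>R axis i 1)\<bar> powr p) \<partial>lborel) \<le> ball_int p (r + h) f"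
proof -
  let ?g = "\<lambda>x. ennreal (\<bar>f x\<bar> powr p) * indicator (ball 0 (r + h)) x"
  have "(\<integral>\<^sup>+x\<in>ball 0 r. ennreal (\<bar>f (x + s *\<^sub>R axis i 1)\<bar> powr p) \<partial>lborel) \<le> (\<integral>\<^sup>+x. ?g (s *\<^sub>R axis i 1 + x) \<partial>lborel)"
    using norm_shift_less[of _ r s h i] s by (intro nn_integral_mono) (auto simp: indicator_def add.commute)
  also have "\<dots> = ball_int p (r + h) f"
    unfolding ball_int_def by (rule nn_integral_lborel_shift[OF ball_int_measurable[OF c]])
  finally show ?thesis .
qed

lemma ball_int_fdiff_le:
  fixes f :: "real^'n::finite \<Rightarrow> real"
  assumes p: "0 \<le> p" and c: "continuous_on (ball 0 (r + h)) f" and h: "0 \<le> h"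
  shows "ball_int p r (fdiff i h f) \<le> ennreal (2 * 2 powr p) * ball_int p (r + h) f"
proof -
  have c1: "continuous_on (ball 0 r) (\<lambda>x. f (x + h *\<^sub>R axis i 1))" by (rule continuous_on_shift[OF c h])
  have c2: "continuous_on (ball 0 r) (\<lambda>x. - f x)" using h by (intro continuous_on_minus continuous_on_subset[OF c]) auto
  have "ball_int p r (fdiff i h f) = ball_int p r (\<lambda>x. f (x + h *\<^sub>R axis i 1) + - f x)"
    by (simp add: fdiff_def[abs_def])
  also have "\<dots> \<le> ennreal (2 powr p) * (ball_int p r (\<lambda>x. f (x + h *\<^sub>R axis i 1)) + ball_int p r (\<lambda>x. - f x))"
    by (rule ball_int_add_le[OF p c1 c2])
  also have "\<dots> \<le> ennreal (2 powr p) * (ball_int p (r + h) f + ball_int p (r + h) f)"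
    using ball_int_shift_le[OF c h order_refl, of i p] ball_int_mono[of r "r + h" p f] h
    by (intro mult_left_mono add_mono) (auto simp: ball_int_def)
  also have "\<dots> = ennreal (2 * 2 powr p) * ball_int p (r + h) f"
    by (simp add: mult_2[symmetric] ennreal_mult mult_ac)
  finally show ?thesis .
qed

text \<open>The bound for functions without smoothness: each difference costs
  \<open>2 * 2 powr p\<close> and enlarges the radius by h, with no gain in h. It is applied to the
  remainder between the norm and its approximant.\<close>

lemma ball_int_fdiff_iter_le:
  fixes f :: "real^'n::finite \<Rightarrow> real"
  assumes p: "0 \<le> p" and h: "0 \<le> h" and c: "continuous_on (ball 0 (r + real k * h)) f"
  shows "ball_int p r ((fdiff i h ^^ k) f) \<le> ennreal ((2 * 2 powr p) ^ k) * ball_int p (r + real k * h) f"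
  using c
proof (induction k arbitrary: f)
  case (Suc k)
  have e: "r + real (Suc k) * h = (r + real k * h) + h" by (simp add: algebra_simps)
  note c = Suc.prems[unfolded e]
  have "ball_int p r ((fdiff i h ^^ Suc k) f) \<le> ennreal ((2 * 2 powr p) ^ k) * ball_int p (r + real k * h) (fdiff i h f)"
    unfolding funpow_Suc_right o_def by (rule Suc.IH[OF continuous_on_fdiff[OF c h]])
  also have "\<dots> \<le> ennreal ((2 * 2 powr p) ^ k) * (ennreal (2 * 2 powr p) * ball_int p (r + real (Suc k) * h) f)"
    unfolding e by (intro mult_left_mono ball_int_fdiff_le[OF p c h]) auto
  finally show ?case by (simp add: ennreal_mult mult_ac ennreal_power[symmetric])
qed simp

lemma hsmooth_line_deriv:
  fixes f :: "real^'n::finite \<Rightarrow> real"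
  assumes f: "hsmooth S f" and x: "x + s *\<^sub>R axis i 1 \<in> S"
  shows "((\<lambda>s. f (x + s *\<^sub>R axis i 1)) has_real_derivative pd i f (x + s *\<^sub>R axis i 1)) (at s)"
proof -
  have "((\<lambda>z. f ((x + s *\<^sub>R axis i 1) + z *\<^sub>R axis i 1)) has_real_derivative pd i f (x + s *\<^sub>R axis i 1)) (at 0)"
    by (rule hsmooth_has_pd'[OF f x])
  also have "(\<lambda>z. f ((x + s *\<^sub>R axis i 1) + z *\<^sub>R axis i 1)) = (\<lambda>z. (\<lambda>s. f (x + s *\<^sub>R axis i 1)) (z + s))"
    by (simp add: scaleR_add_left add_ac)
  finally show ?thesis using DERIV_shift[of "\<lambda>s. f (x + s *\<^sub>R axis i 1)" _ 0 s] by simp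
qed

text \<open>The difference is the integral of the partial derivative over a segment of length h, to
  which Jensen's inequality applies.\<close>

lemma fdiff_powr_le:
  fixes f :: "real^'n::finite \<Rightarrow> real"
  assumes p: "1 \<le> p" and f: "hsmooth (ball 0 (r + h)) f" and h: "0 < h" and x: "norm x < r"
  shows "ennreal (\<bar>fdiff i h f x\<bar> powr p)
    \<le> ennreal (h powr (p - 1)) * (\<integral>\<^sup>+s\<in>{0..h}. ennreal (\<bar>pd i f (x + s *\<^sub>R axis i 1)\<bar> powr p) \<partial>lborel)"
proof -
  let ?M = "restrict_space lborel {0..h}" and ?g = "\<lambda>s. pd i f (x + s *\<^sub>R axis i 1)"
  have b: "x + s *\<^sub>R axis i 1 \<in> ball 0 (r + h)" if "s \<in> {0..h}" for s
    using norm_shift_less[OF x, of s h i] that by simp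
  have c: "continuous_on {0..h} ?g"
    by (rule continuous_on_compose2[OF hsmooth_continuous[OF hsmooth_pd[OF f]]]) (use b in \<open>auto intro!: continuous_intros\<close>)
  have "set_integrable lborel {0..h} (\<lambda>s. \<bar>?g s\<bar>)"
    by (intro borel_integrable_atLeastAtMost' continuous_on_rabs c)
  then have int: "integrable ?M (\<lambda>s. \<bar>?g s\<bar>)" by (simp add: integrable_restrict_space set_integrable_def)
  have "(\<integral>s. indicator {0..h} s *\<^sub>R ?g s \<partial>lborel) = f (x + h *\<^sub>R axis i 1) - f (x + 0 *\<^sub>R axis i 1)"
    using h by (intro integral_FTC_atLeastAtMost c)
      (auto intro!: has_vector_derivative_at_within hsmooth_line_deriv[OF f b, unfolded has_real_derivative_iff_has_vector_derivative])
  then have "fdiff i h f x = (\<integral>s. ?g s \<partial>?M)"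
    by (simp add: fdiff_def integral_restrict_space)
  then have "\<bar>fdiff i h f x\<bar> \<le> (\<integral>s. \<bar>?g s\<bar> \<partial>?M)"
    using integral_abs_bound[of ?M ?g] by simp
  then have "ennreal (\<bar>fdiff i h f x\<bar> powr p) \<le> ennreal ((\<integral>s. \<bar>?g s\<bar> \<partial>?M) powr p)"
    using p by (intro ennreal_leI powr_mono2) auto
  also have "\<dots> \<le> ennreal (h powr (p - 1)) * (\<integral>\<^sup>+s. ennreal (\<bar>?g s\<bar> powr p) \<partial>?M)"
    using h by (intro powr_integral_le int p) (auto simp: emeasure_restrict_space space_restrict_space)
  also have "(\<integral>\<^sup>+s. ennreal (\<bar>?g s\<bar> powr p) \<partial>?M) = (\<integral>\<^sup>+s\<in>{0..h}. ennreal (\<bar>?g s\<bar> powr p) \<partial>lborel)"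
    by (simp add: nn_integral_restrict_space)
  finally show ?thesis .
qed

text \<open>The pointwise bound is integrated over the ball. For each fixed s the translated ball
  lies in the one of radius \<open>r + h\<close>, so the remaining integral over s gives the missing
  factor h.\<close>

lemma ball_int_fdiff_smooth_le:
  fixes f :: "real^'n::finite \<Rightarrow> real"
  assumes p: "1 \<le> p" and f: "hsmooth (ball 0 (r + h)) f" and h: "0 < h"
  shows "ball_int p r (fdiff i h f) \<le> ennreal (h powr p) * ball_int p (r + h) (pd i f)"
proof -
  let ?G = "\<lambda>y. ennreal (\<bar>pd i f y\<bar> powr p) * indicator (ball 0 (r + h)) y"
  have c: "continuous_on (ball 0 (r + h)) (pd i f)" by (rule hsmooth_continuous[OF hsmooth_pd[OF f]])
  note [measurable] = ball_int_measurable[OF c]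
  have "ball_int p r (fdiff i h f) \<le> (\<integral>\<^sup>+x. ennreal (h powr (p - 1)) * (\<integral>\<^sup>+s. ?G (x + s *\<^sub>R axis i 1) * indicator {0..h} s \<partial>lborel) \<partial>lborel)"
    unfolding ball_int_def
  proof (intro nn_integral_mono)
    fix x :: "real^'n"
    show "ennreal (\<bar>fdiff i h f x\<bar> powr p) * indicator (ball 0 r) x \<le> ennreal (h powr (p - 1)) * (\<integral>\<^sup>+s. ?G (x + s *\<^sub>R axis i 1) * indicator {0..h} s \<partial>lborel)"
    proof (cases "norm x < r")
      case True
      have "(\<integral>\<^sup>+s\<in>{0..h}. ennreal (\<bar>pd i f (x + s *\<^sub>R axis i 1)\<bar> powr p) \<partial>lborel) = (\<integral>\<^sup>+s. ?G (x + s *\<^sub>R axis i 1) * indicator {0..h} s \<partial>lborel)"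
        using norm_shift_less[OF True, of _ h i] by (intro nn_integral_cong) (auto simp: indicator_def)
      then show ?thesis using fdiff_powr_le[OF p f h True, of i] True by simp
    qed simp
  qed
  also have "\<dots> = ennreal (h powr (p - 1)) * (\<integral>\<^sup>+x. \<integral>\<^sup>+s. ?G (x + s *\<^sub>R axis i 1) * indicator {0..h} s \<partial>lborel \<partial>lborel)"
    by (rule nn_integral_cmult) measurable
  also have "(\<integral>\<^sup>+x. \<integral>\<^sup>+s. ?G (x + s *\<^sub>R axis i 1) * indicator {0..h} s \<partial>lborel \<partial>lborel)
      = (\<integral>\<^sup>+s. \<integral>\<^sup>+x. ?G (x + s *\<^sub>R axis i 1) * indicator {0..h} s \<partial>lborel \<partial>lborel)"
    by (rule lborel_pair.Fubini') measurable
  also have "\<dots> = (\<integral>\<^sup>+s. ball_int p (r + h) (pd i f) * indicator {0..h} s \<partial>lborel)"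
  proof (intro nn_integral_cong)
    fix s :: real
    have "(\<integral>\<^sup>+x. ?G (x + s *\<^sub>R axis i 1) \<partial>lborel) = ball_int p (r + h) (pd i f)"
      using nn_integral_lborel_shift[OF ball_int_measurable[OF c, of p], of "s *\<^sub>R axis i 1"] by (simp add: ball_int_def add.commute)
    then show "(\<integral>\<^sup>+x. ?G (x + s *\<^sub>R axis i 1) * indicator {0..h} s \<partial>lborel) = ball_int p (r + h) (pd i f) * indicator {0..h} s"
      by (simp add: nn_integral_multc)
  qed
  also have "\<dots> = ball_int p (r + h) (pd i f) * ennreal h"
    using h by (simp add: nn_integral_cmult)
  also have "ennreal (h powr (p - 1)) * (ball_int p (r + h) (pd i f) * ennreal h) = ennreal (h powr (p - 1) * h) * ball_int p (r + h) (pd i f)"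
    using h by (simp add: ennreal_mult mult_ac)
  also have "h powr (p - 1) * h = h powr p" using h by (simp add: powr_diff)
  finally show ?thesis .
qed

lemma pds_shift: "pds is (\<lambda>x. f (x + a)) = (\<lambda>x. pds is f (x + a))"
  by (induction "is") (auto simp: pd_def fun_eq_iff add_ac)

lemma hsmooth_shift:
  fixes f :: "real^'n::finite \<Rightarrow> real"
  assumes f: "hsmooth (ball 0 (r + h)) f" and h: "0 \<le> h"
  shows "hsmooth (ball 0 r) (\<lambda>x. f (x + h *\<^sub>R axis i 1))"
  unfolding hsmooth_def pds_shift
proof (intro allI conjI ballI)
  fix "is" :: "'n list" and x :: "real^'n" and j
  show "continuous_on (ball 0 r) (\<lambda>x. pds is f (x + h *\<^sub>R axis i 1))"
    by (rule continuous_on_shift[OF hsmooth_continuous_pds[OF f] h])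
  assume "x \<in> ball 0 r"
  then have "x + h *\<^sub>R axis i 1 \<in> ball 0 (r + h)" using norm_shift_less[of x r h h i] h by simp
  from hsmooth_has_pd[OF f this, of "is" j]
  show "(\<lambda>s. pds is f (x + s *\<^sub>R axis j 1 + h *\<^sub>R axis i 1)) differentiable (at 0)"
    by (auto simp: real_differentiable_def add_ac simp del: pds.simps)
qed

lemma hsmooth_fdiff:
  fixes f :: "real^'n::finite \<Rightarrow> real"
  assumes f: "hsmooth (ball 0 (r + h)) f" and h: "0 \<le> h"
  shows "hsmooth (ball 0 r) (fdiff i h f)"
    and "x \<in> ball 0 r \<Longrightarrow> pds is (fdiff i h f) x = fdiff i h (pds is f) x"
proof -
  have f': "hsmooth (ball 0 r) f" using h by (intro hsmooth_subset[OF f]) auto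
  show "hsmooth (ball 0 r) (fdiff i h f)"
    unfolding fdiff_def[abs_def] by (intro hsmooth_diff hsmooth_shift[OF f h] f') simp
  show "pds is (fdiff i h f) x = fdiff i h (pds is f) x" if "x \<in> ball 0 r"
    unfolding fdiff_def[abs_def] by (subst pds_diff[OF _ hsmooth_shift[OF f h] f' that]) (auto simp: pds_shift)
qed

lemma hsmooth_pds: "hsmooth S f \<Longrightarrow> hsmooth S (pds is f)"
  by (induction "is") (auto intro: hsmooth_pd)

text \<open>Differences commute with partial derivatives, so every difference in turn can be
  exchanged for a derivative and a factor \<open>h powr p\<close>.\<close>

lemma ball_int_fdiff_iter_smooth_le:
  fixes f :: "real^'n::finite \<Rightarrow> real"
  assumes p: "1 \<le> p" and h: "0 < h" and f: "hsmooth (ball 0 (r + real k * h)) f"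
  shows "ball_int p r ((fdiff i h ^^ k) f) \<le> ennreal (h powr (real k * p)) * ball_int p (r + real k * h) (pds (replicate k i) f)"
  using f
proof (induction k arbitrary: f)
  case (Suc k)
  have e: "r + real (Suc k) * h = (r + real k * h) + h" by (simp add: algebra_simps)
  note f = Suc.prems[unfolded e]
  have "ball_int p r ((fdiff i h ^^ Suc k) f) \<le> ennreal (h powr (real k * p)) * ball_int p (r + real k * h) (pds (replicate k i) (fdiff i h f))"
    unfolding funpow_Suc_right o_def by (rule Suc.IH[OF hsmooth_fdiff(1)[OF f]]) (use h in simp)
  also have "ball_int p (r + real k * h) (pds (replicate k i) (fdiff i h f)) = ball_int p (r + real k * h) (fdiff i h (pds (replicate k i) f))"
    using hsmooth_fdiff(2)[OF f] h by (intro ball_int_cong) auto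
  also have "ennreal (h powr (real k * p)) * \<dots> \<le> ennreal (h powr (real k * p)) * (ennreal (h powr p) * ball_int p (r + real (Suc k) * h) (pds (replicate (Suc k) i) f))"
    unfolding e replicate_Suc pds.simps
    by (intro mult_left_mono ball_int_fdiff_smooth_le[OF p hsmooth_pds[OF f] h]) auto
  also have "\<dots> = ennreal (h powr (real (Suc k) * p)) * ball_int p (r + real (Suc k) * h) (pds (replicate (Suc k) i) f)"
  proof -
    have "h powr (real k * p) * h powr p = h powr (real (Suc k) * p)" by (simp add: powr_add[symmetric] algebra_simps)
    then show ?thesis by (simp only: mult.assoc[symmetric] ennreal_mult[symmetric] powr_ge_zero)
  qed
  finally show ?case .
qed (use h in simp)

lemma continuous_on_fdiff_iter:
  fixes f :: "real^'n::finite \<Rightarrow> real"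
  assumes "continuous_on (ball 0 (r + real k * h)) f" "0 \<le> h"
  shows "continuous_on (ball 0 r) ((fdiff i h ^^ k) f)"
  using assms(1)
proof (induction k arbitrary: f)
  case (Suc k)
  have "r + real (Suc k) * h = (r + real k * h) + h" by (simp add: algebra_simps)
  from Suc.prems[unfolded this] show ?case unfolding funpow_Suc_right o_def
    by (intro Suc.IH continuous_on_fdiff assms(2))
qed simp

lemma fdiff_iter_add: "(fdiff i h ^^ k) (\<lambda>x. f x + g x) = (\<lambda>x. (fdiff i h ^^ k) f x + (fdiff i h ^^ k) g x)"
  by (induction k) (auto simp: fdiff_def fun_eq_iff)

text \<open>Translation preserves the Lipschitz constant and a difference at most doubles it. This
  spreads the value at one grid point to a ball of radius proportional to h.\<close>

lemma fdiff_iter_lipschitz: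
  fixes f :: "real^'n::finite \<Rightarrow> real"
  assumes "\<And>x y. \<bar>f x - f y\<bar> \<le> norm (x - y)"
  shows "\<bar>(fdiff i h ^^ k) f x - (fdiff i h ^^ k) f y\<bar> \<le> 2 ^ k * norm (x - y)"
proof (induction k arbitrary: x y)
  case (Suc k)
  from Suc[of x y] Suc[of "x + h *\<^sub>R axis i 1" "y + h *\<^sub>R axis i 1"] show ?case
    by (simp add: fdiff_def)
qed (simp add: assms)

lemma fdiff_iter_Suc: "(fdiff i h ^^ Suc n) f x = (fdiff i h ^^ n) f (x + h *\<^sub>R axis i 1) - (fdiff i h ^^ n) f x"
  by (simp add: fdiff_def)

text \<open>Along the axis the norm is a tent with vertex at the origin, so its second difference with
  step h is concentrated at the single grid point -h, and all higher differences see only that value.\<close>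
lemma fdiff_iter_norm:
  fixes i :: "'n::finite"
  assumes h: "0 < h"
  shows "(fdiff i h ^^ Suc (Suc j)) norm (- h *\<^sub>R axis i 1) = (-1) ^ j * (2 * h)
    \<and> (\<forall>m::nat. (fdiff i h ^^ Suc (Suc j)) norm ((real m * h) *\<^sub>R axis i 1) = 0)"
proof (induction j)
  case 0
  have e: "a *\<^sub>R axis i 1 + h *\<^sub>R axis i 1 = (a + h) *\<^sub>R (axis i 1 :: real^'n)" for a by (rule scaleR_add_left[symmetric])
  have n: "norm (a *\<^sub>R axis i 1 :: real^'n) = \<bar>a\<bar>" for a by simp
  have v: "(fdiff i h ^^ Suc (Suc 0)) norm (a *\<^sub>R axis i 1) = \<bar>a + h + h\<bar> - \<bar>a + h\<bar> - (\<bar>a + h\<bar> - \<bar>a\<bar>)" for a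
    by (simp only: funpow.simps o_apply id_apply fdiff_def e n)
  show ?case using h unfolding v by (simp add: abs_mult)
next
  case (Suc j)
  define F where "F = (fdiff i h ^^ Suc (Suc j)) (norm :: real^'n \<Rightarrow> real)"
  have F: "F (- h *\<^sub>R axis i 1) = (-1) ^ j * (2 * h)" "F ((real m * h) *\<^sub>R axis i 1) = 0" for m :: nat
    using Suc unfolding F_def by auto
  have S: "(fdiff i h ^^ Suc (Suc (Suc j))) norm x = F (x + h *\<^sub>R axis i 1) - F x" for x
    unfolding F_def by (rule fdiff_iter_Suc)
  have "(real m * h) *\<^sub>R axis i 1 + h *\<^sub>R axis i 1 = (real (Suc m) * h) *\<^sub>R (axis i 1 :: real^'n)" for m
    by (simp add: scaleR_add_left[symmetric] distrib_right add.commute)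
  then show ?case unfolding S using F(1) F(2)[of 0] F(2) by (simp del: of_nat_Suc)
qed

text \<open>At the grid point -h the k-th difference has modulus 2 h; having Lipschitz constant 2^k,
  it stays at least h on the ball of radius h / 2^k. The volume contributes the exponent N and the
  value the exponent p.\<close>

lemma ball_int_fdiff_iter_norm_ge:
  fixes i :: "'n::finite"
  assumes h: "0 < h" and k: "2 \<le> k" and p: "0 \<le> p"
  shows "ennreal (unit_ball_vol (real CARD('n)) / (2 ^ k) ^ CARD('n) * h powr (real CARD('n) + p)) \<le> ball_int p (2 * h) ((fdiff i h ^^ k) norm)"
proof -
  let ?c = "- h *\<^sub>R axis i 1 :: real^'n" and ?r = "h / 2 ^ k"
  have kj: "k = Suc (Suc (k - 2))" using k by simp
  have "(fdiff i h ^^ k) norm ?c = (-1) ^ (k - 2) * (2 * h)" using fdiff_iter_norm[OF h, where i=i and j="k - 2"] kj by metis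
  then have v: "\<bar>(fdiff i h ^^ k) norm ?c\<bar> = 2 * h" using h by (simp add: abs_mult power_abs)
  have r: "?r \<le> h" "?r > 0" using h by (auto simp: field_simps)
  have big: "h powr p \<le> \<bar>(fdiff i h ^^ k) norm x\<bar> powr p \<and> x \<in> ball 0 (2 * h)" if x: "x \<in> ball ?c ?r" for x
  proof
    have "2 ^ k * norm (x - ?c) \<le> 2 ^ k * ?r" using x by (intro mult_left_mono) (auto simp: dist_norm norm_minus_commute)
    then have "\<bar>(fdiff i h ^^ k) norm x - (fdiff i h ^^ k) norm ?c\<bar> \<le> h"
      using fdiff_iter_lipschitz[OF norm_triangle_ineq3, where i=i and h=h and k=k and x=x and y="?c"] by simp
    then show "h powr p \<le> \<bar>(fdiff i h ^^ k) norm x\<bar> powr p" using v h p by (intro powr_mono2) auto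
    have "norm x \<le> norm ?c + dist ?c x" by (metis dist_norm norm_minus_commute norm_triangle_sub add.commute)
    then show "x \<in> ball 0 (2 * h)" using x r h by simp
  qed
  have "h powr (real CARD('n) + p) = h powr p * h ^ CARD('n)" using h by (simp add: powr_add powr_realpow)
  then have "ennreal (unit_ball_vol (real CARD('n)) / (2 ^ k) ^ CARD('n) * h powr (real CARD('n) + p)) = ennreal (h powr p) * ennreal (unit_ball_vol (real CARD('n)) * ?r ^ CARD('n))"
    using h by (simp add: ennreal_mult[symmetric] power_divide)
  also have "\<dots> = (\<integral>\<^sup>+x. ennreal (h powr p) * indicator (ball ?c ?r) x \<partial>lborel)"
    using r by (simp add: nn_integral_cmult emeasure_ball)
  also have "\<dots> \<le> ball_int p (2 * h) ((fdiff i h ^^ k) norm)"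
    unfolding ball_int_def using big by (intro nn_integral_mono) (auto simp: indicator_def intro!: ennreal_leI)
  finally show ?thesis .
qed

section \<open>Smallness of the k-th derivatives and the lower bound for N\<close>

lemma ball_int_bounded_le:
  fixes f :: "real^'n::finite \<Rightarrow> real"
  assumes "\<And>x. norm x < r \<Longrightarrow> \<bar>f x\<bar> \<le> B" "0 \<le> p" "0 \<le> r"
  shows "ball_int p r f \<le> ennreal (B powr p * (unit_ball_vol (real CARD('n)) * r ^ CARD('n)))"
proof -
  have "ball_int p r f \<le> (\<integral>\<^sup>+x. ennreal (B powr p) * indicator (ball (0::real^'n) r) x \<partial>lborel)"
    unfolding ball_int_def using assms by (intro nn_integral_mono) (auto simp: indicator_def intro!: ennreal_leI powr_mono2)
  also have "\<dots> = ennreal (B powr p * (unit_ball_vol (real CARD('n)) * r ^ CARD('n)))"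
    using assms(3) by (simp add: nn_integral_cmult emeasure_ball ennreal_mult)
  finally show ?thesis .
qed

text \<open>All late members are close to one fixed member, whose derivative is bounded near the
  origin and hence small on small balls. This uniform smallness supplies the little-o that decides
  the borderline case.\<close>

lemma happrox_pds_small:
  fixes "is" :: "'n::finite list"
  assumes ap: "happrox k p R \<phi> u" and k: "length is = k" and p: "0 \<le> p" and R: "0 < R" and \<eta>: "0 < \<eta>"
    and \<delta>: "0 < \<delta>" "\<delta> \<le> 1/2" "ball 0 \<delta> \<subseteq> (hball R :: (real^'n) set)"
  shows "\<exists>M. \<exists>r0>0. \<forall>n\<ge>M. \<forall>r. 0 < r \<longrightarrow> r < r0 \<longrightarrow> ball_int p r (pds is (\<phi> n)) \<le> ennreal \<eta>"
proof -
  have sm: "hsmooth (hball R) (\<phi> n)" for n using ap by (simp add: happrox_def)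
  obtain C where C: "C \<ge> 0" "\<And>\<phi>. hsmooth (hball R) \<phi> \<Longrightarrow> ball_int p \<delta> (pds is \<phi>) \<le> ennreal C * (\<Sum>j\<le>k. hint p R j \<phi>)"
    using ball_int_pds_le_hint[OF p \<delta>(2,3), of "is"] k by blast
  define K where "K = 2 powr p"
  have K: "K > 0" by (simp add: K_def)
  \<comment> \<open>\<open>Suc k\<close> seminorms of size e, multiplied by \<open>C\<close>, then
    give at most \<open>\<eta> / (2 * K)\<close>; the summand 1 next to \<open>C\<close> prevents a
    division by zero.\<close>
  define e where "e = \<eta> / (2 * K * (C + 1) * real (Suc k))"
  have e: "e > 0" using \<eta> K C by (simp add: e_def)
  have "\<forall>j\<in>{..k}. \<exists>M. \<forall>m\<ge>M. \<forall>n\<ge>M. hint p R j (\<lambda>x. \<phi> m x - \<phi> n x) < ennreal e"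
    using ap e by (simp add: happrox_def)
  then obtain Mf where Mf: "\<And>j m n. j \<le> k \<Longrightarrow> m \<ge> Mf j \<Longrightarrow> n \<ge> Mf j \<Longrightarrow> hint p R j (\<lambda>x. \<phi> m x - \<phi> n x) < ennreal e"
    unfolding bchoice_iff by auto
  \<comment> \<open>\<open>M\<close> is both the threshold and the index of the member used for
    comparison.\<close>
  define M where "M = Max (Mf ` {..k})"
  have M: "hint p R j (\<lambda>x. \<phi> n x - \<phi> M x) \<le> ennreal e" if "j \<le> k" "n \<ge> M" for j n
  proof -
    have "Mf j \<le> M" unfolding M_def using that by (intro Max_ge) auto
    then show ?thesis using Mf[of j n M] that by (auto intro: less_imp_le)
  qed
  have c: "continuous_on (ball 0 \<delta>) (pds is (\<phi> n))" for n
    using hsmooth_continuous_pds[OF sm] \<delta>(3) by (rule continuous_on_subset)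
  have "continuous_on (cball 0 (\<delta>/2)) (pds is (\<phi> M))" by (rule continuous_on_subset[OF c]) (use \<delta> in auto)
  then have "bounded (pds is (\<phi> M) ` cball 0 (\<delta>/2))" by (intro compact_imp_bounded compact_continuous_image) auto
  then obtain B where "\<forall>y\<in>pds is (\<phi> M) ` cball 0 (\<delta>/2). norm y \<le> B" unfolding bounded_iff by blast
  then have B: "\<bar>pds is (\<phi> M) x\<bar> \<le> B" if "norm x \<le> \<delta>/2" for x using that by simp
  have "((\<lambda>r. B powr p * (unit_ball_vol (real CARD('n)) * r ^ CARD('n))) \<longlongrightarrow> B powr p * (unit_ball_vol (real CARD('n)) * 0 ^ CARD('n))) (at_right 0)"
    by (intro tendsto_intros)
  moreover have "B powr p * (unit_ball_vol (real CARD('n)) * 0 ^ CARD('n)) = 0" by simp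
  ultimately have "((\<lambda>r. B powr p * (unit_ball_vol (real CARD('n)) * r ^ CARD('n))) \<longlongrightarrow> 0) (at_right 0)" by (simp only:)
  then have "\<forall>\<^sub>F r in at_right 0. B powr p * (unit_ball_vol (real CARD('n)) * r ^ CARD('n)) < \<eta> / (2 * K)"
    by (rule order_tendstoD) (use \<eta> K in simp)
  then obtain b where b: "b > 0" "\<And>r. 0 < r \<Longrightarrow> r < b \<Longrightarrow> B powr p * (unit_ball_vol (real CARD('n)) * r ^ CARD('n)) < \<eta> / (2 * K)"
    unfolding eventually_at_right_field by blast
  have "ball_int p r (pds is (\<phi> n)) \<le> ennreal \<eta>" if n: "n \<ge> M" and r: "0 < r" "r < min b (\<delta>/2)" for n r
  proof -
    let ?d = "\<lambda>x. pds is (\<phi> n) x - pds is (\<phi> M) x"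
    have cr: "continuous_on (ball 0 r) (pds is (\<phi> n))" for n by (rule continuous_on_subset[OF c]) (use r in auto)
    have "ball_int p r ?d \<le> ball_int p \<delta> ?d" using r by (intro ball_int_mono) auto
    also have "\<dots> = ball_int p \<delta> (pds is (\<lambda>x. \<phi> n x - \<phi> M x))"
      using pds_diff[OF open_hball sm sm] \<delta>(3) by (intro ball_int_cong) (auto simp: subset_iff)
    also have "\<dots> \<le> ennreal C * (\<Sum>j\<le>k. hint p R j (\<lambda>x. \<phi> n x - \<phi> M x))"
      by (intro C(2) hsmooth_diff open_hball sm)
    also have "\<dots> \<le> ennreal C * (\<Sum>j\<le>k. ennreal e)" using M n by (intro mult_left_mono sum_mono) auto
    also have "\<dots> = ennreal (C * (real (Suc k) * e))" using C e by (simp add: ennreal_mult ennreal_of_nat_eq_real_of_nat)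
    also have "\<dots> \<le> ennreal (\<eta> / (2 * K))"
    proof (intro ennreal_leI)
      have "C * (real (Suc k) * e) \<le> (C + 1) * (real (Suc k) * e)" using e by (intro mult_right_mono) auto
      also have "\<dots> = \<eta> / (2 * K)" using K C(1) by (simp add: e_def divide_simps del: of_nat_Suc)
      finally show "C * (real (Suc k) * e) \<le> \<eta> / (2 * K)" .
    qed
    finally have 1: "ball_int p r ?d \<le> ennreal (\<eta> / (2 * K))" .
    have 2: "ball_int p r (pds is (\<phi> M)) \<le> ennreal (\<eta> / (2 * K))"
    proof (rule order_trans[OF ball_int_bounded_le[of r "pds is (\<phi> M)" B p]])
      show "\<bar>pds is (\<phi> M) x\<bar> \<le> B" if "norm x < r" for x using that r by (intro B) simp
      show "ennreal (B powr p * (unit_ball_vol (real CARD('n)) * r ^ CARD('n))) \<le> ennreal (\<eta> / (2 * K))"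
        using b(2)[of r] r by (intro ennreal_leI less_imp_le) simp
    qed (use r p in auto)
    have "ball_int p r (pds is (\<phi> n)) = ball_int p r (\<lambda>x. ?d x + pds is (\<phi> M) x)" by simp
    also have "\<dots> \<le> ennreal K * (ball_int p r ?d + ball_int p r (pds is (\<phi> M)))"
      unfolding K_def by (intro ball_int_add_le p continuous_on_diff cr)
    also have "\<dots> \<le> ennreal K * (ennreal (\<eta> / (2 * K)) + ennreal (\<eta> / (2 * K)))" by (intro mult_left_mono add_mono 1 2) auto
    also have "\<dots> = ennreal \<eta>" using K \<eta> by (simp add: ennreal_plus[symmetric] ennreal_mult[symmetric] del: ennreal_plus)
    finally show ?thesis .
  qed
  then show ?thesis using b(1) \<delta>(1) by (intro exI[of _ M] exI[of _ "min b (\<delta>/2)"]) auto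
qed

text \<open>The order of the choices is essential: \<eta> from the lower bound, then the threshold
  and radius for the derivatives, then the step h, and only then the index n, for which the
  remainder must be small relative to h.\<close>

lemma happrox_norm_imp_less:
  fixes u :: "real^'n::finite \<Rightarrow> real"
  assumes ap: "happrox k p R \<phi> u" and u: "\<And>x. x \<in> hball R \<Longrightarrow> u x = norm x"
    and p: "1 \<le> p" and k: "2 \<le> k" and R: "0 < R"
  shows "real (k - 1) * p < real CARD('n)"
proof (rule ccontr)
  let ?d = "\<lambda>n. \<integral>\<^sup>+x\<in>hball R. ennreal (\<bar>\<phi> n x - u x\<bar> powr p * lam x ^ CARD('n)) \<partial>lborel"
  assume "\<not> ?thesis"
  \<comment> \<open>The negated claim, read as a comparison of exponents: that of the lower bound is
    at most that of the upper bound.\<close>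
  then have le: "real CARD('n) + p \<le> real k * p" using k by (simp add: of_nat_diff algebra_simps)
  obtain i :: 'n where True by simp
  have p0: "0 \<le> p" using p by simp
  have sm: "hsmooth (hball R) (\<phi> n)" for n using ap by (simp add: happrox_def)
  have "(0::real^'n) \<in> hball R" using R by (simp add: hball_def hdist_def zero_ereal_def)
  then obtain d where d: "d > 0" "ball (0::real^'n) d \<subseteq> hball R" using open_hball[of R] unfolding open_contains_ball by blast
  define \<delta> where "\<delta> = min d (1/2)"
  have "ball (0::real^'n) \<delta> \<subseteq> ball 0 d" by (simp add: \<delta>_def subset_ball)
  then have \<delta>: "0 < \<delta>" "\<delta> \<le> 1/2" "ball 0 \<delta> \<subseteq> (hball R :: (real^'n) set)" using d by (auto simp: \<delta>_def)
  define A where "A = unit_ball_vol (real CARD('n)) / (2 ^ k) ^ CARD('n)"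
  have A: "A > 0" by (simp add: A_def unit_ball_vol_pos)
  define K where "K = 2 powr p"
  have K: "K > 0" by (simp add: K_def)
  define L where "L = (2 * 2 powr p) ^ k"
  have L: "L > 0" by (simp add: L_def)
  \<comment> \<open>With this value the two error terms together amount to
    \<open>A * h powr (real k * p) / 2\<close>.\<close>
  define \<eta> where "\<eta> = A / (4 * K)"
  have \<eta>: "\<eta> > 0" using A K by (simp add: \<eta>_def)
  obtain M r0 where r0: "r0 > 0" and M: "\<And>n r. n \<ge> M \<Longrightarrow> 0 < r \<Longrightarrow> r < r0 \<Longrightarrow> ball_int p r (pds (replicate k i) (\<phi> n)) \<le> ennreal \<eta>"
    using happrox_pds_small[OF ap length_replicate p0 R \<eta> \<delta>] by blast
  define m where "m = min r0 (min \<delta> 1) / 2"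
  have m: "0 < m" "m < r0" "m < \<delta>" "m < 1" using r0 \<delta>(1) by (auto simp: m_def)
  \<comment> \<open>The k differences enlarge the ball of radius \<open>2 * h\<close> by
    \<open>real k * h\<close>, exactly to radius \<open>m\<close>.\<close>
  define h where "h = m / (2 + real k)"
  have h: "0 < h" "h \<le> m" using m(1) by (auto simp: h_def field_simps)
  have "2 + real k \<noteq> 0" by linarith
  then have hm: "2 * h + real k * h = m" unfolding distrib_right[symmetric] h_def by simp
  have h1: "h < 1" using h m by simp
  let ?e = "h powr (real k * p) * \<eta>"
  have e: "?e > 0" using h \<eta> by simp
  have sub: "ball 0 (2 * h + real k * h) \<subseteq> (hball R :: (real^'n) set)"
    using \<delta>(3) m(3) unfolding hm by (auto dest: subsetD)
  have "?d \<longlonglongrightarrow> 0"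
    using ap by (simp add: happrox_def)
  \<comment> \<open>The remainder has no derivatives from which powers of h could be gained, so n is
    taken large enough to make it small compared with \<open>h powr (real k * p)\<close>.\<close>
  then have "\<forall>\<^sub>F n in sequentially. ?d n < ennreal (?e / L)"
    by (rule order_tendstoD) (use e L in simp)
  then obtain n where n: "n \<ge> M" "?d n < ennreal (?e / L)"
    unfolding eventually_sequentially by (meson le_cases)
  let ?g = "\<lambda>x. norm x - \<phi> n x"
  have c: "continuous_on (ball 0 (2 * h + real k * h)) (\<phi> n)" by (rule continuous_on_subset[OF hsmooth_continuous[OF sm] sub])
  have cg: "continuous_on (ball 0 (2 * h + real k * h)) ?g" by (intro continuous_intros c)
  have "ball_int p (2 * h + real k * h) ?g \<le> ?d n"
    unfolding ball_int_def
  proof (intro nn_integral_mono)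
    fix x :: "real^'n"
    show "ennreal (\<bar>norm x - \<phi> n x\<bar> powr p) * indicator (ball 0 (2 * h + real k * h)) x \<le> ennreal (\<bar>\<phi> n x - u x\<bar> powr p * lam x ^ CARD('n)) * indicator (hball R) x"
    proof (cases "x \<in> ball 0 (2 * h + real k * h)")
      case True
      then have x: "x \<in> hball R" using sub by blast
      then have "norm x < 1" using hball_subset[of R] by (auto simp: hball_def)
      then have l: "1 \<le> lam x ^ CARD('n)" using lam_ge_2[of x] by (intro one_le_power) auto
      have "\<bar>norm x - \<phi> n x\<bar> powr p \<le> \<bar>\<phi> n x - u x\<bar> powr p * lam x ^ CARD('n)"
        using mult_left_mono[OF l, of "\<bar>\<phi> n x - u x\<bar> powr p"] u[OF x] by (simp add: abs_minus_commute)
      then show ?thesis using True x by (simp add: ennreal_leI)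
    qed simp
  qed
  with n(2) have "ball_int p (2 * h + real k * h) ?g \<le> ennreal (?e / L)" by simp
  then have 1: "ball_int p (2 * h) ((fdiff i h ^^ k) ?g) \<le> ennreal ?e"
  proof -
    have "ball_int p (2 * h) ((fdiff i h ^^ k) ?g) \<le> ennreal L * ball_int p (2 * h + real k * h) ?g"
      unfolding L_def by (rule ball_int_fdiff_iter_le[OF p0 _ cg]) (use h in simp)
    also have "\<dots> \<le> ennreal L * ennreal (?e / L)" by (intro mult_left_mono \<open>ball_int p (2 * h + real k * h) ?g \<le> ennreal (?e / L)\<close>) simp
    also have "\<dots> = ennreal ?e" using L e by (simp add: ennreal_mult[symmetric])
    finally show ?thesis .
  qed
  have 2: "ball_int p (2 * h) ((fdiff i h ^^ k) (\<phi> n)) \<le> ennreal ?e"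
  proof -
    have "ball_int p (2 * h) ((fdiff i h ^^ k) (\<phi> n)) \<le> ennreal (h powr (real k * p)) * ball_int p (2 * h + real k * h) (pds (replicate k i) (\<phi> n))"
      by (rule ball_int_fdiff_iter_smooth_le[OF p h(1) hsmooth_subset[OF sm sub]])
    also have "\<dots> \<le> ennreal (h powr (real k * p)) * ennreal \<eta>"
      unfolding hm by (intro mult_left_mono M n(1) m) simp
    finally show ?thesis using \<eta> by (simp add: ennreal_mult)
  qed
  have cc: "continuous_on (ball 0 (2 * h)) ((fdiff i h ^^ k) ?g)" "continuous_on (ball 0 (2 * h)) ((fdiff i h ^^ k) (\<phi> n))"
    using c cg h by (auto intro!: continuous_on_fdiff_iter)
  have "ennreal (A * h powr (real CARD('n) + p)) \<le> ball_int p (2 * h) ((fdiff i h ^^ k) norm)"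
    unfolding A_def by (rule ball_int_fdiff_iter_norm_ge[OF h(1) k p0])
  also have "(norm :: real^'n \<Rightarrow> real) = (\<lambda>x. ?g x + \<phi> n x)" by simp
  also have "ball_int p (2 * h) ((fdiff i h ^^ k) (\<lambda>x. ?g x + \<phi> n x))
     \<le> ennreal K * (ball_int p (2 * h) ((fdiff i h ^^ k) ?g) + ball_int p (2 * h) ((fdiff i h ^^ k) (\<phi> n)))"
    unfolding K_def fdiff_iter_add by (rule ball_int_add_le[OF p0 cc])
  also have "\<dots> \<le> ennreal K * (ennreal ?e + ennreal ?e)" by (intro mult_left_mono add_mono 1 2) simp
  also have "\<dots> = ennreal (K * (?e + ?e))" using K e by (simp only: ennreal_mult[of K] ennreal_plus less_imp_le add_nonneg_nonneg)
  finally have "A * h powr (real CARD('n) + p) \<le> K * (?e + ?e)" 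
    by (subst (asm) ennreal_le_iff) (use \<eta> K in auto)
  also have "\<dots> = A * h powr (real k * p) / 2" using K by (simp add: \<eta>_def field_simps)
  \<comment> \<open>As \<open>h < 1\<close>, the larger exponent gives the smaller power; a positive
    number would be at most its half.\<close>
  also have "\<dots> \<le> A * h powr (real CARD('n) + p) / 2"
    using A powr_mono'[OF le, of h] h h1 by simp
  finally show False using A h by simp
qed

text \<open>All derivatives of tanh (t / 2) are polynomials in tanh (t / 2); the second factor is (1
  - z^2) / 2, the derivative of z = tanh (t / 2).\<close>

primrec tanh_poly :: "nat \<Rightarrow> real poly" where
  "tanh_poly 0 = [:0, 1:]"
| "tanh_poly (Suc i) = pderiv (tanh_poly i) * [:1/2, 0, -1/2:]"

lemma smooth_fam_tanh: "smooth_fam UNIV (\<lambda>i t. poly (tanh_poly i) (tanh (t / 2)))"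
  unfolding smooth_fam_def
proof (intro allI ballI)
  fix i and t :: real
  have "((\<lambda>t::real. tanh (t / 2)) has_real_derivative (1 - tanh (t / 2) ^ 2) * (1 / 2)) (at t)"
    by (auto intro!: derivative_eq_intros)
  from DERIV_chain2[OF poly_DERIV this, of "tanh_poly i"]
  show "((\<lambda>t. poly (tanh_poly i) (tanh (t / 2))) has_real_derivative poly (tanh_poly (Suc i)) (tanh (t / 2))) (at t)"
    by (simp add: power2_eq_square algebra_simps)
qed

text \<open>The polynomial form makes every derivative continuous on the whole line, hence
  integrable on a bounded interval against any of the weights; the profile thus lies in the weighted
  space for every \<open>k\<close> and \<open>p\<close>.\<close>

lemma rad_equiv_imp_less:
  assumes eq: "rad_equiv TYPE('n::finite) k p (ereal \<rho>)" and \<rho>: "0 < \<rho>" and p: "1 \<le> p" and k: "2 \<le> k"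
  shows "real (k - 1) * p < real CARD('n)"
proof -
  let ?F = "\<lambda>i t. poly (tanh_poly i) (tanh (t / 2))"
  have "wvalid CARD('n) k p (ereal \<rho>) (?F 0) ?F"
    unfolding wvalid_def
    by (intro conjI ballI allI impI refl smooth_fam_weak_deriv[of _ ?F] smooth_fam_subset[OF smooth_fam_tanh]
        wint_finite_continuous smooth_fam_continuous[OF smooth_fam_tanh] \<rho>) (use p in auto)
  then have F0: "?F 0 \<in> wW CARD('n) k p (ereal \<rho>)" unfolding wW_def by blast
  have H: "(\<lambda>x::real^'n. v (hdist x)) \<in> hW k p (ereal \<rho>)" if "v \<in> wW CARD('n) k p (ereal \<rho>)" for v :: "real \<Rightarrow> real"
    using eq that unfolding rad_equiv_def by blast
  obtain \<phi> where "happrox k p (ereal \<rho>) \<phi> (\<lambda>x::real^'n. ?F 0 (hdist x))"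
    using H[OF F0] unfolding hW_def by blast
  then show ?thesis
    by (rule happrox_norm_imp_less) (use p k \<rho> in \<open>auto simp: hball_def tanh_half_hdist\<close>)
qed

theorem theorem1p2:
  fixes R :: ereal and p :: real and k :: nat
  assumes "0 < R" and "1 \<le> p" and "1 \<le> k"
  shows "(\<exists>C. \<forall>v::real \<Rightarrow> real. (\<lambda>x::real^'n::finite. v (hdist x)) \<in> hW k p R \<longrightarrow>
            v \<in> wW CARD('n) k p R \<and>
            wnorm CARD('n) k p R v \<le> C * hnormW k p R (\<lambda>x::real^'n. v (hdist x)))
       \<and> rad_equiv TYPE('n) 1 p R
       \<and> (R < \<infinity> \<and> 2 \<le> k \<longrightarrow> (rad_equiv TYPE('n) k p R \<longleftrightarrow> real CARD('n) > real (k - 1) * p))"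
proof (intro conjI impI)
  show "\<exists>C. \<forall>v::real \<Rightarrow> real. (\<lambda>x::real^'n. v (hdist x)) \<in> hW k p R \<longrightarrow>
            v \<in> wW CARD('n) k p R \<and>
            wnorm CARD('n) k p R v \<le> C * hnormW k p R (\<lambda>x::real^'n. v (hdist x))"
    using hW_imp_wW[OF assms(2)] by blast
  show "rad_equiv TYPE('n) 1 p R" by (rule rad_equiv_1[OF assms(2,1)])
  assume *: "R < \<infinity> \<and> 2 \<le> k"
  with assms(1) obtain \<rho> where \<rho>: "R = ereal \<rho>" "0 < \<rho>" by (cases R) auto
  show "rad_equiv TYPE('n) k p R \<longleftrightarrow> real CARD('n) > real (k - 1) * p"
    using rad_equiv_finite[OF assms(2,3) \<rho>(2)] rad_equiv_imp_less[OF _ \<rho>(2) assms(2)] * unfolding \<rho>(1) by blast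
qed

end
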